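(* Let $N\ge2$ and let $\mathcal C\subseteq\mathbb R^N$ be an open convex cone (with vertex at the origin). Let $\mathbf a:\mathbb R^N\to\mathbb R^N$ satisfy, for some constants $a_0,a_1>0$, $$|\mathbf a(p)|\le a_1|p|^{N-1}\quad\text{and}\quad\langle\mathbf a(p),p\rangle\ge a_0|p|^N\qquad\forall\,p\in\mathbb R^N,$$ and let $f\in L^1(\mathcal C\setminus\overline{B_1(0)})$ be a scalar function with $$0\le f(x)\le\frac{K}{|x|^N}\qquad\text{for a.e. }x\in\mathcal C\setminus\overline{B_1(0)}$$ for some constant $K>0$. Let $u$ be a nonnegative solution of $$\operatorname{div}\mathbf a(\nabla u)=f\ \text{ in }\mathcal C\setminus\overline{B_1(0)},\qquad \mathbf a(\nabla u)\cdot\nu=0\ \text{ on }\partial\mathcal C\setminus\overline{B_1(0)}.$$ If $u(x)\to+\infty$ as $|x|\to+\infty$ with $x\in\mathcal C$, then there exists a constant $L>1$ such that $$\frac1L\log|x|\le u(x)\le L\log|x|$$ for any $x\in\mathcal C$ with $|x|$ large enough.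
   Context: The cone has, as throughout the paper, the form $\mathcal C=\mathbb R^k\times\widetilde{\mathcal C}$ with $k\in\{0,\dots,N\}$ and $\widetilde{\mathcal C}\subset\mathbb R^{N-k}$ an open convex cone with vertex at the origin containing no line. $\nu$ is the outer unit normal to $\partial\mathcal C$. Solutions are understood in the weak sense: $u\in W^{1,N}_{loc}(\overline{\mathcal C}\setminus\overline{B_1(0)})$, $\mathbf a(\nabla u)$ is measurable and $\int_{\mathcal C}\langle\mathbf a(\nabla u),\nabla\psi\rangle\,dx=-\int_{\mathcal C}f\psi\,dx$ for all $\psi\in W^{1,N}(\mathbb R^N)\cap L^\infty(\mathbb R^N)$ with compact support in $\mathbb R^N\setminus\overline{B_1(0)}$ (so the conormal boundary condition on $\partial\mathcal C$ is encoded in the test functions). Pointwise values refer to the continuous representative of $u$. *)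

theory Defs
  imports "HOL-Analysis.Analysis"
begin

section \<open>Open convex cones\<close>

text \<open>
  The library predicates \<open>cone\<close> and \<open>conic\<close> force the vertex to belong to
  every nonempty cone, which is not the case for an open cone; hence only dilations by
  strictly positive factors are used. Openness is relative to a subspace \<open>V\<close>.
\<close>

definition open_convex_cone_in :: "'a::euclidean_space set \<Rightarrow> 'a set \<Rightarrow> bool" where
  "open_convex_cone_in V D \<longleftrightarrow>
     D \<noteq> {} \<and> D \<subseteq> V \<and> openin (top_of_set V) D \<and> convex D \<and>
     (\<forall>x\<in>D. \<forall>t>0. t *\<^sub>R x \<in> D)"

definition contains_line :: "'a::real_vector set \<Rightarrow> bool" where
  "contains_line D \<longleftrightarrow> (\<exists>p v. v \<noteq> 0 \<and> (\<forall>t. p + t *\<^sub>R v \<in> D))"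

text \<open>
  \<open>coordinate_cone k C\<close>: \<open>C\<close> is the product of \<open>\<real>\<^sup>k\<close> and an open convex cone in
  \<open>\<real>\<^sup>N\<^sup>-\<^sup>k\<close> that contains no line. The coordinates are indexed by a type without a preferred
  order, so the \<open>k\<close> coordinates of the first factor are an arbitrary index set \<open>I\<close>; the
  factors are realised as the complementary coordinate subspaces. The case
  \<open>k = CARD('n)\<close> (where the second factor is \<open>{0}\<close>) is the whole space.
\<close>

definition coordinate_cone :: "nat \<Rightarrow> (real^'n) set \<Rightarrow> bool" where
  "coordinate_cone k C \<longleftrightarrow>
     (\<exists>I D. card I = k \<and>
        open_convex_cone_in {x. \<forall>i\<in>I. x $ i = 0} D \<and> \<not> contains_line D \<and>
        C = {y + z |y z. (\<forall>i. i \<notin> I \<longrightarrow> y $ i = 0) \<and> z \<in> D})"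

section \<open>Weak gradients and Sobolev spaces\<close>

text \<open>Infinitely differentiable functions: differentiable, with smooth partial derivatives.\<close>

coinductive smooth :: "(real^'n \<Rightarrow> real) \<Rightarrow> bool" where
  "\<lbrakk>\<And>x. GDERIV \<phi> x :> G x; \<And>i. smooth (\<lambda>x. G x $ i)\<rbrakk> \<Longrightarrow> smooth \<phi>"

definition test_function :: "(real^'n) set \<Rightarrow> (real^'n \<Rightarrow> real) \<Rightarrow> bool" where
  "test_function \<Omega> \<phi> \<longleftrightarrow>
     smooth \<phi> \<and> compact (closure {x. \<phi> x \<noteq> 0}) \<and> closure {x. \<phi> x \<noteq> 0} \<subseteq> \<Omega>"

definition locally_integrable :: "(real^'n) set \<Rightarrow> (real^'n \<Rightarrow> 'b::euclidean_space) \<Rightarrow> bool" where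
  "locally_integrable \<Omega> h \<longleftrightarrow> (\<forall>K. compact K \<longrightarrow> K \<subseteq> \<Omega> \<longrightarrow> h absolutely_integrable_on K)"

definition weak_gradient ::
    "(real^'n) set \<Rightarrow> (real^'n \<Rightarrow> real) \<Rightarrow> (real^'n \<Rightarrow> real^'n) \<Rightarrow> bool" where
  "weak_gradient \<Omega> u g \<longleftrightarrow>
     locally_integrable \<Omega> u \<and> locally_integrable \<Omega> g \<and>
     (\<forall>\<phi> G. test_function \<Omega> \<phi> \<longrightarrow> (\<forall>x. GDERIV \<phi> x :> G x) \<longrightarrow>
        (LINT x|lebesgue_on \<Omega>. u x *\<^sub>R G x) = - (LINT x|lebesgue_on \<Omega>. \<phi> x *\<^sub>R g x))"

definition in_Lp :: "nat \<Rightarrow> (real^'n) set \<Rightarrow> (real^'n \<Rightarrow> 'b::euclidean_space) \<Rightarrow> bool" where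
  "in_Lp p S h \<longleftrightarrow>
     h \<in> borel_measurable (lebesgue_on S) \<and> integrable (lebesgue_on S) (\<lambda>x. norm (h x) ^ p)"

definition in_Linf :: "(real^'n) set \<Rightarrow> (real^'n \<Rightarrow> real) \<Rightarrow> bool" where
  "in_Linf S h \<longleftrightarrow>
     h \<in> borel_measurable (lebesgue_on S) \<and> (\<exists>M. AE x in lebesgue_on S. \<bar>h x\<bar> \<le> M)"

text \<open>In the following predicates \<open>g\<close> is the weak gradient of \<open>u\<close>.\<close>

definition W1p :: "nat \<Rightarrow> (real^'n) set \<Rightarrow> (real^'n \<Rightarrow> real) \<Rightarrow> (real^'n \<Rightarrow> real^'n) \<Rightarrow> bool" where
  "W1p p \<Omega> u g \<longleftrightarrow> weak_gradient \<Omega> u g \<and> in_Lp p \<Omega> u \<and> in_Lp p \<Omega> g"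

text \<open>
  \<open>W1p_loc p \<Omega> A u g\<close>: here \<open>\<Omega>\<close> is open and \<open>\<Omega> \<subseteq> A \<subseteq> closure \<Omega>\<close>. The integrability
  is required near every point of \<open>A\<close>, in particular up to the boundary points of \<open>\<Omega>\<close>
  that belong to \<open>A\<close>.
\<close>

definition W1p_loc :: "nat \<Rightarrow> (real^'n) set \<Rightarrow> (real^'n) set \<Rightarrow>
    (real^'n \<Rightarrow> real) \<Rightarrow> (real^'n \<Rightarrow> real^'n) \<Rightarrow> bool" where
  "W1p_loc p \<Omega> A u g \<longleftrightarrow> weak_gradient \<Omega> u g \<and>
     (\<forall>K. compact K \<longrightarrow> K \<subseteq> A \<longrightarrow> in_Lp p (K \<inter> \<Omega>) u \<and> in_Lp p (K \<inter> \<Omega>) g)"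

section \<open>The exterior conormal problem\<close>

text \<open>
  Weak solutions of \<open>div a(\<nabla>u) = f\<close> in \<open>C - cball 0 1\<close> with \<open>a(\<nabla>u) \<cdot> \<nu> = 0\<close> on
  \<open>\<partial>C - cball 0 1\<close>. The test functions \<open>\<psi>\<close>, with weak gradient \<open>h\<close>, vanish near the
  closed unit ball but not on \<open>\<partial>C\<close>, which encodes the boundary condition. Since \<open>\<psi>\<close> and
  \<open>h\<close> vanish almost everywhere on the ball, where \<open>u\<close> and \<open>f\<close> are not given, the integrals over
  \<open>C\<close> are integrals over \<open>C - cball 0 1\<close>. As \<open>lebesgue\<close> is complete, nothing depends on the
  choice of the representative \<open>g\<close> of the weak gradient of \<open>u\<close>.
\<close>

definition weak_solution ::
    "(real^'n \<Rightarrow> real^'n) \<Rightarrow> (real^'n \<Rightarrow> real) \<Rightarrow> (real^'n) set \<Rightarrow> (real^'n \<Rightarrow> real) \<Rightarrow> bool" where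
  "weak_solution a f C u \<longleftrightarrow>
     (\<exists>g. W1p_loc CARD('n) (C - cball 0 1) (closure C - cball 0 1) u g \<and>
        (\<lambda>x. a (g x)) \<in> borel_measurable (lebesgue_on (C - cball 0 1)) \<and>
        (\<forall>\<psi> h. W1p CARD('n) UNIV \<psi> h \<longrightarrow> in_Linf UNIV \<psi> \<longrightarrow>
           (\<exists>K. compact K \<and> K \<subseteq> - cball 0 1 \<and> (AE x in lebesgue. x \<notin> K \<longrightarrow> \<psi> x = 0)) \<longrightarrow>
           (LINT x|lebesgue_on (C - cball 0 1). a (g x) \<bullet> h x) =
             - (LINT x|lebesgue_on (C - cball 0 1). f x * \<psi> x)))"

end

theory Submission
  imports Defs "HOL-Computational_Algebra.Polynomial"
begin

text \<open>
  The exponent equals the dimension, so that energies are invariant under dilations. Testing with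
  \<open>e\<^sub>0 (1 - min (u - s)\<^sup>+ h / h)\<close> shows that the energy of \<open>u\<close> on \<open>s < u < s + h\<close> equals, up to the
  structure constants, \<open>h\<close> times a positive bounded flux.

  Everything else follows from difference estimates along dilations and translations by vectors of
  the cone, which stay in the cone. Comparing \<open>u\<close> at \<open>x\<close> and \<open>2 x\<close> gives a logarithmic Hardy
  inequality and thus \<open>\<integral> \<phi>\<^sup>N \<le> c R\<^sup>N (ln R)\<^sup>N\<^sup>-\<^sup>1 h\<close> over \<open>\<bar>x\<bar> \<sim> R\<close> for the truncation \<open>\<phi>\<close> of \<open>u\<close> at
  height \<open>h\<close>; as this is small against \<open>R\<^sup>N h\<^sup>N\<close> once \<open>h\<close> exceeds a multiple of \<open>ln R\<close>, De Giorgi iteration gives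
  \<open>u \<le> L ln \<bar>x\<bar>\<close>. Given the upper bound, a Poincare inequality, again with De Giorgi iteration, bounds
  the oscillation of \<open>u\<close> over \<open>R / 2 \<le> \<bar>x\<bar> \<le> R\<close> by \<open>\<epsilon> ln R\<close>. The flux through every dyadic annulus is
  bounded from below, hence so is its energy, and the energy identity shows that the maximum of \<open>u\<close> over
  \<open>\<bar>x\<bar> \<le> R\<close> is at least \<open>c ln R\<close>. By the maximum principle it is essentially attained on the
  outer annulus, where the oscillation bound carries it over to every point.
\<close>

section \<open>Mollifiers\<close>

text \<open>No monotonicity of \<open>a\<close> is assumed, so solutions cannot be compared with
  each other or with a logarithm, and only energies are available. As f \<ge> 0, u is a subsolution:
  there is a maximum principle but no minimum principle, which is why the pointwise lower bound has
  to go through an oscillation estimate. The boundary of the cone may be irregular and test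
  functions do not vanish on it; segments from x to l x + h with l \<ge> 1 and h in the cone avoid
  it altogether. One difference estimate along such segments therefore replaces the Sobolev
  inequality (shifts that leave a small set), the Poincare inequality (two points compared through
  their sum) and the Hardy inequality (doubling). The flux is positive because u tends to infinity:
  far out the truncation equals h, so by Hardy its energy cannot vanish. The oscillation is small
  because, once u is of order ln R, the Poincare error is of order R^N ln R, whereas De Giorgi
  tolerates R^N (\<epsilon> ln R)^N, and N \<ge> 2. The bound on f is invariant under dilations, and
  the source is absorbed as soon as the level increments are at least 1.\<close>

definition smooth1 :: "(real \<Rightarrow> real) \<Rightarrow> bool" where
  "smooth1 b \<longleftrightarrow> (\<exists>F. F 0 = b \<and> (\<forall>n::nat. \<forall>x. (F n has_real_derivative F (Suc n) x) (at x)))"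

lemma smooth1_derivE:
  assumes "smooth1 b"
  obtains b' where "smooth1 b'" "\<And>x. (b has_real_derivative b' x) (at x)"
proof -
  from assms obtain F where F: "F 0 = b" "\<And>n::nat. \<And>x. (F n has_real_derivative F (Suc n) x) (at x)"
    unfolding smooth1_def by blast
  have "smooth1 (F 1)"
    unfolding smooth1_def using F by (intro exI[of _ "\<lambda>n. F (Suc n)"]) auto
  moreover have "(b has_real_derivative F 1 x) (at x)" for x
    using F(2)[of 0 x] F(1) by simp
  ultimately show ?thesis using that by blast
qed

lemma smooth1_affine:
  assumes "smooth1 b"
  shows "smooth1 (\<lambda>t. c * b (p * t + q))"
proof -
  from assms obtain F where F: "F 0 = b" "\<And>n::nat. \<And>x. (F n has_real_derivative F (Suc n) x) (at x)"
    unfolding smooth1_def by blast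
  show ?thesis
    unfolding smooth1_def
  proof (intro exI[of _ "\<lambda>n t. c * p ^ n * F n (p * t + q)"] conjI allI)
    show "(\<lambda>t. c * p ^ 0 * F 0 (p * t + q)) = (\<lambda>t. c * b (p * t + q))"
      using F(1) by simp
    fix n t
    have "((\<lambda>t. F n (p * t + q)) has_real_derivative F (Suc n) (p * t + q) * p) (at t)"
      by (rule DERIV_chain2[OF F(2)]) (auto intro!: derivative_eq_intros)
    from DERIV_cmult[OF this, of "c * p ^ n"]
    show "((\<lambda>t. c * p ^ n * F n (p * t + q)) has_real_derivative
        c * p ^ Suc n * F (Suc n) (p * t + q)) (at t)"
      by (simp add: mult_ac)
  qed
qed

text \<open>Coinduction over all products of one-variable smooth functions: a partial derivative
  only replaces the factor of its own coordinate by the derivative of that factor, so the class is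
  closed under partial derivatives.\<close>

lemma smooth_prod:
  fixes b :: "'n::finite \<Rightarrow> real \<Rightarrow> real"
  assumes "\<And>i. smooth1 (b i)"
  shows "smooth (\<lambda>x::real^'n. \<Prod>i\<in>UNIV. b i (x $ i))"
proof -
  define X where "X = (\<lambda>\<phi>::real^'n \<Rightarrow> real. \<exists>b. (\<forall>i. smooth1 (b i)) \<and> \<phi> = (\<lambda>x. \<Prod>i\<in>UNIV. b i (x $ i)))"
  have "X (\<lambda>x::real^'n. \<Prod>i\<in>UNIV. b i (x $ i))"
    unfolding X_def using assms by blast
  then show ?thesis
  proof (rule smooth.coinduct)
    fix \<phi> assume "X \<phi>"
    then obtain b where b: "\<And>i. smooth1 (b i)" and \<phi>: "\<phi> = (\<lambda>x. \<Prod>i\<in>UNIV. b i (x $ i))"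
      unfolding X_def by blast
    have "\<forall>i. \<exists>b'. smooth1 b' \<and> (\<forall>x. (b i has_real_derivative b' x) (at x))"
      using b smooth1_derivE by metis
    then obtain b' where b': "\<And>i. smooth1 (b' i)"
      "\<And>i x. (b i has_real_derivative b' i x) (at x)" by metis
    define G :: "real^'n \<Rightarrow> real^'n" where
      "G = (\<lambda>x. \<chi> j. b' j (x $ j) * (\<Prod>i\<in>UNIV - {j}. b i (x $ i)))"
    have "GDERIV \<phi> x :> G x" for x
    proof -
      have d: "((\<lambda>x. b i (x $ i)) has_derivative (\<lambda>h. h $ i * b' i (x $ i))) (at x)" for i
        by (rule has_derivative_eq_rhs[OF has_derivative_in_compose2[where t=UNIV and g="b i" and g'="\<lambda>y h. h * b' i y"]])
          (use b'(2)[of i] in \<open>auto intro!: bounded_linear_imp_has_derivative bounded_linear_vec_nth simp: has_field_derivative_def mult.commute[of _ "b' _ _"]\<close>)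
      have "(\<phi> has_derivative (\<lambda>h. \<Sum>i\<in>UNIV. h $ i * b' i (x $ i) * (\<Prod>j\<in>UNIV - {i}. b j (x $ j)))) (at x)"
        unfolding \<phi> by (rule has_derivative_prod) (rule d)
      then show ?thesis
        unfolding gderiv_def G_def inner_vec_def by (simp add: mult.assoc)
    qed
    moreover have "X (\<lambda>x. G x $ j)" for j
      unfolding X_def
    proof (intro exI[of _ "b(j := b' j)"] conjI allI)
      show "smooth1 ((b(j := b' j)) i)" for i using b b' by auto
      show "(\<lambda>x. G x $ j) = (\<lambda>x. \<Prod>i\<in>UNIV. (b(j := b' j)) i (x $ i))"
      proof
        fix x :: "real^'n"
        have "(\<Prod>i\<in>UNIV. (b(j := b' j)) i (x $ i)) =
          b' j (x $ j) * (\<Prod>i\<in>UNIV - {j}. (b(j := b' j)) i (x $ i))"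
          by (subst prod.remove[of UNIV j]) auto
        also have "(\<Prod>i\<in>UNIV - {j}. (b(j := b' j)) i (x $ i)) = (\<Prod>i\<in>UNIV - {j}. b i (x $ i))"
          by (rule prod.cong) auto
        finally show "G x $ j = (\<Prod>i\<in>UNIV. (b(j := b' j)) i (x $ i))"
          by (simp add: G_def)
      qed
    qed
    ultimately show "\<exists>\<phi>' G. \<phi> = \<phi>' \<and> (\<forall>x. GDERIV \<phi>' x :> G x) \<and>
        (\<forall>i. X (\<lambda>x. G x $ i) \<or> smooth (\<lambda>x. G x $ i))" by blast
  qed
qed

text \<open>
  The derivatives of \<open>exp (- 1 / (1 - t\<^sup>2))\<close> have the form
  \<open>P t / (1 - t\<^sup>2) ^ k * exp (- 1 / (1 - t\<^sup>2))\<close>; \<open>bump_step\<close> is the recursion for the pair \<open>(P, k)\<close>.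
\<close>

definition bump_poly :: "real poly \<Rightarrow> nat \<Rightarrow> real \<Rightarrow> real" where
  "bump_poly P k t = (if \<bar>t\<bar> < 1 then poly P t / (1 - t\<^sup>2) ^ k * exp (- (1 / (1 - t\<^sup>2))) else 0)"

definition bump_step :: "real poly \<times> nat \<Rightarrow> real poly \<times> nat" where
  "bump_step = (\<lambda>(P, k). (pderiv P * [:1, 0, -1:]\<^sup>2 + smult (2 * real k) ([:0, 1:] * P * [:1, 0, -1:])
     - smult 2 ([:0, 1:] * P), k + 2))"

text \<open>A single term of the exponential series at \<open>1 / s\<close> is at most the whole
  sum. This makes the exponential factor beat every power of \<open>1 / (1 - t\<^sup>2)\<close> at
  the ends of the support of the bump.\<close>

lemma exp_minus_inverse_le:
  fixes s :: real
  assumes "s > 0"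
  shows "exp (- (1 / s)) \<le> fact m * s ^ m"
proof -
  have "(1 / s) ^ m / fact m \<le> exp (1 / s)"
  proof -
    have "(\<Sum>n\<in>{m}. (1 / s) ^ n / fact n) \<le> exp (1 / s)"
    proof -
      have "(\<Sum>n\<in>{m}. (1 / s) ^ n /\<^sub>R fact n) \<le> (\<Sum>n. (1 / s) ^ n /\<^sub>R fact n)"
        using assms by (intro sum_le_suminf summable_exp_generic) auto
      then show ?thesis by (simp add: exp_def divide_inverse mult.commute)
    qed
    then show ?thesis by simp
  qed
  then have "1 \<le> exp (1 / s) * (fact m * s ^ m)"
    using assms by (simp add: power_divide field_simps)
  then show ?thesis
    by (simp add: exp_minus field_simps)
qed

text \<open>Inside and outside the interval this is calculus. At its two ends the exponential
  absorbs \<open>k + 2\<close> powers of \<open>1 - x\<^sup>2\<close> while the denominator has only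
  \<open>k\<close>; a quadratic bound remains, so the derivative there is 0.\<close>

lemma bump_poly_deriv:
  "(bump_poly P k has_real_derivative (case bump_step (P, k) of (P', k') \<Rightarrow> bump_poly P' k' t)) (at t)"
proof -
  consider "\<bar>t\<bar> < 1" | "\<bar>t\<bar> > 1" | "\<bar>t\<bar> = 1" by linarith
  then show ?thesis
  proof cases
    case 1
    then have s: "1 - t\<^sup>2 > 0" by (simp add: abs_square_less_1)
    define s where "s = 1 - t\<^sup>2"
    have s0: "s > 0" using s s_def by simp
    have D: "((\<lambda>t. poly P t / (1 - t\<^sup>2) ^ k * exp (- (1 / (1 - t\<^sup>2)))) has_real_derivative
        (case bump_step (P, k) of (P', k') \<Rightarrow> bump_poly P' k' t)) (at t)"
    proof -
      have d1: "((\<lambda>t::real. 1 - t\<^sup>2) has_real_derivative (- 2 * t)) (at t)"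
        by (auto intro!: derivative_eq_intros)
      have d2: "((\<lambda>t::real. inverse (1 - t\<^sup>2)) has_real_derivative 2 * t * inverse s ^ 2) (at t)"
        using DERIV_inverse'[OF d1] s by (simp add: s_def power2_eq_square mult_ac)
      have d3: "((\<lambda>t::real. inverse (1 - t\<^sup>2) ^ k) has_real_derivative
          real k * inverse s ^ (k - 1) * (2 * t * inverse s ^ 2)) (at t)"
        using DERIV_power[OF d2, of k] by (simp add: s_def mult_ac)
      have k: "real k * inverse s ^ (k - 1) * (2 * t * inverse s ^ 2) = real k * 2 * t * inverse s ^ (k + 1)"
        by (cases k) (auto simp: power2_eq_square)
      have d4: "((\<lambda>t::real. exp (- inverse (1 - t\<^sup>2))) has_real_derivative
          exp (- inverse s) * (- (2 * t * inverse s ^ 2))) (at t)"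
        using DERIV_fun_exp[OF DERIV_minus[OF d2]] by (simp add: s_def)
      have h1: "((\<lambda>t. poly P t * inverse (1 - t\<^sup>2) ^ k * exp (- inverse (1 - t\<^sup>2))) has_real_derivative
          (poly (pderiv P) t * inverse s ^ k + poly P t * (real k * 2 * t * inverse s ^ (k + 1))) * exp (- inverse s)
          + poly P t * inverse s ^ k * (exp (- inverse s) * (- (2 * t * inverse s ^ 2)))) (at t)"
        using DERIV_mult[OF DERIV_mult[OF poly_DERIV d3] d4]
        unfolding k by (simp add: s_def algebra_simps)
      have W: "poly [:1, 0, -1:] t = s" by (simp add: s_def power2_eq_square)
      have h2: "(case bump_step (P, k) of (P', k') \<Rightarrow> bump_poly P' k' t) =
          (poly (pderiv P) t * s ^ 2 + 2 * real k * t * poly P t * s - 2 * t * poly P t) * inverse s ^ (k + 2)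
           * exp (- inverse s)"
        using 1 unfolding bump_step_def bump_poly_def prod.case poly_add poly_diff poly_mult poly_power poly_smult W
        by (simp add: s_def[symmetric] divide_inverse power_inverse mult_ac)
      have h3: "(poly (pderiv P) t * s ^ 2 + 2 * real k * t * poly P t * s - 2 * t * poly P t) * inverse s ^ (k + 2)
          = (poly (pderiv P) t * inverse s ^ k + poly P t * (real k * 2 * t * inverse s ^ (k + 1)))
            + poly P t * inverse s ^ k * (- (2 * t * inverse s ^ 2))"
        using s0 by (simp add: field_simps power2_eq_square)
      have "(case bump_step (P, k) of (P', k') \<Rightarrow> bump_poly P' k' t) =
          (poly (pderiv P) t * inverse s ^ k + poly P t * (real k * 2 * t * inverse s ^ (k + 1))) * exp (- inverse s)
          + poly P t * inverse s ^ k * (exp (- inverse s) * (- (2 * t * inverse s ^ 2)))"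
        unfolding h2 h3 by (simp only: distrib_right distrib_left mult_ac)
      then show ?thesis using h1
        by (simp add: divide_inverse power_inverse)
    qed
    show ?thesis
      by (rule has_field_derivative_transform_within_open[OF D, of "{-1<..<1}"])
        (use 1 in \<open>auto simp: bump_poly_def abs_less_iff\<close>)
  next
    case 2
    have "(case bump_step (P, k) of (P', k') \<Rightarrow> bump_poly P' k' t) = 0"
      using 2 by (auto simp: bump_poly_def split: prod.split)
    moreover have "(bump_poly P k has_real_derivative 0) (at t)"
      by (rule has_field_derivative_transform_within_open[OF DERIV_const, of "- {-1..1}"])
        (use 2 in \<open>auto simp: bump_poly_def\<close>)
    ultimately show ?thesis by simp
  next
    case 3
    have z: "(case bump_step (P, k) of (P', k') \<Rightarrow> bump_poly P' k' t) = 0"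
      using 3 by (auto simp: bump_poly_def split: prod.split)
    obtain B where B: "\<And>x. \<bar>x\<bar> \<le> 1 \<Longrightarrow> \<bar>poly P x\<bar> \<le> B"
    proof -
      have "compact (poly P ` {-1..1})"
        by (intro compact_continuous_image continuous_intros) auto
      then have "bounded (poly P ` {-1..1})" by (rule compact_imp_bounded)
      then obtain B where "\<forall>x\<in>poly P ` {-1..1}. norm x \<le> B" by (auto simp: bounded_iff)
      then show ?thesis using that[of B] by (auto simp: abs_le_iff)
    qed
    \<comment> \<open>The 4 comes from 1 - x^2 = (t - x) (t + x) with |t + x| \<le> 2.\<close>
    define D where "D = B * fact (k + 2) * 4"
    have bd: "\<bar>bump_poly P k x\<bar> \<le> D * (x - t)\<^sup>2" for x
    proof (cases "\<bar>x\<bar> < 1")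
      case True
      then have s: "1 - x\<^sup>2 > 0" by (simp add: abs_square_less_1)
      have "B \<ge> 0" using B[of 0] by auto
      have "\<bar>bump_poly P k x\<bar> = \<bar>poly P x\<bar> * (exp (- (1 / (1 - x\<^sup>2))) / (1 - x\<^sup>2) ^ k)"
        using True s by (simp add: bump_poly_def abs_mult)
      also have "\<dots> \<le> B * (fact (k + 2) * (1 - x\<^sup>2) ^ (k + 2) / (1 - x\<^sup>2) ^ k)"
        using s True \<open>B \<ge> 0\<close> by (intro mult_mono B divide_right_mono exp_minus_inverse_le) auto
      also have "fact (k + 2) * (1 - x\<^sup>2) ^ (k + 2) / (1 - x\<^sup>2) ^ k = fact (k + 2) * (1 - x\<^sup>2)\<^sup>2"
        using s by (simp add: power_add power2_eq_square[of "1 - x\<^sup>2"])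
      also have "B * (fact (k + 2) * (1 - x\<^sup>2)\<^sup>2) \<le> B * (fact (k + 2) * (4 * (x - t)\<^sup>2))"
      proof (intro mult_left_mono \<open>B \<ge> 0\<close>)
        have "t\<^sup>2 = 1" using 3 by (simp add: abs_square_eq_1)
        then have "1 - x\<^sup>2 = (t - x) * (t + x)" by (simp add: power2_eq_square algebra_simps)
        then have "(1 - x\<^sup>2)\<^sup>2 = (x - t)\<^sup>2 * (t + x)\<^sup>2" by (simp add: power2_eq_square algebra_simps)
        also have "\<dots> \<le> (x - t)\<^sup>2 * 2\<^sup>2"
          using True 3 by (intro mult_left_mono power2_le_iff_abs_le[THEN iffD2]) auto
        finally show "(1 - x\<^sup>2)\<^sup>2 \<le> 4 * (x - t)\<^sup>2" by simp
      qed simp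
      finally show ?thesis unfolding D_def by (simp only: mult_ac)
    next
      case False
      have "B \<ge> 0" using B[of 0] by auto
      then show ?thesis using False by (simp add: bump_poly_def D_def)
    qed
    have "(bump_poly P k has_real_derivative 0) (at t)"
    proof -
      have "((\<lambda>x. bump_poly P k x / (x - t)) \<longlongrightarrow> 0) (at t)"
      proof (rule Lim_null_comparison)
        show "\<forall>\<^sub>F x in at t. norm (bump_poly P k x / (x - t)) \<le> D * \<bar>x - t\<bar>"
          unfolding eventually_at_filter
        proof (intro always_eventually allI impI)
          fix x assume "x \<noteq> t"
          then show "norm (bump_poly P k x / (x - t)) \<le> D * \<bar>x - t\<bar>"
            using bd[of x] by (simp add: abs_divide pos_divide_le_eq power2_eq_square mult_ac abs_mult_self_eq)
        qed
        show "((\<lambda>x. D * \<bar>x - t\<bar>) \<longlongrightarrow> 0) (at t)"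
          by (auto intro!: tendsto_eq_intros)
      qed
      moreover have "bump_poly P k t = 0" using 3 by (simp add: bump_poly_def)
      ultimately show ?thesis by (simp add: has_field_derivative_iff)
    qed
    then show ?thesis using z by simp
  qed
qed

lemma smooth1_bump: "smooth1 (bump_poly 1 0)"
  unfolding smooth1_def
proof (intro exI[of _ "\<lambda>n. case (bump_step ^^ n) (1, 0) of (P, k) \<Rightarrow> bump_poly P k"] conjI allI)
  show "(case (bump_step ^^ 0) (1, 0) of (P, k) \<Rightarrow> bump_poly P k) = bump_poly 1 0" by simp
  fix n x
  show "((case (bump_step ^^ n) (1, 0) of (P, k) \<Rightarrow> bump_poly P k) has_real_derivative
     (case (bump_step ^^ Suc n) (1, 0) of (P, k) \<Rightarrow> bump_poly P k) x) (at x)"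
    using bump_poly_deriv[of "fst ((bump_step ^^ n) (1, 0))" "snd ((bump_step ^^ n) (1, 0))" x]
    by (simp add: case_prod_beta)
qed

lemma smooth_imp_C1:
  assumes "smooth \<phi>"
  obtains G where "\<And>x. GDERIV \<phi> x :> G x" "continuous_on UNIV G"
proof -
  have cont: "continuous_on UNIV \<psi>" if "smooth \<psi>" for \<psi> :: "real^'n \<Rightarrow> real"
    using that
  proof cases
    case (1 G)
    show ?thesis
      by (rule has_derivative_continuous_on) (use 1(1)[unfolded gderiv_def] in \<open>auto intro: has_derivative_at_withinI\<close>)
  qed
  from assms show ?thesis
  proof cases
    case (1 G)
    have "continuous_on UNIV G"
    proof -
      have "continuous_on UNIV (\<lambda>x. \<chi> i. G x $ i)"
        by (rule continuous_on_vec_lambda) (use 1(2) cont in blast)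
      then show ?thesis by simp
    qed
    then show ?thesis using 1(1) that by blast
  qed
qed

lemma GDERIV_unique:
  assumes "GDERIV f x :> A" "GDERIV f x :> B"
  shows "A = B"
proof -
  have "(\<lambda>h. h \<bullet> A) = (\<lambda>h. h \<bullet> B)"
    using assms unfolding gderiv_def by (rule has_derivative_unique)
  then have "(A - B) \<bullet> A = (A - B) \<bullet> B" by meson
  then have "(A - B) \<bullet> (A - B) = 0" by (simp add: inner_diff_right)
  then show ?thesis by simp
qed

text \<open>The smoothness clause covers multiples and affine rescalings because the rescaled
  kernels themselves serve as test functions. The function is a normalised product of bumps in
  coordinates scaled by the dimension, so a nonzero value forces the l1 norm, hence the Euclidean
  norm, below 1.\<close>

lemma mollifier_exists:
  obtains \<rho> :: "real^'n \<Rightarrow> real"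
  where "\<And>c p q. smooth (\<lambda>y. c * \<rho> (p *\<^sub>R y + q))" "\<And>x. \<rho> x \<ge> 0" "\<And>x. \<rho> x \<noteq> 0 \<Longrightarrow> norm x < 1"
    "integrable lborel \<rho>" "integral\<^sup>L lborel \<rho> = 1"
proof -
  define N where "N = real CARD('n)"
  have N: "N > 0" by (simp add: N_def)
  define b where "b = bump_poly 1 0"
  define q where "q = (\<lambda>x::real^'n. \<Prod>i\<in>UNIV. b (N * x $ i))"
  have sm: "smooth (\<lambda>y. c * q (p *\<^sub>R y + z))" for c p z
  proof -
    \<comment> \<open>One distinguished coordinate, whose factor carries the constant
      \<open>c\<close>.\<close>
    obtain i0 :: 'n where True by auto
    have "smooth (\<lambda>y::real^'n. \<Prod>i\<in>UNIV. (if i = i0 then c else 1) * b (N * p * y $ i + N * z $ i))"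
      using smooth1_bump by (intro smooth_prod smooth1_affine) (simp add: b_def)
    also have "(\<lambda>y::real^'n. \<Prod>i\<in>UNIV. (if i = i0 then c else 1) * b (N * p * y $ i + N * z $ i))
       = (\<lambda>y. c * q (p *\<^sub>R y + z))"
      by (auto simp: q_def prod.distrib algebra_simps fun_eq_iff)
    finally show ?thesis .
  qed
  have b0: "b t \<ge> 0" for t by (auto simp: b_def bump_poly_def)
  have bz: "\<bar>t\<bar> < 1" if "b t \<noteq> 0" for t using that by (auto simp: b_def bump_poly_def split: if_splits)
  have q0: "q x \<ge> 0" for x by (auto simp: q_def intro!: prod_nonneg b0)
  have qz: "norm x < 1" if "q x \<noteq> 0" for x
  proof -
    have "b (N * x $ i) \<noteq> 0" for i using that by (auto simp: q_def prod_zero_iff)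
    then have "\<bar>N * x $ i\<bar> < 1" for i using bz by blast
    then have "\<bar>x $ i\<bar> < 1 / N" for i using N by (simp add: abs_mult field_simps)
    then have "(\<Sum>i\<in>UNIV. \<bar>x $ i\<bar>) < (\<Sum>i\<in>(UNIV::'n set). 1 / N)"
      by (intro sum_strict_mono) auto
    also have "\<dots> = 1" by (simp add: N_def)
    finally show ?thesis using norm_le_l1_cart[of x] by linarith
  qed
  have cq: "continuous_on UNIV q"
  proof -
    obtain G where "\<And>x. GDERIV (\<lambda>y. 1 * q (1 *\<^sub>R y + 0)) x :> G x" using smooth_imp_C1[OF sm[of 1 1 0]] by metis
    then show ?thesis
      by (intro has_derivative_continuous_on[of _ q "\<lambda>x h. h \<bullet> G x"]) (auto simp: gderiv_def intro: has_derivative_at_withinI)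
  qed
  have iq: "integrable lborel q"
  proof -
    have "integrable lborel (\<lambda>x. indicator (cball 0 1) x *\<^sub>R q x)"
      by (rule borel_integrable_compact[unfolded set_integrable_def]) (auto intro: continuous_on_subset[OF cq])
    moreover have "(\<lambda>x. indicator (cball 0 1) x *\<^sub>R q x) = q"
      using qz by (auto simp: fun_eq_iff indicator_def dest: less_imp_le)
    ultimately show ?thesis by simp
  qed
  define I where "I = integral\<^sup>L lborel q"
  have "I > 0"
  proof -
    have "I \<ge> 0" unfolding I_def using q0 by (intro Bochner_Integration.integral_nonneg) auto
    moreover have "I \<noteq> 0"
    proof
      assume "I = 0"
      then have ae: "AE x in lborel. q x = 0"
        using integral_nonneg_eq_0_iff_AE[OF iq] q0 by (auto simp: I_def)
      have "b 0 > 0" by (simp add: b_def bump_poly_def)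
      then have "q 0 > 0" by (simp add: q_def)
      then have "open {x. q x > 0}" "0 \<in> {x. q x > 0}"
        using cq by (auto intro: open_Collect_less continuous_intros)
      then obtain e where e: "e > 0" "ball 0 e \<subseteq> {x. q x > 0}" by (meson open_contains_ball)
      from ae have "AE x in lborel. x \<notin> ball (0::real^'n) e"
        by eventually_elim (use e in force)
      then have "ball (0::real^'n) e \<in> null_sets lborel"
        by (subst AE_iff_null_sets) auto
      then have "measure lborel (ball (0::real^'n) e) = 0" by (simp add: measure_eq_0_null_sets)
      then show False using content_ball_pos[of e "0::real^'n"] e by simp
    qed
    ultimately show ?thesis by simp
  qed
  show ?thesis
  proof (rule that[of "\<lambda>x. (1 / I) * q x"])
    show "smooth (\<lambda>y. c * (1 / I * q (p *\<^sub>R y + z)))" for c p z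
      using sm[of "c * (1 / I)" p z] by (simp add: mult.assoc)
    show "(1 / I) * q x \<ge> 0" for x using q0 \<open>I > 0\<close> by simp
    show "(1 / I) * q x \<noteq> 0 \<Longrightarrow> norm x < 1" for x using qz by auto
    show "integrable lborel (\<lambda>x. 1 / I * q x)" using iq by simp
    show "(LINT x|lborel. 1 / I * q x) = 1" using \<open>I > 0\<close> by (simp add: I_def)
  qed
qed

section \<open>Test functions and translations\<close>

text \<open>A compact set is carried along instead of the exact support, so that it can be exchanged
  for a shell avoiding the unit ball.\<close>

definition C1c :: "(real^'n \<Rightarrow> real) \<Rightarrow> (real^'n \<Rightarrow> real^'n) \<Rightarrow> (real^'n) set \<Rightarrow> bool" where
  "C1c \<psi> h K \<longleftrightarrow> (\<forall>x. GDERIV \<psi> x :> h x) \<and> continuous_on UNIV h \<and> compact K \<and> (\<forall>x. x \<notin> K \<longrightarrow> \<psi> x = 0)"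

lemma GDERIV_imp_continuous_on:
  assumes "\<And>x. GDERIV \<psi> x :> h x"
  shows "continuous_on S \<psi>"
  by (rule has_derivative_continuous_on)
    (use assms in \<open>auto simp: gderiv_def intro: has_derivative_at_withinI\<close>)

lemma C1cD:
  assumes "C1c \<psi> h K"
  shows "\<And>x. GDERIV \<psi> x :> h x" "continuous_on UNIV h" "continuous_on UNIV \<psi>" "compact K"
    "\<And>x. x \<notin> K \<Longrightarrow> \<psi> x = 0" "\<And>x. x \<notin> K \<Longrightarrow> h x = 0"
proof -
  show 1: "\<And>x. GDERIV \<psi> x :> h x" "continuous_on UNIV h" "compact K" "\<And>x. x \<notin> K \<Longrightarrow> \<psi> x = 0"
    using assms by (auto simp: C1c_def)
  show "continuous_on UNIV \<psi>" using 1(1) by (rule GDERIV_imp_continuous_on)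
  show "h x = 0" if "x \<notin> K" for x
  proof -
    have "open (- K)" using 1(3) compact_imp_closed by blast
    have "(\<psi> has_derivative (\<lambda>h. 0)) (at x)"
      by (rule has_derivative_transform_within_open[OF has_derivative_const \<open>open (- K)\<close>])
        (use that 1(4) in auto)
    then have "GDERIV \<psi> x :> 0" by (simp add: gderiv_def)
    then show ?thesis using 1(1) GDERIV_unique by blast
  qed
qed

lemma integrable_compact_support:
  fixes f :: "'a::euclidean_space \<Rightarrow> 'b::{banach,second_countable_topology}"
  assumes "continuous_on UNIV f" "compact K" "\<And>x. x \<notin> K \<Longrightarrow> f x = 0"
  shows "integrable lborel f"
proof -
  have "set_integrable lborel K f"
    unfolding set_integrable_def
    using assms by (intro borel_integrable_compact) (auto intro: continuous_on_subset)
  moreover have "(\<lambda>x. indicator K x *\<^sub>R f x) = f"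
    using assms(3) by (auto simp: indicator_def fun_eq_iff)
  ultimately show ?thesis by (simp add: set_integrable_def)
qed

lemma bounded_compact_support:
  fixes f :: "'a::euclidean_space \<Rightarrow> 'b::real_normed_vector"
  assumes "continuous_on UNIV f" "compact K" "\<And>x. x \<notin> K \<Longrightarrow> f x = 0"
  obtains B where "B > 0" "\<And>x. norm (f x) \<le> B"
proof -
  have "bounded (f ` K)"
    using assms by (intro compact_imp_bounded compact_continuous_image) (auto intro: continuous_on_subset)
  then obtain B where "B > 0" "\<And>x. x \<in> K \<Longrightarrow> norm (f x) \<le> B" by (auto simp: bounded_pos)
  then have "norm (f x) \<le> B" for x using assms(3)[of x] by (cases "x \<in> K") auto
  with \<open>B > 0\<close> show ?thesis using that by blast
qed

section \<open>Affine changes of variables and difference quotients\<close>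

lemma nn_integral_lborel_affine:
  fixes f :: "'a::euclidean_space \<Rightarrow> ennreal"
  assumes [measurable]: "f \<in> borel_measurable borel" and "c > 0"
  shows "(\<integral>\<^sup>+x. f (c *\<^sub>R x + v) \<partial>lborel) = ennreal (1 / c ^ DIM('a)) * (\<integral>\<^sup>+x. f x \<partial>lborel)"
proof -
  have "(\<integral>\<^sup>+x. f x \<partial>lborel) = (\<integral>\<^sup>+x. f x \<partial>density (distr lborel borel (\<lambda>x. v + c *\<^sub>R x)) (\<lambda>_. \<bar>c\<bar> ^ DIM('a)))"
    using lborel_affine[of c v] \<open>c > 0\<close> by simp
  also have "\<dots> = ennreal (c ^ DIM('a)) * (\<integral>\<^sup>+x. f (v + c *\<^sub>R x) \<partial>lborel)"
    using \<open>c > 0\<close> by (simp add: nn_integral_density nn_integral_distr nn_integral_cmult)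
  finally have "ennreal (1 / c ^ DIM('a)) * (\<integral>\<^sup>+x. f x \<partial>lborel)
      = ennreal (1 / c ^ DIM('a)) * ennreal (c ^ DIM('a)) * (\<integral>\<^sup>+x. f (v + c *\<^sub>R x) \<partial>lborel)"
    by (simp add: mult.assoc)
  also have "ennreal (1 / c ^ DIM('a)) * ennreal (c ^ DIM('a)) = 1"
    using \<open>c > 0\<close> by (simp flip: ennreal_mult)
  finally show ?thesis by (simp add: add.commute)
qed

lemma nn_integral_lborel_translate:
  fixes f :: "'a::euclidean_space \<Rightarrow> ennreal"
  assumes "f \<in> borel_measurable borel"
  shows "(\<integral>\<^sup>+x. f (x + v) \<partial>lborel) = (\<integral>\<^sup>+x. f x \<partial>lborel)"
  using nn_integral_lborel_affine[OF assms, of 1 v] by simp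

lemma integral_lborel_translate:
  fixes f :: "'a::euclidean_space \<Rightarrow> 'b::{banach,second_countable_topology}"
  assumes [measurable]: "f \<in> borel_measurable borel"
  shows "(LINT x|lborel. f (x + v)) = (LINT x|lborel. f x)"
proof -
  have "(LINT x|lborel. f x) = (LINT x|distr lborel borel (\<lambda>x. v + x). f x)"
    by (simp add: lborel_distr_plus)
  also have "\<dots> = (LINT x|lborel. f (v + x))" by (rule integral_distr) auto
  finally show ?thesis by (simp add: add.commute)
qed

lemma C1_increment_bound:
  fixes \<psi> :: "real^'n \<Rightarrow> real"
  assumes "\<And>x. GDERIV \<psi> x :> h x" "\<And>x. norm (h x) \<le> B"
  shows "\<bar>\<psi> y - \<psi> x\<bar> \<le> B * norm (y - x)"
proof -
  have "norm (\<psi> y - \<psi> x) \<le> B * norm (y - x)"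
  proof (rule differentiable_bound[of UNIV \<psi> "\<lambda>x v. v \<bullet> h x"])
    show "(\<psi> has_derivative (\<lambda>v. v \<bullet> h x)) (at x within UNIV)" for x
      using assms(1)[of x] by (simp add: gderiv_def)
    show "onorm (\<lambda>v. v \<bullet> h x) \<le> B" for x
    proof (rule onorm_le)
      fix v
      show "norm (v \<bullet> h x) \<le> B * norm v"
        using Cauchy_Schwarz_ineq2[of v "h x"] mult_left_mono[OF assms(2)[of x] norm_ge_zero[of v]]
        by (simp add: mult.commute)
    qed
  qed auto
  then show ?thesis by simp
qed

lemma C1_directional_limit:
  fixes \<psi> :: "real^'n \<Rightarrow> real"
  assumes "GDERIV \<psi> x :> h"
  shows "(\<lambda>n. real (Suc n) * (\<psi> (x + (1 / real (Suc n)) *\<^sub>R e) - \<psi> x)) \<longlonglongrightarrow> e \<bullet> h"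
proof -
  have "((\<lambda>t. \<psi> (x + t *\<^sub>R e)) has_derivative (\<lambda>t. (t *\<^sub>R e) \<bullet> h)) (at 0)"
    by (rule has_derivative_compose[of "\<lambda>t. x + t *\<^sub>R e" "\<lambda>t. t *\<^sub>R e" 0 UNIV \<psi>, simplified])
      (use assms in \<open>auto simp: gderiv_def intro!: derivative_eq_intros\<close>)
  then have "((\<lambda>t. \<psi> (x + t *\<^sub>R e)) has_real_derivative (e \<bullet> h)) (at 0)"
    by (simp add: has_field_derivative_def mult.commute[of _ "e \<bullet> h"])
  then have "((\<lambda>t. (\<psi> (x + t *\<^sub>R e) - \<psi> x) / t) \<longlongrightarrow> e \<bullet> h) (at 0)"
    by (simp add: has_field_derivative_iff)
  moreover have "filterlim (\<lambda>n. 1 / real (Suc n)) (at 0) sequentially"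
    unfolding filterlim_at using LIMSEQ_inverse_real_of_nat by (auto simp: divide_inverse)
  ultimately have "(\<lambda>n. (\<psi> (x + (1 / real (Suc n)) *\<^sub>R e) - \<psi> x) / (1 / real (Suc n))) \<longlonglongrightarrow> e \<bullet> h"
    by (rule filterlim_compose)
  then show ?thesis by (simp add: mult.commute)
qed

text \<open>The difference quotients of \<open>q\<close> integrate to 0 by translation invariance.
  They converge to the directional derivative under an integrable bound, since \<open>q\<close> is
  Lipschitz and all quotients live in one compact set.\<close>

lemma C1c_integral_gradient:
  assumes "C1c q h K"
  shows "integrable lborel h" "(LINT x|lborel. h x) = 0"
proof -
  note C = C1cD[OF assms]
  have qm [measurable]: "q \<in> borel_measurable borel" "h \<in> borel_measurable borel"
    using C by (auto intro: borel_measurable_continuous_onI)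
  show ih: "integrable lborel h"
    using C by (intro integrable_compact_support[of h K]) auto
  have iq: "integrable lborel q"
    using C by (intro integrable_compact_support[of q K]) auto
  obtain B where B: "B > 0" "\<And>x. norm (h x) \<le> B"
    using bounded_compact_support[of h K] C by metis
  have "(LINT x|lborel. e \<bullet> h x) = 0" for e
  proof -
    define f where "f = (\<lambda>n x. real (Suc n) * (q (x + (1 / real (Suc n)) *\<^sub>R e) - q x))"
    \<comment> \<open>The steps \<open>1 / Suc n\<close> are at most 1, so enlarging
      \<open>K\<close> by the radius \<open>norm e\<close> covers every difference quotient.\<close>
    define K1 where "K1 = {x - y |x y. x \<in> K \<and> y \<in> cball 0 (norm e)}"
    have K1: "compact K1" unfolding K1_def using C by (intro compact_differences) auto
    have sub: "x \<in> K1" if "f n x \<noteq> 0" for n x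
    proof -
      have "x \<in> K \<or> x + (1 / real (Suc n)) *\<^sub>R e \<in> K"
        using that C(5) by (force simp: f_def)
      moreover have "norm ((1 / real (Suc n)) *\<^sub>R e) \<le> norm e"
        using mult_left_mono[of 1 "real (Suc n)" "norm e"] by (simp add: field_simps)
      moreover have "x = x - 0" "x = (x + (1 / real (Suc n)) *\<^sub>R e) - (1 / real (Suc n)) *\<^sub>R e" by auto
      ultimately show ?thesis unfolding K1_def mem_Collect_eq
        by (metis mem_cball_0 norm_ge_zero norm_zero)
    qed
    have lim: "(\<lambda>n. LINT x|lborel. f n x) \<longlonglongrightarrow> (LINT x|lborel. e \<bullet> h x)"
    proof (rule integral_dominated_convergence[where w="\<lambda>x. B * norm e * indicator K1 x"])
      have "K1 \<in> sets lborel" "emeasure lborel K1 < \<infinity>"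
        using K1 emeasure_bounded_finite[OF compact_imp_bounded[OF K1]] by (auto intro: borel_compact)
      then show "integrable lborel (\<lambda>x. B * norm e * indicator K1 x)"
        by (intro integrable_mult_right integrable_real_indicator) auto
      show "AE x in lborel. (\<lambda>i. f i x) \<longlonglongrightarrow> e \<bullet> h x"
        using C1_directional_limit[OF C(1)] by (auto simp: f_def)
      show "AE x in lborel. norm (f i x) \<le> B * norm e * indicator K1 x" for i
      proof (rule AE_I2)
        fix x
        show "norm (f i x) \<le> B * norm e * indicator K1 x"
        proof (cases "f i x = 0")
          case True then show ?thesis using B by simp
        next
          case False
          have "\<bar>q (x + (1 / real (Suc i)) *\<^sub>R e) - q x\<bar> \<le> B * norm ((1 / real (Suc i)) *\<^sub>R e)"
            using C1_increment_bound[OF C(1) B(2), of "x + (1 / real (Suc i)) *\<^sub>R e" x] by simp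
          then have "real (Suc i) * \<bar>q (x + (1 / real (Suc i)) *\<^sub>R e) - q x\<bar> \<le> real (Suc i) * (B * norm ((1 / real (Suc i)) *\<^sub>R e))"
            by (intro mult_left_mono) auto
          also have "\<dots> = B * norm e" by simp
          finally have "\<bar>f i x\<bar> \<le> B * norm e" unfolding f_def abs_mult by simp
          then show ?thesis using sub[OF False] by simp
        qed
      qed
    qed (auto simp: f_def)
    moreover have "(LINT x|lborel. f n x) = 0" for n
    proof -
      have m: "(\<lambda>x. q (x + (1 / real (Suc n)) *\<^sub>R e)) \<in> borel_measurable borel" by measurable
      have "integrable lborel (\<lambda>x. q (x + (1 / real (Suc n)) *\<^sub>R e))"
      proof (rule integrable_compact_support[of _ K1])
        show "continuous_on UNIV (\<lambda>x. q (x + (1 / real (Suc n)) *\<^sub>R e))"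
          by (intro continuous_on_compose2[OF C(3)] continuous_intros) auto
        show "compact K1" by (rule K1)
        fix x assume "x \<notin> K1"
        show "q (x + (1 / real (Suc n)) *\<^sub>R e) = 0"
        proof (rule ccontr)
          assume "q (x + (1 / real (Suc n)) *\<^sub>R e) \<noteq> 0"
          then have "x + (1 / real (Suc n)) *\<^sub>R e \<in> K" using C(5) by blast
          moreover have "norm ((1 / real (Suc n)) *\<^sub>R e) \<le> norm e"
            using mult_left_mono[of 1 "real (Suc n)" "norm e"] by (simp add: field_simps)
          moreover have "x = (x + (1 / real (Suc n)) *\<^sub>R e) - (1 / real (Suc n)) *\<^sub>R e" by auto
          ultimately have "x \<in> K1" unfolding K1_def mem_Collect_eq by (metis mem_cball_0)
          with \<open>x \<notin> K1\<close> show False by simp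
        qed
      qed
      then have "(LINT x|lborel. f n x) = real (Suc n) * ((LINT x|lborel. q (x + (1 / real (Suc n)) *\<^sub>R e)) - (LINT x|lborel. q x))"
        unfolding f_def using iq by (subst integral_mult_right_zero, subst Bochner_Integration.integral_diff) auto
      then show ?thesis by (simp add: integral_lborel_translate)
    qed
    ultimately have "(\<lambda>n. 0) \<longlonglongrightarrow> (LINT x|lborel. e \<bullet> h x)" by simp
    then show ?thesis by (simp add: LIMSEQ_const_iff)
  qed
  then have "(LINT x|lborel. h x) \<bullet> (LINT x|lborel. h x) = 0"
    using ih by (metis integral_inner_right)
  then show "(LINT x|lborel. h x) = 0" by simp
qed

lemma C1c_mult:
  assumes "C1c \<phi> G K" "\<And>x. GDERIV \<psi> x :> h x" "continuous_on UNIV h"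
  shows "C1c (\<lambda>x. \<phi> x * \<psi> x) (\<lambda>x. \<phi> x *\<^sub>R h x + \<psi> x *\<^sub>R G x) K"
proof -
  note C = C1cD[OF assms(1)]
  have "continuous_on UNIV \<psi>" using assms(2) by (rule GDERIV_imp_continuous_on)
  then show ?thesis
    unfolding C1c_def using C assms by (auto intro!: GDERIV_mult continuous_intros)
qed

lemma GDERIV_comp:
  assumes "\<And>x. GDERIV \<psi> x :> h x" "\<And>t. (G has_real_derivative \<gamma> t) (at t)"
  shows "GDERIV (\<lambda>x. G (\<psi> x)) x :> \<gamma> (\<psi> x) *\<^sub>R h x"
  using GDERIV_DERIV_compose[OF assms(1) assms(2)] .

lemma integrable_lebesgue_iff_lborel:
  fixes f :: "'a::euclidean_space \<Rightarrow> 'b::{banach,second_countable_topology}"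
  assumes "f \<in> borel_measurable borel"
  shows "integrable lebesgue f \<longleftrightarrow> integrable lborel f" "integral\<^sup>L lebesgue f = integral\<^sup>L lborel f"
  using assms by (auto simp: integrable_completion integral_completion)

text \<open>Integration by parts against a smooth test function is the vanishing of the integrated
  gradient of the product. Compactly supported C^1 functions can thus be inserted into the weak
  formulation.\<close>

lemma C1c_W1p:
  fixes \<psi> :: "real^'n \<Rightarrow> real"
  assumes "C1c \<psi> h K" "p > 0"
  shows "W1p p UNIV \<psi> h" "in_Linf UNIV \<psi>"
proof -
  note C = C1cD[OF assms(1)]
  have mb [measurable]: "\<psi> \<in> borel_measurable borel" "h \<in> borel_measurable borel"
    using C by (auto intro: borel_measurable_continuous_onI)
  have ml: "\<psi> \<in> borel_measurable lebesgue" "h \<in> borel_measurable lebesgue"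
    by (rule measurable_completion, simp)+
  have li: "locally_integrable UNIV q" if "continuous_on UNIV q" for q :: "real^'n \<Rightarrow> 'z::euclidean_space"
    unfolding locally_integrable_def
  proof (intro allI impI)
    fix K' :: "(real^'n) set" assume "compact K'"
    then have "set_integrable lborel K' q"
      unfolding set_integrable_def
      using that by (intro borel_integrable_compact) (auto intro: continuous_on_subset)
    moreover have "(\<lambda>x. indicator K' x *\<^sub>R q x) \<in> borel_measurable borel"
      using that \<open>compact K'\<close> by (intro borel_measurable_scaleR borel_measurable_indicator)
        (auto intro: borel_measurable_continuous_onI borel_compact)
    ultimately show "q absolutely_integrable_on K'"
      by (simp add: set_integrable_def integrable_lebesgue_iff_lborel)
  qed
  have wg: "weak_gradient UNIV \<psi> h"
    unfolding weak_gradient_def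
  proof (intro conjI allI impI)
    show "locally_integrable UNIV \<psi>" "locally_integrable UNIV h" using li C by auto
    fix \<phi> :: "real^'n \<Rightarrow> real" and G assume t: "test_function UNIV \<phi>" and g: "\<forall>x. GDERIV \<phi> x :> G x"
    obtain G' where G': "\<And>x. GDERIV \<phi> x :> G' x" "continuous_on UNIV G'"
      using t smooth_imp_C1 unfolding test_function_def by metis
    have "G' = G" using G'(1) g GDERIV_unique by blast
    have c\<phi>: "continuous_on UNIV \<phi>" using G'(1) by (rule GDERIV_imp_continuous_on)
    have "C1c (\<lambda>x. \<psi> x * \<phi> x) (\<lambda>x. \<psi> x *\<^sub>R G x + \<phi> x *\<^sub>R h x) K"
      using G' \<open>G' = G\<close> by (intro C1c_mult[OF assms(1)]) auto
    from C1c_integral_gradient(2)[OF this]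
    have "(LINT x|lborel. \<psi> x *\<^sub>R G x + \<phi> x *\<^sub>R h x) = 0" .
    moreover have i: "integrable lborel (\<lambda>x. \<psi> x *\<^sub>R G x)" "integrable lborel (\<lambda>x. \<phi> x *\<^sub>R h x)"
      using C G' \<open>G' = G\<close> c\<phi> by (auto intro!: integrable_compact_support[of _ K] continuous_intros)
    ultimately have "(LINT x|lborel. \<psi> x *\<^sub>R G x) = - (LINT x|lborel. \<phi> x *\<^sub>R h x)"
      by (simp add: eq_neg_iff_add_eq_0)
    moreover have "(\<lambda>x. \<psi> x *\<^sub>R G x) \<in> borel_measurable borel" "(\<lambda>x. \<phi> x *\<^sub>R h x) \<in> borel_measurable borel"
      using i by auto
    ultimately show "(LINT x|lebesgue_on UNIV. \<psi> x *\<^sub>R G x) = - (LINT x|lebesgue_on UNIV. \<phi> x *\<^sub>R h x)"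
      by (simp add: integrable_lebesgue_iff_lborel lebesgue_on_UNIV_eq)
  qed
  have lp: "in_Lp p UNIV q" if "continuous_on UNIV q" "\<And>x. x \<notin> K \<Longrightarrow> q x = 0"
    for q :: "real^'n \<Rightarrow> 'z::euclidean_space"
  proof -
    have "integrable lborel (\<lambda>x. norm (q x) ^ p)"
      using that C \<open>p > 0\<close> by (intro integrable_compact_support[of _ K] continuous_intros) auto
    moreover have "(\<lambda>x. norm (q x) ^ p) \<in> borel_measurable borel" "q \<in> borel_measurable borel"
      using that by (auto intro!: borel_measurable_continuous_onI continuous_intros)
    ultimately show ?thesis
      unfolding in_Lp_def by (auto simp: integrable_lebesgue_iff_lborel lebesgue_on_UNIV_eq intro: measurable_completion)
  qed
  show "W1p p UNIV \<psi> h" unfolding W1p_def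
    using wg lp[OF C(3) C(5)] lp[OF C(2) C(6)] by blast
  obtain B where B: "B > 0" "\<And>x. norm (\<psi> x) \<le> B"
    using bounded_compact_support[of \<psi> K] C by metis
  then show "in_Linf UNIV \<psi>" using ml unfolding in_Linf_def by (auto simp: lebesgue_on_UNIV_eq)
qed

section \<open>Continuity of translations in the mean\<close>

lemma power_add_le:
  fixes a b :: real assumes "a \<ge> 0" "b \<ge> 0"
  shows "(a + b) ^ n \<le> 2 ^ n * (a ^ n + b ^ n)"
proof -
  have "(a + b) ^ n \<le> (2 * max a b) ^ n" using assms by (intro power_mono) auto
  also have "\<dots> \<le> 2 ^ n * (a ^ n + b ^ n)"
    using assms by (simp add: power_mult_distrib max_def)
  finally show ?thesis .
qed

lemma power_add3_le:
  fixes a b c :: real assumes "a \<ge> 0" "b \<ge> 0" "c \<ge> 0"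
  shows "(a + b + c) ^ n \<le> 3 ^ n * (a ^ n + b ^ n + c ^ n)"
proof -
  have "(a + b + c) ^ n \<le> (3 * max a (max b c)) ^ n" using assms by (intro power_mono) auto
  also have "\<dots> \<le> 3 ^ n * (a ^ n + b ^ n + c ^ n)"
    using assms by (simp add: power_mult_distrib max_def)
  finally show ?thesis .
qed

text \<open>Induction on integrable functions. For an indicator, take a compact subset and an open
  superset whose difference is small: a translation shorter than the distance between the compact
  set and the complement of the open one changes the indicator only on that difference and its
  translate.\<close>

lemma L1_translation_continuous:
  fixes q :: "'a::euclidean_space \<Rightarrow> 'b::{banach,second_countable_topology}"
  assumes "integrable lborel q" and "\<epsilon> > (0::real)"
  shows "\<exists>\<delta>>0. \<forall>v. norm v < \<delta> \<longrightarrow> (\<integral>\<^sup>+x. norm (q (x + v) - q x) \<partial>lborel) < ennreal \<epsilon>"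
  using assms
proof (induction arbitrary: \<epsilon> rule: integrable_induct)
  case (base A c)
  have A [measurable]: "A \<in> sets borel" using base by simp
  define e where "e = \<epsilon> / (8 * (norm c + 1))"
  have e: "e > 0" using base by (simp add: e_def add_nonneg_pos)
  obtain T where T: "closed T" "T \<subseteq> A" "A - T \<in> lmeasurable" "emeasure lebesgue (A - T) < ennreal e"
  proof -
    have "A \<in> sets lebesgue" using A by simp
    from sets_lebesgue_inner_closed[OF this e] show ?thesis using that by blast
  qed
  obtain U where U: "open U" "A \<subseteq> U" "emeasure lborel (U - A) < ennreal e"
    using outer_regular_lborel[OF A e] by blast
  have [measurable]: "T \<in> sets borel" "U \<in> sets borel" using T U by auto
  have "emeasure lebesgue (A - T) = emeasure lborel (A - T)" by simp
  then have AT: "emeasure lborel (A - T) < ennreal e" using T by simp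
  have "emeasure lborel (U - T) \<le> emeasure lborel (U - A) + emeasure lborel (A - T)"
    by (rule order_trans[OF emeasure_mono[of _ "(U - A) \<union> (A - T)"] emeasure_subadditive]) auto
  also have "\<dots> < ennreal e + ennreal e" using AT U by (intro add_strict_mono)
  finally have UT: "emeasure lborel (U - T) < ennreal (2 * e)" using e by (simp flip: ennreal_plus)
  have Tfin: "emeasure lborel T < \<infinity>" using base T(2)
    by (meson A emeasure_mono le_less_trans sets_lborel)
  obtain T' where T': "compact T'" "T' \<subseteq> T" "emeasure lborel (T - T') < ennreal e"
  proof -
    \<comment> \<open>Regularity supplies a closed inner set; cutting it with a large ball makes it
      compact at the cost of a small measure.\<close>
    define Tn where "Tn = (\<lambda>n::nat. T - cball 0 (real n))"
    have "(\<lambda>n. emeasure lborel (Tn n)) \<longlonglongrightarrow> emeasure lborel (\<Inter>n. Tn n)"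
    proof (rule Lim_emeasure_decseq)
      show "range Tn \<subseteq> sets lborel" by (auto simp: Tn_def)
      show "decseq Tn" by (auto simp: decseq_def Tn_def)
      show "emeasure lborel (Tn i) \<noteq> \<infinity>" for i
        using Tfin emeasure_mono[of "Tn i" T lborel] by (auto simp: Tn_def top_unique less_top)
    qed
    moreover have "(\<Inter>n. Tn n) = {}"
    proof -
      have "\<exists>n. x \<notin> Tn n" for x using real_arch_simple[of "norm x"] by (auto simp: Tn_def)
      then show ?thesis by blast
    qed
    ultimately have "(\<lambda>n. emeasure lborel (Tn n)) \<longlonglongrightarrow> 0" by simp
    then have "\<forall>\<^sub>F n in sequentially. emeasure lborel (Tn n) < ennreal e"
      using e by (intro order_tendstoD) auto
    then obtain n where "emeasure lborel (Tn n) < ennreal e" by (auto simp: eventually_sequentially)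
    moreover have "T - (T \<inter> cball 0 (real n)) = Tn n" by (auto simp: Tn_def)
    ultimately show ?thesis using T by (intro that[of "T \<inter> cball 0 (real n)"]) auto
  qed
  have [measurable]: "T' \<in> sets borel" using T' by (auto intro: borel_compact)
  have "emeasure lborel (U - T') \<le> emeasure lborel (U - T) + emeasure lborel (T - T')"
    by (rule order_trans[OF emeasure_mono[of _ "(U - T) \<union> (T - T')"] emeasure_subadditive]) auto
  also have "\<dots> \<le> ennreal (2 * e) + ennreal e" using UT T' by (intro add_mono) auto
  finally have UT': "emeasure lborel (U - T') \<le> ennreal (3 * e)" using e by (simp flip: ennreal_plus)
  have "compact T'" "closed (- U)" "T' \<inter> - U = {}" using T' T U by auto
  then obtain \<delta> where \<delta>: "\<delta> > 0" "\<And>x y. x \<in> T' \<Longrightarrow> y \<in> - U \<Longrightarrow> \<delta> \<le> dist x y"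
    using separate_compact_closed[of T' "- U"] by auto
  show ?case
  proof (intro exI[of _ \<delta>] conjI allI impI)
    fix v :: 'a assume v: "norm v < \<delta>"
    have shift: "x + w \<in> U" if "x \<in> T'" "norm w < \<delta>" for x w
      using \<delta>(2)[OF that(1), of "x + w"] that(2) by (auto simp: dist_norm)
    have "(\<integral>\<^sup>+x. norm (indicator A (x + v) *\<^sub>R c - indicator A x *\<^sub>R c) \<partial>lborel)
      \<le> (\<integral>\<^sup>+x. ennreal (norm c) * (indicator (U - T') x + indicator (U - T') (x + v)) \<partial>lborel)"
    proof (rule nn_integral_mono)
      fix x
      have "T' \<subseteq> A" "A \<subseteq> U" using T T' U by auto
      moreover have "x \<in> T' \<Longrightarrow> x + v \<in> U" "x + v \<in> T' \<Longrightarrow> x \<in> U"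
        using shift[of x v] shift[of "x + v" "- v"] v by auto
      ultimately show "ennreal (norm (indicator A (x + v) *\<^sub>R c - indicator A x *\<^sub>R c))
          \<le> ennreal (norm c) * (indicator (U - T') x + indicator (U - T') (x + v))"
        by (auto simp: indicator_def distrib_left)
    qed
    also have "\<dots> = ennreal (norm c) * (emeasure lborel (U - T') + (\<integral>\<^sup>+x. indicator (U - T') (x + v) \<partial>lborel))"
      by (subst nn_integral_cmult, simp, subst nn_integral_add, simp, simp, simp)
    also have "(\<integral>\<^sup>+x. indicator (U - T') (x + v) \<partial>lborel) = emeasure lborel (U - T')"
      by (subst nn_integral_lborel_translate[of "indicator (U - T')"]) auto
    also have "ennreal (norm c) * (emeasure lborel (U - T') + emeasure lborel (U - T')) \<le> ennreal (norm c) * (ennreal (3 * e) + ennreal (3 * e))"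
      by (intro mult_left_mono add_mono UT') auto
    also have "\<dots> = ennreal (norm c * (6 * e))" using e by (simp flip: ennreal_plus ennreal_mult)
    also have "\<dots> < ennreal \<epsilon>"
    proof (rule ennreal_lessI)
      have "norm c * (6 * e) \<le> (norm c + 1) * (6 * e)" using e by (intro mult_right_mono) auto
      also have "\<dots> = \<epsilon> * (6 / 8)" unfolding e_def
        using norm_ge_zero[of c] by (simp add: field_simps add_nonneg_eq_0_iff)
      also have "\<dots> < \<epsilon>" using base by simp
      finally show "norm c * (6 * e) < \<epsilon>" .
    qed (use base in auto)
    finally show "(\<integral>\<^sup>+x. norm (indicator A (x + v) *\<^sub>R c - indicator A x *\<^sub>R c) \<partial>lborel) < ennreal \<epsilon>" .
  qed (rule \<delta>(1))
next
  case (add f g)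
  obtain d1 where d1: "d1 > 0" "\<And>v. norm v < d1 \<Longrightarrow> (\<integral>\<^sup>+x. norm (f (x + v) - f x) \<partial>lborel) < ennreal (\<epsilon>/2)"
    using add.IH(1)[of "\<epsilon>/2"] add.prems by auto
  obtain d2 where d2: "d2 > 0" "\<And>v. norm v < d2 \<Longrightarrow> (\<integral>\<^sup>+x. norm (g (x + v) - g x) \<partial>lborel) < ennreal (\<epsilon>/2)"
    using add.IH(2)[of "\<epsilon>/2"] add.prems by auto
  have [measurable]: "f \<in> borel_measurable borel" "g \<in> borel_measurable borel" using add by auto
  show ?case
  proof (intro exI[of _ "min d1 d2"] conjI allI impI)
    fix v :: 'a assume v: "norm v < min d1 d2"
    have "(\<integral>\<^sup>+x. norm (f (x + v) + g (x + v) - (f x + g x)) \<partial>lborel)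
      \<le> (\<integral>\<^sup>+x. ennreal (norm (f (x + v) - f x)) + ennreal (norm (g (x + v) - g x)) \<partial>lborel)"
    proof (rule nn_integral_mono)
      fix x
      have "norm (f (x + v) + g (x + v) - (f x + g x)) \<le> norm (f (x + v) - f x) + norm (g (x + v) - g x)"
        unfolding add_diff_add by (rule norm_triangle_ineq)
      then show "ennreal (norm (f (x + v) + g (x + v) - (f x + g x))) \<le> ennreal (norm (f (x + v) - f x)) + ennreal (norm (g (x + v) - g x))"
        by (simp flip: ennreal_plus)
    qed
    also have "\<dots> = (\<integral>\<^sup>+x. ennreal (norm (f (x + v) - f x)) \<partial>lborel) + (\<integral>\<^sup>+x. ennreal (norm (g (x + v) - g x)) \<partial>lborel)"
      by (rule nn_integral_add) auto
    also have "\<dots> < ennreal (\<epsilon>/2) + ennreal (\<epsilon>/2)" using d1 d2 v by (intro add_strict_mono) auto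
    also have "\<dots> = ennreal \<epsilon>" using add.prems by (simp flip: ennreal_plus)
    finally show "(\<integral>\<^sup>+x. norm (f (x + v) + g (x + v) - (f x + g x)) \<partial>lborel) < ennreal \<epsilon>" .
  qed (use d1 d2 in auto)
next
  case (lim f s)
  have [measurable]: "f \<in> borel_measurable borel" "\<And>i. s i \<in> borel_measurable borel" using lim by auto
  have "(\<lambda>i. \<integral>\<^sup>+x. norm (f x - s i x) \<partial>lborel) \<longlonglongrightarrow> 0"
  proof (rule nn_integral_dominated_convergence_norm[where w="\<lambda>x. 2 * norm (f x)"])
    show "(\<integral>\<^sup>+ x. ennreal (2 * norm (f x)) \<partial>lborel) < \<infinity>"
      using lim by (intro finite_measure.integrable_const | auto simp: integrable_iff_bounded ennreal_mult nn_integral_cmult ennreal_mult_less_top)+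
  qed (use lim in auto)
  then have "\<forall>\<^sub>F i in sequentially. (\<integral>\<^sup>+x. norm (f x - s i x) \<partial>lborel) < ennreal (\<epsilon>/3)"
    using lim.prems by (intro order_tendstoD) auto
  then obtain i where i: "(\<integral>\<^sup>+x. norm (f x - s i x) \<partial>lborel) < ennreal (\<epsilon>/3)"
    by (auto simp: eventually_sequentially)
  obtain d where d: "d > 0" "\<And>v. norm v < d \<Longrightarrow> (\<integral>\<^sup>+x. norm (s i (x + v) - s i x) \<partial>lborel) < ennreal (\<epsilon>/3)"
    using lim.IH[of "\<epsilon>/3" i] lim.prems by auto
  show ?case
  proof (intro exI[of _ d] conjI allI impI)
    fix v :: 'a assume v: "norm v < d"
    have "(\<integral>\<^sup>+x. norm (f (x + v) - f x) \<partial>lborel)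
      \<le> (\<integral>\<^sup>+x. ennreal (norm (f (x + v) - s i (x + v))) + ennreal (norm (s i (x + v) - s i x)) + ennreal (norm (f x - s i x)) \<partial>lborel)"
    proof (rule nn_integral_mono)
      fix x
      have "norm (f (x + v) - f x) \<le> norm (f (x + v) - s i (x + v)) + norm (s i (x + v) - s i x) + norm (f x - s i x)"
        using norm_triangle_ineq[of "(f (x + v) - s i (x + v)) + (s i (x + v) - s i x)" "s i x - f x"]
          norm_triangle_ineq[of "f (x + v) - s i (x + v)" "s i (x + v) - s i x"]
        by (simp add: norm_minus_commute)
      then show "ennreal (norm (f (x + v) - f x)) \<le> ennreal (norm (f (x + v) - s i (x + v))) + ennreal (norm (s i (x + v) - s i x)) + ennreal (norm (f x - s i x))"
        by (simp flip: ennreal_plus)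
    qed
    also have "\<dots> = (\<integral>\<^sup>+x. ennreal (norm (f (x + v) - s i (x + v))) \<partial>lborel) + (\<integral>\<^sup>+x. ennreal (norm (s i (x + v) - s i x)) \<partial>lborel) + (\<integral>\<^sup>+x. ennreal (norm (f x - s i x)) \<partial>lborel)"
      by (subst nn_integral_add, simp, simp)+ (rule refl)
    also have "(\<integral>\<^sup>+x. ennreal (norm (f (x + v) - s i (x + v))) \<partial>lborel) = (\<integral>\<^sup>+x. ennreal (norm (f x - s i x)) \<partial>lborel)"
      by (rule nn_integral_lborel_translate) auto
    also have "(\<integral>\<^sup>+x. ennreal (norm (f x - s i x)) \<partial>lborel) + (\<integral>\<^sup>+x. ennreal (norm (s i (x + v) - s i x)) \<partial>lborel) + (\<integral>\<^sup>+x. ennreal (norm (f x - s i x)) \<partial>lborel)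
       < ennreal (\<epsilon>/3) + ennreal (\<epsilon>/3) + ennreal (\<epsilon>/3)" using i d v by (intro add_strict_mono) auto
    also have "\<dots> = ennreal \<epsilon>" using lim.prems by (simp flip: ennreal_plus)
    finally show "(\<integral>\<^sup>+x. norm (f (x + v) - f x) \<partial>lborel) < ennreal \<epsilon>" .
  qed (use d in auto)
qed

text \<open>Truncate in height. For bounded functions the N-th power of the difference is at most a
  constant times the difference itself, which reduces to L^1, and the bounded support makes the
  truncation integrable. The truncation error is small by dominated convergence.\<close>

lemma LN_translation_continuous:
  fixes q :: "'a::euclidean_space \<Rightarrow> 'b::{banach,second_countable_topology}"
  assumes [measurable]: "q \<in> borel_measurable borel" and fin: "(\<integral>\<^sup>+x. norm (q x) ^ N \<partial>lborel) < \<infinity>"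
    and supp: "\<And>x. norm x > R \<Longrightarrow> q x = 0" and "N > 0" and "\<epsilon> > (0::real)"
  shows "\<exists>\<delta>>0. \<forall>v. norm v < \<delta> \<longrightarrow> (\<integral>\<^sup>+x. norm (q (x + v) - q x) ^ N \<partial>lborel) < ennreal \<epsilon>"
proof -
  define qm where "qm = (\<lambda>(m::nat) x. if norm (q x) \<le> real m then q x else 0)"
  have [measurable]: "qm m \<in> borel_measurable borel" for m unfolding qm_def by measurable
  define e where "e = \<epsilon> / (4 * 3 ^ N)"
  have e: "e > 0" using assms by (simp add: e_def)
  have "(\<lambda>m. \<integral>\<^sup>+x. norm (q x - qm m x) ^ N \<partial>lborel) \<longlonglongrightarrow> (\<integral>\<^sup>+(x::'a). 0 \<partial>lborel)"
  proof (rule nn_integral_dominated_convergence[where w="\<lambda>x. ennreal (norm (q x) ^ N)"])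
    show "AE x in lborel. ennreal (norm (q x - qm j x) ^ N) \<le> ennreal (norm (q x) ^ N)" for j
      by (intro AE_I2 ennreal_leI power_mono) (auto simp: qm_def)
    show "AE x in lborel. (\<lambda>i. ennreal (norm (q x - qm i x) ^ N)) \<longlonglongrightarrow> 0"
    proof (rule AE_I2, rule tendsto_eventually)
      fix x
      obtain m where "norm (q x) \<le> real m" using real_arch_simple by blast
      then show "\<forall>\<^sub>F i in sequentially. ennreal (norm (q x - qm i x) ^ N) = 0"
        using \<open>N > 0\<close> by (auto simp: eventually_sequentially qm_def intro!: exI[of _ m])
    qed
  qed (use fin in auto)
  then have "\<forall>\<^sub>F m in sequentially. (\<integral>\<^sup>+x. norm (q x - qm m x) ^ N \<partial>lborel) < ennreal e"
    using e by (intro order_tendstoD) auto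
  then obtain m where m: "(\<integral>\<^sup>+x. norm (q x - qm m x) ^ N \<partial>lborel) < ennreal e"
    by (auto simp: eventually_sequentially)
  define p where "p = qm m"
  have [measurable]: "p \<in> borel_measurable borel" by (simp add: p_def)
  have pb: "norm (p x) \<le> real m" for x by (simp add: p_def qm_def)
  have "integrable lborel p"
  proof (rule Bochner_Integration.integrable_bound[of _ "\<lambda>x. real m * indicator (cball 0 R) x"])
    show "integrable lborel (\<lambda>x::'a. real m * indicator (cball 0 R) x)"
      using emeasure_bounded_finite[of "cball (0::'a) R"]
      by (intro integrable_mult_right integrable_real_indicator) auto
    show "AE x in lborel. norm (p x) \<le> norm (real m * indicator (cball 0 R) x)"
      using pb supp by (auto simp: indicator_def p_def qm_def not_le)
  qed auto
  \<comment> \<open>Two values of the truncation differ by at most \<open>2 * real m\<close>; the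
    extra 1 keeps the constant positive.\<close>
  define M where "M = (2 * real m + 1) ^ (N - 1)"
  have M: "M > 0" unfolding M_def by (intro zero_less_power) auto
  obtain \<delta> where \<delta>: "\<delta> > 0" "\<And>v. norm v < \<delta> \<Longrightarrow> (\<integral>\<^sup>+x. norm (p (x + v) - p x) \<partial>lborel) < ennreal (e / M)"
    using L1_translation_continuous[OF \<open>integrable lborel p\<close>, of "e / M"] e M by auto
  show ?thesis
  proof (intro exI[of _ \<delta>] conjI allI impI)
    fix v :: 'a assume v: "norm v < \<delta>"
    have "(\<integral>\<^sup>+x. norm (q (x + v) - q x) ^ N \<partial>lborel)
      \<le> (\<integral>\<^sup>+x. ennreal (3 ^ N) * (ennreal (norm (q (x + v) - p (x + v)) ^ N) + ennreal M * ennreal (norm (p (x + v) - p x)) + ennreal (norm (q x - p x) ^ N)) \<partial>lborel)"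
    proof (rule nn_integral_mono)
      fix x
      have "norm (q (x + v) - q x) \<le> norm (q (x + v) - p (x + v)) + norm (p (x + v) - p x) + norm (q x - p x)"
        using norm_triangle_ineq[of "(q (x + v) - p (x + v)) + (p (x + v) - p x)" "p x - q x"]
          norm_triangle_ineq[of "q (x + v) - p (x + v)" "p (x + v) - p x"]
        by (simp add: norm_minus_commute)
      then have "norm (q (x + v) - q x) ^ N \<le> (norm (q (x + v) - p (x + v)) + norm (p (x + v) - p x) + norm (q x - p x)) ^ N"
        by (intro power_mono) auto
      also have "\<dots> \<le> 3 ^ N * (norm (q (x + v) - p (x + v)) ^ N + norm (p (x + v) - p x) ^ N + norm (q x - p x) ^ N)"
        by (rule power_add3_le) auto
      also have "norm (p (x + v) - p x) ^ N = norm (p (x + v) - p x) ^ (N - 1) * norm (p (x + v) - p x)"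
        using \<open>N > 0\<close> by (metis power_minus_mult)
      also have "norm (p (x + v) - p x) ^ (N - 1) \<le> M"
        unfolding M_def using norm_triangle_ineq4[of "p (x + v)" "p x"] pb[of x] pb[of "x + v"]
        by (intro power_mono) auto
      finally have "norm (q (x + v) - q x) ^ N \<le> 3 ^ N * (norm (q (x + v) - p (x + v)) ^ N + M * norm (p (x + v) - p x) + norm (q x - p x) ^ N)"
        by (simp add: mult_left_mono mult_right_mono)
      then show "ennreal (norm (q (x + v) - q x) ^ N) \<le> ennreal (3 ^ N) * (ennreal (norm (q (x + v) - p (x + v)) ^ N) + ennreal M * ennreal (norm (p (x + v) - p x)) + ennreal (norm (q x - p x) ^ N))"
        using M by (simp flip: ennreal_plus ennreal_mult)
    qed
    also have "\<dots> = ennreal (3 ^ N) * ((\<integral>\<^sup>+x. ennreal (norm (q (x + v) - p (x + v)) ^ N) \<partial>lborel) + ennreal M * (\<integral>\<^sup>+x. norm (p (x + v) - p x) \<partial>lborel) + (\<integral>\<^sup>+x. ennreal (norm (q x - p x) ^ N) \<partial>lborel))"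
      by (simp add: nn_integral_cmult nn_integral_add)
    also have "(\<integral>\<^sup>+x. ennreal (norm (q (x + v) - p (x + v)) ^ N) \<partial>lborel) = (\<integral>\<^sup>+x. ennreal (norm (q x - p x) ^ N) \<partial>lborel)"
      by (rule nn_integral_lborel_translate) auto
    also have "ennreal (3 ^ N) * ((\<integral>\<^sup>+x. ennreal (norm (q x - p x) ^ N) \<partial>lborel) + ennreal M * (\<integral>\<^sup>+x. norm (p (x + v) - p x) \<partial>lborel) + (\<integral>\<^sup>+x. ennreal (norm (q x - p x) ^ N) \<partial>lborel))
      \<le> ennreal (3 ^ N) * (ennreal e + ennreal M * ennreal (e / M) + ennreal e)"
      using m \<delta>(2)[OF v] by (intro mult_left_mono add_mono) (auto simp: p_def less_imp_le)
    also have "\<dots> = ennreal (3 ^ N * (3 * e))" using e M by (simp flip: ennreal_plus ennreal_mult)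
    also have "\<dots> < ennreal \<epsilon>" using assms by (intro ennreal_lessI) (auto simp: e_def)
    finally show "(\<integral>\<^sup>+x. norm (q (x + v) - q x) ^ N \<partial>lborel) < ennreal \<epsilon>" .
  qed (rule \<delta>(1))
qed

section \<open>Mollification in a convex cone\<close>

lemma integral_lborel_affine:
  fixes f :: "'a::euclidean_space \<Rightarrow> 'b::{banach,second_countable_topology}"
  assumes [measurable]: "f \<in> borel_measurable borel" and "c > 0"
  shows "(LINT x|lborel. f (c *\<^sub>R x + v)) = (1 / c ^ DIM('a)) *\<^sub>R (LINT x|lborel. f x)"
proof -
  have "(LINT x|lborel. f x) = (LINT x|density (distr lborel borel (\<lambda>x. v + c *\<^sub>R x)) (\<lambda>_. \<bar>c\<bar> ^ DIM('a)). f x)"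
    using lborel_affine[of c v] \<open>c > 0\<close> by simp
  also have "\<dots> = (c ^ DIM('a)) *\<^sub>R (LINT x|lborel. f (v + c *\<^sub>R x))"
    using \<open>c > 0\<close> by (simp add: integral_density integral_distr)
  finally show ?thesis using \<open>c > 0\<close> by (simp add: add.commute)
qed

text \<open>Convexity as the tangent line at \<open>m\<close>, which is Bernoulli's inequality after
  division by \<open>m ^ n\<close>.\<close>

lemma power_tangent_le:
  fixes m t :: real
  assumes "m \<ge> 0" "t \<ge> 0" "n > 0"
  shows "m ^ n + real n * m ^ (n - 1) * (t - m) \<le> t ^ n"
proof (cases "m = 0")
  case True
  then show ?thesis using assms by (cases n) (auto simp: power_0_left)
next
  case False
  then have m: "m > 0" using assms by simp
  have "1 + real n * ((t - m) / m) \<le> (1 + (t - m) / m) ^ n"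
    using assms m by (intro Bernoulli_inequality) (auto simp: field_simps)
  also have "1 + (t - m) / m = t / m" using m by (simp add: field_simps)
  finally have "m ^ n * (1 + real n * ((t - m) / m)) \<le> t ^ n"
    using m mult_left_mono[of "1 + real n * ((t - m) / m)" "(t / m) ^ n" "m ^ n"] by (simp add: power_divide)
  also have "m ^ n * (1 + real n * ((t - m) / m)) = m ^ n + real n * (m ^ n / m) * (t - m)"
    by (simp add: algebra_simps)
  also have "m ^ n / m = m ^ (n - 1)" using m \<open>n > 0\<close> by (cases n) auto
  finally show ?thesis .
qed

text \<open>Integrate the tangent line inequality at the weighted mean of the norm, where the linear
  term has mean 0. An infinite right-hand side leaves nothing to show.\<close>

lemma jensen_power:
  fixes H :: "'a \<Rightarrow> 'b::{banach,second_countable_topology}"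
  assumes "integrable M \<rho>" "integral\<^sup>L M \<rho> = 1" "\<And>x. \<rho> x \<ge> (0::real)"
    and [measurable]: "H \<in> borel_measurable M" and HI: "integrable M (\<lambda>x. \<rho> x *\<^sub>R H x)" and "n > 0"
  shows "ennreal (norm (LINT x|M. \<rho> x *\<^sub>R H x) ^ n) \<le> (\<integral>\<^sup>+x. \<rho> x * norm (H x) ^ n \<partial>M)"
proof (cases "(\<integral>\<^sup>+x. \<rho> x * norm (H x) ^ n \<partial>M) < \<infinity>")
  case False
  then show ?thesis by (metis infinity_ennreal_def top.not_eq_extremum top_greatest)
next
  case True
  have [measurable]: "\<rho> \<in> borel_measurable M" using assms by auto
  have I: "integrable M (\<lambda>x. \<rho> x * norm (H x) ^ n)"
    using True assms(3) by (intro integrableI_nonneg) auto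
  define m where "m = (LINT x|M. \<rho> x * norm (H x))"
  have J: "integrable M (\<lambda>x. \<rho> x * norm (H x))"
    using integrable_norm[OF HI] assms(3) by simp
  have m: "m \<ge> 0" unfolding m_def using assms(3) by (intro Bochner_Integration.integral_nonneg) auto
  have "norm (LINT x|M. \<rho> x *\<^sub>R H x) \<le> (LINT x|M. norm (\<rho> x *\<^sub>R H x))"
    by (rule integral_norm_bound)
  also have "\<dots> = m" unfolding m_def using assms(3) by simp
  finally have "norm (LINT x|M. \<rho> x *\<^sub>R H x) ^ n \<le> m ^ n" by (intro power_mono) auto
  also have "m ^ n = (LINT x|M. m ^ n * \<rho> x + real n * m ^ (n - 1) * (\<rho> x * norm (H x) - m * \<rho> x))"
    using assms(1,2) J by (simp add: m_def)
  also have "\<dots> \<le> (LINT x|M. \<rho> x * norm (H x) ^ n)"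
  proof (rule integral_mono)
    show "integrable M (\<lambda>x. m ^ n * \<rho> x + real n * m ^ (n - 1) * (\<rho> x * norm (H x) - m * \<rho> x))"
      using assms(1) J by auto
    fix x
    have "\<rho> x * (m ^ n + real n * m ^ (n - 1) * (norm (H x) - m)) \<le> \<rho> x * norm (H x) ^ n"
      using power_tangent_le[OF m _ \<open>n > 0\<close>, of "norm (H x)"] assms(3) by (intro mult_left_mono) auto
    then show "m ^ n * \<rho> x + real n * m ^ (n - 1) * (\<rho> x * norm (H x) - m * \<rho> x) \<le> \<rho> x * norm (H x) ^ n"
      by (simp add: algebra_simps)
  qed (rule I)
  finally have "ennreal (norm (LINT x|M. \<rho> x *\<^sub>R H x) ^ n) \<le> ennreal (LINT x|M. \<rho> x * norm (H x) ^ n)"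
    by (rule ennreal_leI)
  also have "\<dots> = (\<integral>\<^sup>+x. \<rho> x * norm (H x) ^ n \<partial>M)"
    using I assms(3) by (intro nn_integral_eq_integral[symmetric]) auto
  finally show ?thesis .
qed

lemma uniformly_continuous_compact_support:
  fixes h :: "'a::euclidean_space \<Rightarrow> 'b::real_normed_vector"
  assumes "continuous_on UNIV h" "compact K" "\<And>x. x \<notin> K \<Longrightarrow> h x = 0"
  shows "uniformly_continuous_on UNIV h"
proof -
  define K1 where "K1 = {x + y |x y. x \<in> K \<and> y \<in> cball 0 1}"
  have "compact K1" unfolding K1_def using assms by (intro compact_sums) auto
  then have uc: "uniformly_continuous_on K1 h"
    using assms by (intro compact_uniformly_continuous) (auto intro: continuous_on_subset)
  show ?thesis
    unfolding uniformly_continuous_on_def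
  proof (intro allI impI)
    fix e :: real assume "e > 0"
    then obtain d where d: "d > 0" "\<And>x x'. x \<in> K1 \<Longrightarrow> x' \<in> K1 \<Longrightarrow> dist x' x < d \<Longrightarrow> dist (h x') (h x) < e"
      using uc unfolding uniformly_continuous_on_def by meson
    show "\<exists>d>0. \<forall>x\<in>UNIV. \<forall>x'\<in>UNIV. dist x' x < d \<longrightarrow> dist (h x') (h x) < e"
    proof (intro exI[of _ "min d 1"] conjI ballI impI)
      fix x x' :: 'a assume *: "dist x' x < min d 1"
      show "dist (h x') (h x) < e"
      proof (cases "x \<in> K \<or> x' \<in> K")
        case True
        have "x = x + 0" "x' = x' + 0" "x = x' + (x - x')" "x' = x + (x' - x)" by auto
        moreover have "norm (x - x') \<le> 1" "norm (x' - x) \<le> 1" using * by (auto simp: dist_norm norm_minus_commute)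
        ultimately have "x \<in> K1 \<and> x' \<in> K1" using True unfolding K1_def mem_Collect_eq
          by (metis mem_cball_0 norm_zero zero_le_one)
        then show ?thesis using d(2)[of x x'] * by simp
      next
        case False
        then show ?thesis using assms(3) \<open>e > 0\<close> by simp
      qed
    qed (use d in auto)
  qed
qed

text \<open>Differentiation under the integral with \<open>U\<close> merely integrable: the Taylor
  remainder of the kernel is uniformly small because its gradient is uniformly continuous. The minus
  sign is the inner derivative of y - x with respect to x.\<close>

lemma convolution_C1:
  fixes U :: "real^'n \<Rightarrow> real"
  assumes U: "integrable lborel U" and k: "C1c k Dk S"
  shows "GDERIV (\<lambda>x. LINT y|lborel. U y * k (y - x)) x :> - (LINT y|lborel. U y *\<^sub>R Dk (y - x))" (is ?A)
    and "continuous_on UNIV (\<lambda>x. - (LINT y|lborel. U y *\<^sub>R Dk (y - x)))" (is ?B)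
proof -
  note C = C1cD[OF k]
  have [measurable]: "U \<in> borel_measurable borel" "k \<in> borel_measurable borel" "Dk \<in> borel_measurable borel"
    using U C by (auto intro: borel_measurable_continuous_onI)
  obtain B where B: "B > 0" "\<And>x. norm (k x) \<le> B" using bounded_compact_support[of k S] C by metis
  obtain B' where B': "B' > 0" "\<And>x. norm (Dk x) \<le> B'" using bounded_compact_support[of Dk S] C by metis
  have i1: "integrable lborel (\<lambda>y. U y * k (y - x))" for x
  proof (rule Bochner_Integration.integrable_bound[of _ "\<lambda>y. B * U y"])
    show "AE y in lborel. norm (U y * k (y - x)) \<le> norm (B * U y)"
      by (rule AE_I2) (use mult_left_mono[OF B(2) abs_ge_zero] B(1) in \<open>simp add: abs_mult mult.commute[of B]\<close>)
  qed (use U in auto)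
  have i2: "integrable lborel (\<lambda>y. U y *\<^sub>R Dk (y - x))" for x
  proof (rule Bochner_Integration.integrable_bound[of _ "\<lambda>y. B' * U y"])
    show "AE y in lborel. norm (U y *\<^sub>R Dk (y - x)) \<le> norm (B' * U y)"
      by (rule AE_I2) (use mult_left_mono[OF B'(2) abs_ge_zero] B'(1) in \<open>simp add: abs_mult mult.commute[of B']\<close>)
  qed (use U in auto)
  define I where "I = (LINT y|lborel. \<bar>U y\<bar>) + 1"
  have iU: "integrable lborel (\<lambda>y. \<bar>U y\<bar>)" using U by auto
  have I: "I > 0" "(LINT y|lborel. \<bar>U y\<bar>) \<le> I"
    using Bochner_Integration.integral_nonneg[of lborel "\<lambda>y. \<bar>U y\<bar>"] by (simp_all add: I_def add_nonneg_pos)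
  have uc: "uniformly_continuous_on UNIV Dk" using C by (intro uniformly_continuous_compact_support) auto
  have mod: "\<exists>d>0. \<forall>x y. norm (y - x) < d \<longrightarrow> norm (Dk y - Dk x) \<le> e" if "e > 0" for e
  proof -
    have "\<exists>d>0. \<forall>x\<in>UNIV. \<forall>x'\<in>UNIV. dist x' x < d \<longrightarrow> dist (Dk x') (Dk x) < e"
      using uc that unfolding uniformly_continuous_on_def by blast
    then obtain d where "d > 0" "\<forall>x\<in>UNIV. \<forall>x'\<in>UNIV. dist x' x < d \<longrightarrow> dist (Dk x') (Dk x) < e" by blast
    then show ?thesis by (intro exI[of _ d] conjI allI impI less_imp_le) (auto simp: dist_norm)
  qed
  show ?A
    unfolding gderiv_def has_derivative_at_alt
  proof (intro conjI allI impI)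
    show "bounded_linear (\<lambda>h. h \<bullet> - (LINT y|lborel. U y *\<^sub>R Dk (y - x)))" by (rule bounded_linear_inner_left)
    fix e :: real assume "e > 0"
    then obtain d where d: "d > 0" "\<And>x y. norm (y - x) < d \<Longrightarrow> norm (Dk y - Dk x) \<le> e / I"
      using mod[OF divide_pos_pos[OF \<open>e > 0\<close> I(1)]] by blast
    have lin: "\<bar>k z' - k z - (z' - z) \<bullet> Dk z\<bar> \<le> e / I * norm (z' - z)" if "norm (z' - z) < d" for z z'
    proof -
      have "norm ((k z' - z' \<bullet> Dk z) - (k z - z \<bullet> Dk z)) \<le> (e / I) * norm (z' - z)"
      proof (rule differentiable_bound[of "ball z d" "\<lambda>w. k w - w \<bullet> Dk z" "\<lambda>w v. v \<bullet> (Dk w - Dk z)"])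
        fix w assume w: "w \<in> ball z d"
        show "((\<lambda>w. k w - w \<bullet> Dk z) has_derivative (\<lambda>v. v \<bullet> (Dk w - Dk z))) (at w within ball z d)"
          by (rule has_derivative_at_withinI)
            (use C(1)[of w] in \<open>auto simp: gderiv_def inner_diff_right intro!: derivative_eq_intros\<close>)
        show "onorm (\<lambda>v. v \<bullet> (Dk w - Dk z)) \<le> e / I"
        proof (rule onorm_le)
          fix v
          show "norm (v \<bullet> (Dk w - Dk z)) \<le> e / I * norm v"
            using Cauchy_Schwarz_ineq2[of v "Dk w - Dk z"]
              mult_left_mono[OF d(2)[of w z] norm_ge_zero[of v]] w
            by (simp add: mult.commute dist_norm norm_minus_commute)
        qed
      qed (use that d in \<open>auto simp: dist_norm norm_minus_commute\<close>)
      moreover have "(k z' - z' \<bullet> Dk z) - (k z - z \<bullet> Dk z) = k z' - k z - (z' - z) \<bullet> Dk z"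
        unfolding inner_diff_left by simp
      ultimately show ?thesis by (simp only: real_norm_def)
    qed
    show "\<exists>d>0. \<forall>y. norm (y - x) < d \<longrightarrow>
        norm ((LINT ya|lborel. U ya * k (ya - y)) - (LINT y|lborel. U y * k (y - x)) -
          (y - x) \<bullet> - (LINT y|lborel. U y *\<^sub>R Dk (y - x))) \<le> e * norm (y - x)"
    proof (intro exI[of _ d] conjI allI impI d(1))
      fix x' assume x': "norm (x' - x) < d"
      have "(LINT y|lborel. U y * k (y - x')) - (LINT y|lborel. U y * k (y - x)) - (x' - x) \<bullet> - (LINT y|lborel. U y *\<^sub>R Dk (y - x))
        = (LINT y|lborel. U y * (k (y - x') - k (y - x) - ((y - x') - (y - x)) \<bullet> Dk (y - x)))"
      proof -
        have i3: "integrable lborel (\<lambda>y. (x' - x) \<bullet> (U y *\<^sub>R Dk (y - x)))" using i2 by (rule integrable_inner_right)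
        have "(x' - x) \<bullet> (LINT y|lborel. U y *\<^sub>R Dk (y - x)) = (LINT y|lborel. (x' - x) \<bullet> (U y *\<^sub>R Dk (y - x)))"
          using i2 by (intro integral_inner_right[symmetric]) auto
        then have "(LINT y|lborel. U y * k (y - x')) - (LINT y|lborel. U y * k (y - x)) - (x' - x) \<bullet> - (LINT y|lborel. U y *\<^sub>R Dk (y - x))
          = (LINT y|lborel. U y * k (y - x')) - (LINT y|lborel. U y * k (y - x)) + (LINT y|lborel. (x' - x) \<bullet> (U y *\<^sub>R Dk (y - x)))"
          by (simp only: inner_minus_right diff_minus_eq_add)
        also have "\<dots> = (LINT y|lborel. U y * k (y - x') - U y * k (y - x) + (x' - x) \<bullet> (U y *\<^sub>R Dk (y - x)))"
          by (simp only: Bochner_Integration.integral_add[OF Bochner_Integration.integrable_diff[OF i1 i1] i3]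
              Bochner_Integration.integral_diff[OF i1 i1])
        also have "\<dots> = (LINT y|lborel. U y * (k (y - x') - k (y - x) - ((y - x') - (y - x)) \<bullet> Dk (y - x)))"
        proof (intro Bochner_Integration.integral_cong refl)
          fix y
          have "(y - x') - (y - x) = - (x' - x)" by simp
          then show "U y * k (y - x') - U y * k (y - x) + (x' - x) \<bullet> (U y *\<^sub>R Dk (y - x))
            = U y * (k (y - x') - k (y - x) - ((y - x') - (y - x)) \<bullet> Dk (y - x))"
            by (simp only: inner_minus_left inner_scaleR_right diff_minus_eq_add distrib_left right_diff_distrib)
        qed
        finally show ?thesis .
      qed
      also have "norm \<dots> \<le> (LINT y|lborel. \<bar>U y\<bar> * (e / I * norm (x' - x)))"
      proof (rule order_trans[OF integral_norm_bound integral_mono_AE'])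
        show "AE y in lborel. norm (U y * (k (y - x') - k (y - x) - ((y - x') - (y - x)) \<bullet> Dk (y - x))) \<le> \<bar>U y\<bar> * (e / I * norm (x' - x))"
        proof (rule AE_I2)
          fix y
          have "\<bar>k (y - x') - k (y - x) - ((y - x') - (y - x)) \<bullet> Dk (y - x)\<bar> \<le> e / I * norm ((y - x') - (y - x))"
            using x' by (intro lin) (simp add: norm_minus_commute)
          also have "norm ((y - x') - (y - x)) = norm (x' - x)" by (simp add: norm_minus_commute)
          finally show "norm (U y * (k (y - x') - k (y - x) - ((y - x') - (y - x)) \<bullet> Dk (y - x))) \<le> \<bar>U y\<bar> * (e / I * norm (x' - x))"
            unfolding real_norm_def abs_mult by (rule mult_left_mono) auto
        qed
      qed (use iU I \<open>e > 0\<close> in \<open>auto intro!: AE_I2 mult_nonneg_nonneg\<close>)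
      also have "\<dots> = (LINT y|lborel. \<bar>U y\<bar>) * (e / I * norm (x' - x))" by simp
      also have "\<dots> \<le> I * (e / I * norm (x' - x))" using I \<open>e > 0\<close> by (intro mult_right_mono) auto
      also have "\<dots> = e * norm (x' - x)" using I by simp
      finally show "norm ((LINT y|lborel. U y * k (y - x')) - (LINT y|lborel. U y * k (y - x)) - (x' - x) \<bullet> - (LINT y|lborel. U y *\<^sub>R Dk (y - x))) \<le> e * norm (x' - x)" .
    qed
  qed
  show ?B
    unfolding continuous_on_iff
  proof (intro ballI allI impI)
    fix x e assume "e > (0::real)"
    then obtain d where d: "d > 0" "\<And>x y. norm (y - x) < d \<Longrightarrow> norm (Dk y - Dk x) \<le> e / 2 / I"
      using mod[OF divide_pos_pos[OF half_gt_zero[OF \<open>e > 0\<close>] I(1)]] by blast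
    show "\<exists>d>0. \<forall>x'\<in>UNIV. dist x' x < d \<longrightarrow>
       dist (- (LINT y|lborel. U y *\<^sub>R Dk (y - x'))) (- (LINT y|lborel. U y *\<^sub>R Dk (y - x))) < e"
    proof (intro exI[of _ d] conjI ballI impI d(1))
      fix x' :: "real^'n" assume "dist x' x < d"
      then have x': "norm (x' - x) < d" by (simp add: dist_norm)
      have "dist (- (LINT y|lborel. U y *\<^sub>R Dk (y - x'))) (- (LINT y|lborel. U y *\<^sub>R Dk (y - x)))
         = norm ((LINT y|lborel. U y *\<^sub>R Dk (y - x')) - (LINT y|lborel. U y *\<^sub>R Dk (y - x)))"
        by (simp add: dist_norm norm_minus_commute)
      also have "\<dots> = norm (LINT y|lborel. U y *\<^sub>R (Dk (y - x') - Dk (y - x)))"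
        using i2 by (simp add: scaleR_diff_right)
      also have "\<dots> \<le> (LINT y|lborel. \<bar>U y\<bar> * (e / 2 / I))"
      proof (rule order_trans[OF integral_norm_bound integral_mono_AE'])
        show "AE y in lborel. norm (U y *\<^sub>R (Dk (y - x') - Dk (y - x))) \<le> \<bar>U y\<bar> * (e / 2 / I)"
        proof (rule AE_I2)
          fix y
          have "norm (Dk (y - x') - Dk (y - x)) \<le> e / 2 / I"
            using x' by (intro d(2)) (simp add: norm_minus_commute)
          then show "norm (U y *\<^sub>R (Dk (y - x') - Dk (y - x))) \<le> \<bar>U y\<bar> * (e / 2 / I)"
            unfolding norm_scaleR by (rule mult_left_mono) auto
        qed
      qed (use iU I \<open>e > 0\<close> in \<open>auto intro!: AE_I2 mult_nonneg_nonneg\<close>)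
      also have "\<dots> = (LINT y|lborel. \<bar>U y\<bar>) * (e / 2 / I)" by simp
      also have "\<dots> \<le> I * (e / 2 / I)" using I \<open>e > 0\<close> by (intro mult_right_mono) auto
      also have "\<dots> < e" using I \<open>e > 0\<close> by simp
      finally show "dist (- (LINT y|lborel. U y *\<^sub>R Dk (y - x'))) (- (LINT y|lborel. U y *\<^sub>R Dk (y - x))) < e" .
    qed
  qed
qed

lemma integrable_lborel_affine:
  fixes f :: "'a::euclidean_space \<Rightarrow> 'b::{banach,second_countable_topology}"
  assumes "integrable lborel f" and "c > 0"
  shows "integrable lborel (\<lambda>x. f (c *\<^sub>R x + v))"
proof -
  have [measurable]: "f \<in> borel_measurable borel" using assms by auto
  have "(\<integral>\<^sup>+x. norm (f (c *\<^sub>R x + v)) \<partial>lborel) = ennreal (1 / c ^ DIM('a)) * (\<integral>\<^sup>+x. norm (f x) \<partial>lborel)"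
    by (rule nn_integral_lborel_affine[OF _ \<open>c > 0\<close>]) auto
  also have "\<dots> < \<infinity>" using assms by (simp add: integrable_iff_bounded ennreal_mult_less_top)
  finally show ?thesis by (intro integrableI_bounded) auto
qed

lemma LIMSEQ_power_zero_imp:
  fixes f :: "nat \<Rightarrow> 'a::real_normed_vector"
  assumes "(\<lambda>n. norm (f n) ^ N) \<longlonglongrightarrow> 0"
  shows "f \<longlonglongrightarrow> 0"
proof (rule LIMSEQ_I)
  fix r :: real assume "r > 0"
  then have "\<forall>\<^sub>F n in sequentially. norm (f n) ^ N < r ^ N" using assms by (intro order_tendstoD) auto
  then obtain no where "\<And>n. n \<ge> no \<Longrightarrow> norm (f n) ^ N < r ^ N" by (auto simp: eventually_sequentially)
  then show "\<exists>no. \<forall>n\<ge>no. norm (f n - 0) < r"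
    using \<open>r > 0\<close> by (intro exI[of _ no]) (simp, meson less_imp_le power_less_imp_less_base)
qed

lemma cone_add_mem:
  assumes "convex C" "\<And>x t. x \<in> C \<Longrightarrow> t > 0 \<Longrightarrow> t *\<^sub>R x \<in> C" "x \<in> C" "y \<in> C"
  shows "x + y \<in> C"
proof -
  have "(1/2) *\<^sub>R x + (1/2) *\<^sub>R y \<in> C"
    using assms by (intro convexD) auto
  then have "2 *\<^sub>R ((1/2) *\<^sub>R x + (1/2) *\<^sub>R y) \<in> C" using assms(2) by force
  then show ?thesis by (simp add: scaleR_add_right)
qed

text \<open>A small ball around a point of the cone is blown up to radius 1. Its centre becomes the
  direction in which mollifying kernels are shifted into the cone.\<close>

lemma cone_unit_ball:
  fixes C :: "'a::euclidean_space set"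
  assumes "open C" "C \<noteq> {}" "\<And>x t. x \<in> C \<Longrightarrow> t > 0 \<Longrightarrow> t *\<^sub>R x \<in> C"
  obtains e where "cball e 1 \<subseteq> C"
proof -
  obtain p where "p \<in> C" using assms by auto
  then obtain s where s: "s > 0" "cball p s \<subseteq> C" using assms(1) open_contains_cball by blast
  have "cball ((1/s) *\<^sub>R p) 1 \<subseteq> C"
  proof
    fix y assume y: "y \<in> cball ((1/s) *\<^sub>R p) 1"
    have "norm (p - s *\<^sub>R y) = s * norm ((1/s) *\<^sub>R p - y)"
    proof -
      have "p - s *\<^sub>R y = s *\<^sub>R ((1/s) *\<^sub>R p - y)" using s by (simp add: scaleR_diff_right)
      then show ?thesis using s by simp
    qed
    also have "\<dots> \<le> s * 1" using y s by (intro mult_left_mono) (auto simp: dist_norm)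
    finally have "s *\<^sub>R y \<in> C" using s by (auto simp: dist_norm)
    from assms(3)[OF this, of "1/s"] s show "y \<in> C" by simp
  qed
  then show ?thesis using that by blast
qed

text \<open>The gap of 2 \<delta> above the unit sphere leaves room for the shift and the width of a
  mollifying kernel.\<close>

lemma compact_outside_cball:
  fixes S :: "'a::euclidean_space set"
  assumes "compact S" "S \<subseteq> - cball 0 1"
  obtains \<delta> r where "\<delta> > 0" "r > 1 + 2 * \<delta>" "\<And>x. x \<in> S \<Longrightarrow> 1 + 2 * \<delta> \<le> norm x \<and> norm x \<le> r"
proof (cases "S = {}")
  case True
  then show ?thesis using that[of 1 4] by auto
next
  case False
  obtain x0 where x0: "x0 \<in> S" "\<And>x. x \<in> S \<Longrightarrow> norm x0 \<le> norm x"
    using continuous_attains_inf[OF assms(1) False, of norm] by (auto intro: continuous_on_norm_id)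
  obtain r where r: "\<And>x. x \<in> S \<Longrightarrow> norm x \<le> r"
    using compact_imp_bounded[OF assms(1)] by (auto simp: bounded_iff)
  have "norm x0 > 1" using x0 assms by auto
  then show ?thesis
  proof (intro that[of "(norm x0 - 1) / 2" "r + 1"])
    show "r + 1 > 1 + 2 * ((norm x0 - 1) / 2)" using \<open>norm x0 > 1\<close> r[OF x0(1)] by (simp add: field_simps)
    show "1 + 2 * ((norm x0 - 1) / 2) \<le> norm x \<and> norm x \<le> r + 1" if "x \<in> S" for x
      using x0(2)[OF that] r[OF that] by (simp add: field_simps)
  qed simp
qed

text \<open>
  The kernel is centred at \<open>\<epsilon> *\<^sub>R e\<close> for an interior direction \<open>e\<close> of the cone, so that, as
  \<open>C + C \<subseteq> C\<close>, the average at a point of \<open>C\<close> only sees values in \<open>C\<close>, also near the boundary.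
\<close>

lemma mollification:
  fixes C :: "(real^'n) set" and u :: "real^'n \<Rightarrow> real" and g :: "real^'n \<Rightarrow> real^'n"
  assumes C: "open C" "C \<noteq> {}" "convex C" "\<And>x t. x \<in> C \<Longrightarrow> t > 0 \<Longrightarrow> t *\<^sub>R x \<in> C"
    and gm [measurable]: "g \<in> borel_measurable borel" and u_cont: "continuous_on (C - cball 0 1) u"
    and "N > 0"
    and uL: "\<And>S. compact S \<Longrightarrow> S \<subseteq> - cball 0 1 \<Longrightarrow> integrable lborel (\<lambda>x. indicator (S \<inter> C) x * u x)"
    and gL1: "\<And>S. compact S \<Longrightarrow> S \<subseteq> - cball 0 1 \<Longrightarrow> integrable lborel (\<lambda>x. indicator (S \<inter> C) x *\<^sub>R g x)"
    and gL: "\<And>S. compact S \<Longrightarrow> S \<subseteq> - cball 0 1 \<Longrightarrow> integrable lborel (\<lambda>x. indicator (S \<inter> C) x * norm (g x) ^ N)"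
    and wg: "\<And>\<phi> G. test_function (C - cball 0 1) \<phi> \<Longrightarrow> (\<And>x. GDERIV \<phi> x :> G x) \<Longrightarrow>
      (LINT x|lborel. (indicator (C - cball 0 1) x * u x) *\<^sub>R G x) = - (LINT x|lborel. \<phi> x *\<^sub>R g x)"
    and S: "compact S" "S \<subseteq> - cball 0 1"
  shows "\<exists>v Dv w. (\<forall>n::nat. \<forall>x. GDERIV (v n) x :> Dv n x) \<and> (\<forall>n. continuous_on UNIV (Dv n)) \<and>
    (\<forall>x\<in>S \<inter> C. (\<lambda>n. v n x) \<longlonglongrightarrow> u x) \<and>
    (AE x in lborel. x \<in> S \<inter> C \<longrightarrow> (\<lambda>n. Dv n x) \<longlonglongrightarrow> g x) \<and>
    integrable lborel w \<and> (AE x in lborel. x \<in> S \<inter> C \<longrightarrow> (\<forall>n. norm (Dv n x) ^ N \<le> w x))"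
proof -
  obtain \<delta> r where dr: "\<delta> > 0" "r > 1 + 2 * \<delta>" "\<And>x. x \<in> S \<Longrightarrow> 1 + 2 * \<delta> \<le> norm x \<and> norm x \<le> r"
    using compact_outside_cball[OF S] by metis
  obtain e where e: "cball e 1 \<subseteq> C" using cone_unit_ball[OF C(1,2,4)] by blast
  obtain \<rho> :: "real^'n \<Rightarrow> real" where \<rho>: "\<And>c p q. smooth (\<lambda>y. c * \<rho> (p *\<^sub>R y + q))" "\<And>x. \<rho> x \<ge> 0" "\<And>x. \<rho> x \<noteq> 0 \<Longrightarrow> norm x < 1"
    "integrable lborel \<rho>" "integral\<^sup>L lborel \<rho> = 1" using mollifier_exists by blast
  obtain D\<rho> where D\<rho>: "\<And>x. GDERIV \<rho> x :> D\<rho> x" "continuous_on UNIV D\<rho>"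
    using smooth_imp_C1[OF \<rho>(1)[of 1 1 0]] by auto
  have \<rho>m [measurable]: "\<rho> \<in> borel_measurable borel" using \<rho>(4) by auto
  define n where "n = CARD('n)"
  \<comment> \<open>A slightly larger annular part of the cone, on which u and its gradient are
    integrable; all averages are taken inside it.\<close>
  define A where "A = C \<inter> {x. 1 + \<delta> < norm x \<and> norm x < r + 1}"
  define A' where "A' = cball 0 (r + 1) - ball (0::real^'n) (1 + \<delta>)"
  have A': "compact A'" "A' \<subseteq> - cball 0 1" "A \<subseteq> A' \<inter> C"
    using dr(1) by (auto simp: A'_def A_def intro: compact_diff)
  have openA: "open A" unfolding A_def
    by (intro open_Int C(1) open_Collect_conj open_Collect_less continuous_intros)
  have [measurable]: "A \<in> sets borel" "C \<in> sets borel" "S \<in> sets borel" using openA C(1) S by (auto intro: borel_compact)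
  have A\<Omega>: "A \<subseteq> C - cball 0 1" using dr(1) by (auto simp: A_def)
  define U where "U = (\<lambda>x. indicator A x * u x)"
  define Gt where "Gt = (\<lambda>x. indicator A x *\<^sub>R g x)"
  have [measurable]: "U \<in> borel_measurable borel"
    unfolding U_def
  proof -
    have "(\<lambda>x. indicator A x *\<^sub>R u x) \<in> borel_measurable borel"
      by (rule borel_measurable_continuous_on_indicator) (auto intro: continuous_on_subset[OF u_cont A\<Omega>])
    then show "(\<lambda>x. indicator A x * u x) \<in> borel_measurable borel" by simp
  qed
  have [measurable]: "Gt \<in> borel_measurable borel" unfolding Gt_def by measurable
  have U: "integrable lborel U"
    by (rule Bochner_Integration.integrable_bound[OF uL[OF A'(1,2)]], measurable)
      (use A' in \<open>auto simp: U_def indicator_def\<close>)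
  have GtI: "integrable lborel Gt"
    by (rule Bochner_Integration.integrable_bound[OF gL1[OF A'(1,2)]], measurable)
      (use A' in \<open>auto simp: Gt_def indicator_def\<close>)
  have GtN: "integrable lborel (\<lambda>x. norm (Gt x) ^ N)"
    by (rule Bochner_Integration.integrable_bound[OF gL[OF A'(1,2)]], measurable)
      (use A' \<open>N > 0\<close> in \<open>auto simp: Gt_def indicator_def zero_power\<close>)
  define M0 where "M0 = norm e + 1"
  have M0: "M0 > 0" by (simp add: M0_def add_nonneg_pos)
  define k where "k = (\<lambda>\<epsilon> z. (1 / \<epsilon>) ^ n * \<rho> ((1 / \<epsilon>) *\<^sub>R z - e))"
  define Dk where "Dk = (\<lambda>\<epsilon> z. (1 / \<epsilon>) ^ Suc n *\<^sub>R D\<rho> ((1 / \<epsilon>) *\<^sub>R z - e))"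
  have k_supp: "dist z (\<epsilon> *\<^sub>R e) < \<epsilon>" if "k \<epsilon> z \<noteq> 0" "\<epsilon> > 0" for \<epsilon> z
  proof -
    have "norm ((1 / \<epsilon>) *\<^sub>R z - e) < 1" using that \<rho>(3) by (auto simp: k_def)
    moreover have "z - \<epsilon> *\<^sub>R e = \<epsilon> *\<^sub>R ((1 / \<epsilon>) *\<^sub>R z - e)" using that by (simp add: scaleR_diff_right)
    ultimately have "norm (z - \<epsilon> *\<^sub>R e) < \<epsilon>" using that by simp
    then show ?thesis by (simp add: dist_norm)
  qed
  have kC1: "C1c (k \<epsilon>) (Dk \<epsilon>) (cball (\<epsilon> *\<^sub>R e) \<epsilon>)" if "\<epsilon> > 0" for \<epsilon>
    unfolding C1c_def
  proof (intro conjI allI impI)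
    fix z
    have "((\<lambda>z. \<rho> ((1 / \<epsilon>) *\<^sub>R z - e)) has_derivative (\<lambda>h. ((1 / \<epsilon>) *\<^sub>R h) \<bullet> D\<rho> ((1 / \<epsilon>) *\<^sub>R z - e))) (at z)"
      by (rule has_derivative_compose[of "\<lambda>z. (1 / \<epsilon>) *\<^sub>R z - e" "\<lambda>h. (1 / \<epsilon>) *\<^sub>R h" z UNIV \<rho>])
        (use D\<rho>(1) in \<open>auto simp: gderiv_def intro!: derivative_eq_intros\<close>)
    then have "((\<lambda>z. (1 / \<epsilon>) ^ n * \<rho> ((1 / \<epsilon>) *\<^sub>R z - e)) has_derivative (\<lambda>h. (1 / \<epsilon>) ^ n * (((1 / \<epsilon>) *\<^sub>R h) \<bullet> D\<rho> ((1 / \<epsilon>) *\<^sub>R z - e)))) (at z)"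
      by (rule has_derivative_mult_right)
    then show "GDERIV (k \<epsilon>) z :> Dk \<epsilon> z"
      unfolding gderiv_def k_def Dk_def by (rule has_derivative_eq_rhs) (simp add: fun_eq_iff mult_ac)
    show "continuous_on UNIV (Dk \<epsilon>)" unfolding Dk_def
      by (intro continuous_intros continuous_on_compose2[OF D\<rho>(2)]) auto
    show "k \<epsilon> z = 0" if "z \<notin> cball (\<epsilon> *\<^sub>R e) \<epsilon>" 
      using k_supp[of \<epsilon> z] that \<open>\<epsilon> > 0\<close> by (auto simp: dist_commute)
  qed auto
  define v where "v = (\<lambda>\<epsilon> x. LINT y|lborel. U y * k \<epsilon> (y - x))"
  define V where "V = (\<lambda>\<epsilon> x. - (LINT y|lborel. U y *\<^sub>R Dk \<epsilon> (y - x)))"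
  have vV: "GDERIV (v \<epsilon>) x :> V \<epsilon> x" "continuous_on UNIV (V \<epsilon>)" if "\<epsilon> > 0" for \<epsilon> x
    unfolding v_def V_def using convolution_C1[OF U kC1[OF that]] by auto
  \<comment> \<open>A kernel of scale \<epsilon> reaches at most \<epsilon> times \<open>M0\<close>
    far, which must stay below the inner gap \<delta> and the outer gap 1.\<close>
  define \<epsilon>0 where "\<epsilon>0 = min \<delta> 1 / (2 * M0)"
  have \<epsilon>0: "\<epsilon>0 > 0" "\<epsilon>0 * M0 < \<delta>" "\<epsilon>0 * M0 < 1" using dr(1) M0 by (auto simp: \<epsilon>0_def)
  have small: "x + \<epsilon> *\<^sub>R (e + w) \<in> A" if "x \<in> S \<inter> C" "0 < \<epsilon>" "\<epsilon> \<le> \<epsilon>0" "norm w \<le> 1" for x \<epsilon> w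
  proof -
    have "e + w \<in> C" using e that(4) by (auto simp: dist_norm)
    then have "x + \<epsilon> *\<^sub>R (e + w) \<in> C" using that C by (intro cone_add_mem[OF C(3,4)]) auto
    moreover have "norm (\<epsilon> *\<^sub>R (e + w)) \<le> \<epsilon>0 * M0"
      using that norm_triangle_ineq[of e w] M0 unfolding norm_scaleR M0_def by (intro mult_mono) auto
    ultimately show ?thesis
      using dr(3)[of x] that \<epsilon>0 norm_triangle_ineq[of x "\<epsilon> *\<^sub>R (e + w)"] norm_diff_ineq[of x "\<epsilon> *\<^sub>R (e + w)"]
      unfolding A_def by auto
  qed
  have cov: "(LINT y|lborel. k \<epsilon> (y - x) *\<^sub>R q y) = (LINT w|lborel. \<rho> w *\<^sub>R q (x + \<epsilon> *\<^sub>R (e + w)))"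
    if [measurable]: "q \<in> borel_measurable borel" and "\<epsilon> > 0" for q :: "real^'n \<Rightarrow> 'z::{banach,second_countable_topology}" and x \<epsilon>
  proof -
    have [measurable]: "k \<epsilon> \<in> borel_measurable borel" unfolding k_def by measurable
    have "(LINT w|lborel. k \<epsilon> (\<epsilon> *\<^sub>R w + (x + \<epsilon> *\<^sub>R e) - x) *\<^sub>R q (\<epsilon> *\<^sub>R w + (x + \<epsilon> *\<^sub>R e)))
       = (1 / \<epsilon> ^ DIM(real^'n)) *\<^sub>R (LINT y|lborel. k \<epsilon> (y - x) *\<^sub>R q y)"
      using \<open>\<epsilon> > 0\<close> by (intro integral_lborel_affine) auto
    moreover have "(LINT w|lborel. k \<epsilon> (\<epsilon> *\<^sub>R w + (x + \<epsilon> *\<^sub>R e) - x) *\<^sub>R q (\<epsilon> *\<^sub>R w + (x + \<epsilon> *\<^sub>R e)))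
       = (LINT w|lborel. (1 / \<epsilon>) ^ n *\<^sub>R (\<rho> w *\<^sub>R q (x + \<epsilon> *\<^sub>R (e + w))))"
      using \<open>\<epsilon> > 0\<close> by (intro Bochner_Integration.integral_cong) (auto simp: k_def algebra_simps)
    ultimately have "(1 / \<epsilon>) ^ n *\<^sub>R (LINT w|lborel. \<rho> w *\<^sub>R q (x + \<epsilon> *\<^sub>R (e + w)))
        = (1 / \<epsilon>) ^ n *\<^sub>R (LINT y|lborel. k \<epsilon> (y - x) *\<^sub>R q y)"
      unfolding integral_scaleR_right by (simp only: n_def power_divide power_one DIM_cart DIM_real mult_1_right)
    then show ?thesis using \<open>\<epsilon> > 0\<close> by simp
  qed
  have vform: "v \<epsilon> x = (LINT w|lborel. \<rho> w *\<^sub>R U (x + \<epsilon> *\<^sub>R (e + w)))" if "\<epsilon> > 0" for \<epsilon> x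
    unfolding v_def using cov[of U \<epsilon> x] that by (simp add: mult.commute)
  \<comment> \<open>For x in \<open>S \<inter> C\<close> the kernel is supported in
    \<open>A\<close>, hence a legitimate test function, and the weak gradient moves the derivative
    from the kernel to u.\<close>
  have Vform: "V \<epsilon> x = (LINT w|lborel. \<rho> w *\<^sub>R Gt (x + \<epsilon> *\<^sub>R (e + w)))" if "\<epsilon> > 0" "\<epsilon> \<le> \<epsilon>0" "x \<in> S \<inter> C" for \<epsilon> x
  proof -
    have inA: "y \<in> A" if "dist (y - x) (\<epsilon> *\<^sub>R e) \<le> \<epsilon>" for y
    proof -
      define w where "w = (1 / \<epsilon>) *\<^sub>R (y - x) - e"
      have "y = x + \<epsilon> *\<^sub>R (e + w)" using \<open>\<epsilon> > 0\<close> by (simp add: w_def)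
      moreover have "\<epsilon> * norm w \<le> \<epsilon>"
      proof -
        have "\<epsilon> * norm w = norm (\<epsilon> *\<^sub>R w)" using \<open>\<epsilon> > 0\<close> by simp
        also have "\<epsilon> *\<^sub>R w = (y - x) - \<epsilon> *\<^sub>R e" using \<open>\<epsilon> > 0\<close> by (simp add: w_def scaleR_diff_right)
        finally show ?thesis using that by (simp add: dist_norm)
      qed
      ultimately show ?thesis using small[of x \<epsilon> w] \<open>\<epsilon> > 0\<close> \<open>\<epsilon> \<le> \<epsilon>0\<close> \<open>x \<in> S \<inter> C\<close> by simp
    qed
    define B where "B = cball (x + \<epsilon> *\<^sub>R e) \<epsilon>"
    have BA: "B \<subseteq> A"
    proof
      fix y assume "y \<in> B"
      then have "dist (y - x) (\<epsilon> *\<^sub>R e) \<le> \<epsilon>" by (simp add: B_def dist_norm norm_minus_commute algebra_simps)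
      then show "y \<in> A" by (rule inA)
    qed
    have kz: "k \<epsilon> (y - x) = 0 \<and> Dk \<epsilon> (y - x) = 0" if "y \<notin> B" for y
    proof -
      have "y - x \<notin> cball (\<epsilon> *\<^sub>R e) \<epsilon>" using that by (simp add: B_def dist_norm algebra_simps)
      then show ?thesis using C1cD(5,6)[OF kC1[OF \<open>\<epsilon> > 0\<close>]] by blast
    qed
    have tf: "test_function (C - cball 0 1) (\<lambda>y. k \<epsilon> (y - x))"
      unfolding test_function_def
    proof (intro conjI)
      have "(\<lambda>y. k \<epsilon> (y - x)) = (\<lambda>y. (1 / \<epsilon>) ^ n * \<rho> ((1 / \<epsilon>) *\<^sub>R y + (- (1 / \<epsilon>) *\<^sub>R x - e)))"
        by (simp add: k_def fun_eq_iff algebra_simps)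
      then show "smooth (\<lambda>y. k \<epsilon> (y - x))" using \<rho>(1) by simp
      have "closure {y. k \<epsilon> (y - x) \<noteq> 0} \<subseteq> B"
      proof (rule closure_minimal)
        show "{y. k \<epsilon> (y - x) \<noteq> 0} \<subseteq> B" using kz by blast
        show "closed B" by (simp add: B_def)
      qed
      then show "compact (closure {y. k \<epsilon> (y - x) \<noteq> 0})" "closure {y. k \<epsilon> (y - x) \<noteq> 0} \<subseteq> C - cball 0 1"
        using BA A\<Omega> compact_Int_closed[of B "closure {y. k \<epsilon> (y - x) \<noteq> 0}"]
        by (auto simp: B_def Int_absorb1)
    qed
    have gd: "GDERIV (\<lambda>y. k \<epsilon> (y - x)) y :> Dk \<epsilon> (y - x)" for y
    proof -
      have "((\<lambda>y. k \<epsilon> (y - x)) has_derivative (\<lambda>h. h \<bullet> Dk \<epsilon> (y - x))) (at y)"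
        by (rule has_derivative_compose[of "\<lambda>y. y - x" "\<lambda>h. h" y UNIV "k \<epsilon>"])
          (use C1cD(1)[OF kC1[OF \<open>\<epsilon> > 0\<close>]] in \<open>auto simp: gderiv_def intro!: derivative_eq_intros\<close>)
      then show ?thesis by (simp add: gderiv_def)
    qed
    have "V \<epsilon> x = - (LINT y|lborel. (indicator (C - cball 0 1) y * u y) *\<^sub>R Dk \<epsilon> (y - x))"
      unfolding V_def
    proof (intro arg_cong[of _ _ uminus] Bochner_Integration.integral_cong refl)
      fix y
      show "U y *\<^sub>R Dk \<epsilon> (y - x) = (indicator (C - cball 0 1) y * u y) *\<^sub>R Dk \<epsilon> (y - x)"
        using kz[of y] BA A\<Omega> by (cases "y \<in> B") (auto simp: U_def indicator_def)
    qed
    also have "\<dots> = (LINT y|lborel. k \<epsilon> (y - x) *\<^sub>R g y)" using wg[OF tf gd] by simp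
    also have "\<dots> = (LINT y|lborel. k \<epsilon> (y - x) *\<^sub>R Gt y)"
    proof (intro Bochner_Integration.integral_cong refl)
      fix y
      show "k \<epsilon> (y - x) *\<^sub>R g y = k \<epsilon> (y - x) *\<^sub>R Gt y"
        using kz[of y] BA by (cases "y \<in> B") (auto simp: Gt_def indicator_def)
    qed
    also have "\<dots> = (LINT w|lborel. \<rho> w *\<^sub>R Gt (x + \<epsilon> *\<^sub>R (e + w)))" using that by (intro cov) auto
    finally show ?thesis .
  qed
  have SA: "x \<in> A" if "x \<in> S \<inter> C" for x using that dr(1,2) dr(3)[of x] by (auto simp: A_def)
  have \<rho>int: "integrable lborel (\<lambda>w. \<rho> w *\<^sub>R q (x + \<epsilon> *\<^sub>R (e + w)))"
    if "integrable lborel q" "\<epsilon> > 0" for q :: "real^'n \<Rightarrow> 'z::{banach,second_countable_topology}" and x \<epsilon>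
  proof -
    have [measurable]: "q \<in> borel_measurable borel" using that by auto
    have C\<rho>: "continuous_on UNIV \<rho>" using D\<rho>(1) by (rule GDERIV_imp_continuous_on)
    obtain B where B: "B > 0" "\<And>x. norm (\<rho> x) \<le> B"
    proof -
      have "\<rho> x = 0" if "x \<notin> cball 0 1" for x using \<rho>(3)[of x] that by (cases "\<rho> x = 0") auto
      then show thesis using bounded_compact_support[OF C\<rho> compact_cball] that by blast
    qed
    have "integrable lborel (\<lambda>w. q (\<epsilon> *\<^sub>R w + (x + \<epsilon> *\<^sub>R e)))"
      using that by (rule integrable_lborel_affine)
    then have "integrable lborel (\<lambda>w. B *\<^sub>R q (x + \<epsilon> *\<^sub>R (e + w)))"
      by (intro integrable_scaleR_right) (simp add: algebra_simps)
    then show ?thesis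
    proof (rule Bochner_Integration.integrable_bound)
      show "AE w in lborel. norm (\<rho> w *\<^sub>R q (x + \<epsilon> *\<^sub>R (e + w))) \<le> norm (B *\<^sub>R q (x + \<epsilon> *\<^sub>R (e + w)))"
        using B by (intro AE_I2) (auto intro!: mult_right_mono)
    qed auto
  qed
  \<comment> \<open>The moduli 2^(-j) make the approximation errors summable. This yields almost
    everywhere convergence and a dominating function at once.\<close>
  have "\<exists>d>0. \<forall>h. norm h < d \<longrightarrow> (\<integral>\<^sup>+x. norm (Gt (x + h) - Gt x) ^ N \<partial>lborel) < ennreal ((1/2) ^ j)" for j
  proof (rule LN_translation_continuous[where R="r + 1"])
    show "(\<integral>\<^sup>+ x. ennreal (norm (Gt x) ^ N) \<partial>lborel) < \<infinity>" using GtN by (simp add: integrable_iff_bounded)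
    show "Gt x = 0" if "norm x > r + 1" for x using that by (simp add: Gt_def A_def)
  qed (use \<open>N > 0\<close> in auto)
  then have "\<exists>d. \<forall>j. d j > 0 \<and> (\<forall>h. norm h < d j \<longrightarrow> (\<integral>\<^sup>+x. norm (Gt (x + h) - Gt x) ^ N \<partial>lborel) < ennreal ((1/2) ^ j))"
    by (intro choice allI)
  then obtain d where d: "\<And>j. d j > 0"
    "\<And>j h. norm h < d j \<Longrightarrow> (\<integral>\<^sup>+x. norm (Gt (x + h) - Gt x) ^ N \<partial>lborel) < ennreal ((1/2) ^ j)" by blast
  define eps where "eps = (\<lambda>j. min \<epsilon>0 (min (d j / (2 * M0)) (1 / real (Suc j))))"
  have eps: "eps j > 0" "eps j \<le> \<epsilon>0" "eps j * M0 < d j" "eps j \<le> 1 / real (Suc j)" for j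
  proof -
    show "eps j > 0" "eps j \<le> \<epsilon>0" "eps j \<le> 1 / real (Suc j)" using \<epsilon>0 d(1)[of j] M0 by (auto simp: eps_def)
    have "eps j * M0 \<le> (d j / (2 * M0)) * M0" using M0 by (intro mult_right_mono) (auto simp: eps_def)
    also have "\<dots> < d j" using M0 d(1)[of j] by simp
    finally show "eps j * M0 < d j" .
  qed
  have hb: "norm (eps j *\<^sub>R (e + w)) \<le> eps j * M0" if "\<rho> w \<noteq> 0" for j w
    using \<rho>(3)[OF that] norm_triangle_ineq[of e w] eps(1)[of j] unfolding norm_scaleR M0_def
    by (intro mult_mono) auto
  have ptw: "(\<lambda>j. v (eps j) x) \<longlonglongrightarrow> u x" if x: "x \<in> S \<inter> C" for x
  proof (rule LIMSEQ_I)
    fix \<eta> :: real assume "\<eta> > 0"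
    have "continuous_on A U"
      by (rule continuous_on_eq[OF continuous_on_subset[OF u_cont A\<Omega>]]) (simp add: U_def)
    then have "isCont U x" using openA SA[OF x] by (simp add: continuous_on_eq_continuous_at)
    then obtain s where s: "s > 0" "\<And>y. dist y x < s \<Longrightarrow> dist (U y) (U x) < \<eta> / 2"
      using \<open>\<eta> > 0\<close> unfolding continuous_at_eps_delta by (metis half_gt_zero)
    obtain j0 where j0: "M0 / s < real j0" using reals_Archimedean2 by blast
    show "\<exists>no. \<forall>j\<ge>no. norm (v (eps j) x - u x) < \<eta>"
    proof (intro exI[of _ j0] allI impI)
      fix j assume "j \<ge> j0"
      have "eps j * M0 < s"
      proof -
        have "eps j * M0 \<le> 1 / real (Suc j) * M0" using eps(4) M0 by (intro mult_right_mono) auto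
        also have "M0 / s < real (Suc j)" using j0 \<open>j \<ge> j0\<close> by simp
        then have "1 / real (Suc j) * M0 < s" using s(1) M0 by (simp add: field_simps)
        finally show ?thesis .
      qed
      have "u x = (LINT w|lborel. \<rho> w * U x)" using \<rho>(5) SA[OF x] by (simp add: U_def)
      then have "norm (v (eps j) x - u x) = norm (LINT w|lborel. \<rho> w * (U (x + eps j *\<^sub>R (e + w)) - U x))"
        using \<rho>int[OF U eps(1), of x j] \<rho>(4) unfolding vform[OF eps(1)]
        by (simp add: right_diff_distrib)
      also have "\<dots> \<le> (LINT w|lborel. \<rho> w * (\<eta> / 2))"
      proof (rule order_trans[OF integral_norm_bound integral_mono_AE'])
        show "AE w in lborel. norm (\<rho> w * (U (x + eps j *\<^sub>R (e + w)) - U x)) \<le> \<rho> w * (\<eta> / 2)"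
        proof (rule AE_I2)
          fix w
          show "norm (\<rho> w * (U (x + eps j *\<^sub>R (e + w)) - U x)) \<le> \<rho> w * (\<eta> / 2)"
          proof (cases "\<rho> w = 0")
            case False
            then have "dist (U (x + eps j *\<^sub>R (e + w))) (U x) < \<eta> / 2"
              using hb[of w j] \<open>eps j * M0 < s\<close> by (intro s(2)) (simp add: dist_norm)
            then have "\<bar>U (x + eps j *\<^sub>R (e + w)) - U x\<bar> \<le> \<eta> / 2" by (simp add: dist_norm)
            from mult_left_mono[OF this \<rho>(2)[of w]] show ?thesis using \<rho>(2)[of w] by (simp add: abs_mult)
          qed simp
        qed
      qed (use \<rho> \<open>\<eta> > 0\<close> in auto)
      also have "\<dots> < \<eta>" using \<rho>(5) \<open>\<eta> > 0\<close> by simp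
      finally show "norm (v (eps j) x - u x) < \<eta>" .
    qed
  qed
  define T where "T = (\<lambda>j x. indicator (S \<inter> C) x * ennreal (norm (V (eps j) x - g x) ^ N))"
  have [measurable]: "V (eps j) \<in> borel_measurable borel" for j
    using vV(2)[OF eps(1)] by (rule borel_measurable_continuous_onI)
  have [measurable]: "T j \<in> borel_measurable borel" for j unfolding T_def by measurable
  \<comment> \<open>Jensen for the kernel at each point, followed by Fubini, bounds the error by the
    L^N modulus of continuity.\<close>
  have TI: "(\<integral>\<^sup>+x. T j x \<partial>lborel) \<le> ennreal ((1/2) ^ j)" for j
  proof -
    have "(\<integral>\<^sup>+x. T j x \<partial>lborel) \<le> (\<integral>\<^sup>+x. \<integral>\<^sup>+w. \<rho> w * norm (Gt (x + eps j *\<^sub>R (e + w)) - Gt x) ^ N \<partial>lborel \<partial>lborel)"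
    proof (rule nn_integral_mono)
      fix x
      show "T j x \<le> (\<integral>\<^sup>+w. \<rho> w * norm (Gt (x + eps j *\<^sub>R (e + w)) - Gt x) ^ N \<partial>lborel)"
      proof (cases "x \<in> S \<inter> C")
        case True
        have i1: "integrable lborel (\<lambda>w. \<rho> w *\<^sub>R Gt (x + eps j *\<^sub>R (e + w)))" by (rule \<rho>int[OF GtI eps(1)])
        have i2: "integrable lborel (\<lambda>w. \<rho> w *\<^sub>R Gt x)" using \<rho>(4) by (rule integrable_scaleR_left) 
        have "Gt x = (LINT w|lborel. \<rho> w *\<^sub>R Gt x)" using \<rho>(5,4) by simp
        moreover have "g x = Gt x" using SA[OF True] by (simp add: Gt_def)
        ultimately have "V (eps j) x - g x = (LINT w|lborel. \<rho> w *\<^sub>R (Gt (x + eps j *\<^sub>R (e + w)) - Gt x))"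
          unfolding Vform[OF eps(1,2) True] scaleR_diff_right using Bochner_Integration.integral_diff[OF i1 i2] by simp
        moreover have "integrable lborel (\<lambda>w. \<rho> w *\<^sub>R (Gt (x + eps j *\<^sub>R (e + w)) - Gt x))"
          unfolding scaleR_diff_right using i1 i2 by auto
        ultimately show ?thesis
          using jensen_power[OF \<rho>(4,5,2), of "\<lambda>w. Gt (x + eps j *\<^sub>R (e + w)) - Gt x" N] \<open>N > 0\<close> True
          by (simp add: T_def)
      qed (simp add: T_def)
    qed
    also have "\<dots> = (\<integral>\<^sup>+w. \<integral>\<^sup>+x. \<rho> w * norm (Gt (x + eps j *\<^sub>R (e + w)) - Gt x) ^ N \<partial>lborel \<partial>lborel)"
      by (rule lborel_pair.Fubini') measurable
    also have "\<dots> \<le> (\<integral>\<^sup>+w. ennreal (\<rho> w) * ennreal ((1/2) ^ j) \<partial>lborel)"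
    proof (rule nn_integral_mono)
      fix w
      have "(\<integral>\<^sup>+x. \<rho> w * norm (Gt (x + eps j *\<^sub>R (e + w)) - Gt x) ^ N \<partial>lborel)
        = ennreal (\<rho> w) * (\<integral>\<^sup>+x. norm (Gt (x + eps j *\<^sub>R (e + w)) - Gt x) ^ N \<partial>lborel)"
        using \<rho>(2)[of w] by (simp add: ennreal_mult nn_integral_cmult)
      also have "\<dots> \<le> ennreal (\<rho> w) * ennreal ((1/2) ^ j)"
      proof (cases "\<rho> w = 0")
        case False
        then have "(\<integral>\<^sup>+x. norm (Gt (x + eps j *\<^sub>R (e + w)) - Gt x) ^ N \<partial>lborel) < ennreal ((1/2) ^ j)"
          using hb[of w j] eps(3)[of j] by (intro d(2)) auto
        then show ?thesis by (intro mult_left_mono) auto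
      qed simp
      finally show "(\<integral>\<^sup>+x. \<rho> w * norm (Gt (x + eps j *\<^sub>R (e + w)) - Gt x) ^ N \<partial>lborel) \<le> ennreal (\<rho> w) * ennreal ((1/2) ^ j)" .
    qed
    also have "\<dots> = (\<integral>\<^sup>+w. ennreal (\<rho> w) \<partial>lborel) * ennreal ((1/2) ^ j)" by (simp add: nn_integral_multc)
    also have "(\<integral>\<^sup>+w. ennreal (\<rho> w) \<partial>lborel) = 1"
      using nn_integral_eq_integral[OF \<rho>(4)] \<rho>(2,5) by simp
    finally show ?thesis by simp
  qed
  have fin: "(\<integral>\<^sup>+x. (\<Sum>j. T j x) \<partial>lborel) < \<infinity>"
  proof -
    have "(\<integral>\<^sup>+x. (\<Sum>j. T j x) \<partial>lborel) = (\<Sum>j. \<integral>\<^sup>+x. T j x \<partial>lborel)" by (rule nn_integral_suminf) auto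
    also have "\<dots> \<le> (\<Sum>j. ennreal ((1/2) ^ j))" by (intro suminf_le TI) auto
    also have "\<dots> = ennreal (\<Sum>j. (1/2) ^ j)" by (intro suminf_ennreal2) auto
    also have "\<dots> < \<infinity>" by simp
    finally show ?thesis .
  qed
  then have AEfin: "AE x in lborel. (\<Sum>j. T j x) \<noteq> \<infinity>"
    by (intro nn_integral_PInf_AE) auto
  have key: "summable (\<lambda>j. norm (V (eps j) x - g x) ^ N) \<and> (\<Sum>j. T j x) = ennreal (\<Sum>j. norm (V (eps j) x - g x) ^ N)"
    if "(\<Sum>j. T j x) \<noteq> \<infinity>" "x \<in> S \<inter> C" for x
  proof -
    have T: "T j x = ennreal (norm (V (eps j) x - g x) ^ N)" for j using that by (simp add: T_def)
    have "summable (\<lambda>j. norm (V (eps j) x - g x) ^ N)"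
      using that(1) unfolding T by (intro summable_suminf_not_top) auto
    then show ?thesis unfolding T by (auto intro!: suminf_ennreal2)
  qed
  \<comment> \<open>The sum of all errors dominates each single one, so \<open>w\<close> bounds all
    approximating gradients simultaneously.\<close>
  define w where "w = (\<lambda>x. 2 ^ N * (norm (Gt x) ^ N + enn2real (\<Sum>j. T j x)))"
  have "integrable lborel (\<lambda>x. enn2real (\<Sum>j. T j x))"
  proof (rule integrableI_nonneg)
    have "(\<integral>\<^sup>+x. ennreal (enn2real (\<Sum>j. T j x)) \<partial>lborel) \<le> (\<integral>\<^sup>+x. (\<Sum>j. T j x) \<partial>lborel)"
      by (intro nn_integral_mono) (metis ennreal_enn2real_if enn2real_top ennreal_0 order_refl zero_le)
    then show "(\<integral>\<^sup>+x. ennreal (enn2real (\<Sum>j. T j x)) \<partial>lborel) < \<infinity>" using fin by (rule le_less_trans)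
  qed auto
  then have wI: "integrable lborel w" unfolding w_def using GtN by auto
  show ?thesis
  proof (intro exI[of _ "\<lambda>j. v (eps j)"] exI[of _ "\<lambda>j. V (eps j)"] exI[of _ w] conjI allI ballI)
    show "GDERIV (v (eps j)) x :> V (eps j) x" "continuous_on UNIV (V (eps j))" for j x
      using vV[OF eps(1)] by auto
    show "AE x in lborel. x \<in> S \<inter> C \<longrightarrow> (\<lambda>j. V (eps j) x) \<longlonglongrightarrow> g x"
      using AEfin
    proof eventually_elim
      case (elim x)
      show ?case
      proof
        assume x: "x \<in> S \<inter> C"
        have "(\<lambda>j. norm (V (eps j) x - g x) ^ N) \<longlonglongrightarrow> 0"
          using key[OF elim x] by (intro summable_LIMSEQ_zero) auto
        then have "(\<lambda>j. V (eps j) x - g x) \<longlonglongrightarrow> 0" by (rule LIMSEQ_power_zero_imp)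
        then show "(\<lambda>j. V (eps j) x) \<longlonglongrightarrow> g x" by (simp add: LIM_zero_iff)
      qed
    qed
    show "AE x in lborel. x \<in> S \<inter> C \<longrightarrow> (\<forall>j. norm (V (eps j) x) ^ N \<le> w x)"
      using AEfin
    proof eventually_elim
      case (elim x)
      show ?case
      proof (intro impI allI)
        fix j assume x: "x \<in> S \<inter> C"
        have "norm (V (eps j) x - g x) ^ N \<le> (\<Sum>j. norm (V (eps j) x - g x) ^ N)"
          using key[OF elim x] sum_le_suminf[of "\<lambda>j. norm (V (eps j) x - g x) ^ N" "{j}"] by simp
        also have "\<dots> = enn2real (\<Sum>j. T j x)" using key[OF elim x] by (simp add: suminf_nonneg)
        finally have 1: "norm (V (eps j) x - g x) ^ N \<le> enn2real (\<Sum>j. T j x)" .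
        have "norm (V (eps j) x) \<le> norm (Gt x) + norm (V (eps j) x - g x)"
          using SA[OF x] norm_triangle_ineq[of "g x" "V (eps j) x - g x"] by (simp add: Gt_def)
        then have "norm (V (eps j) x) ^ N \<le> (norm (Gt x) + norm (V (eps j) x - g x)) ^ N" by (intro power_mono) auto
        also have "\<dots> \<le> 2 ^ N * (norm (Gt x) ^ N + norm (V (eps j) x - g x) ^ N)" by (intro power_add_le) auto
        also have "\<dots> \<le> w x" unfolding w_def using 1 by (intro mult_left_mono) auto
        finally show "norm (V (eps j) x) ^ N \<le> w x" .
      qed
    qed
  qed (use ptw wI in auto)
qed

section \<open>The conormal problem and admissible test pairs\<close>

text \<open>The fundamental theorem of calculus on the segment, followed by Jensen on the unit
  interval.\<close>

lemma C1_segment_power_le: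
  fixes \<phi> :: "real^'n \<Rightarrow> real"
  assumes "\<And>x. GDERIV \<phi> x :> \<Phi> x" "continuous_on UNIV \<Phi>" "norm w \<le> r" "n > 0"
  shows "ennreal (\<bar>\<phi> (x + w) - \<phi> x\<bar> ^ n) \<le>
    ennreal (r ^ n) * (\<integral>\<^sup>+t. indicator {0..1} t * ennreal (norm (\<Phi> (x + t *\<^sub>R w)) ^ n) \<partial>lborel)"
proof -
  have "r \<ge> 0" using assms(3) norm_ge_zero order_trans by blast
  have [measurable]: "\<Phi> \<in> borel_measurable borel" using assms(2) by (rule borel_measurable_continuous_onI)
  define q where "q = (\<lambda>t. w \<bullet> \<Phi> (x + t *\<^sub>R w))"
  have cq: "continuous_on UNIV q"
    unfolding q_def by (intro continuous_intros continuous_on_compose2[OF assms(2)]) auto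
  have [measurable]: "q \<in> borel_measurable borel" using cq by (rule borel_measurable_continuous_onI)
  have dq: "((\<lambda>t. \<phi> (x + t *\<^sub>R w)) has_vector_derivative q t) (at t within {0..1})" for t
  proof -
    have "((\<lambda>t. \<phi> (x + t *\<^sub>R w)) has_derivative (\<lambda>s. (s *\<^sub>R w) \<bullet> \<Phi> (x + t *\<^sub>R w))) (at t)"
      by (rule has_derivative_compose[of "\<lambda>t. x + t *\<^sub>R w" "\<lambda>s. s *\<^sub>R w" t UNIV \<phi>])
        (use assms(1) in \<open>auto simp: gderiv_def intro!: derivative_eq_intros\<close>)
    from has_derivative_at_withinI[OF this, of "{0..1}"] show ?thesis
      by (simp add: has_vector_derivative_def q_def)
  qed
  have int: "(LINT t|lborel. indicator {0..1} t *\<^sub>R q t) = \<phi> (x + w) - \<phi> x"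
    using integral_FTC_atLeastAtMost[of 0 1 "\<lambda>t. \<phi> (x + t *\<^sub>R w)" q] dq
    by (auto intro: continuous_on_subset[OF cq])
  have "ennreal (norm (LINT t|lborel. indicator {0..1} t *\<^sub>R q t) ^ n)
    \<le> (\<integral>\<^sup>+t. ennreal (indicator {0..1} t * norm (q t) ^ n) \<partial>lborel)"
  proof (rule jensen_power)
    show "integrable lborel (\<lambda>t. indicator {0..1} t *\<^sub>R q t)"
      by (rule borel_integrable_compact) (auto intro: continuous_on_subset[OF cq])
  qed (use \<open>n > 0\<close> in auto)
  also have "\<dots> \<le> (\<integral>\<^sup>+t. ennreal (r ^ n) * (indicator {0..1} t * ennreal (norm (\<Phi> (x + t *\<^sub>R w)) ^ n)) \<partial>lborel)"
  proof (rule nn_integral_mono)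
    fix t
    have "norm (q t) \<le> r * norm (\<Phi> (x + t *\<^sub>R w))"
      unfolding q_def using Cauchy_Schwarz_ineq2[of w "\<Phi> (x + t *\<^sub>R w)"] mult_right_mono[OF assms(3) norm_ge_zero[of "\<Phi> (x + t *\<^sub>R w)"]] by simp
    then have "norm (q t) ^ n \<le> r ^ n * norm (\<Phi> (x + t *\<^sub>R w)) ^ n"
      using power_mono[of "norm (q t)" "r * norm (\<Phi> (x + t *\<^sub>R w))" n] by (simp add: power_mult_distrib)
    then show "ennreal (indicator {0..1} t * norm (q t) ^ n)
        \<le> ennreal (r ^ n) * (indicator {0..1} t * ennreal (norm (\<Phi> (x + t *\<^sub>R w)) ^ n))"
      using \<open>r \<ge> 0\<close> by (auto simp: indicator_def simp flip: ennreal_mult)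
  qed
  finally show ?thesis unfolding int by (simp add: nn_integral_cmult)
qed

text \<open>Integrate the segment estimate over x and exchange the integrals. For fixed t the point
  on the segment depends on x through a dilation by a factor at least 1 and a translation, so the
  change of variables costs a factor of at most 1.\<close>

lemma C1_dilation_translation_le:
  fixes \<phi> :: "real^'n \<Rightarrow> real"
  assumes "\<And>x. GDERIV \<phi> x :> \<Phi> x" "continuous_on UNIV \<Phi>" "n > 0"
    and [measurable]: "A \<in> sets borel" "A' \<in> sets borel" and "l \<ge> 1"
    and A: "\<And>x t. x \<in> A \<Longrightarrow> 0 \<le> t \<Longrightarrow> t \<le> 1 \<Longrightarrow> (1 + t * (l - 1)) *\<^sub>R x + t *\<^sub>R h \<in> A'"
      "\<And>x. x \<in> A \<Longrightarrow> norm ((l - 1) *\<^sub>R x + h) \<le> r"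
  shows "(\<integral>\<^sup>+x. indicator A x * ennreal (\<bar>\<phi> (l *\<^sub>R x + h) - \<phi> x\<bar> ^ n) \<partial>lborel)
    \<le> ennreal (r ^ n) * (\<integral>\<^sup>+x. indicator A' x * ennreal (norm (\<Phi> x) ^ n) \<partial>lborel)"
proof -
  have [measurable]: "\<Phi> \<in> borel_measurable borel" "\<phi> \<in> borel_measurable borel"
    using assms(2) GDERIV_imp_continuous_on[OF assms(1)] by (auto intro: borel_measurable_continuous_onI)
  define I where "I = (\<integral>\<^sup>+x. indicator A' x * ennreal (norm (\<Phi> x) ^ n) \<partial>lborel)"
  have "(\<integral>\<^sup>+x. indicator A x * ennreal (\<bar>\<phi> (l *\<^sub>R x + h) - \<phi> x\<bar> ^ n) \<partial>lborel)
    \<le> (\<integral>\<^sup>+x. \<integral>\<^sup>+t. ennreal (r ^ n) * (indicator A x * (indicator {0..1} t * ennreal (norm (\<Phi> ((1 + t * (l - 1)) *\<^sub>R x + t *\<^sub>R h)) ^ n))) \<partial>lborel \<partial>lborel)"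
  proof (rule nn_integral_mono)
    fix x
    show "indicator A x * ennreal (\<bar>\<phi> (l *\<^sub>R x + h) - \<phi> x\<bar> ^ n)
      \<le> (\<integral>\<^sup>+t. ennreal (r ^ n) * (indicator A x * (indicator {0..1} t * ennreal (norm (\<Phi> ((1 + t * (l - 1)) *\<^sub>R x + t *\<^sub>R h)) ^ n))) \<partial>lborel)"
    proof (cases "x \<in> A")
      case True
      have e1: "x + ((l - 1) *\<^sub>R x + h) = l *\<^sub>R x + h" by (simp add: algebra_simps)
      have e2: "x + t *\<^sub>R ((l - 1) *\<^sub>R x + h) = (1 + t * (l - 1)) *\<^sub>R x + t *\<^sub>R h" for t
        by (simp add: algebra_simps)
      show ?thesis
        using C1_segment_power_le[OF assms(1,2) A(2)[OF True] \<open>n > 0\<close>, of x, unfolded e1 e2] True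
        by (simp add: nn_integral_cmult)
    qed simp
  qed
  also have "\<dots> = (\<integral>\<^sup>+t. \<integral>\<^sup>+x. ennreal (r ^ n) * (indicator A x * (indicator {0..1} t * ennreal (norm (\<Phi> ((1 + t * (l - 1)) *\<^sub>R x + t *\<^sub>R h)) ^ n))) \<partial>lborel \<partial>lborel)"
    by (rule lborel_pair.Fubini') measurable
  also have "\<dots> \<le> (\<integral>\<^sup>+t. ennreal (r ^ n) * (indicator {0..1} (t::real) * I) \<partial>lborel)"
  proof (rule nn_integral_mono)
    fix t :: real
    show "(\<integral>\<^sup>+x. ennreal (r ^ n) * (indicator A x * (indicator {0..1} t * ennreal (norm (\<Phi> ((1 + t * (l - 1)) *\<^sub>R x + t *\<^sub>R h)) ^ n))) \<partial>lborel)
      \<le> ennreal (r ^ n) * (indicator {0..1} t * I)"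
    proof (cases "t \<in> {0..1}")
      case True
      define c where "c = 1 + t * (l - 1)"
      have c: "c \<ge> 1" using True \<open>l \<ge> 1\<close> by (simp add: c_def)
      have "(\<integral>\<^sup>+x. indicator A x * ennreal (norm (\<Phi> (c *\<^sub>R x + t *\<^sub>R h)) ^ n) \<partial>lborel)
         \<le> (\<integral>\<^sup>+x. indicator A' (c *\<^sub>R x + t *\<^sub>R h) * ennreal (norm (\<Phi> (c *\<^sub>R x + t *\<^sub>R h)) ^ n) \<partial>lborel)"
        using A(1) True by (intro nn_integral_mono) (auto simp: indicator_def c_def)
      also have "\<dots> = ennreal (1 / c ^ DIM(real^'n)) * I"
        unfolding I_def using c by (intro nn_integral_lborel_affine[of "\<lambda>y. indicator A' y * ennreal (norm (\<Phi> y) ^ n)"]) auto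
      also have "\<dots> \<le> 1 * I"
        using c by (intro mult_right_mono) (auto simp: ennreal_le_1 one_le_power simp del: DIM_cart)
      finally have "(\<integral>\<^sup>+x. indicator A x * ennreal (norm (\<Phi> (c *\<^sub>R x + t *\<^sub>R h)) ^ n) \<partial>lborel) \<le> I" by simp
      then have "ennreal (r ^ n) * (\<integral>\<^sup>+x. indicator A x * ennreal (norm (\<Phi> (c *\<^sub>R x + t *\<^sub>R h)) ^ n) \<partial>lborel) \<le> ennreal (r ^ n) * I"
        by (rule mult_left_mono) simp
      then show ?thesis using True by (simp add: nn_integral_cmult c_def)
    qed simp
  qed
  also have "\<dots> = ennreal (r ^ n) * I"
    by (simp add: nn_integral_cmult nn_integral_multc)
  finally show ?thesis unfolding I_def .
qed

text \<open>
  \<open>\<gamma>\<close> is a Borel derivative of \<open>G\<close> for which the chain rule survives the approximation of the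
  weakly differentiable function by smooth ones, even if \<open>\<gamma>\<close> is discontinuous.
\<close>

definition nice :: "(real \<Rightarrow> real) \<Rightarrow> (real \<Rightarrow> real) \<Rightarrow> bool" where
  "nice G \<gamma> \<longleftrightarrow> G \<in> borel_measurable borel \<and> \<gamma> \<in> borel_measurable borel \<and>
    (\<exists>Gn \<gamma>n c. (\<forall>n t. (Gn n has_real_derivative \<gamma>n n t) (at t)) \<and> (\<forall>n::nat. continuous_on UNIV (\<gamma>n n)) \<and>
      (\<forall>n t. \<bar>Gn n t\<bar> \<le> c \<and> \<bar>\<gamma>n n t\<bar> \<le> c) \<and> (\<forall>t. (\<lambda>n. Gn n t) \<longlonglongrightarrow> G t) \<and> (\<forall>t. (\<lambda>n. \<gamma>n n t) \<longlonglongrightarrow> \<gamma> t))"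

lemma norm_combination_power_le:
  fixes p q :: "'z::real_normed_vector"
  assumes "\<bar>s\<bar> \<le> c" "norm p \<le> B" "\<bar>r\<bar> \<le> b" "norm q ^ n \<le> w"
  shows "norm (s *\<^sub>R p + r *\<^sub>R q) ^ n \<le> 2 ^ n * ((c * B) ^ n + b ^ n * w)"
proof -
  have nn: "c \<ge> 0" "B \<ge> 0" "b \<ge> 0" using assms norm_ge_zero order_trans abs_ge_zero by blast+
  have "norm (s *\<^sub>R p + r *\<^sub>R q) \<le> c * B + b * norm q"
    using norm_triangle_ineq[of "s *\<^sub>R p" "r *\<^sub>R q"] mult_mono[OF assms(1,2)] mult_right_mono[OF assms(3) norm_ge_zero[of q]] nn
    by simp
  then have "norm (s *\<^sub>R p + r *\<^sub>R q) ^ n \<le> (c * B + b * norm q) ^ n" by (intro power_mono) auto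
  also have "\<dots> \<le> 2 ^ n * ((c * B) ^ n + (b * norm q) ^ n)" using nn by (intro power_add_le) auto
  also have "\<dots> \<le> 2 ^ n * ((c * B) ^ n + b ^ n * w)"
    using nn assms(4) by (intro mult_left_mono add_left_mono) (auto simp: power_mult_distrib mult_left_mono)
  finally show ?thesis .
qed

text \<open>
  At the kinks \<open>dclamp\<close> takes the mean value \<open>1/2\<close>, the limit of the derivatives of the
  regularisations by \<open>sqrt (t\<^sup>2 + 1 / n)\<close>. Hence it is not needed that the gradient vanishes almost
  everywhere on level sets.
\<close>

definition clamp :: "real \<Rightarrow> real \<Rightarrow> real \<Rightarrow> real" where
  "clamp k h t = (h + \<bar>t - k\<bar> - \<bar>t - k - h\<bar>) / 2"

definition dclamp :: "real \<Rightarrow> real \<Rightarrow> real \<Rightarrow> real" where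
  "dclamp k h t = (sgn (t - k) - sgn (t - k - h)) / 2"

lemma clamp_eq: "h \<ge> 0 \<Longrightarrow> clamp k h t = min (max (t - k) 0) h"
  by (auto simp: clamp_def min_def max_def abs_if)

lemma dclamp_bounds: "h \<ge> 0 \<Longrightarrow> 0 \<le> dclamp k h t" "h \<ge> 0 \<Longrightarrow> dclamp k h t \<le> 1"
  by (auto simp: dclamp_def sgn_if)

lemma sqrt_diff_abs_le: "\<bar>sqrt (a\<^sup>2 + e) - sqrt (b\<^sup>2 + e)\<bar> \<le> \<bar>a - b\<bar>" if "e > 0" for a b e :: real
proof -
  have p: "sqrt (a\<^sup>2 + e) > 0" "sqrt (b\<^sup>2 + e) > 0" using that by (auto simp: add_nonneg_pos)
  have le: "\<bar>a\<bar> \<le> sqrt (a\<^sup>2 + e)" "\<bar>b\<bar> \<le> sqrt (b\<^sup>2 + e)" using that by (auto intro!: real_le_rsqrt)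
  have "(sqrt (a\<^sup>2 + e) - sqrt (b\<^sup>2 + e)) * (sqrt (a\<^sup>2 + e) + sqrt (b\<^sup>2 + e)) = (a - b) * (a + b)"
    using that by (simp add: algebra_simps power2_eq_square[symmetric] add_nonneg_pos)
  then have "\<bar>sqrt (a\<^sup>2 + e) - sqrt (b\<^sup>2 + e)\<bar> * \<bar>sqrt (a\<^sup>2 + e) + sqrt (b\<^sup>2 + e)\<bar> = \<bar>a - b\<bar> * \<bar>a + b\<bar>"
    unfolding abs_mult[symmetric] by (rule arg_cong)
  moreover have "\<bar>sqrt (a\<^sup>2 + e) + sqrt (b\<^sup>2 + e)\<bar> = sqrt (a\<^sup>2 + e) + sqrt (b\<^sup>2 + e)" using p by linarith
  ultimately have "\<bar>sqrt (a\<^sup>2 + e) - sqrt (b\<^sup>2 + e)\<bar> * (sqrt (a\<^sup>2 + e) + sqrt (b\<^sup>2 + e)) = \<bar>a - b\<bar> * \<bar>a + b\<bar>"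
    by simp
  also have "\<dots> \<le> \<bar>a - b\<bar> * (sqrt (a\<^sup>2 + e) + sqrt (b\<^sup>2 + e))"
    using le by (intro mult_left_mono) auto
  finally show ?thesis using p by (simp add: mult_le_cancel_right)
qed

lemma sqrt_reg_deriv:
  assumes "e > (0::real)"
  shows "((\<lambda>t. sqrt (t\<^sup>2 + e)) has_real_derivative t / sqrt (t\<^sup>2 + e)) (at t)"
proof -
  have p: "t\<^sup>2 + e > 0" using assms by (intro add_nonneg_pos) auto
  have "((\<lambda>t. t\<^sup>2 + e) has_real_derivative 2 * t) (at t)"
    by (auto intro!: derivative_eq_intros)
  from DERIV_chain2[OF DERIV_real_sqrt[OF p] this]
  show ?thesis by (rule DERIV_cong) (simp add: field_simps)
qed
lemma sqrt_reg_lim: "(\<lambda>n. sqrt (t\<^sup>2 + 1 / real (Suc n))) \<longlonglongrightarrow> \<bar>t\<bar>"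
proof -
  have "(\<lambda>n. 1 / real (Suc n)) \<longlonglongrightarrow> 0"
    using LIMSEQ_inverse_real_of_nat by (simp only: divide_inverse mult_1_left)
  then have "(\<lambda>n. sqrt (t\<^sup>2 + 1 / real (Suc n))) \<longlonglongrightarrow> sqrt (t\<^sup>2 + 0)"
    by (intro tendsto_real_sqrt tendsto_add tendsto_const)
  then show ?thesis by simp
qed

text \<open>\<sigma> = -1 gives truncations of -u; the affine parameters provide constants and
  \<open>1 - clamp s h t / h\<close>. The regularising square roots are unbounded, but only their
  difference enters, which is controlled because they are Lipschitz.\<close>

lemma nice_clamp:
  assumes "h > 0" "\<bar>\<sigma>\<bar> = 1"
  shows "nice (\<lambda>t. \<alpha> + \<beta> * clamp k h (\<sigma> * t)) (\<lambda>t. \<beta> * \<sigma> * dclamp k h (\<sigma> * t))"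
proof -
  define q where "q = (\<lambda>(n::nat) t. sqrt (t\<^sup>2 + 1 / real (Suc n)))"
  have e: "1 / real (Suc n) > 0" for n by simp
  have q0: "q n t > 0" for n t unfolding q_def by (intro real_sqrt_gt_zero add_nonneg_pos) auto
  have dq: "(q n has_real_derivative t / q n t) (at t)" for n t
    unfolding q_def by (rule sqrt_reg_deriv[OF e])
  have qle: "\<bar>t\<bar> \<le> q n t" for n t unfolding q_def by (rule real_le_rsqrt) simp
  have qlim: "(\<lambda>n. q n t) \<longlonglongrightarrow> \<bar>t\<bar>" for t
    unfolding q_def by (rule sqrt_reg_lim)
  have dqlim: "(\<lambda>n. t / q n t) \<longlonglongrightarrow> sgn t" for t
  proof (cases "t = 0")
    case False
    then have "(\<lambda>n. t / q n t) \<longlonglongrightarrow> t / \<bar>t\<bar>" by (intro tendsto_divide tendsto_const qlim) auto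
    then show ?thesis by (simp add: sgn_real_def abs_if split: if_splits)
  qed simp
  have dqle: "\<bar>t / q n t\<bar> \<le> 1" for n t using q0[of n t] qle[of t n] by (simp add: abs_divide)
  define Gn where "Gn = (\<lambda>n t. \<alpha> + \<beta> * ((h + (q n (\<sigma> * t - k) - q n (\<sigma> * t - k - h))) / 2))"
  define \<gamma>n where "\<gamma>n = (\<lambda>n t. \<beta> * \<sigma> * (((\<sigma> * t - k) / q n (\<sigma> * t - k) - (\<sigma> * t - k - h) / q n (\<sigma> * t - k - h)) / 2))"
  define c where "c = \<bar>\<alpha>\<bar> + \<bar>\<beta>\<bar> * (h + 1)"
  have d: "(Gn n has_real_derivative \<gamma>n n t) (at t)" for n t
  proof -
    have lin: "((\<lambda>t. \<sigma> * t - k) has_real_derivative \<sigma>) (at t)" "((\<lambda>t. \<sigma> * t - k - h) has_real_derivative \<sigma>) (at t)"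
      by (auto intro!: derivative_eq_intros)
    note d = DERIV_diff[OF DERIV_chain2[OF dq lin(1), of n] DERIV_chain2[OF dq lin(2), of n]]
    have eq: "0 + \<beta> * ((0 + (x * \<sigma> - y * \<sigma>)) / 2) = \<beta> * \<sigma> * ((x - y) / 2)" for x y
      by (simp add: algebra_simps)
    show ?thesis
      unfolding Gn_def \<gamma>n_def
      by (rule DERIV_cong[OF DERIV_add[OF DERIV_const DERIV_cmult[OF DERIV_cdivide[OF DERIV_add[OF DERIV_const d]]]] eq])
  qed
  have cont: "continuous_on UNIV (\<gamma>n n)" for n
  proof -
    have cq: "continuous_on UNIV (q n)"
      unfolding q_def by (intro continuous_on_real_sqrt continuous_on_add continuous_on_power continuous_on_id continuous_on_const)
    have nz: "q n s \<noteq> 0" for s using q0[of n s] by simp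
    have r: "continuous_on UNIV (\<lambda>t. f t / q n (f t))" if "continuous_on UNIV f" for f :: "real \<Rightarrow> real"
      using that nz by (intro continuous_on_divide continuous_on_compose2[OF cq]) auto
    have l: "continuous_on UNIV (\<lambda>t. \<sigma> * t - k)" "continuous_on UNIV (\<lambda>t. \<sigma> * t - k - h)"
      by (intro continuous_intros)+
    show ?thesis unfolding \<gamma>n_def
      by (intro continuous_on_mult_left continuous_on_divide[OF continuous_on_diff[OF r[OF l(1)] r[OF l(2)]] continuous_on_const]) simp
  qed
  have b1: "\<bar>Gn n t\<bar> \<le> c" for n t
  proof -
    have "\<bar>q n (\<sigma> * t - k) - q n (\<sigma> * t - k - h)\<bar> \<le> \<bar>(\<sigma> * t - k) - (\<sigma> * t - k - h)\<bar>"
      unfolding q_def by (rule sqrt_diff_abs_le[OF e])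
    then have "\<bar>(h + (q n (\<sigma> * t - k) - q n (\<sigma> * t - k - h))) / 2\<bar> \<le> h + 1" using \<open>h > 0\<close> by simp
    from mult_left_mono[OF this abs_ge_zero[of \<beta>]]
    have "\<bar>\<beta> * ((h + (q n (\<sigma> * t - k) - q n (\<sigma> * t - k - h))) / 2)\<bar> \<le> \<bar>\<beta>\<bar> * (h + 1)" by (simp only: abs_mult)
    then show ?thesis unfolding Gn_def c_def by linarith
  qed
  have b2: "\<bar>\<gamma>n n t\<bar> \<le> c" for n t
  proof -
    have "\<bar>(x - y) / 2\<bar> \<le> h + 1" if "\<bar>x\<bar> \<le> 1" "\<bar>y\<bar> \<le> 1" for x y :: real
      using that \<open>h > 0\<close> by (auto simp: abs_le_iff field_simps)
    from this[OF dqle dqle] have "\<bar>((\<sigma> * t - k) / q n (\<sigma> * t - k) - (\<sigma> * t - k - h) / q n (\<sigma> * t - k - h)) / 2\<bar> \<le> h + 1" .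
    from mult_left_mono[OF this abs_ge_zero[of \<beta>]] have "\<bar>\<gamma>n n t\<bar> \<le> \<bar>\<beta>\<bar> * (h + 1)"
      unfolding \<gamma>n_def by (simp only: abs_mult assms(2) mult_1_right)
    then show ?thesis unfolding c_def by linarith
  qed
  have l1: "(\<lambda>n. Gn n t) \<longlonglongrightarrow> \<alpha> + \<beta> * clamp k h (\<sigma> * t)" for t
  proof -
    have "(\<lambda>n. Gn n t) \<longlonglongrightarrow> \<alpha> + \<beta> * ((h + (\<bar>\<sigma> * t - k\<bar> - \<bar>\<sigma> * t - k - h\<bar>)) / 2)"
      unfolding Gn_def
      by (rule tendsto_add[OF tendsto_const tendsto_mult_left[OF tendsto_divide[OF tendsto_add[OF tendsto_const tendsto_diff[OF qlim qlim]] tendsto_const]]]) simp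
    then show ?thesis by (simp add: clamp_def add_diff_eq)
  qed
  have l2: "(\<lambda>n. \<gamma>n n t) \<longlonglongrightarrow> \<beta> * \<sigma> * dclamp k h (\<sigma> * t)" for t
    unfolding \<gamma>n_def dclamp_def
    by (rule tendsto_mult_left[OF tendsto_divide[OF tendsto_diff[OF dqlim dqlim] tendsto_const]]) simp
  have m: "(\<lambda>t. \<alpha> + \<beta> * clamp k h (\<sigma> * t)) \<in> borel_measurable borel" "(\<lambda>t. \<beta> * \<sigma> * dclamp k h (\<sigma> * t)) \<in> borel_measurable borel"
    unfolding clamp_def dclamp_def sgn_real_def by measurable
  show ?thesis
    unfolding nice_def using d cont b1 b2 l1 l2 m by blast
qed

text \<open>
  \<open>g\<close> and \<open>F\<close> stand for Borel versions of the weak gradient of \<open>u\<close> and of \<open>a(\<nabla>u)\<close>, extended by \<open>0\<close>.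
  Only \<open>approx\<close> relates \<open>u\<close> to \<open>g\<close>, and only the growth and coercivity of \<open>F\<close> are used.
\<close>

locale conormal =
  fixes C :: "(real^'n) set" and u f :: "real^'n \<Rightarrow> real" and g F :: "real^'n \<Rightarrow> real^'n"
    and a\<^sub>0 a\<^sub>1 K :: real and N :: nat
  assumes N_def: "N = CARD('n)" and N2: "N \<ge> 2"
    and C_open: "open C" and C_ne: "C \<noteq> {}" and C_convex: "convex C"
    and C_scale: "\<And>x t. x \<in> C \<Longrightarrow> t > 0 \<Longrightarrow> t *\<^sub>R x \<in> C"
    and a0: "a\<^sub>0 > 0" and a1: "a\<^sub>1 > 0" and K: "K > 0"
    and um [measurable]: "u \<in> borel_measurable borel" and fm [measurable]: "f \<in> borel_measurable borel"
    and gm [measurable]: "g \<in> borel_measurable borel" and Fm [measurable]: "F \<in> borel_measurable borel"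
    and f_zero: "\<And>x. x \<notin> C - cball 0 1 \<Longrightarrow> f x = 0" and F_zero: "\<And>x. x \<notin> C - cball 0 1 \<Longrightarrow> F x = 0"
    and g_zero: "\<And>x. x \<notin> C - cball 0 1 \<Longrightarrow> g x = 0"
    and F_le: "\<And>x. norm (F x) \<le> a\<^sub>1 * norm (g x) ^ (N - 1)"
    and F_ge: "\<And>x. F x \<bullet> g x \<ge> a\<^sub>0 * norm (g x) ^ N"
    and f_nonneg: "\<And>x. f x \<ge> 0" and f_le: "\<And>x. x \<in> C - cball 0 1 \<Longrightarrow> f x \<le> K / norm x ^ N"
    and f_int: "integrable lborel f"
    and u_cont: "continuous_on (C - cball 0 1) u" and u_nonneg: "\<And>x. u x \<ge> 0"
    and u_inf: "\<And>Z. \<exists>b. \<forall>x\<in>C. norm x \<ge> b \<longrightarrow> u x \<ge> Z"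
    and u_LN: "\<And>S. compact S \<Longrightarrow> S \<subseteq> - cball 0 1 \<Longrightarrow> integrable lborel (\<lambda>x. indicator (S \<inter> C) x * u x ^ N)"
    and g_LN: "\<And>S. compact S \<Longrightarrow> S \<subseteq> - cball 0 1 \<Longrightarrow> integrable lborel (\<lambda>x. indicator S x * norm (g x) ^ N)"
    and approx: "\<And>S. compact S \<Longrightarrow> S \<subseteq> - cball 0 1 \<Longrightarrow>
      \<exists>v Dv w. (\<forall>n::nat. \<forall>x. GDERIV (v n) x :> Dv n x) \<and> (\<forall>n. continuous_on UNIV (Dv n)) \<and>
        (\<forall>x\<in>S \<inter> C. (\<lambda>n. v n x) \<longlonglongrightarrow> u x) \<and>
        (AE x in lborel. x \<in> S \<inter> C \<longrightarrow> (\<lambda>n. Dv n x) \<longlonglongrightarrow> g x) \<and>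
        integrable lborel w \<and> (AE x in lborel. x \<in> S \<inter> C \<longrightarrow> (\<forall>n. norm (Dv n x) ^ N \<le> w x))"
    and weak: "\<And>\<psi> h S. C1c \<psi> h S \<Longrightarrow> S \<subseteq> - cball 0 1 \<Longrightarrow>
      (LINT x|lborel. F x \<bullet> h x) = - (LINT x|lborel. f x * \<psi> x)"
begin

lemma Npos: "N > 0" using N2 by simp

lemma Cm [measurable]: "C \<in> sets borel" using C_open by simp

lemma C_add: "x \<in> C \<Longrightarrow> y \<in> C \<Longrightarrow> x + y \<in> C"
  using cone_add_mem[OF C_convex C_scale] by blast

text \<open>
  The pair \<open>(\<phi>, \<Phi>)\<close> satisfies the weak formulation and the difference estimate that a function with
  gradient \<open>\<Phi>\<close> has along the segments from \<open>x\<close> to \<open>l *\<^sub>R x + h\<close>. Both properties pass to limits, so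
  no Sobolev space is needed; the translations and dilations stay in the cone.
\<close>

definition testable :: "(real^'n \<Rightarrow> real) \<Rightarrow> (real^'n \<Rightarrow> real^'n) \<Rightarrow> bool" where
  "testable \<phi> \<Phi> \<longleftrightarrow> \<phi> \<in> borel_measurable borel \<and> \<Phi> \<in> borel_measurable borel \<and>
    (LINT x|lborel. F x \<bullet> \<Phi> x) = - (LINT x|lborel. f x * \<phi> x) \<and>
    (\<forall>A A' l h r. A \<in> sets borel \<longrightarrow> A' \<in> sets borel \<longrightarrow> A' \<subseteq> C \<longrightarrow> l \<ge> 1 \<longrightarrow>
      (\<forall>x t. x \<in> A \<longrightarrow> 0 \<le> t \<longrightarrow> t \<le> 1 \<longrightarrow> (1 + t * (l - 1)) *\<^sub>R x + t *\<^sub>R h \<in> A') \<longrightarrow>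
      (\<forall>x\<in>A. norm ((l - 1) *\<^sub>R x + h) \<le> r) \<longrightarrow>
      (\<integral>\<^sup>+x. indicator A x * ennreal (\<bar>\<phi> (l *\<^sub>R x + h) - \<phi> x\<bar> ^ N) \<partial>lborel)
        \<le> ennreal (r ^ N) * (\<integral>\<^sup>+x. indicator A' x * ennreal (norm (\<Phi> x) ^ N) \<partial>lborel))"

lemma testable_measurable: "testable \<phi> \<Phi> \<Longrightarrow> \<phi> \<in> borel_measurable borel" "testable \<phi> \<Phi> \<Longrightarrow> \<Phi> \<in> borel_measurable borel"
  by (simp_all only: testable_def)

lemma testable_weak: "testable \<phi> \<Phi> \<Longrightarrow> (LINT x|lborel. F x \<bullet> \<Phi> x) = - (LINT x|lborel. f x * \<phi> x)"
  by (simp only: testable_def)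

lemma testable_le:
  assumes "testable \<phi> \<Phi>" "A \<in> sets borel" "A' \<in> sets borel" "A' \<subseteq> C" "l \<ge> 1"
    and "\<And>x t. x \<in> A \<Longrightarrow> 0 \<le> t \<Longrightarrow> t \<le> 1 \<Longrightarrow> (1 + t * (l - 1)) *\<^sub>R x + t *\<^sub>R h \<in> A'"
    and "\<And>x. x \<in> A \<Longrightarrow> norm ((l - 1) *\<^sub>R x + h) \<le> r"
  shows "(\<integral>\<^sup>+x. indicator A x * ennreal (\<bar>\<phi> (l *\<^sub>R x + h) - \<phi> x\<bar> ^ N) \<partial>lborel)
        \<le> ennreal (r ^ N) * (\<integral>\<^sup>+x. indicator A' x * ennreal (norm (\<Phi> x) ^ N) \<partial>lborel)"
proof -
  note T = assms(1)[unfolded testable_def, THEN conjunct2, THEN conjunct2, THEN conjunct2]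
  show ?thesis by (rule T[rule_format]) (fact assms)+
qed

lemma testable_C1c:
  assumes "C1c \<psi> h S" "S \<subseteq> - cball 0 1"
  shows "testable \<psi> h"
proof -
  note D = C1cD[OF assms(1)]
  show ?thesis
    unfolding testable_def
  proof (intro conjI allI impI)
    show "\<psi> \<in> borel_measurable borel" "h \<in> borel_measurable borel"
      using D by (auto intro: borel_measurable_continuous_onI)
    show "(LINT x|lborel. F x \<bullet> h x) = - (LINT x|lborel. f x * \<psi> x)" using weak[OF assms] .
  next
    fix A A' :: "(real^'n) set" and l k r
    assume "A \<in> sets borel" "A' \<in> sets borel" "1 \<le> (l::real)"
      "\<forall>x t. x \<in> A \<longrightarrow> 0 \<le> t \<longrightarrow> t \<le> 1 \<longrightarrow> (1 + t * (l - 1)) *\<^sub>R x + t *\<^sub>R k \<in> A'"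
      "\<forall>x\<in>A. norm ((l - 1) *\<^sub>R x + k) \<le> r"
    then show "(\<integral>\<^sup>+x. indicator A x * ennreal (\<bar>\<psi> (l *\<^sub>R x + k) - \<psi> x\<bar> ^ N) \<partial>lborel)
        \<le> ennreal (r ^ N) * (\<integral>\<^sup>+x. indicator A' x * ennreal (norm (h x) ^ N) \<partial>lborel)"
      by (intro C1_dilation_translation_le[OF D(1,2) Npos]) simp_all
  qed
qed

section \<open>Young's inequality and limits of admissible pairs\<close>

lemma power_young:
  fixes x y \<tau> :: real
  assumes "x \<ge> 0" "y \<ge> 0" "\<tau> > 0"
  shows "x ^ (N - 1) * y \<le> \<tau> * x ^ N + (1 / \<tau>) ^ (N - 1) * y ^ N"
\<comment> \<open>Comparing y with \<tau> x takes the place of the duality of exponents: in either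
  case one of the two terms alone dominates.\<close>
proof (cases "y \<le> \<tau> * x")
  case True
  have "x ^ (N - 1) * y \<le> x ^ (N - 1) * (\<tau> * x)" using True assms by (intro mult_left_mono) auto
  also have "\<dots> = \<tau> * x ^ N" using power_minus_mult[OF Npos, of x] by (simp add: mult_ac)
  also have "\<dots> \<le> \<tau> * x ^ N + (1 / \<tau>) ^ (N - 1) * y ^ N" using assms by simp
  finally show ?thesis .
next
  case False
  then have "x \<le> (1 / \<tau>) * y" using assms by (simp add: field_simps)
  then have "x ^ (N - 1) * y \<le> ((1 / \<tau>) * y) ^ (N - 1) * y" using assms by (intro mult_right_mono power_mono) auto
  also have "\<dots> = (1 / \<tau>) ^ (N - 1) * y ^ N"
    using power_minus_mult[OF Npos, of y] by (simp only: power_mult_distrib mult.assoc)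
  also have "\<dots> \<le> \<tau> * x ^ N + (1 / \<tau>) ^ (N - 1) * y ^ N" using assms by simp
  finally show ?thesis .
qed

lemma F_inner_le: "\<bar>F x \<bullet> y\<bar> \<le> a\<^sub>1 * (norm (g x) ^ N + norm y ^ N)"
proof -
  have "\<bar>F x \<bullet> y\<bar> \<le> norm (F x) * norm y" by (rule Cauchy_Schwarz_ineq2)
  also have "\<dots> \<le> (a\<^sub>1 * norm (g x) ^ (N - 1)) * norm y" by (intro mult_right_mono F_le) auto
  also have "\<dots> \<le> a\<^sub>1 * (norm (g x) ^ N + norm y ^ N)"
    using power_young[of "norm (g x)" "norm y" 1] a1 by (simp add: mult.assoc)
  finally show ?thesis .
qed

text \<open>The weak formulation passes to the limit by dominated convergence. In the difference
  estimate the left-hand side is handled by Fatou, so the functions need to converge only pointwise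
  on the cone.\<close>

lemma testable_limit:
  assumes TPn: "\<And>n. testable (\<phi>n n) (\<Phi>n n)" and S: "compact S" "S \<subseteq> - cball 0 1"
    and [measurable]: "\<phi> \<in> borel_measurable borel" "\<Phi> \<in> borel_measurable borel"
    and lim: "\<And>x. x \<in> C \<Longrightarrow> (\<lambda>n. \<phi>n n x) \<longlonglongrightarrow> \<phi> x"
    and limD: "AE x in lborel. x \<in> C \<longrightarrow> (\<lambda>n. \<Phi>n n x) \<longlonglongrightarrow> \<Phi> x"
    and w: "integrable lborel w" "AE x in lborel. x \<in> C \<longrightarrow> (\<forall>n. norm (\<Phi>n n x) ^ N \<le> w x)"
    and bd: "\<And>n x. x \<in> C \<Longrightarrow> \<bar>\<phi>n n x\<bar> \<le> c" and z: "\<And>n x. x \<notin> S \<Longrightarrow> \<Phi>n n x = 0"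
  shows "testable \<phi> \<Phi>"
proof -
  have [measurable]: "\<phi>n n \<in> borel_measurable borel" "\<Phi>n n \<in> borel_measurable borel" for n
    using testable_measurable[OF TPn] by auto
  have Sm [measurable]: "S \<in> sets borel" using S(1) by (rule borel_compact)
  have "c \<ge> 0"
  proof -
    obtain x where "x \<in> C" using C_ne by auto
    then show ?thesis using bd[of x 0] by linarith
  qed
  have L1: "(\<lambda>n. LINT x|lborel. F x \<bullet> \<Phi>n n x) \<longlonglongrightarrow> (LINT x|lborel. F x \<bullet> \<Phi> x)"
  proof (rule integral_dominated_convergence[where w="\<lambda>x. a\<^sub>1 * (indicator S x * norm (g x) ^ N + \<bar>w x\<bar>)"])
    show "integrable lborel (\<lambda>x. a\<^sub>1 * (indicator S x * norm (g x) ^ N + \<bar>w x\<bar>))"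
      using g_LN[OF S] w(1) by auto
    show "AE x in lborel. (\<lambda>n. F x \<bullet> \<Phi>n n x) \<longlonglongrightarrow> F x \<bullet> \<Phi> x"
      using limD
    proof eventually_elim
      case (elim x)
      show ?case
      proof (cases "x \<in> C")
        case True with elim show ?thesis by (auto intro!: tendsto_intros)
      next
        case False then show ?thesis by (simp add: F_zero)
      qed
    qed
    show "AE x in lborel. norm (F x \<bullet> \<Phi>n n x) \<le> a\<^sub>1 * (indicator S x * norm (g x) ^ N + \<bar>w x\<bar>)" for n
      using w(2) 
    proof eventually_elim
      case (elim x)
      show ?case
      proof (cases "x \<in> C")
        case False
        then show ?thesis using a1 by (simp add: F_zero)
      next
        case True
        then have w: "norm (\<Phi>n n x) ^ N \<le> w x" using elim by blast
        show ?thesis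
        proof (cases "x \<in> S")
          case True
          have "\<bar>F x \<bullet> \<Phi>n n x\<bar> \<le> a\<^sub>1 * (norm (g x) ^ N + norm (\<Phi>n n x) ^ N)" by (rule F_inner_le)
          also have "\<dots> \<le> a\<^sub>1 * (norm (g x) ^ N + \<bar>w x\<bar>)" using a1 w by (intro mult_left_mono) auto
          finally show ?thesis using True by simp
        next
          case False
          then show ?thesis using a1 z by simp
        qed
      qed
    qed
  qed auto
  have L2: "(\<lambda>n. LINT x|lborel. f x * \<phi>n n x) \<longlonglongrightarrow> (LINT x|lborel. f x * \<phi> x)"
  proof (rule integral_dominated_convergence[where w="\<lambda>x. c * f x"])
    show "AE x in lborel. (\<lambda>n. f x * \<phi>n n x) \<longlonglongrightarrow> f x * \<phi> x"
    proof (rule AE_I2)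
      fix x show "(\<lambda>n. f x * \<phi>n n x) \<longlonglongrightarrow> f x * \<phi> x"
        using lim[of x] f_zero[of x] by (cases "x \<in> C") (auto intro!: tendsto_intros)
    qed
    show "AE x in lborel. norm (f x * \<phi>n n x) \<le> c * f x" for n
    proof (rule AE_I2)
      fix x show "norm (f x * \<phi>n n x) \<le> c * f x"
        using mult_left_mono[OF bd[of x n] f_nonneg[of x]] f_zero[of x] f_nonneg[of x]
        by (cases "x \<in> C") (auto simp: abs_mult mult.commute)
    qed
  qed (use f_int in auto)
  show ?thesis
    unfolding testable_def
  proof (intro conjI allI impI)
    have "(\<lambda>n. LINT x|lborel. F x \<bullet> \<Phi>n n x) \<longlonglongrightarrow> - (LINT x|lborel. f x * \<phi> x)"
      unfolding testable_weak[OF TPn] using L2 by (rule tendsto_minus)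
    with L1 show "(LINT x|lborel. F x \<bullet> \<Phi> x) = - (LINT x|lborel. f x * \<phi> x)" by (rule LIMSEQ_unique)
  next
    fix A A' :: "(real^'n) set" and l k r
    assume A [measurable]: "A \<in> sets borel" "A' \<in> sets borel" and AC: "A' \<subseteq> C" and l: "1 \<le> (l::real)"
      and A1: "\<forall>x t. x \<in> A \<longrightarrow> 0 \<le> t \<longrightarrow> t \<le> 1 \<longrightarrow> (1 + t * (l - 1)) *\<^sub>R x + t *\<^sub>R k \<in> A'"
      and A2: "\<forall>x\<in>A. norm ((l - 1) *\<^sub>R x + k) \<le> r"
    have "(\<integral>\<^sup>+x. indicator A x * ennreal (\<bar>\<phi> (l *\<^sub>R x + k) - \<phi> x\<bar> ^ N) \<partial>lborel)
      = (\<integral>\<^sup>+x. liminf (\<lambda>n. indicator A x * ennreal (\<bar>\<phi>n n (l *\<^sub>R x + k) - \<phi>n n x\<bar> ^ N)) \<partial>lborel)"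
    proof (rule nn_integral_cong)
      fix x
      show "indicator A x * ennreal (\<bar>\<phi> (l *\<^sub>R x + k) - \<phi> x\<bar> ^ N) = liminf (\<lambda>n. indicator A x * ennreal (\<bar>\<phi>n n (l *\<^sub>R x + k) - \<phi>n n x\<bar> ^ N))"
      proof (cases "x \<in> A")
        case True
        \<comment> \<open>The end points t = 0 and t = 1 of the segment lie in \<open>A'\<close>,
          hence in the cone, where convergence is known.\<close>
        have "x \<in> C" "l *\<^sub>R x + k \<in> C" using A1[rule_format, OF True, of 0] A1[rule_format, OF True, of 1] AC by auto
        then have "(\<lambda>n. ennreal (\<bar>\<phi>n n (l *\<^sub>R x + k) - \<phi>n n x\<bar> ^ N)) \<longlonglongrightarrow> ennreal (\<bar>\<phi> (l *\<^sub>R x + k) - \<phi> x\<bar> ^ N)"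
          by (intro tendsto_intros tendsto_ennrealI lim)
        then show ?thesis using True lim_imp_Liminf[OF sequentially_bot] by fastforce
      qed (simp add: Liminf_const)
    qed
    also have "\<dots> \<le> liminf (\<lambda>n. \<integral>\<^sup>+x. indicator A x * ennreal (\<bar>\<phi>n n (l *\<^sub>R x + k) - \<phi>n n x\<bar> ^ N) \<partial>lborel)"
      by (rule nn_integral_liminf) auto
    also have "\<dots> \<le> liminf (\<lambda>n. ennreal (r ^ N) * (\<integral>\<^sup>+x. indicator A' x * ennreal (norm (\<Phi>n n x) ^ N) \<partial>lborel))"
      using A1 A2 by (intro Liminf_mono always_eventually allI testable_le[OF TPn A AC l]) auto
    also have "\<dots> = ennreal (r ^ N) * (\<integral>\<^sup>+x. indicator A' x * ennreal (norm (\<Phi> x) ^ N) \<partial>lborel)"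
    proof (rule lim_imp_Liminf[OF sequentially_bot])
      have "(\<lambda>n. \<integral>\<^sup>+x. indicator A' x * ennreal (norm (\<Phi>n n x) ^ N) \<partial>lborel) \<longlonglongrightarrow> (\<integral>\<^sup>+x. indicator A' x * ennreal (norm (\<Phi> x) ^ N) \<partial>lborel)"
      proof (rule nn_integral_dominated_convergence[where w="\<lambda>x. ennreal (norm (w x))"])
        show "AE x in lborel. indicator A' x * ennreal (norm (\<Phi>n j x) ^ N) \<le> ennreal (norm (w x))" for j
          using w(2)
        proof eventually_elim
          case (elim x)
          have "norm (\<Phi>n j x) ^ N \<le> norm (w x)" if "x \<in> A'"
            using elim that AC order_trans[OF _ abs_ge_self[of "w x"]] by (simp add: subset_iff)
          then show ?case by (auto simp: indicator_def intro!: ennreal_leI)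
        qed
        show "(\<integral>\<^sup>+ x. ennreal (norm (w x)) \<partial>lborel) < \<infinity>" using w(1) by (simp add: integrable_iff_bounded)
        show "AE x in lborel. (\<lambda>i. indicator A' x * ennreal (norm (\<Phi>n i x) ^ N)) \<longlonglongrightarrow> indicator A' x * ennreal (norm (\<Phi> x) ^ N)"
          using limD
        proof eventually_elim
          case (elim x)
          show ?case
          proof (cases "x \<in> A'")
            case True
            then have "(\<lambda>n. ennreal (norm (\<Phi>n n x) ^ N)) \<longlonglongrightarrow> ennreal (norm (\<Phi> x) ^ N)"
              using AC elim by (intro tendsto_intros tendsto_ennrealI) auto
            then show ?thesis using True by simp
          qed simp
        qed
      qed (use w in auto)
      then show "(\<lambda>n. ennreal (r ^ N) * (\<integral>\<^sup>+x. indicator A' x * ennreal (norm (\<Phi>n n x) ^ N) \<partial>lborel)) \<longlonglongrightarrow> ennreal (r ^ N) * (\<integral>\<^sup>+x. indicator A' x * ennreal (norm (\<Phi> x) ^ N) \<partial>lborel)"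
        by (intro ennreal_tendsto_cmult) auto
    qed
    finally show "(\<integral>\<^sup>+x. indicator A x * ennreal (\<bar>\<phi> (l *\<^sub>R x + k) - \<phi> x\<bar> ^ N) \<partial>lborel)
        \<le> ennreal (r ^ N) * (\<integral>\<^sup>+x. indicator A' x * ennreal (norm (\<Phi> x) ^ N) \<partial>lborel)" .
  qed auto
qed

text \<open>Replacing u by its mollifications gives compactly supported C^1 functions. They
  approximate u only on \<open>S\<close>, which suffices since \<eta> and its gradient vanish
  elsewhere.\<close>

lemma testable_C1_comp:
  assumes \<eta>: "C1c \<eta> D\<eta> S" "S \<subseteq> - cball 0 1"
    and G: "\<And>t. (G has_real_derivative \<gamma> t) (at t)" "continuous_on UNIV \<gamma>" "\<And>t. \<bar>G t\<bar> \<le> c" "\<And>t. \<bar>\<gamma> t\<bar> \<le> c"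
  shows "testable (\<lambda>x. \<eta> x * G (u x)) (\<lambda>x. G (u x) *\<^sub>R D\<eta> x + (\<eta> x * \<gamma> (u x)) *\<^sub>R g x)"
proof -
  note D = C1cD[OF \<eta>(1)]
  have S: "compact S" by (rule D(4))
  have Sm [measurable]: "S \<in> sets borel" using S by (rule borel_compact)
  obtain v Dv w where v: "\<And>n x. GDERIV (v n) x :> Dv n x" "\<And>n::nat. continuous_on UNIV (Dv n)"
      "\<And>x. x \<in> S \<inter> C \<Longrightarrow> (\<lambda>n. v n x) \<longlonglongrightarrow> u x"
      "AE x in lborel. x \<in> S \<inter> C \<longrightarrow> (\<lambda>n. Dv n x) \<longlonglongrightarrow> g x"
      "integrable lborel w" "AE x in lborel. x \<in> S \<inter> C \<longrightarrow> (\<forall>n. norm (Dv n x) ^ N \<le> w x)"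
    using approx[OF S \<eta>(2)] by blast
  have cG: "continuous_on UNIV G" using G(1) by (meson DERIV_continuous_on has_field_derivative_at_within)
  have [measurable]: "G \<in> borel_measurable borel" "\<gamma> \<in> borel_measurable borel" "\<eta> \<in> borel_measurable borel" "D\<eta> \<in> borel_measurable borel"
    using cG G(2) D by (auto intro: borel_measurable_continuous_onI)
  have cv: "continuous_on UNIV (v n)" for n using v(1) by (rule GDERIV_imp_continuous_on)
  obtain B where B: "B > 0" "\<And>x. norm (\<eta> x) \<le> B" using bounded_compact_support[OF D(3) S D(5)] by blast
  obtain B' where B': "B' > 0" "\<And>x. norm (D\<eta> x) \<le> B'" using bounded_compact_support[OF D(2) S D(6)] by blast
  have c: "c \<ge> 0" using G(3)[of 0] by linarith
  define W where "W = (\<lambda>x. 2 ^ N * (indicator S x * (c * B') ^ N + (B * c) ^ N * \<bar>w x\<bar>))"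
  have "integrable lborel (\<lambda>x. indicator S x :: real)"
    using emeasure_bounded_finite[OF compact_imp_bounded[OF S]] by (intro integrable_real_indicator) auto
  then have "integrable lborel W" unfolding W_def
    by (intro integrable_mult_right Bochner_Integration.integrable_add integrable_mult_left integrable_abs v(5))
  have cts: "continuous (at t) G" "continuous (at t) \<gamma>" for t
    using cG G(2) by (auto simp: continuous_on_eq_continuous_at)
  show ?thesis
  proof (rule testable_limit[where \<phi>n="\<lambda>n x. \<eta> x * G (v n x)" and \<Phi>n="\<lambda>n x. G (v n x) *\<^sub>R D\<eta> x + (\<eta> x * \<gamma> (v n x)) *\<^sub>R Dv n x"
        and w=W and c="B * c" and S=S])
    fix n
    have "C1c (\<lambda>x. \<eta> x * G (v n x)) (\<lambda>x. \<eta> x *\<^sub>R (\<gamma> (v n x) *\<^sub>R Dv n x) + G (v n x) *\<^sub>R D\<eta> x) S"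
    proof (rule C1c_mult[OF \<eta>(1)])
      show "GDERIV (\<lambda>x. G (v n x)) x :> \<gamma> (v n x) *\<^sub>R Dv n x" for x
        using v(1) G(1) by (rule GDERIV_comp)
      show "continuous_on UNIV (\<lambda>x. \<gamma> (v n x) *\<^sub>R Dv n x)"
        using v(2) cv by (intro continuous_intros continuous_on_compose2[OF G(2)]) auto
    qed
    then show "testable (\<lambda>x. \<eta> x * G (v n x)) (\<lambda>x. G (v n x) *\<^sub>R D\<eta> x + (\<eta> x * \<gamma> (v n x)) *\<^sub>R Dv n x)"
      using testable_C1c[OF _ \<eta>(2)] by (simp add: add.commute)
    show "G (v n x) *\<^sub>R D\<eta> x + (\<eta> x * \<gamma> (v n x)) *\<^sub>R Dv n x = 0" if "x \<notin> S" for x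
      using D(5,6)[OF that] by simp
    show "\<bar>\<eta> x * G (v n x)\<bar> \<le> B * c" for x
      using mult_mono[OF B(2)[of x] G(3)[of "v n x"]] B(1) by (simp add: abs_mult)
  next
    fix x assume "x \<in> C"
    show "(\<lambda>n. \<eta> x * G (v n x)) \<longlonglongrightarrow> \<eta> x * G (u x)"
    proof (cases "x \<in> S")
      case True
      with \<open>x \<in> C\<close> have "(\<lambda>n. v n x) \<longlonglongrightarrow> u x" by (intro v(3)) auto
      then show ?thesis using cts(1) by (intro tendsto_mult_left isCont_tendsto_compose[of _ G]) auto
    qed (simp add: D(5))
  next
    show "AE x in lborel. x \<in> C \<longrightarrow> (\<lambda>n. G (v n x) *\<^sub>R D\<eta> x + (\<eta> x * \<gamma> (v n x)) *\<^sub>R Dv n x) \<longlonglongrightarrow> G (u x) *\<^sub>R D\<eta> x + (\<eta> x * \<gamma> (u x)) *\<^sub>R g x"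
      using v(4)
    proof eventually_elim
      case (elim x)
      show ?case
      proof
        assume "x \<in> C"
        show "(\<lambda>n. G (v n x) *\<^sub>R D\<eta> x + (\<eta> x * \<gamma> (v n x)) *\<^sub>R Dv n x) \<longlonglongrightarrow> G (u x) *\<^sub>R D\<eta> x + (\<eta> x * \<gamma> (u x)) *\<^sub>R g x"
        proof (cases "x \<in> S")
          case True
          with \<open>x \<in> C\<close> have "(\<lambda>n. v n x) \<longlonglongrightarrow> u x" by (intro v(3)) auto
          moreover have "(\<lambda>n. Dv n x) \<longlonglongrightarrow> g x" using elim True \<open>x \<in> C\<close> by blast
          ultimately show ?thesis using cts
            by (intro tendsto_add tendsto_scaleR tendsto_mult_left tendsto_const isCont_tendsto_compose[of _ G] isCont_tendsto_compose[of _ \<gamma>]) auto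
        qed (simp add: D(5,6))
      qed
    qed
    show "AE x in lborel. x \<in> C \<longrightarrow> (\<forall>n. norm (G (v n x) *\<^sub>R D\<eta> x + (\<eta> x * \<gamma> (v n x)) *\<^sub>R Dv n x) ^ N \<le> W x)"
      using v(6)
    proof eventually_elim
      case (elim x)
      show ?case
      proof (intro impI allI)
        fix n assume "x \<in> C"
        show "norm (G (v n x) *\<^sub>R D\<eta> x + (\<eta> x * \<gamma> (v n x)) *\<^sub>R Dv n x) ^ N \<le> W x"
        proof (cases "x \<in> S")
          case True
          with elim \<open>x \<in> C\<close> have "norm (Dv n x) ^ N \<le> \<bar>w x\<bar>" by (auto intro: order_trans[OF _ abs_ge_self])
          moreover have "\<bar>\<eta> x * \<gamma> (v n x)\<bar> \<le> B * c"
            using mult_mono[OF B(2)[of x] G(4)[of "v n x"]] B(1) by (simp add: abs_mult)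
          ultimately show ?thesis
            using norm_combination_power_le[OF G(3) B'(2), of "\<eta> x * \<gamma> (v n x)" "B * c" "Dv n x" N "\<bar>w x\<bar>" "v n x" x] True
            by (simp add: W_def)
        next
          case False
          then show ?thesis using D(5,6)[OF False] Npos c B B' by (simp add: W_def zero_power)
        qed
      qed
    qed
  qed (use S \<eta>(2) \<open>integrable lborel W\<close> in auto)
qed

text \<open>A second limit, with u fixed, from the C^1 approximations of \<open>G\<close> to
  \<open>G\<close> itself. It also fixes which value of \<gamma> counts at a kink: the pointwise
  limit of the approximating derivatives.\<close>

lemma testable_nice:
  assumes \<eta>: "C1c \<eta> D\<eta> S" "S \<subseteq> - cball 0 1" and "nice G \<gamma>"
  shows "testable (\<lambda>x. \<eta> x * G (u x)) (\<lambda>x. G (u x) *\<^sub>R D\<eta> x + (\<eta> x * \<gamma> (u x)) *\<^sub>R g x)"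
proof -
  note D = C1cD[OF \<eta>(1)]
  have S: "compact S" by (rule D(4))
  have Sm [measurable]: "S \<in> sets borel" using S by (rule borel_compact)
  obtain Gn \<gamma>n c where G: "\<And>n t. (Gn n has_real_derivative \<gamma>n n t) (at t)" "\<And>n::nat. continuous_on UNIV (\<gamma>n n)"
      "\<And>n t. \<bar>Gn n t\<bar> \<le> c" "\<And>n t. \<bar>\<gamma>n n t\<bar> \<le> c" "\<And>t. (\<lambda>n. Gn n t) \<longlonglongrightarrow> G t" "\<And>t. (\<lambda>n. \<gamma>n n t) \<longlonglongrightarrow> \<gamma> t"
    and [measurable]: "G \<in> borel_measurable borel" "\<gamma> \<in> borel_measurable borel"
    using assms(3) unfolding nice_def by blast
  have [measurable]: "\<eta> \<in> borel_measurable borel" "D\<eta> \<in> borel_measurable borel"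
    using D by (auto intro: borel_measurable_continuous_onI)
  obtain B where B: "B > 0" "\<And>x. norm (\<eta> x) \<le> B" using bounded_compact_support[OF D(3) S D(5)] by blast
  obtain B' where B': "B' > 0" "\<And>x. norm (D\<eta> x) \<le> B'" using bounded_compact_support[OF D(2) S D(6)] by blast
  have c: "c \<ge> 0" using G(3)[of 0 0] by linarith
  define W where "W = (\<lambda>x. 2 ^ N * (indicator S x * (c * B') ^ N + (B * c) ^ N * (indicator S x * norm (g x) ^ N)))"
  have "integrable lborel (\<lambda>x. indicator S x :: real)"
    using emeasure_bounded_finite[OF compact_imp_bounded[OF S]] by (intro integrable_real_indicator) auto
  then have "integrable lborel W" unfolding W_def
    by (intro integrable_mult_right Bochner_Integration.integrable_add integrable_mult_left g_LN[OF S \<eta>(2)])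
  show ?thesis
  proof (rule testable_limit[where \<phi>n="\<lambda>n x. \<eta> x * Gn n (u x)" and \<Phi>n="\<lambda>n x. Gn n (u x) *\<^sub>R D\<eta> x + (\<eta> x * \<gamma>n n (u x)) *\<^sub>R g x"
        and w=W and c="B * c" and S=S])
    fix n
    show "testable (\<lambda>x. \<eta> x * Gn n (u x)) (\<lambda>x. Gn n (u x) *\<^sub>R D\<eta> x + (\<eta> x * \<gamma>n n (u x)) *\<^sub>R g x)"
      by (rule testable_C1_comp[OF \<eta> G(1-4)])
    show "Gn n (u x) *\<^sub>R D\<eta> x + (\<eta> x * \<gamma>n n (u x)) *\<^sub>R g x = 0" if "x \<notin> S" for x
      using D(5,6)[OF that] by simp
    show "\<bar>\<eta> x * Gn n (u x)\<bar> \<le> B * c" for x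
      using mult_mono[OF B(2)[of x] G(3)[of n "u x"]] B(1) by (simp add: abs_mult)
  next
    fix x
    show "(\<lambda>n. \<eta> x * Gn n (u x)) \<longlonglongrightarrow> \<eta> x * G (u x)" by (intro tendsto_mult_left G(5))
  next
    show "AE x in lborel. x \<in> C \<longrightarrow> (\<lambda>n. Gn n (u x) *\<^sub>R D\<eta> x + (\<eta> x * \<gamma>n n (u x)) *\<^sub>R g x) \<longlonglongrightarrow> G (u x) *\<^sub>R D\<eta> x + (\<eta> x * \<gamma> (u x)) *\<^sub>R g x"
      by (intro AE_I2 impI tendsto_add tendsto_scaleR tendsto_mult_left tendsto_const G(5,6))
    show "AE x in lborel. x \<in> C \<longrightarrow> (\<forall>n. norm (Gn n (u x) *\<^sub>R D\<eta> x + (\<eta> x * \<gamma>n n (u x)) *\<^sub>R g x) ^ N \<le> W x)"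
    proof (intro AE_I2 impI allI)
      fix x n
      show "norm (Gn n (u x) *\<^sub>R D\<eta> x + (\<eta> x * \<gamma>n n (u x)) *\<^sub>R g x) ^ N \<le> W x"
      proof (cases "x \<in> S")
        case True
        have "\<bar>\<eta> x * \<gamma>n n (u x)\<bar> \<le> B * c"
          using mult_mono[OF B(2)[of x] G(4)[of n "u x"]] B(1) by (simp add: abs_mult)
        then show ?thesis
          using norm_combination_power_le[OF G(3) B'(2), of "\<eta> x * \<gamma>n n (u x)" "B * c" "g x" N "norm (g x) ^ N" n "u x" x] True
          by (simp add: W_def)
      next
        case False
        then show ?thesis using D(5,6)[OF False] Npos c B B' by (simp add: W_def zero_power)
      qed
    qed
  qed (use S \<eta>(2) \<open>integrable lborel W\<close> in auto)
qed

end

section \<open>Cutoffs and the Faber--Krahn inequality\<close>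

definition sqp :: "real \<Rightarrow> real" where "sqp t = (max 0 t)\<^sup>2"

lemma sqp_deriv: "(sqp has_real_derivative 2 * max 0 t) (at t)"
proof -
  consider "t > 0" | "t < 0" | "t = 0" by linarith
  then show ?thesis
  proof cases
    case 1
    have "((\<lambda>t. t\<^sup>2) has_real_derivative 2 * t) (at t)" by (auto intro!: derivative_eq_intros)
    then have "(sqp has_real_derivative 2 * t) (at t)"
      by (rule has_field_derivative_transform_within_open[of _ _ _ "{0<..}"]) (use 1 in \<open>auto simp: sqp_def\<close>)
    then show ?thesis using 1 by simp
  next
    case 2
    have "(sqp has_real_derivative 0) (at t)"
      by (rule has_field_derivative_transform_within_open[OF DERIV_const, of "{..<0}"]) (use 2 in \<open>auto simp: sqp_def\<close>)
    then show ?thesis using 2 by simp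
  next
    case 3
    have "((\<lambda>x. sqp x / x) \<longlongrightarrow> 0) (at 0)"
    proof (rule Lim_null_comparison)
      show "\<forall>\<^sub>F x in at 0. norm (sqp x / x) \<le> \<bar>x\<bar>"
        by (intro always_eventually allI) (auto simp: sqp_def max_def power2_eq_square)
      show "((\<lambda>x::real. \<bar>x\<bar>) \<longlongrightarrow> 0) (at 0)" by (auto intro!: tendsto_eq_intros)
    qed
    then show ?thesis using 3 by (simp add: has_field_derivative_iff sqp_def)
  qed
qed

lemma sqp_ge_0 [simp]: "sqp t \<ge> 0" by (simp add: sqp_def)

text \<open>Two nested squared positive parts give a C^1 step across the unit interval, which is all
  the regularity that cutoffs need here.\<close>

definition step :: "real \<Rightarrow> real" where "step t = 1 - sqp (1 - sqp t)"
definition dstep :: "real \<Rightarrow> real" where "dstep t = 2 * max 0 (1 - sqp t) * (2 * max 0 t)"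

lemma step_deriv: "(step has_real_derivative dstep t) (at t)"
proof -
  have "((\<lambda>t. 1 - sqp t) has_real_derivative 0 - 2 * max 0 t) (at t)"
    by (rule DERIV_diff[OF DERIV_const sqp_deriv])
  from DERIV_diff[OF DERIV_const DERIV_chain2[OF sqp_deriv this], of 1]
  show ?thesis unfolding step_def[abs_def] dstep_def by (rule DERIV_cong) simp
qed

lemma step_0: "t \<le> 0 \<Longrightarrow> step t = 0"
  by (simp add: step_def sqp_def)

lemma sqp_ge_1: "t \<ge> 1 \<Longrightarrow> sqp t \<ge> 1"
  using one_le_power[of t 2] by (simp add: sqp_def)

lemma step_1: "t \<ge> 1 \<Longrightarrow> step t = 1"
  using sqp_ge_1[of t] by (simp add: step_def sqp_def[of "1 - sqp t"] max_def)

lemma step_bounds: "0 \<le> step t" "step t \<le> 1"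
proof -
  have "0 \<le> max 0 (1 - sqp t)" "max 0 (1 - sqp t) \<le> 1" by auto
  then have "(max 0 (1 - sqp t))\<^sup>2 \<le> 1" by (simp add: power_le_one)
  then show "0 \<le> step t" "step t \<le> 1" by (auto simp: step_def sqp_def[of "1 - sqp t"])
qed

lemma dstep_zero: "t \<le> 0 \<or> t \<ge> 1 \<Longrightarrow> dstep t = 0"
  using sqp_ge_1[of t] by (auto simp: dstep_def max_def)

lemma dstep_bounds: "\<bar>dstep t\<bar> \<le> 4"
proof (cases "t \<le> 0 \<or> t \<ge> 1")
  case True
  then show ?thesis using dstep_zero by simp
next
  case False
  have "0 \<le> max 0 (1 - sqp t)" "max 0 (1 - sqp t) \<le> 1" by auto
  then have "max 0 (1 - sqp t) * max 0 t \<le> 1 * 1" using False by (intro mult_mono) auto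
  moreover have "max 0 (1 - sqp t) * max 0 t \<ge> 0" by simp
  ultimately show ?thesis by (simp add: dstep_def)
qed

lemma dstep_continuous: "continuous_on UNIV dstep"
  unfolding dstep_def[abs_def] sqp_def by (intro continuous_intros)

text \<open>The step is applied to the squared distance, which keeps the cutoff differentiable at
  its centre.\<close>

definition cut :: "'a::real_inner \<Rightarrow> real \<Rightarrow> real \<Rightarrow> 'a \<Rightarrow> real" where
  "cut x0 r r' x = step ((r'\<^sup>2 - (norm (x - x0))\<^sup>2) / (r'\<^sup>2 - r\<^sup>2))"

definition Dcut :: "'a::real_inner \<Rightarrow> real \<Rightarrow> real \<Rightarrow> 'a \<Rightarrow> 'a" where
  "Dcut x0 r r' x = (dstep ((r'\<^sup>2 - (norm (x - x0))\<^sup>2) / (r'\<^sup>2 - r\<^sup>2)) * (- 2 / (r'\<^sup>2 - r\<^sup>2))) *\<^sub>R (x - x0)"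

lemma cut_props:
  assumes "0 \<le> r" "r < r'"
  shows "0 \<le> cut x0 r r' x" "cut x0 r r' x \<le> 1"
    "norm (x - x0) \<le> r \<Longrightarrow> cut x0 r r' x = 1" "norm (x - x0) \<ge> r' \<Longrightarrow> cut x0 r r' x = 0"
    "norm (x - x0) \<le> r \<Longrightarrow> Dcut x0 r r' x = 0" "norm (x - x0) \<ge> r' \<Longrightarrow> Dcut x0 r r' x = 0"
    "norm (Dcut x0 r r' x) \<le> 8 / (r' - r)"
proof -
  have p: "r'\<^sup>2 - r\<^sup>2 > 0" using assms by (simp add: power_strict_mono)
  show "0 \<le> cut x0 r r' x" "cut x0 r r' x \<le> 1" unfolding cut_def using step_bounds by auto
  have 1: "(r'\<^sup>2 - (norm (x - x0))\<^sup>2) / (r'\<^sup>2 - r\<^sup>2) \<ge> 1" if "norm (x - x0) \<le> r"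
    using power_mono[OF that, of 2] p by simp
  have 2: "(r'\<^sup>2 - (norm (x - x0))\<^sup>2) / (r'\<^sup>2 - r\<^sup>2) \<le> 0" if "norm (x - x0) \<ge> r'"
    using power_mono[OF that, of 2] p assms by (simp add: divide_nonpos_pos)
  show "norm (x - x0) \<le> r \<Longrightarrow> cut x0 r r' x = 1" "norm (x - x0) \<ge> r' \<Longrightarrow> cut x0 r r' x = 0"
    using 1 2 by (auto simp: cut_def step_0 step_1)
  show "norm (x - x0) \<le> r \<Longrightarrow> Dcut x0 r r' x = 0" and z: "norm (x - x0) \<ge> r' \<Longrightarrow> Dcut x0 r r' x = 0"
    using 1 2 by (auto simp: Dcut_def dstep_zero)
  show "norm (Dcut x0 r r' x) \<le> 8 / (r' - r)"
  proof (cases "norm (x - x0) \<ge> r'")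
    case True
    then show ?thesis using z assms by simp
  next
    case False
    have "norm (Dcut x0 r r' x) = \<bar>dstep ((r'\<^sup>2 - (norm (x - x0))\<^sup>2) / (r'\<^sup>2 - r\<^sup>2))\<bar> * (2 / (r'\<^sup>2 - r\<^sup>2)) * norm (x - x0)"
      using p by (simp add: Dcut_def abs_mult)
    also have "\<dots> \<le> 4 * (2 / (r'\<^sup>2 - r\<^sup>2)) * r'"
      using p False assms dstep_bounds by (intro mult_mono) auto
    also have "r'\<^sup>2 - r\<^sup>2 = (r' - r) * (r' + r)" by (simp add: power2_eq_square algebra_simps)
    also have "4 * (2 / ((r' - r) * (r' + r))) * r' = 8 / (r' - r) * (r' / (r' + r))" using assms by simp
    \<comment> \<open>The difference of squares loses its factor \<open>r' + r\<close> against
      \<open>r'\<close>; only the inverse width of the transition layer is left.\<close>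
    also have "\<dots> \<le> 8 / (r' - r) * 1" using assms by (intro mult_left_mono) auto
    finally show ?thesis by simp
  qed
qed

lemma cut_C1c:
  assumes "0 \<le> r" "r < r'"
  shows "C1c (cut (x0::real^'n) r r') (Dcut x0 r r') (cball x0 r')"
  unfolding C1c_def
proof (intro conjI allI impI)
  have "r\<^sup>2 < r'\<^sup>2" using assms by (intro power_strict_mono) auto
  then have ne: "r'\<^sup>2 \<noteq> r\<^sup>2" by simp
  fix x :: "real^'n"
  have "((\<lambda>x. (r'\<^sup>2 - (x - x0) \<bullet> (x - x0)) / (r'\<^sup>2 - r\<^sup>2)) has_derivative (\<lambda>h. - (2 * (h \<bullet> (x - x0))) / (r'\<^sup>2 - r\<^sup>2))) (at x)"
    using ne by (auto intro!: derivative_eq_intros simp: inner_commute)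
  then have g: "GDERIV (\<lambda>x. (r'\<^sup>2 - (norm (x - x0))\<^sup>2) / (r'\<^sup>2 - r\<^sup>2)) x :> (- 2 / (r'\<^sup>2 - r\<^sup>2)) *\<^sub>R (x - x0)"
    unfolding gderiv_def power2_norm_eq_inner by (rule has_derivative_eq_rhs) (simp add: fun_eq_iff)
  show "GDERIV (cut x0 r r') x :> Dcut x0 r r' x"
    using GDERIV_DERIV_compose[OF g step_deriv] by (simp add: cut_def[abs_def] Dcut_def)
  show "continuous_on UNIV (Dcut x0 r r')"
    unfolding Dcut_def[abs_def]
    by (intro continuous_intros continuous_on_compose2[OF dstep_continuous]) (use ne in auto)
  show "cut x0 r r' x = 0" if "x \<notin> cball x0 r'"
    using that assms by (intro cut_props(4)) (auto simp: dist_norm norm_minus_commute)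
qed auto

text \<open>In energy estimates the cutoff enters as its N-th power: the power N - 1 left by
  differentiation then matches the growth of F.\<close>

lemma C1c_power:
  assumes "C1c \<eta> D\<eta> S" "n > 0"
  shows "C1c (\<lambda>x. \<eta> x ^ n) (\<lambda>x. (real n * \<eta> x ^ (n - 1)) *\<^sub>R D\<eta> x) S"
proof -
  note D = C1cD[OF assms(1)]
  have "((\<lambda>t::real. t ^ n) has_real_derivative real n * t ^ (n - 1)) (at t)" for t
    using DERIV_pow[of n t] by simp
  from GDERIV_comp[OF D(1) this]
  show ?thesis unfolding C1c_def
    using D assms(2) by (auto intro!: continuous_intros)
qed

text \<open>The value 1/2 at 0 is the limit of \<open>dclamp k h\<close> at \<open>k\<close> as
  \<open>h\<close> grows, so removing the upper truncation is exact at every point.\<close>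

definition heaviside :: "real \<Rightarrow> real" where "heaviside t = (1 + sgn t) / 2"

lemma dclamp_le_heaviside: "dclamp k h t \<le> heaviside (t - k)"
  by (simp add: dclamp_def heaviside_def sgn_if)

lemma dclamp_tendsto_heaviside: "(\<lambda>n. dclamp k (real n) t) \<longlonglongrightarrow> heaviside (t - k)"
proof (rule tendsto_eventually)
  obtain m where m: "t - k < real m" using reals_Archimedean2 by blast
  show "\<forall>\<^sub>F n in sequentially. dclamp k (real n) t = heaviside (t - k)"
    unfolding eventually_sequentially
    using m by (intro exI[of _ m]) (auto simp: dclamp_def heaviside_def sgn_if)
qed

lemma heaviside_bounds: "0 \<le> heaviside t" "heaviside t \<le> 1" "t > 0 \<Longrightarrow> heaviside t = 1"
  by (auto simp: heaviside_def sgn_if)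

context conormal
begin

section \<open>Bounds and integrability for admissible pairs\<close>

lemma nice_bounds:
  assumes "nice G \<gamma>"
  obtains c where "\<And>t. \<bar>G t\<bar> \<le> c" "\<And>t. \<bar>\<gamma> t\<bar> \<le> c" "c \<ge> 0"
proof -
  obtain Gn \<gamma>n c where b: "\<And>n::nat. \<And>t. \<bar>Gn n t\<bar> \<le> c" "\<And>n t. \<bar>\<gamma>n n t\<bar> \<le> c" "\<And>t. (\<lambda>n. Gn n t) \<longlonglongrightarrow> G t" "\<And>t. (\<lambda>n. \<gamma>n n t) \<longlonglongrightarrow> \<gamma> t"
    using assms unfolding nice_def by blast
  have "\<bar>G t\<bar> \<le> c" "\<bar>\<gamma> t\<bar> \<le> c" for t
    using LIMSEQ_le_const2[OF tendsto_rabs[OF b(3)]] LIMSEQ_le_const2[OF tendsto_rabs[OF b(4)]] b(1,2) by blast+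
  moreover from this(1)[of 0] have "c \<ge> 0" by linarith
  ultimately show ?thesis using that by blast
qed

lemma nice_integrable:
  assumes \<eta>: "C1c \<eta> D\<eta> S" "S \<subseteq> - cball 0 1" and "nice G \<gamma>"
  defines "\<Phi> \<equiv> \<lambda>x. G (u x) *\<^sub>R D\<eta> x + (\<eta> x * \<gamma> (u x)) *\<^sub>R g x"
  shows "integrable lborel (\<lambda>x. norm (\<Phi> x) ^ N)" "integrable lborel (\<lambda>x. F x \<bullet> \<Phi> x)"
proof -
  note D = C1cD[OF \<eta>(1)]
  have S: "compact S" by (rule D(4))
  have Sm [measurable]: "S \<in> sets borel" using S by (rule borel_compact)
  have [measurable]: "G \<in> borel_measurable borel" "\<gamma> \<in> borel_measurable borel" using assms(3) by (auto simp: nice_def)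
  obtain c where c: "\<And>t. \<bar>G t\<bar> \<le> c" "\<And>t. \<bar>\<gamma> t\<bar> \<le> c" "c \<ge> 0" using nice_bounds[OF assms(3)] by blast
  have [measurable]: "\<eta> \<in> borel_measurable borel" "D\<eta> \<in> borel_measurable borel"
    using D by (auto intro: borel_measurable_continuous_onI)
  have \<Phi>m [measurable]: "\<Phi> \<in> borel_measurable borel" unfolding \<Phi>_def by measurable
  obtain B where B: "B > 0" "\<And>x. norm (\<eta> x) \<le> B" using bounded_compact_support[OF D(3) S D(5)] by blast
  obtain B' where B': "B' > 0" "\<And>x. norm (D\<eta> x) \<le> B'" using bounded_compact_support[OF D(2) S D(6)] by blast
  define W where "W = (\<lambda>x. 2 ^ N * (indicator S x * (c * B') ^ N + (B * c) ^ N * (indicator S x * norm (g x) ^ N)))"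
  have "integrable lborel (\<lambda>x. indicator S x :: real)"
    using emeasure_bounded_finite[OF compact_imp_bounded[OF S]] by (intro integrable_real_indicator) auto
  then have W: "integrable lborel W" unfolding W_def
    by (intro integrable_mult_right Bochner_Integration.integrable_add integrable_mult_left g_LN[OF S \<eta>(2)])
  have W0: "W x \<ge> 0" for x unfolding W_def using c B B' by simp
  have le: "norm (\<Phi> x) ^ N \<le> W x" for x
  proof (cases "x \<in> S")
    case True
    have "\<bar>\<eta> x * \<gamma> (u x)\<bar> \<le> B * c"
      using mult_mono[OF B(2)[of x] c(2)[of "u x"]] B(1) by (simp add: abs_mult)
    then show ?thesis
      using norm_combination_power_le[OF c(1) B'(2), of "\<eta> x * \<gamma> (u x)" "B * c" "g x" N "norm (g x) ^ N" "u x" x] True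
      by (simp add: W_def \<Phi>_def)
  next
    case False
    then show ?thesis using D(5,6)[OF False] Npos c B B' by (simp add: W_def zero_power \<Phi>_def)
  qed
  show "integrable lborel (\<lambda>x. norm (\<Phi> x) ^ N)"
    by (rule Bochner_Integration.integrable_bound[OF W]) (use le W0 in auto)
  show "integrable lborel (\<lambda>x. F x \<bullet> \<Phi> x)"
  proof (rule Bochner_Integration.integrable_bound[of _ "\<lambda>x. a\<^sub>1 * (indicator S x * norm (g x) ^ N + W x)"])
    show "integrable lborel (\<lambda>x. a\<^sub>1 * (indicator S x * norm (g x) ^ N + W x))"
      using g_LN[OF S \<eta>(2)] W by auto
    show "AE x in lborel. norm (F x \<bullet> \<Phi> x) \<le> norm (a\<^sub>1 * (indicator S x * norm (g x) ^ N + W x))"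
    proof (rule AE_I2)
      fix x
      show "norm (F x \<bullet> \<Phi> x) \<le> norm (a\<^sub>1 * (indicator S x * norm (g x) ^ N + W x))"
      proof (cases "x \<in> S")
        case True
        have "\<bar>F x \<bullet> \<Phi> x\<bar> \<le> a\<^sub>1 * (norm (g x) ^ N + norm (\<Phi> x) ^ N)" by (rule F_inner_le)
        also have "\<dots> \<le> a\<^sub>1 * (norm (g x) ^ N + W x)" using le a1 by (intro mult_left_mono add_left_mono) auto
        finally show ?thesis using True a1 W0[of x] by simp
      next
        case False
        then show ?thesis using D(5,6)[OF False] by (simp add: \<Phi>_def)
      qed
    qed
  qed auto
qed

section \<open>Volume of the cone in balls and small supports\<close>

definition cC :: real where "cC = measure lborel (C \<inter> ball 0 1)"

lemma emeasure_cone_ball: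
  assumes "\<rho> > 0"
  shows "emeasure lborel (C \<inter> ball 0 \<rho>) = ennreal (cC * \<rho> ^ N)"
proof -
  have "emeasure lborel (C \<inter> ball 0 1) = ennreal cC"
    unfolding cC_def using emeasure_bounded_finite[of "C \<inter> ball 0 1"]
    by (intro emeasure_eq_ennreal_measure) (auto simp: bounded_Int)
  have "emeasure lborel (C \<inter> ball 0 \<rho>) = (\<integral>\<^sup>+x. indicator (C \<inter> ball 0 \<rho>) x \<partial>lborel)" by simp
  also have "\<dots> = (\<integral>\<^sup>+x. indicator (C \<inter> ball 0 1) ((1 / \<rho>) *\<^sub>R x + 0) \<partial>lborel)"
  proof (rule nn_integral_cong)
    fix x :: "real^'n"
    have "x \<in> C \<longleftrightarrow> (1 / \<rho>) *\<^sub>R x \<in> C"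
      using C_scale[of x "1 / \<rho>"] C_scale[of "(1 / \<rho>) *\<^sub>R x" \<rho>] assms by auto
    moreover have "norm x < \<rho> \<longleftrightarrow> norm ((1 / \<rho>) *\<^sub>R x) < 1" using assms by (simp add: field_simps)
    ultimately show "(indicator (C \<inter> ball 0 \<rho>) x :: ennreal) = indicator (C \<inter> ball 0 1) ((1 / \<rho>) *\<^sub>R x + 0)"
      by (simp add: indicator_def)
  qed
  also have "\<dots> = ennreal (1 / (1 / \<rho>) ^ DIM(real^'n)) * (\<integral>\<^sup>+x. indicator (C \<inter> ball 0 1) x \<partial>lborel)"
    using assms C_open by (intro nn_integral_lborel_affine borel_measurable_indicator) auto
  also have "\<dots> = ennreal (\<rho> ^ N) * ennreal cC"
    using \<open>emeasure lborel (C \<inter> ball 0 1) = ennreal cC\<close> assms by (simp add: N_def power_divide)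
  also have "\<dots> = ennreal (cC * \<rho> ^ N)" using ennreal_mult[of "\<rho> ^ N" cC] assms by (simp add: mult.commute cC_def)
  finally show ?thesis .
qed

text \<open>Turns almost everywhere statements about the continuous function u into pointwise ones:
  a violation would hold on a nonempty open set.\<close>

lemma open_pos_measure:
  fixes U :: "(real^'n) set"
  assumes "open U" "x \<in> U"
  shows "emeasure lborel U > 0"
proof -
  obtain e where e: "e > 0" "ball x e \<subseteq> U" using assms open_contains_ball by blast
  have "0 < measure lborel (ball x e)" using content_ball_pos[OF e(1)] by simp
  then have "0 < emeasure lborel (ball x e)" by (cases "emeasure lborel (ball x e) = 0") (auto simp: measure_def zero_less_iff_neq_zero)
  also have "\<dots> \<le> emeasure lborel U" using e assms by (intro emeasure_mono) auto
  finally show ?thesis .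
qed

lemma cC_pos: "cC > 0"
proof -
  obtain p where p: "p \<in> C" using C_ne by auto
  define t where "t = 1 / (norm p + 1)"
  have t: "t > 0" by (simp add: t_def add_nonneg_pos)
  have "norm (t *\<^sub>R p) < 1" by (simp add: t_def add_nonneg_pos)
  then have "t *\<^sub>R p \<in> C \<inter> ball 0 1" using C_scale[OF p t] by simp
  then have "emeasure lborel (C \<inter> ball 0 1) > 0" by (intro open_pos_measure[of _ "t *\<^sub>R p"]) (auto simp: C_open)
  then show ?thesis using emeasure_cone_ball[of 1] by simp
qed

text \<open>
  If \<open>C \<inter> ball 0 \<rho>\<close> has measure \<open>2 * m\<close>, then for every \<open>x\<close> at least half of the translates \<open>x + h\<close>
  with \<open>h\<close> in this set leave \<open>S\<close>, so \<open>\<bar>\<phi> x\<bar>\<close> is bounded by averages of \<open>\<bar>\<phi> (x + h) - \<phi> x\<bar>\<close>.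
\<close>

lemma faber_krahn:
  assumes testable: "testable \<phi> \<Phi>" and [measurable]: "S \<in> sets borel" and m: "m > 0" "emeasure lborel S \<le> ennreal m"
    and z: "\<And>x. x \<in> C \<Longrightarrow> \<phi> x \<noteq> 0 \<Longrightarrow> x \<in> S"
  shows "(\<integral>\<^sup>+x. indicator C x * ennreal (\<bar>\<phi> x\<bar> ^ N) \<partial>lborel)
     \<le> ennreal (4 * m / cC) * (\<integral>\<^sup>+x. indicator C x * ennreal (norm (\<Phi> x) ^ N) \<partial>lborel)"
proof -
  have [measurable]: "\<phi> \<in> borel_measurable borel" "\<Phi> \<in> borel_measurable borel" using testable_measurable[OF testable] by auto
  define E where "E = (\<integral>\<^sup>+x. indicator C x * ennreal (norm (\<Phi> x) ^ N) \<partial>lborel)"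
  define \<rho> where "\<rho> = root N (2 * m / cC)"
  have \<rho>: "\<rho> > 0" "\<rho> ^ N = 2 * m / cC" unfolding \<rho>_def using m cC_pos Npos by (auto intro!: real_root_pow_pos2)
  define P where "P = C \<inter> ball 0 \<rho>"
  have [measurable]: "P \<in> sets borel" by (simp add: P_def)
  have eP: "emeasure lborel P = ennreal (2 * m)"
    unfolding P_def emeasure_cone_ball[OF \<rho>(1)] using \<rho> cC_pos by simp
  have pt: "ennreal m * (indicator C x * ennreal (\<bar>\<phi> x\<bar> ^ N)) \<le> (\<integral>\<^sup>+h. indicator C x * (indicator P h * ennreal (\<bar>\<phi> (x + h) - \<phi> x\<bar> ^ N)) \<partial>lborel)" for x
  proof (cases "x \<in> C")
    case True
    define T where "T = {h. x + h \<in> S}"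
    have [measurable]: "T \<in> sets borel"
    proof -
      have "T = (\<lambda>h. x + h) -` S \<inter> space borel" by (auto simp: T_def)
      also have "\<dots> \<in> sets borel" by (rule measurable_sets[of _ borel borel]) auto
      finally show ?thesis .
    qed
    have "emeasure lborel T = (\<integral>\<^sup>+h. indicator T h \<partial>lborel)" by simp
    also have "\<dots> = (\<integral>\<^sup>+h. indicator S (h + x) \<partial>lborel)"
      by (intro nn_integral_cong) (auto simp: T_def indicator_def add.commute)
    also have "\<dots> = emeasure lborel S" by (subst nn_integral_lborel_translate) auto
    finally have eT: "emeasure lborel T \<le> ennreal m" using m by simp
    have "ennreal (2 * m) \<le> emeasure lborel ((P - T) \<union> T)"
      unfolding eP[symmetric] by (intro emeasure_mono) auto
    also have "\<dots> \<le> emeasure lborel (P - T) + emeasure lborel T" by (intro emeasure_subadditive) auto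
    also have "\<dots> \<le> emeasure lborel (P - T) + ennreal m" using eT by (intro add_left_mono)
    finally have "ennreal m \<le> emeasure lborel (P - T)"
      using m by (cases "emeasure lborel (P - T)") (auto simp flip: ennreal_plus)
    then have "ennreal m * ennreal (\<bar>\<phi> x\<bar> ^ N) \<le> emeasure lborel (P - T) * ennreal (\<bar>\<phi> x\<bar> ^ N)"
      by (rule mult_right_mono) simp
    also have "\<dots> = (\<integral>\<^sup>+h. indicator (P - T) h * ennreal (\<bar>\<phi> x\<bar> ^ N) \<partial>lborel)"
      by (simp add: nn_integral_multc)
    also have "\<dots> \<le> (\<integral>\<^sup>+h. indicator P h * ennreal (\<bar>\<phi> (x + h) - \<phi> x\<bar> ^ N) \<partial>lborel)"
    proof (rule nn_integral_mono)
      fix h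
      show "indicator (P - T) h * ennreal (\<bar>\<phi> x\<bar> ^ N) \<le> indicator P h * ennreal (\<bar>\<phi> (x + h) - \<phi> x\<bar> ^ N)"
      proof (cases "h \<in> P - T")
        case h: True
        then have "x + h \<in> C" "x + h \<notin> S" using C_add[OF True, of h] by (auto simp: P_def T_def)
        then have "\<phi> (x + h) = 0" using z by blast
        then show ?thesis using h by simp
      qed simp
    qed
    finally show ?thesis using True by simp
  qed simp
  have "ennreal m * (\<integral>\<^sup>+x. indicator C x * ennreal (\<bar>\<phi> x\<bar> ^ N) \<partial>lborel)
     = (\<integral>\<^sup>+x. ennreal m * (indicator C x * ennreal (\<bar>\<phi> x\<bar> ^ N)) \<partial>lborel)" by (simp add: nn_integral_cmult)
  also have "\<dots> \<le> (\<integral>\<^sup>+x. \<integral>\<^sup>+h. indicator C x * (indicator P h * ennreal (\<bar>\<phi> (x + h) - \<phi> x\<bar> ^ N)) \<partial>lborel \<partial>lborel)"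
    by (intro nn_integral_mono pt)
  also have "\<dots> = (\<integral>\<^sup>+h. \<integral>\<^sup>+x. indicator C x * (indicator P h * ennreal (\<bar>\<phi> (x + h) - \<phi> x\<bar> ^ N)) \<partial>lborel \<partial>lborel)"
    by (rule lborel_pair.Fubini') measurable
  also have "\<dots> \<le> (\<integral>\<^sup>+h. indicator P h * (ennreal (\<rho> ^ N) * E) \<partial>lborel)"
  proof (rule nn_integral_mono)
    fix h :: "real^'n"
    show "(\<integral>\<^sup>+x. indicator C x * (indicator P h * ennreal (\<bar>\<phi> (x + h) - \<phi> x\<bar> ^ N)) \<partial>lborel) \<le> indicator P h * (ennreal (\<rho> ^ N) * E)"
    proof (cases "h \<in> P")
      case True
      then have h: "h \<in> C" "norm h \<le> \<rho>" by (auto simp: P_def)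
      have "x + t *\<^sub>R h \<in> C" if "x \<in> C" "0 \<le> t" for x t
        using C_add[OF that(1) C_scale[OF h(1), of t]] that by (cases "t = 0") auto
      then have "(\<integral>\<^sup>+x. indicator C x * ennreal (\<bar>\<phi> (1 *\<^sub>R x + h) - \<phi> x\<bar> ^ N) \<partial>lborel) \<le> ennreal (\<rho> ^ N) * E"
        unfolding E_def using h by (intro testable_le[OF testable]) auto
      then show ?thesis using True by simp
    qed simp
  qed
  also have "\<dots> = ennreal (2 * m) * (ennreal (\<rho> ^ N) * E)" by (simp add: nn_integral_multc eP)
  \<comment> \<open>The translates have measure \<open>2 * m\<close> and length at most \<rho> with
    \<open>\<rho> ^ N = 2 * m / cC\<close>; dividing by \<open>m\<close> gives the constant.\<close>
  also have "\<dots> = ennreal m * (ennreal (4 * m / cC) * E)"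
  proof -
    have "ennreal (2 * m) * ennreal (\<rho> ^ N) = ennreal m * ennreal (4 * m / cC)"
      unfolding \<rho>(2) using m cC_pos by (simp flip: ennreal_mult)
    then show ?thesis by (simp add: mult.assoc[symmetric])
  qed
  finally have *: "ennreal m * (\<integral>\<^sup>+x. indicator C x * ennreal (\<bar>\<phi> x\<bar> ^ N) \<partial>lborel) \<le> ennreal m * (ennreal (4 * m / cC) * E)" .
  have inv: "ennreal (1 / m) * (ennreal m * X) = X" for X
    using m by (simp add: mult.assoc[symmetric] flip: ennreal_mult)
  from mult_left_mono[OF *, of "ennreal (1 / m)"] show ?thesis unfolding inv E_def by simp
qed

end

section \<open>De Giorgi iteration\<close>

context conormal
begin

section \<open>Integrability of the truncations and energy estimates\<close>

lemma pos_part_power_le: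
  assumes "\<bar>\<sigma>\<bar> = (1::real)"
  shows "(max 0 (\<sigma> * u x - k)) ^ N \<le> 2 ^ N * (u x ^ N + \<bar>k\<bar> ^ N)"
proof -
  have "\<bar>\<sigma> * u x\<bar> = u x" using assms u_nonneg[of x] by (simp add: abs_mult)
  then have "max 0 (\<sigma> * u x - k) \<le> u x + \<bar>k\<bar>" using u_nonneg[of x] by linarith
  then have "(max 0 (\<sigma> * u x - k)) ^ N \<le> (u x + \<bar>k\<bar>) ^ N" by (intro power_mono) auto
  also have "\<dots> \<le> 2 ^ N * (u x ^ N + \<bar>k\<bar> ^ N)" using u_nonneg[of x] by (intro power_add_le) auto
  finally show ?thesis .
qed

lemma integrable_indicator_compact: "compact S \<Longrightarrow> integrable lborel (\<lambda>x. indicator S x :: real)" for S :: "(real^'n) set"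
  using emeasure_bounded_finite[OF compact_imp_bounded] by (intro integrable_real_indicator) (auto intro: borel_compact)

lemma pos_part_integrable:
  assumes S: "compact S" "S \<subseteq> - cball 0 1" and "\<bar>\<sigma>\<bar> = (1::real)"
  shows "integrable lborel (\<lambda>x. indicator (S \<inter> C) x * (max 0 (\<sigma> * u x - k)) ^ N)"
proof -
  have [measurable]: "S \<in> sets borel" using S(1) by (rule borel_compact)
  show ?thesis
  proof (rule Bochner_Integration.integrable_bound[of _ "\<lambda>x. 2 ^ N * (indicator (S \<inter> C) x * u x ^ N + indicator S x * \<bar>k\<bar> ^ N)"])
    show "integrable lborel (\<lambda>x. 2 ^ N * (indicator (S \<inter> C) x * u x ^ N + indicator S x * \<bar>k\<bar> ^ N))"
      using u_LN[OF S] integrable_indicator_compact[OF S(1)] by auto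
    show "AE x in lborel. norm (indicator (S \<inter> C) x * (max 0 (\<sigma> * u x - k)) ^ N)
        \<le> norm (2 ^ N * (indicator (S \<inter> C) x * u x ^ N + indicator S x * \<bar>k\<bar> ^ N))"
    proof (rule AE_I2)
      fix x
      show "norm (indicator (S \<inter> C) x * (max 0 (\<sigma> * u x - k)) ^ N)
        \<le> norm (2 ^ N * (indicator (S \<inter> C) x * u x ^ N + indicator S x * \<bar>k\<bar> ^ N))"
        using pos_part_power_le[OF assms(3), of x k] u_nonneg[of x]
        by (cases "x \<in> S \<inter> C") (auto simp: abs_of_nonneg)
    qed
  qed auto
qed

lemma f_le_K: "f x \<le> K"
proof (cases "x \<in> C - cball 0 1")
  case True
  then have "norm x ^ N \<ge> 1" by (intro one_le_power) auto
  then have "K / norm x ^ N \<le> K" using K by (simp add: divide_le_eq_1 divide_le_eq mult_le_cancel_left1)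
  then show ?thesis using f_le[OF True] by linarith
next
  case False
  then show ?thesis using f_zero K by simp
qed

text \<open>What Young's inequality leaves in front of the cutoff term when its parameter
  \<open>a\<^sub>0 / (2 * real N * a\<^sub>1)\<close> lets the mixed term consume half of the
  coercive one.\<close>

definition cacc where "cacc = real N * a\<^sub>1 * (2 * real N * a\<^sub>1 / a\<^sub>0) ^ (N - 1)"

lemma cacc_pos: "cacc > 0"
  unfolding cacc_def using Npos a0 a1 by auto

text \<open>Test with \<eta>^N times the positive part of \<sigma> u - k, truncated in height to
  stay bounded, and absorb the mixed term by Young. The source has a favourable sign for \<sigma> =
  1 but not for \<sigma> = -1, so it is kept on the right in both cases.\<close>

lemma caccioppoli:
  fixes k :: real
  assumes \<eta>: "C1c \<eta> D\<eta> S" "S \<subseteq> - cball 0 1" "\<And>x. \<eta> x \<ge> 0" and \<sigma>: "\<bar>\<sigma>\<bar> = (1::real)"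
  defines "w \<equiv> \<lambda>x. max 0 (\<sigma> * u x - k)"
  shows "integrable lborel (\<lambda>x. \<eta> x ^ N * heaviside (\<sigma> * u x - k) * norm (g x) ^ N)"
    and "integrable lborel (\<lambda>x. indicator C x * (w x * norm (D\<eta> x)) ^ N)"
    and "integrable lborel (\<lambda>x. f x * (\<eta> x ^ N * w x))"
    and "a\<^sub>0 / 2 * (LINT x|lborel. \<eta> x ^ N * heaviside (\<sigma> * u x - k) * norm (g x) ^ N)
      \<le> cacc * (LINT x|lborel. indicator C x * (w x * norm (D\<eta> x)) ^ N) + (LINT x|lborel. f x * (\<eta> x ^ N * w x))"
proof -
  note D = C1cD[OF \<eta>(1)]
  have S: "compact S" by (rule D(4))
  have Sm [measurable]: "S \<in> sets borel" using S by (rule borel_compact)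
  have [measurable]: "\<eta> \<in> borel_measurable borel" "D\<eta> \<in> borel_measurable borel"
    using D by (auto intro: borel_measurable_continuous_onI)
  have [measurable]: "w \<in> borel_measurable borel" unfolding w_def by measurable
  have [measurable]: "heaviside \<in> borel_measurable borel" unfolding heaviside_def[abs_def] sgn_real_def by measurable
  obtain B where B: "B > 0" "\<And>x. norm (\<eta> x) \<le> B" using bounded_compact_support[OF D(3) S D(5)] by blast
  obtain B' where B': "B' > 0" "\<And>x. norm (D\<eta> x) \<le> B'" using bounded_compact_support[OF D(2) S D(6)] by blast
  have w0: "w x \<ge> 0" for x by (simp add: w_def)
  have wI: "integrable lborel (\<lambda>x. indicator (S \<inter> C) x * w x ^ N)"
    unfolding w_def by (rule pos_part_integrable[OF S \<eta>(2) \<sigma>])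
  have \<eta>B: "\<eta> x ^ N \<le> B ^ N" for x using B(2)[of x] \<eta>(3)[of x] by (intro power_mono) auto
  define H where "H = (\<lambda>x. heaviside (\<sigma> * u x - k))"
  have H: "0 \<le> H x" "H x \<le> 1" for x using heaviside_bounds by (auto simp: H_def)
  have [measurable]: "H \<in> borel_measurable borel" unfolding H_def by measurable
  have Hw: "H x = 1" if "w x > 0" for x
  proof -
    have "\<sigma> * u x - k > 0" using that by (auto simp: w_def max_def split: if_splits)
    then show ?thesis unfolding H_def by (rule heaviside_bounds(3))
  qed
  have i1: "integrable lborel (\<lambda>x. \<eta> x ^ N * H x * norm (g x) ^ N)"
  proof (rule Bochner_Integration.integrable_bound[of _ "\<lambda>x. B ^ N * (indicator S x * norm (g x) ^ N)"])
    show "integrable lborel (\<lambda>x. B ^ N * (indicator S x * norm (g x) ^ N))" using g_LN[OF S \<eta>(2)] by auto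
    show "AE x in lborel. norm (\<eta> x ^ N * H x * norm (g x) ^ N) \<le> norm (B ^ N * (indicator S x * norm (g x) ^ N))"
    proof (rule AE_I2)
      fix x
      show "norm (\<eta> x ^ N * H x * norm (g x) ^ N) \<le> norm (B ^ N * (indicator S x * norm (g x) ^ N))"
      proof (cases "x \<in> S")
        case True
        have "\<eta> x ^ N * H x \<le> B ^ N * 1" using \<eta>B H[of x] \<eta>(3)[of x] B(1) by (intro mult_mono) auto
        then have "\<eta> x ^ N * H x * norm (g x) ^ N \<le> B ^ N * norm (g x) ^ N" by (intro mult_right_mono) auto
        then show ?thesis using True H[of x] \<eta>(3)[of x] B(1) by simp
      qed (simp add: D(5) zero_power Npos)
    qed
  qed auto
  then show "integrable lborel (\<lambda>x. \<eta> x ^ N * heaviside (\<sigma> * u x - k) * norm (g x) ^ N)" by (simp add: H_def)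
  show i2: "integrable lborel (\<lambda>x. indicator C x * (w x * norm (D\<eta> x)) ^ N)"
  proof (rule Bochner_Integration.integrable_bound[of _ "\<lambda>x. B' ^ N * (indicator (S \<inter> C) x * w x ^ N)"])
    show "integrable lborel (\<lambda>x. B' ^ N * (indicator (S \<inter> C) x * w x ^ N))" using wI by auto
    show "AE x in lborel. norm (indicator C x * (w x * norm (D\<eta> x)) ^ N) \<le> norm (B' ^ N * (indicator (S \<inter> C) x * w x ^ N))"
    proof (rule AE_I2)
      fix x
      show "norm (indicator C x * (w x * norm (D\<eta> x)) ^ N) \<le> norm (B' ^ N * (indicator (S \<inter> C) x * w x ^ N))"
      proof (cases "x \<in> S \<inter> C")
        case True
        have "(w x * norm (D\<eta> x)) ^ N \<le> (w x * B') ^ N" using w0[of x] B'(2)[of x] by (intro power_mono mult_left_mono) auto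
        then show ?thesis using True w0[of x] B'(1) by (simp add: power_mult_distrib mult.commute)
      qed (auto simp: D(6) zero_power Npos indicator_def)
    qed
  qed auto
  show i3: "integrable lborel (\<lambda>x. f x * (\<eta> x ^ N * w x))"
  proof (rule Bochner_Integration.integrable_bound[of _ "\<lambda>x. K * B ^ N * (indicator S x + indicator (S \<inter> C) x * w x ^ N)"])
    show "integrable lborel (\<lambda>x. K * B ^ N * (indicator S x + indicator (S \<inter> C) x * w x ^ N))"
      using wI integrable_indicator_compact[OF S] by auto
    show "AE x in lborel. norm (f x * (\<eta> x ^ N * w x)) \<le> norm (K * B ^ N * (indicator S x + indicator (S \<inter> C) x * w x ^ N))"
    proof (rule AE_I2)
      fix x
      show "norm (f x * (\<eta> x ^ N * w x)) \<le> norm (K * B ^ N * (indicator S x + indicator (S \<inter> C) x * w x ^ N))"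
      proof (cases "x \<in> S \<inter> C")
        case True
        have "w x \<le> 1 + w x ^ N"
        proof (cases "w x \<le> 1")
          case True then show ?thesis using w0[of x] by (simp add: add_increasing2)
        next
          case False then show ?thesis using power_increasing[of 1 N "w x"] Npos by simp
        qed
        then have "f x * (\<eta> x ^ N * w x) \<le> K * (B ^ N * (1 + w x ^ N))"
          using f_le_K[of x] f_nonneg[of x] \<eta>B[of x] w0[of x] \<eta>(3)[of x] K B(1) by (intro mult_mono) auto
        then show ?thesis using True f_nonneg[of x] \<eta>(3)[of x] w0[of x] K B(1) by (simp add: mult.assoc)
      next
        case False
        then have z: "f x * (\<eta> x ^ N * w x) = 0" using D(5)[of x] f_zero[of x] Npos by (auto simp: zero_power)
        show ?thesis unfolding z by simp
      qed
    qed
  qed auto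
  define J where "J = (LINT x|lborel. \<eta> x ^ N * H x * norm (g x) ^ N)"
  define I2 where "I2 = (LINT x|lborel. indicator C x * (w x * norm (D\<eta> x)) ^ N)"
  define I3 where "I3 = (LINT x|lborel. f x * (\<eta> x ^ N * w x))"
  \<comment> \<open>Bound for the mixed term of cutoff gradient and flux, up to the factor
    \<open>real N * a\<^sub>1\<close>.\<close>
  define Q where "Q = (\<lambda>x. w x * (\<eta> x * norm (g x)) ^ (N - 1) * norm (D\<eta> x))"
  have Qle: "Q x \<le> \<tau> * (\<eta> x ^ N * H x * norm (g x) ^ N) + (1 / \<tau>) ^ (N - 1) * (indicator C x * (w x * norm (D\<eta> x)) ^ N)" if "\<tau> > 0" for x \<tau>
  proof (cases "x \<in> C \<and> w x > 0")
    case True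
    have "(\<eta> x * norm (g x)) ^ (N - 1) * (w x * norm (D\<eta> x)) \<le> \<tau> * (\<eta> x * norm (g x)) ^ N + (1 / \<tau>) ^ (N - 1) * (w x * norm (D\<eta> x)) ^ N"
      using that \<eta>(3)[of x] w0[of x] by (intro power_young) auto
    then show ?thesis using True Hw[of x] by (simp add: Q_def power_mult_distrib mult_ac)
  next
    case False
    have "Q x = 0"
    proof (cases "x \<in> C")
      case True with False w0[of x] show ?thesis by (simp add: Q_def)
    next
      case False
      then have "g x = 0" using g_zero by auto
      then show ?thesis using N2 by (simp add: Q_def zero_power)
    qed
    then show ?thesis using that \<eta>(3)[of x] H[of x] w0[of x] by simp
  qed
  have Q0: "Q x \<ge> 0" for x unfolding Q_def using w0 \<eta>(3) by simp
  have iQ: "integrable lborel Q"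
  proof (rule Bochner_Integration.integrable_bound[OF Bochner_Integration.integrable_add[OF i1 i2]])
    show "Q \<in> borel_measurable lborel" unfolding Q_def by measurable
    show "AE x in lborel. norm (Q x) \<le> norm (\<eta> x ^ N * H x * norm (g x) ^ N + indicator C x * (w x * norm (D\<eta> x)) ^ N)"
      using Qle[of 1] Q0 by (intro AE_I2) (auto intro: order_trans[OF _ abs_ge_self])
  qed
  have Qint: "(LINT x|lborel. Q x) \<le> \<tau> * J + (1 / \<tau>) ^ (N - 1) * I2" if "\<tau> > 0" for \<tau>
  proof -
    have "(LINT x|lborel. Q x) \<le> (LINT x|lborel. \<tau> * (\<eta> x ^ N * H x * norm (g x) ^ N) + (1 / \<tau>) ^ (N - 1) * (indicator C x * (w x * norm (D\<eta> x)) ^ N))"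
      by (intro integral_mono iQ Qle that Bochner_Integration.integrable_add integrable_mult_right i1 i2)
    also have "\<dots> = \<tau> * J + (1 / \<tau>) ^ (N - 1) * I2"
      unfolding J_def I2_def using i1 i2 by simp
    finally show ?thesis .
  qed
  have main: "a\<^sub>0 * (LINT x|lborel. \<eta> x ^ N * dclamp k (real (Suc n)) (\<sigma> * u x) * norm (g x) ^ N) \<le> I3 + real N * a\<^sub>1 * (LINT x|lborel. Q x)" for n
  proof -
    define p where "p = (\<lambda>x. clamp k (real (Suc n)) (\<sigma> * u x))"
    define \<gamma> where "\<gamma> = (\<lambda>x. dclamp k (real (Suc n)) (\<sigma> * u x))"
    have p: "0 \<le> p x" "p x \<le> w x" for x unfolding p_def w_def by (auto simp: clamp_eq)
    have \<gamma>: "0 \<le> \<gamma> x" "\<gamma> x \<le> H x" for x unfolding \<gamma>_def H_def using dclamp_bounds(1) dclamp_le_heaviside by auto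
    have [measurable]: "\<gamma> \<in> borel_measurable borel" "p \<in> borel_measurable borel" unfolding \<gamma>_def dclamp_def sgn_real_def p_def clamp_def by measurable
    have nc: "nice (\<lambda>t. clamp k (real (Suc n)) (\<sigma> * t)) (\<lambda>t. \<sigma> * dclamp k (real (Suc n)) (\<sigma> * t))"
      using nice_clamp[of "real (Suc n)" \<sigma> 0 1 k] \<sigma> by simp
    define \<Phi> where "\<Phi> = (\<lambda>x. p x *\<^sub>R ((real N * \<eta> x ^ (N - 1)) *\<^sub>R D\<eta> x) + (\<eta> x ^ N * (\<sigma> * \<gamma> x)) *\<^sub>R g x)"
    have cN: "C1c (\<lambda>x. \<eta> x ^ N) (\<lambda>x. (real N * \<eta> x ^ (N - 1)) *\<^sub>R D\<eta> x) S" by (rule C1c_power[OF \<eta>(1) Npos])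
    have W: "(LINT x|lborel. F x \<bullet> \<Phi> x) = - (LINT x|lborel. f x * (\<eta> x ^ N * p x))"
      using testable_weak[OF testable_nice[OF cN \<eta>(2) nc]] unfolding \<Phi>_def p_def \<gamma>_def .
    have iF: "integrable lborel (\<lambda>x. F x \<bullet> \<Phi> x)"
      using nice_integrable(2)[OF cN \<eta>(2) nc] unfolding \<Phi>_def p_def \<gamma>_def .
    have i\<gamma>: "integrable lborel (\<lambda>x. \<eta> x ^ N * \<gamma> x * norm (g x) ^ N)"
    proof (rule Bochner_Integration.integrable_bound[OF i1])
      show "AE x in lborel. norm (\<eta> x ^ N * \<gamma> x * norm (g x) ^ N) \<le> norm (\<eta> x ^ N * H x * norm (g x) ^ N)"
        using \<gamma> H \<eta>(3) by (intro AE_I2) (auto simp: abs_mult intro!: mult_mono)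
    qed auto
    have ip: "integrable lborel (\<lambda>x. f x * (\<eta> x ^ N * p x))"
    proof (rule Bochner_Integration.integrable_bound[OF i3])
      show "AE x in lborel. norm (f x * (\<eta> x ^ N * p x)) \<le> norm (f x * (\<eta> x ^ N * w x))"
        using p w0 f_nonneg \<eta>(3) by (intro AE_I2) (auto simp: abs_mult intro!: mult_left_mono)
    qed auto
    have \<sigma>2: "\<sigma> * \<sigma> = 1" using \<sigma> by (metis abs_mult_self_eq mult_1)
    have pt: "a\<^sub>0 * (\<eta> x ^ N * \<gamma> x * norm (g x) ^ N) \<le> \<sigma> * (F x \<bullet> \<Phi> x) + real N * a\<^sub>1 * Q x" for x
    proof -
      have "a\<^sub>0 * (\<eta> x ^ N * \<gamma> x * norm (g x) ^ N) = (\<eta> x ^ N * \<gamma> x) * (a\<^sub>0 * norm (g x) ^ N)" by simp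
      also have "\<dots> \<le> (\<eta> x ^ N * \<gamma> x) * (F x \<bullet> g x)" using F_ge \<eta>(3)[of x] \<gamma>[of x] by (intro mult_left_mono) auto
      finally have 1: "a\<^sub>0 * (\<eta> x ^ N * \<gamma> x * norm (g x) ^ N) \<le> (\<eta> x ^ N * \<gamma> x) * (F x \<bullet> g x)" .
      have 2: "\<sigma> * (F x \<bullet> \<Phi> x) = \<sigma> * (p x * (real N * \<eta> x ^ (N - 1)) * (F x \<bullet> D\<eta> x)) + (\<sigma> * \<sigma>) * ((\<eta> x ^ N * \<gamma> x) * (F x \<bullet> g x))"
        unfolding \<Phi>_def inner_add_right inner_scaleR_right by (simp only: distrib_left mult_ac)
      have "\<bar>\<sigma> * (p x * (real N * \<eta> x ^ (N - 1)) * (F x \<bullet> D\<eta> x))\<bar> = p x * (real N * \<eta> x ^ (N - 1)) * \<bar>F x \<bullet> D\<eta> x\<bar>"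
        using \<sigma> p(1)[of x] \<eta>(3)[of x] by (simp add: abs_mult)
      also have "\<dots> \<le> w x * (real N * \<eta> x ^ (N - 1)) * ((a\<^sub>1 * norm (g x) ^ (N - 1)) * norm (D\<eta> x))"
      proof (intro mult_mono)
        show "\<bar>F x \<bullet> D\<eta> x\<bar> \<le> (a\<^sub>1 * norm (g x) ^ (N - 1)) * norm (D\<eta> x)"
          using Cauchy_Schwarz_ineq2[of "F x" "D\<eta> x"] mult_right_mono[OF F_le[of x] norm_ge_zero[of "D\<eta> x"]] by linarith
      qed (use p[of x] w0[of x] \<eta>(3)[of x] in auto)
      also have "\<dots> = real N * a\<^sub>1 * Q x" unfolding Q_def by (simp add: power_mult_distrib mult_ac)
      finally have "- (real N * a\<^sub>1 * Q x) \<le> \<sigma> * (p x * (real N * \<eta> x ^ (N - 1)) * (F x \<bullet> D\<eta> x))" by linarith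
      then show ?thesis using 1 2 \<sigma>2 by simp
    qed
    have "a\<^sub>0 * (LINT x|lborel. \<eta> x ^ N * \<gamma> x * norm (g x) ^ N) = (LINT x|lborel. a\<^sub>0 * (\<eta> x ^ N * \<gamma> x * norm (g x) ^ N))" by simp
    also have "\<dots> \<le> (LINT x|lborel. \<sigma> * (F x \<bullet> \<Phi> x) + real N * a\<^sub>1 * Q x)"
      using i\<gamma> iF iQ by (intro integral_mono pt) auto
    also have "\<dots> = \<sigma> * (LINT x|lborel. F x \<bullet> \<Phi> x) + real N * a\<^sub>1 * (LINT x|lborel. Q x)"
      using iF iQ by simp
    also have "\<sigma> * (LINT x|lborel. F x \<bullet> \<Phi> x) \<le> I3"
    proof -
      have "\<bar>\<sigma> * (LINT x|lborel. F x \<bullet> \<Phi> x)\<bar> = \<bar>LINT x|lborel. f x * (\<eta> x ^ N * p x)\<bar>"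
        unfolding W using \<sigma> by (simp add: abs_mult)
      also have "\<dots> = (LINT x|lborel. f x * (\<eta> x ^ N * p x))"
        using f_nonneg \<eta>(3) p by (intro abs_of_nonneg Bochner_Integration.integral_nonneg) auto
      also have "\<dots> \<le> I3" unfolding I3_def
        using p f_nonneg \<eta>(3) by (intro integral_mono ip i3 mult_left_mono) auto
      finally show ?thesis by linarith
    qed
    finally show ?thesis by (simp add: \<gamma>_def)
  qed
  \<comment> \<open>The truncation height tends to infinity.\<close>
  have "(\<lambda>n. LINT x|lborel. \<eta> x ^ N * dclamp k (real (Suc n)) (\<sigma> * u x) * norm (g x) ^ N) \<longlonglongrightarrow> J"
    unfolding J_def
  proof (rule integral_dominated_convergence[OF _ _ i1])
    show "AE x in lborel. (\<lambda>n. \<eta> x ^ N * dclamp k (real (Suc n)) (\<sigma> * u x) * norm (g x) ^ N) \<longlonglongrightarrow> \<eta> x ^ N * H x * norm (g x) ^ N"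
    proof (rule AE_I2)
      fix x
      have "(\<lambda>n. dclamp k (real (Suc n)) (\<sigma> * u x)) \<longlonglongrightarrow> H x"
        unfolding H_def by (rule LIMSEQ_Suc[OF dclamp_tendsto_heaviside])
      then show "(\<lambda>n. \<eta> x ^ N * dclamp k (real (Suc n)) (\<sigma> * u x) * norm (g x) ^ N) \<longlonglongrightarrow> \<eta> x ^ N * H x * norm (g x) ^ N"
        by (intro tendsto_mult tendsto_const)
    qed
    show "AE x in lborel. norm (\<eta> x ^ N * dclamp k (real (Suc n)) (\<sigma> * u x) * norm (g x) ^ N) \<le> \<eta> x ^ N * H x * norm (g x) ^ N" for n
    proof (rule AE_I2)
      fix x
      have "0 \<le> dclamp k (real (Suc n)) (\<sigma> * u x)" "dclamp k (real (Suc n)) (\<sigma> * u x) \<le> H x"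
        unfolding H_def by (rule dclamp_bounds, simp, rule dclamp_le_heaviside)
      then show "norm (\<eta> x ^ N * dclamp k (real (Suc n)) (\<sigma> * u x) * norm (g x) ^ N) \<le> \<eta> x ^ N * H x * norm (g x) ^ N"
        using \<eta>(3)[of x] by (auto simp: abs_mult intro!: mult_right_mono mult_left_mono)
    qed
  qed (unfold dclamp_def sgn_real_def, measurable)
  then have "(\<lambda>n. a\<^sub>0 * (LINT x|lborel. \<eta> x ^ N * dclamp k (real (Suc n)) (\<sigma> * u x) * norm (g x) ^ N)) \<longlonglongrightarrow> a\<^sub>0 * J"
    by (rule tendsto_mult_left)
  then have L: "a\<^sub>0 * J \<le> I3 + real N * a\<^sub>1 * (LINT x|lborel. Q x)"
    by (rule LIMSEQ_le_const2) (use main in blast)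
  define \<tau> where "\<tau> = a\<^sub>0 / (2 * real N * a\<^sub>1)"
  have \<tau>: "\<tau> > 0" using a0 a1 Npos by (simp add: \<tau>_def)
  have "real N * a\<^sub>1 * (LINT x|lborel. Q x) \<le> real N * a\<^sub>1 * (\<tau> * J + (1 / \<tau>) ^ (N - 1) * I2)"
    using a1 by (intro mult_left_mono Qint \<tau>) auto
  also have "\<dots> = a\<^sub>0 / 2 * J + cacc * I2"
    using a1 Npos by (simp add: \<tau>_def cacc_def distrib_left)
  finally have "a\<^sub>0 / 2 * J \<le> cacc * I2 + I3" using L by simp
  then show "a\<^sub>0 / 2 * (LINT x|lborel. \<eta> x ^ N * heaviside (\<sigma> * u x - k) * norm (g x) ^ N)
      \<le> cacc * (LINT x|lborel. indicator C x * (w x * norm (D\<eta> x)) ^ N) + (LINT x|lborel. f x * (\<eta> x ^ N * w x))"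
    unfolding J_def H_def I2_def I3_def .
qed

text \<open>The factors stem from the Faber-Krahn inequality, from splitting the gradient of \<eta>
  w into two terms, and from the Caccioppoli inequality with its two right-hand terms
  merged.\<close>

definition cstep where "cstep = 4 / cC * 2 ^ N * (1 + 2 / a\<^sub>0 * (cacc + 1))"

lemma cstep_pos: "cstep > 0"
  unfolding cstep_def using cC_pos cacc_pos a0 by (intro mult_pos_pos add_pos_pos divide_pos_pos) auto

text \<open>Faber-Krahn applied to \<eta> times a truncation of \<open>w\<close>, whose energy is
  bounded by Caccioppoli; Fatou removes the truncation. The gain is the factor \<open>m\<close>,
  which is small when the superlevel set is.\<close>

lemma level_set_estimate:
  fixes k :: real
  assumes \<eta>: "C1c \<eta> D\<eta> S" "S \<subseteq> - cball 0 1" "\<And>x. \<eta> x \<ge> 0" and \<sigma>: "\<bar>\<sigma>\<bar> = (1::real)"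
  defines "w \<equiv> \<lambda>x. max 0 (\<sigma> * u x - k)"
  assumes T [measurable]: "T \<in> sets borel" and m: "m > 0" "emeasure lborel T \<le> ennreal m"
    and TC: "\<And>x. x \<in> C \<Longrightarrow> \<eta> x \<noteq> 0 \<Longrightarrow> w x > 0 \<Longrightarrow> x \<in> T"
  shows "(\<integral>\<^sup>+x. ennreal (indicator C x * (\<eta> x * w x) ^ N) \<partial>lborel) \<le>
    ennreal (cstep * m * ((LINT x|lborel. indicator C x * (w x * norm (D\<eta> x)) ^ N) + (LINT x|lborel. f x * (\<eta> x ^ N * w x))))"
proof -
  note D = C1cD[OF \<eta>(1)]
  have wx: "max 0 (\<sigma> * u x - k) = w x" for x by (simp add: w_def)
  note cc = caccioppoli[OF \<eta> \<sigma>, of k, unfolded wx]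
  have [measurable]: "\<eta> \<in> borel_measurable borel" "D\<eta> \<in> borel_measurable borel"
    using D by (auto intro: borel_measurable_continuous_onI)
  have [measurable]: "w \<in> borel_measurable borel" unfolding w_def by measurable
  have w0: "w x \<ge> 0" for x by (simp add: w_def)
  define J where "J = (LINT x|lborel. \<eta> x ^ N * heaviside (\<sigma> * u x - k) * norm (g x) ^ N)"
  define I2 where "I2 = (LINT x|lborel. indicator C x * (w x * norm (D\<eta> x)) ^ N)"
  define I3 where "I3 = (LINT x|lborel. f x * (\<eta> x ^ N * w x))"
  have I2: "I2 \<ge> 0" unfolding I2_def using w0 by (intro Bochner_Integration.integral_nonneg) auto
  have I3: "I3 \<ge> 0" unfolding I3_def using w0 f_nonneg \<eta>(3) by (intro Bochner_Integration.integral_nonneg) auto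
  have "a\<^sub>0 / 2 * J \<le> cacc * I2 + I3" using cc(4) unfolding J_def I2_def I3_def .
  also have "\<dots> \<le> (cacc + 1) * (I2 + I3)" using I2 I3 cacc_pos by (simp add: algebra_simps)
  finally have J: "J \<le> 2 / a\<^sub>0 * ((cacc + 1) * (I2 + I3))" using a0 by (simp add: field_simps)
  define R where "R = cstep * m * (I2 + I3)"
  define p where "p = (\<lambda>n x. clamp k (real (Suc n)) (\<sigma> * u x))"
  have p: "p n x = min (w x) (real (Suc n))" for n x by (simp add: p_def w_def clamp_eq max.commute)
  have pm [measurable]: "p n \<in> borel_measurable borel" for n unfolding p_def clamp_def by measurable
  have est: "(\<integral>\<^sup>+x. indicator C x * ennreal (\<bar>\<eta> x * p n x\<bar> ^ N) \<partial>lborel) \<le> ennreal R" for n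
  proof -
    define \<gamma> where "\<gamma> = (\<lambda>x. dclamp k (real (Suc n)) (\<sigma> * u x))"
    have \<gamma>: "0 \<le> \<gamma> x" "\<gamma> x \<le> 1" "\<gamma> x \<le> heaviside (\<sigma> * u x - k)" for x
      unfolding \<gamma>_def using dclamp_bounds dclamp_le_heaviside by auto
    have nc: "nice (\<lambda>t. clamp k (real (Suc n)) (\<sigma> * t)) (\<lambda>t. \<sigma> * dclamp k (real (Suc n)) (\<sigma> * t))"
      using nice_clamp[of "real (Suc n)" \<sigma> 0 1 k] \<sigma> by simp
    define \<Phi> where "\<Phi> = (\<lambda>x. p n x *\<^sub>R D\<eta> x + (\<eta> x * (\<sigma> * \<gamma> x)) *\<^sub>R g x)"
    have testable: "testable (\<lambda>x. \<eta> x * p n x) \<Phi>"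
      unfolding \<Phi>_def p_def \<gamma>_def by (rule testable_nice[OF \<eta>(1,2) nc])
    have "(\<integral>\<^sup>+x. indicator C x * ennreal (\<bar>\<eta> x * p n x\<bar> ^ N) \<partial>lborel)
      \<le> ennreal (4 * m / cC) * (\<integral>\<^sup>+x. indicator C x * ennreal (norm (\<Phi> x) ^ N) \<partial>lborel)"
    proof (rule faber_krahn[OF testable T m])
      fix x assume "x \<in> C" "\<eta> x * p n x \<noteq> 0"
      then show "x \<in> T" using TC[of x] w0[of x] p[of n x] by (cases "w x = 0") auto
    qed
    also have "(\<integral>\<^sup>+x. indicator C x * ennreal (norm (\<Phi> x) ^ N) \<partial>lborel)
      \<le> (\<integral>\<^sup>+x. ennreal (2 ^ N * (indicator C x * (w x * norm (D\<eta> x)) ^ N + \<eta> x ^ N * heaviside (\<sigma> * u x - k) * norm (g x) ^ N)) \<partial>lborel)"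
    proof (rule nn_integral_mono)
      fix x
      show "indicator C x * ennreal (norm (\<Phi> x) ^ N) \<le> ennreal (2 ^ N * (indicator C x * (w x * norm (D\<eta> x)) ^ N + \<eta> x ^ N * heaviside (\<sigma> * u x - k) * norm (g x) ^ N))"
      proof (cases "x \<in> C")
        case True
        have a: "norm (p n x *\<^sub>R D\<eta> x) \<le> w x * norm (D\<eta> x)" using p[of n x] w0[of x] by (auto intro!: mult_right_mono)
        have b: "norm ((\<eta> x * (\<sigma> * \<gamma> x)) *\<^sub>R g x) = \<eta> x * \<gamma> x * norm (g x)"
          using \<sigma> \<eta>(3)[of x] \<gamma>(1)[of x] by (simp add: abs_mult)
        have "norm (\<Phi> x) \<le> w x * norm (D\<eta> x) + \<eta> x * \<gamma> x * norm (g x)"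
          unfolding \<Phi>_def using norm_triangle_ineq[of "p n x *\<^sub>R D\<eta> x" "(\<eta> x * (\<sigma> * \<gamma> x)) *\<^sub>R g x"] a unfolding b by linarith
        then have "norm (\<Phi> x) ^ N \<le> (w x * norm (D\<eta> x) + \<eta> x * \<gamma> x * norm (g x)) ^ N" by (intro power_mono) auto
        also have "\<dots> \<le> 2 ^ N * ((w x * norm (D\<eta> x)) ^ N + (\<eta> x * \<gamma> x * norm (g x)) ^ N)"
          using w0[of x] \<eta>(3)[of x] \<gamma>(1)[of x] by (intro power_add_le) auto
        also have "(\<eta> x * \<gamma> x * norm (g x)) ^ N \<le> \<eta> x ^ N * heaviside (\<sigma> * u x - k) * norm (g x) ^ N"
        proof -
          have "\<gamma> x ^ N \<le> \<gamma> x ^ 1" using \<gamma>[of x] Npos by (intro power_decreasing) auto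
          then have "\<gamma> x ^ N \<le> heaviside (\<sigma> * u x - k)" using \<gamma>(3)[of x] by simp
          then show ?thesis unfolding power_mult_distrib using \<eta>(3)[of x]
            by (intro mult_right_mono mult_left_mono) auto
        qed
        finally show ?thesis using True by (auto intro!: ennreal_leI)
      next
        case False
        then show ?thesis by simp
      qed
    qed
    also have "\<dots> = ennreal (2 ^ N * (I2 + J))"
    proof (subst nn_integral_eq_integral)
      show "integrable lborel (\<lambda>x. 2 ^ N * (indicator C x * (w x * norm (D\<eta> x)) ^ N + \<eta> x ^ N * heaviside (\<sigma> * u x - k) * norm (g x) ^ N))"
        using cc(1,2) by auto
      show "AE x in lborel. 0 \<le> 2 ^ N * (indicator C x * (w x * norm (D\<eta> x)) ^ N + \<eta> x ^ N * heaviside (\<sigma> * u x - k) * norm (g x) ^ N)"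
        using w0 \<eta>(3) heaviside_bounds(1) by (intro AE_I2) auto
    qed (use cc(1,2) in \<open>simp add: I2_def J_def\<close>)
    also have "\<dots> \<le> ennreal (2 ^ N * ((1 + 2 / a\<^sub>0 * (cacc + 1)) * (I2 + I3)))"
    proof (intro ennreal_leI mult_left_mono)
      have "(1 + 2 / a\<^sub>0 * (cacc + 1)) * (I2 + I3) = (I2 + I3) + 2 / a\<^sub>0 * ((cacc + 1) * (I2 + I3))"
        by (simp only: distrib_right[of 1] mult_1_left mult.assoc)
      then show "I2 + J \<le> (1 + 2 / a\<^sub>0 * (cacc + 1)) * (I2 + I3)" using J I3 by linarith
    qed simp
    also have "ennreal (4 * m / cC) * \<dots> = ennreal R"
      unfolding R_def cstep_def using m cC_pos I2 I3 a0 cacc_pos by (simp add: mult_ac flip: ennreal_mult)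
    finally show ?thesis by (simp add: mult_left_mono)
  qed
  have "(\<integral>\<^sup>+x. ennreal (indicator C x * (\<eta> x * w x) ^ N) \<partial>lborel)
     = (\<integral>\<^sup>+x. liminf (\<lambda>n. indicator C x * ennreal (\<bar>\<eta> x * p n x\<bar> ^ N)) \<partial>lborel)"
  proof (rule nn_integral_cong)
    fix x
    obtain n0 where n0: "w x \<le> real n0" using real_arch_simple by blast
    have "\<forall>\<^sub>F n in sequentially. indicator C x * ennreal (\<bar>\<eta> x * p n x\<bar> ^ N) = ennreal (indicator C x * (\<eta> x * w x) ^ N)"
      unfolding eventually_sequentially
    proof (intro exI[of _ n0] allI impI)
      fix n assume "n0 \<le> n"
      then have "p n x = w x" using n0 by (simp add: p min_def)
      then show "indicator C x * ennreal (\<bar>\<eta> x * p n x\<bar> ^ N) = ennreal (indicator C x * (\<eta> x * w x) ^ N)"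
        using w0[of x] \<eta>(3)[of x] by (simp add: indicator_def)
    qed
    then have "(\<lambda>n. indicator C x * ennreal (\<bar>\<eta> x * p n x\<bar> ^ N)) \<longlonglongrightarrow> ennreal (indicator C x * (\<eta> x * w x) ^ N)"
      by (rule tendsto_eventually)
    from lim_imp_Liminf[OF sequentially_bot this]
    show "ennreal (indicator C x * (\<eta> x * w x) ^ N) = liminf (\<lambda>n. indicator C x * ennreal (\<bar>\<eta> x * p n x\<bar> ^ N))" by simp
  qed
  also have "\<dots> \<le> liminf (\<lambda>n. \<integral>\<^sup>+x. indicator C x * ennreal (\<bar>\<eta> x * p n x\<bar> ^ N) \<partial>lborel)"
    by (rule nn_integral_liminf) auto
  also have "\<dots> \<le> liminf (\<lambda>n. ennreal R)"
    by (intro Liminf_mono always_eventually allI est)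
  also have "\<dots> = ennreal R" by (simp add: Liminf_const)
  finally show ?thesis unfolding R_def I2_def I3_def .
qed

section \<open>The excess over a level and its decay\<close>

definition excess :: "real \<Rightarrow> real^'n \<Rightarrow> real \<Rightarrow> real \<Rightarrow> real" where
  "excess \<sigma> x0 k r = (LINT x|lborel. indicator (C \<inter> ball x0 r) x * (max 0 (\<sigma> * u x - k)) ^ N)"

lemma excess_integrable:
  assumes "norm x0 > 1 + \<rho>" "r \<le> \<rho>" "\<bar>\<sigma>\<bar> = 1"
  shows "integrable lborel (\<lambda>x. indicator (C \<inter> ball x0 r) x * (max 0 (\<sigma> * u x - k)) ^ N)"
proof (rule Bochner_Integration.integrable_bound)
  have "cball x0 \<rho> \<subseteq> - cball 0 1"
  proof
    fix x assume "x \<in> cball x0 \<rho>"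
    then show "x \<in> - cball 0 1" using assms(1) norm_triangle_ineq2[of x0 x] by (auto simp: dist_norm)
  qed
  then show "integrable lborel (\<lambda>x. indicator (cball x0 \<rho> \<inter> C) x * (max 0 (\<sigma> * u x - k)) ^ N)"
    using assms by (intro pos_part_integrable) auto
  show "AE x in lborel. norm (indicator (C \<inter> ball x0 r) x * (max 0 (\<sigma> * u x - k)) ^ N)
      \<le> norm (indicator (cball x0 \<rho> \<inter> C) x * (max 0 (\<sigma> * u x - k)) ^ N)"
    using assms by (intro AE_I2) (auto simp: indicator_def)
  have [measurable]: "C \<inter> ball x0 r \<in> sets borel" using C_open by auto
  have "(\<lambda>x. indicator (C \<inter> ball x0 r) x * (max 0 (\<sigma> * u x - k)) ^ N) \<in> borel_measurable borel"
    by measurable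
  then show "(\<lambda>x. indicator (C \<inter> ball x0 r) x * (max 0 (\<sigma> * u x - k)) ^ N) \<in> borel_measurable lborel" by simp
qed

lemma excess_nonneg: "excess \<sigma> x0 k r \<ge> 0"
  unfolding excess_def by (intro Bochner_Integration.integral_nonneg) auto

lemma excess_mono:
  assumes "norm x0 > 1 + \<rho>" "r \<le> r'" "r' \<le> \<rho>" "\<bar>\<sigma>\<bar> = 1" "k' \<le> k"
  shows "excess \<sigma> x0 k r \<le> excess \<sigma> x0 k' r'"
  unfolding excess_def
proof (rule integral_mono)
  show "integrable lborel (\<lambda>x. indicator (C \<inter> ball x0 r) x * (max 0 (\<sigma> * u x - k)) ^ N)"
    "integrable lborel (\<lambda>x. indicator (C \<inter> ball x0 r') x * (max 0 (\<sigma> * u x - k')) ^ N)"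
    using assms excess_integrable[OF assms(1)] by auto
  show "indicator (C \<inter> ball x0 r) x * (max 0 (\<sigma> * u x - k)) ^ N \<le> indicator (C \<inter> ball x0 r') x * (max 0 (\<sigma> * u x - k')) ^ N" for x
    using assms by (intro mult_mono power_mono) (auto simp: indicator_def)
qed

text \<open>Where \<sigma> u exceeds k it exceeds k' by more than k - k'. Chebyshev then bounds the
  measure of the level set, and the same comparison turns the linear source term into an N-th power.
  The excess appears in both factors, which makes the recursion quadratic.\<close>

lemma excess_step:
  assumes x0: "norm x0 > 1 + \<rho>" "norm x0 \<ge> 2 * \<rho>" and r: "0 < r" "r < r'" "r' \<le> \<rho>" and \<sigma>: "\<bar>\<sigma>\<bar> = 1" and k: "k' < k"
  shows "excess \<sigma> x0 k r \<le> cstep * (excess \<sigma> x0 k' r' / (k - k') ^ N) *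
    (((8 / (r' - r)) ^ N + K / \<rho> ^ N * (1 / (k - k')) ^ (N - 1)) * excess \<sigma> x0 k' r')"
\<comment> \<open>A vanishing excess would give the measure bound 0, whereas the level set estimate
  asks for a positive one; monotonicity settles this case.\<close>
proof (cases "excess \<sigma> x0 k' r' = 0")
  case True
  then show ?thesis using excess_mono[OF x0(1), of r r' \<sigma> k' k] r \<sigma> k by simp
next
  case False
  define excess' where "excess' = excess \<sigma> x0 k' r'"
  have excess': "excess' > 0" using False excess_nonneg[of \<sigma> x0 k' r'] by (simp add: excess'_def)
  define m where "m = excess' / (k - k') ^ N"
  have m: "m > 0" using excess' k by (simp add: m_def)
  define w w' where "w = (\<lambda>x. max 0 (\<sigma> * u x - k))" and "w' = (\<lambda>x. max 0 (\<sigma> * u x - k'))"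
  have ww: "0 \<le> w x" "w x \<le> w' x" "w x > 0 \<Longrightarrow> w' x \<ge> k - k'" for x using k by (auto simp: w_def w'_def)
  have [measurable]: "w \<in> borel_measurable borel" "w' \<in> borel_measurable borel" unfolding w_def w'_def by measurable
  define B where "B = C \<inter> ball x0 r'"
  have [measurable]: "B \<in> sets borel" by (simp add: B_def)
  have iY': "integrable lborel (\<lambda>x. indicator B x * w' x ^ N)"
    unfolding B_def w'_def using excess_integrable[OF x0(1) r(3) \<sigma>] .
  have excess'eq: "excess' = (LINT x|lborel. indicator B x * w' x ^ N)" by (simp add: excess'_def excess_def B_def w'_def)
  define T where "T = {x \<in> B. w' x \<ge> k - k'}"
  have [measurable]: "T \<in> sets borel" unfolding T_def by measurable
  have eT: "emeasure lborel T \<le> ennreal m"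
  proof -
    have "emeasure lborel T = (\<integral>\<^sup>+x. indicator T x \<partial>lborel)" by simp
    also have "\<dots> \<le> (\<integral>\<^sup>+x. ennreal (indicator B x * w' x ^ N / (k - k') ^ N) \<partial>lborel)"
    proof (rule nn_integral_mono)
      fix x
      show "indicator T x \<le> ennreal (indicator B x * w' x ^ N / (k - k') ^ N)"
      proof (cases "x \<in> T")
        case True
        then have "(k - k') ^ N \<le> w' x ^ N" using k by (intro power_mono) (auto simp: T_def)
        then show ?thesis using True k by (simp add: T_def)
      qed simp
    qed
    also have "\<dots> = ennreal (LINT x|lborel. indicator B x * w' x ^ N / (k - k') ^ N)"
      using iY' k ww by (intro nn_integral_eq_integral) (auto simp: w'_def)
    also have "\<dots> = ennreal m" by (simp add: m_def excess'eq)
    finally show ?thesis .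
  qed
  have r0: "0 \<le> r" using r by simp
  note cp = cut_props[OF r0 r(2), where ?x0.0=x0]
  have \<eta>C: "C1c (cut x0 r r') (Dcut x0 r r') (cball x0 r')" by (rule cut_C1c[OF r0 r(2)])
  \<comment> \<open>The ball stays at distance at least \<rho> from the origin, where f is at most
    \<open>K / \<rho> ^ N\<close>.\<close>
  have far: "x \<notin> cball 0 1" "norm x \<ge> \<rho>" if "x \<in> cball x0 r'" for x
    using that x0 r(3) norm_triangle_ineq2[of x0 x] by (auto simp: dist_norm)
  then have sub: "cball x0 r' \<subseteq> - cball 0 1" by auto
  have off: "cut x0 r r' x = 0" "Dcut x0 r r' x = 0" if "x \<notin> ball x0 r'" for x
  proof -
    have n: "norm (x - x0) \<ge> r'" using that by (metis dist_commute dist_norm mem_ball not_less)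
    show "cut x0 r r' x = 0" "Dcut x0 r r' x = 0" using cp(4,6)[OF n] by auto
  qed
  have wx: "max 0 (\<sigma> * u x - k) = w x" for x by (simp add: w_def)
  note cc = caccioppoli[OF \<eta>C sub cp(1) \<sigma>, of k, unfolded wx]
  define I2 where "I2 = (LINT x|lborel. indicator C x * (w x * norm (Dcut x0 r r' x)) ^ N)"
  define I3 where "I3 = (LINT x|lborel. f x * (cut x0 r r' x ^ N * w x))"
  have "I2 \<le> (LINT x|lborel. (8 / (r' - r)) ^ N * (indicator B x * w' x ^ N))"
    unfolding I2_def
  proof (rule integral_mono[OF cc(2) integrable_mult_right[OF iY']])
    fix x
    show "indicator C x * (w x * norm (Dcut x0 r r' x)) ^ N \<le> (8 / (r' - r)) ^ N * (indicator B x * w' x ^ N)"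
    proof (cases "x \<in> B")
      case True
      have "(w x * norm (Dcut x0 r r' x)) ^ N \<le> (w' x * (8 / (r' - r))) ^ N"
        using ww[of x] cp(7)[of x] r by (intro power_mono mult_mono) auto
      also have "\<dots> = (8 / (r' - r)) ^ N * w' x ^ N" by (simp only: power_mult_distrib mult.commute)
      finally show ?thesis using True by (simp add: B_def)
    next
      case False
      then show ?thesis using off[of x] Npos by (cases "x \<in> C") (auto simp: B_def zero_power)
    qed
  qed
  then have I2: "I2 \<le> (8 / (r' - r)) ^ N * excess'" by (simp add: excess'eq)
  have \<rho>: "\<rho> > 0" using r by linarith
  have "I3 \<le> (LINT x|lborel. K / \<rho> ^ N * (1 / (k - k')) ^ (N - 1) * (indicator B x * w' x ^ N))"
    unfolding I3_def
  proof (rule integral_mono[OF cc(3) integrable_mult_right[OF iY']])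
    fix x
    show "f x * (cut x0 r r' x ^ N * w x) \<le> K / \<rho> ^ N * (1 / (k - k')) ^ (N - 1) * (indicator B x * w' x ^ N)"
    proof (cases "x \<in> B \<and> w x > 0")
      case True
      then have xB: "x \<in> C" "x \<in> cball x0 r'" by (auto simp: B_def)
      have "f x \<le> K / norm x ^ N" using f_le[of x] xB far[of x] by auto
      also have "\<dots> \<le> K / \<rho> ^ N" using far(2)[OF xB(2)] \<rho> K by (intro divide_left_mono power_mono mult_pos_pos zero_less_power) auto
      finally have 1: "f x \<le> K / \<rho> ^ N" .
      have "(k - k') ^ (N - 1) * w x \<le> w' x ^ (N - 1) * w' x"
        using ww[of x] True k by (intro mult_mono power_mono) auto
      also have "\<dots> = w' x ^ N" using Npos by (rule power_minus_mult)
      finally have 2: "w x \<le> (1 / (k - k')) ^ (N - 1) * w' x ^ N" using k by (simp add: power_divide field_simps)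
      have "cut x0 r r' x ^ N * w x \<le> 1 * w x" using cp(1,2)[of x] ww(1)[of x] by (intro mult_right_mono power_le_one) auto
      then have 3: "cut x0 r r' x ^ N * w x \<le> (1 / (k - k')) ^ (N - 1) * w' x ^ N" using 2 by linarith
      have "f x * (cut x0 r r' x ^ N * w x) \<le> K / \<rho> ^ N * ((1 / (k - k')) ^ (N - 1) * w' x ^ N)"
        by (rule mult_mono[OF 1 3]) (use cp(1)[of x] ww(1)[of x] K \<rho> in auto)
      then show ?thesis using True by simp
    next
      case False
      have "f x * (cut x0 r r' x ^ N * w x) = 0"
      proof (cases "x \<in> B")
        case True then show ?thesis using False ww(1)[of x] by simp
      next
        case F: False
        then show ?thesis using off(1)[of x] f_zero[of x] Npos by (cases "x \<in> C") (auto simp: B_def zero_power)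
      qed
      moreover have "0 \<le> K / \<rho> ^ N * (1 / (k - k')) ^ (N - 1) * (indicator B x * w' x ^ N)"
        using K \<rho> k by (simp add: w'_def)
      ultimately show ?thesis by linarith
    qed
  qed
  then have I3: "I3 \<le> K / \<rho> ^ N * (1 / (k - k')) ^ (N - 1) * excess'" by (simp add: excess'eq)
  have I23: "I2 \<ge> 0" "I3 \<ge> 0" unfolding I2_def I3_def using ww f_nonneg cp(1)
    by (auto intro!: Bochner_Integration.integral_nonneg)
  have "ennreal (excess \<sigma> x0 k r) = (\<integral>\<^sup>+x. ennreal (indicator (C \<inter> ball x0 r) x * w x ^ N) \<partial>lborel)"
    unfolding excess_def w_def using excess_integrable[OF x0(1) _ \<sigma>, of r k] r
    by (intro nn_integral_eq_integral[symmetric]) auto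
  also have "\<dots> \<le> (\<integral>\<^sup>+x. ennreal (indicator C x * (cut x0 r r' x * w x) ^ N) \<partial>lborel)"
  proof (rule nn_integral_mono)
    fix x
    show "ennreal (indicator (C \<inter> ball x0 r) x * w x ^ N) \<le> ennreal (indicator C x * (cut x0 r r' x * w x) ^ N)"
    proof (cases "x \<in> C \<inter> ball x0 r")
      case True
      then have "norm (x - x0) \<le> r" by (metis IntD2 dist_commute dist_norm mem_ball less_imp_le)
      then show ?thesis using cp(3)[of x] True by simp
    qed simp
  qed
  also have "\<dots> \<le> ennreal (cstep * m * (I2 + I3))"
    unfolding I2_def I3_def w_def
  proof (rule level_set_estimate[OF \<eta>C sub cp(1) \<sigma> _ m eT])
    fix x assume "x \<in> C" "cut x0 r r' x \<noteq> 0" "max 0 (\<sigma> * u x - k) > 0"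
    then show "x \<in> T" using off(1)[of x] ww(3)[of x] by (auto simp: T_def B_def w_def)
  qed auto
  finally have "excess \<sigma> x0 k r \<le> cstep * m * (I2 + I3)"
    using cstep_pos m I23 by (subst (asm) ennreal_le_iff) auto
  also have "\<dots> \<le> cstep * m * (((8 / (r' - r)) ^ N + K / \<rho> ^ N * (1 / (k - k')) ^ (N - 1)) * excess')"
    using I2 I3 cstep_pos m by (intro mult_left_mono) (auto simp: distrib_right)
  finally show ?thesis by (simp add: m_def excess'_def)
qed

text \<open>With radii and levels whose increments halve at each step, \<open>8 / (r' - r)\<close>
  becomes \<open>32 * 2 ^ i / \<rho>\<close>, and the inverse level increment is at most
  \<open>2 * 2 ^ i\<close> when d \<ge> 1. The threshold \<open>cDG\<close> lets the quadratic
  recursion, whose factor grows by 4^N at each step, contract from the start.\<close>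

definition cDG2 where "cDG2 = cstep * 2 ^ N * (32 ^ N + K * 2 ^ N)"
definition cDG where "cDG = 1 / (cDG2 * 4 ^ N)"

lemma cDG_pos: "cDG2 > 0" "cDG > 0"
proof -
  show "cDG2 > 0" unfolding cDG2_def using cstep_pos K by (intro mult_pos_pos add_pos_pos) auto
  then show "cDG > 0" by (simp add: cDG_def)
qed

text \<open>Radii shrink from \<rho> towards \<rho> / 2 while levels rise from k towards k + d, with
  increments of order 2^(-i). The quadratic recursion then drives a small initial excess to 0
  despite its growing factor. As d \<ge> 1, the source term is of no larger order than the cutoff
  term.\<close>

lemma de_giorgi:
  assumes x0: "norm x0 > 1 + \<rho>" "norm x0 \<ge> 2 * \<rho>" and \<rho>: "\<rho> > 0" and \<sigma>: "\<bar>\<sigma>\<bar> = 1" and d: "d \<ge> 1"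
    and small: "excess \<sigma> x0 k \<rho> \<le> cDG * (\<rho> * d) ^ N"
    and x: "x \<in> C" "dist x0 x < \<rho> / 2"
  shows "\<sigma> * u x \<le> k + d"
proof -
  define ri where "ri = (\<lambda>i. \<rho> / 2 * (1 + (1/2) ^ i))"
  define ki where "ki = (\<lambda>i. k + d * (1 - (1/2::real) ^ i))"
  define a where "a = (\<lambda>i. excess \<sigma> x0 (ki i) (ri i))"
  have a0: "a i \<ge> 0" for i by (simp add: a_def excess_nonneg)
  define A where "A = cDG2 / (\<rho> * d) ^ N"
  define b where "b = (4::real) ^ N"
  have b: "b > 0" by (simp add: b_def)
  have A: "A > 0" using cDG_pos \<rho> d by (simp add: A_def)
  have step: "a (Suc i) \<le> A * b ^ i * (a i)\<^sup>2" for i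
  proof -
    define z where "z = (2::real) ^ i"
    have z: "z \<ge> 1" "(1/2) ^ i = 1 / z" by (simp_all add: z_def power_divide)
    have rr: "ri i - ri (Suc i) = \<rho> / (4 * z)" unfolding ri_def power_Suc z(2) using z by (simp add: field_simps)
    have kk: "ki (Suc i) - ki i = d / (2 * z)" unfolding ki_def power_Suc z(2) using z by (simp add: field_simps)
    have "ri (Suc i) > 0" unfolding ri_def using \<rho> by (intro mult_pos_pos add_pos_pos) auto
    moreover have "ri (Suc i) < ri i" using rr divide_pos_pos[of \<rho> "4 * z"] \<rho> z by linarith
    moreover have "ri i \<le> \<rho>"
    proof -
      have "(1/2::real) ^ i \<le> 1" by (intro power_le_one) auto
      then have "\<rho> / 2 * (1 + (1/2) ^ i) \<le> \<rho> / 2 * 2" using \<rho> by (intro mult_left_mono) auto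
      then show ?thesis by (simp add: ri_def)
    qed
    moreover have "ki i < ki (Suc i)" using kk divide_pos_pos[of d "2 * z"] d z by linarith
    ultimately have "a (Suc i) \<le> cstep * (a i / (d / (2 * z)) ^ N) * (((8 / (\<rho> / (4 * z))) ^ N + K / \<rho> ^ N * (1 / (d / (2 * z))) ^ (N - 1)) * a i)"
      using excess_step[OF x0, of "ri (Suc i)" "ri i" \<sigma> "ki i" "ki (Suc i)"] \<sigma> unfolding rr kk a_def by simp
    also have "\<dots> \<le> cstep * (a i / (d / (2 * z)) ^ N) * ((32 ^ N + K * 2 ^ N) * z ^ N / \<rho> ^ N * a i)"
    proof (intro mult_left_mono mult_right_mono)
      have "(8 / (\<rho> / (4 * z))) ^ N = 32 ^ N * z ^ N / \<rho> ^ N" by (simp add: power_divide power_mult_distrib)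
      moreover have "K / \<rho> ^ N * (1 / (d / (2 * z))) ^ (N - 1) \<le> K / \<rho> ^ N * (2 * z) ^ N"
      proof (intro mult_left_mono)
        have "1 / (d / (2 * z)) \<le> 2 * z" using d z by (simp add: field_simps)
        then have "(1 / (d / (2 * z))) ^ (N - 1) \<le> (2 * z) ^ (N - 1)" using d z by (intro power_mono) auto
        also have "\<dots> \<le> (2 * z) ^ N" using z by (intro power_increasing) auto
        finally show "(1 / (d / (2 * z))) ^ (N - 1) \<le> (2 * z) ^ N" .
      qed (use K \<rho> in auto)
      ultimately show "(8 / (\<rho> / (4 * z))) ^ N + K / \<rho> ^ N * (1 / (d / (2 * z))) ^ (N - 1) \<le> (32 ^ N + K * 2 ^ N) * z ^ N / \<rho> ^ N"
        by (simp add: power_mult_distrib distrib_right add_divide_distrib)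
    qed (use a0 cstep_pos d z in auto)
    also have "\<dots> = A * b ^ i * (a i)\<^sup>2"
    proof -
      have "b ^ i = 4 ^ (N * i)" unfolding b_def by (rule power_mult[symmetric])
      also have "\<dots> = (4 ^ i) ^ N" unfolding mult.commute[of N i] by (rule power_mult)
      also have "(4::real) ^ i = z * z" unfolding z_def power_mult_distrib[symmetric] by simp
      also have "(z * z) ^ N = z ^ N * z ^ N" by (rule power_mult_distrib)
      finally have "b ^ i = z ^ N * z ^ N" .
      then show ?thesis using z d \<rho>
        by (simp add: A_def cDG2_def power_divide power_mult_distrib power2_eq_square) (simp only: mult_ac)
    qed
    finally show ?thesis .
  qed
  have A1: "A * b * a 0 \<le> 1"
  proof -
    have "a 0 \<le> cDG * (\<rho> * d) ^ N" using small by (simp add: a_def ki_def ri_def)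
    then have "A * b * a 0 \<le> A * b * (cDG * (\<rho> * d) ^ N)" using A b by (intro mult_left_mono) auto
    also have "\<dots> = 1" using cDG_pos(1) \<rho> d by (simp add: A_def b_def cDG_def)
    finally show ?thesis .
  qed
  \<comment> \<open>Decay with ratio 1 / b reproduces itself: squaring gives b^(-2 i), one b^i is
    lost to the recursion, and the last factor 1 / b comes from
    \<open>A * b * a 0 \<le> 1\<close>.\<close>
  have decay: "a i \<le> a 0 / b ^ i" for i
  proof (induction i)
    case (Suc i)
    have "a (Suc i) \<le> A * b ^ i * (a i)\<^sup>2" by (rule step)
    also have "\<dots> \<le> A * b ^ i * (a 0 / b ^ i)\<^sup>2"
      using Suc a0 A b by (intro mult_left_mono power_mono) auto
    also have "\<dots> = (A * b * a 0) * (a 0 / b ^ Suc i)" using b by (simp add: power2_eq_square field_simps)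
    also have "\<dots> \<le> 1 * (a 0 / b ^ Suc i)" using A1 a0 b by (intro mult_right_mono) auto
    finally show ?case by simp
  qed simp
  have "excess \<sigma> x0 (k + d) (\<rho> / 2) \<le> a i" for i
    unfolding a_def
  proof (rule excess_mono[OF x0(1)])
    have "(1/2::real) ^ i \<le> 1" by (intro power_le_one) auto
    then have "\<rho> / 2 * (1 + (1/2) ^ i) \<le> \<rho> / 2 * 2" using \<rho> by (intro mult_left_mono) auto
    then show "ri i \<le> \<rho>" by (simp add: ri_def)
    show "\<rho> / 2 \<le> ri i" using \<rho> by (simp add: ri_def)
    show "ki i \<le> k + d" using d by (simp add: ki_def mult_left_le)
  qed (use \<sigma> in auto)
  then have "excess \<sigma> x0 (k + d) (\<rho> / 2) \<le> a 0 / b ^ i" for i using decay order_trans by blast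
  moreover have "(\<lambda>i. a 0 / b ^ i) \<longlonglongrightarrow> 0"
  proof -
    have "b > 1" unfolding b_def using Npos by (intro one_less_power) auto
    then have "(\<lambda>i. a 0 * (1 / b) ^ i) \<longlonglongrightarrow> a 0 * 0" by (intro tendsto_mult_left LIMSEQ_power_zero) auto
    then show ?thesis by (simp add: power_divide)
  qed
  ultimately have "excess \<sigma> x0 (k + d) (\<rho> / 2) \<le> 0" by (intro LIMSEQ_le_const) auto
  then have Y0: "excess \<sigma> x0 (k + d) (\<rho> / 2) = 0" using excess_nonneg[of \<sigma> x0 "k + d" "\<rho> / 2"] by linarith
  show ?thesis
  proof (rule ccontr)
    assume "\<not> ?thesis"
    then have gt: "\<sigma> * u x > k + d" by simp
    have "AE y in lborel. indicator (C \<inter> ball x0 (\<rho> / 2)) y * (max 0 (\<sigma> * u y - (k + d))) ^ N = 0"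
      using integral_nonneg_eq_0_iff_AE[OF excess_integrable[OF x0(1) _ \<sigma>, of "\<rho> / 2" "k + d"]] Y0 \<rho> by (simp add: excess_def)
    then have ae: "AE y in lborel. \<not> (y \<in> C \<inter> ball x0 (\<rho> / 2) \<and> \<sigma> * u y > k + d)"
      by eventually_elim (auto simp: indicator_def max_def split: if_splits)
    have op: "open (C \<inter> ball x0 (\<rho> / 2))" using C_open by auto
    have sub: "C \<inter> ball x0 (\<rho> / 2) \<subseteq> C - cball 0 1"
    proof
      fix y assume y: "y \<in> C \<inter> ball x0 (\<rho> / 2)"
      then show "y \<in> C - cball 0 1" using x0(1) \<rho> norm_triangle_ineq2[of x0 y] by (auto simp: dist_norm)
    qed
    define V where "V = (C \<inter> ball x0 (\<rho> / 2)) \<inter> (\<lambda>y. \<sigma> * u y) -` {k + d<..}"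
    have oV: "open V" unfolding V_def
      by (rule continuous_open_preimage[OF _ op]) (auto intro!: continuous_intros continuous_on_subset[OF u_cont sub])
    then have "emeasure lborel V > 0"
      using x gt by (intro open_pos_measure[of _ x]) (auto simp: V_def)
    moreover have "V \<in> null_sets lborel"
    proof (subst AE_iff_null_sets)
      show "V \<in> sets lborel" using oV by simp
      show "AE y in lborel. y \<notin> V" using ae by eventually_elim (auto simp: V_def)
    qed
    ultimately show False by (simp add: null_sets_def)
  qed
qed

end

section \<open>The energy identity and the Hardy inequality\<close>

text \<open>Convexity with weights l and 1 - l. In contrast to \<open>power_add_le\<close>, the
  coefficient of \<open>a ^ n\<close> can be kept close to 1, as an iteration over many annuli
  requires.\<close>

lemma convex_power_split:
  fixes a b l :: real
  assumes "a \<ge> 0" "b \<ge> 0" "0 < l" "l < 1" "n > 0"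
  shows "(a + b) ^ n \<le> (1 / l) ^ (n - 1) * a ^ n + (1 / (1 - l)) ^ (n - 1) * b ^ n"
proof -
  define m where "m = a + b"
  have m: "m \<ge> 0" using assms by (simp add: m_def)
  have 1: "m ^ n + real n * m ^ (n - 1) * (a / l - m) \<le> (a / l) ^ n"
    using assms by (intro power_tangent_le m) auto
  have 2: "m ^ n + real n * m ^ (n - 1) * (b / (1 - l) - m) \<le> (b / (1 - l)) ^ n"
    using assms by (intro power_tangent_le m) auto
  have "l * (m ^ n + real n * m ^ (n - 1) * (a / l - m)) + (1 - l) * (m ^ n + real n * m ^ (n - 1) * (b / (1 - l) - m))
    = m ^ n + real n * m ^ (n - 1) * (l * (a / l) + (1 - l) * (b / (1 - l)) - m)"
    by (simp add: algebra_simps)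
  also have "l * (a / l) + (1 - l) * (b / (1 - l)) - m = 0" using assms by (simp add: m_def)
  finally have "m ^ n = l * (m ^ n + real n * m ^ (n - 1) * (a / l - m)) + (1 - l) * (m ^ n + real n * m ^ (n - 1) * (b / (1 - l) - m))"
    by simp
  also have "\<dots> \<le> l * (a / l) ^ n + (1 - l) * (b / (1 - l)) ^ n"
    using assms by (intro add_mono mult_left_mono 1 2) auto
  also have "l * (a / l) ^ n = (1 / l) ^ (n - 1) * a ^ n"
    using assms by (cases n) (auto simp: power_divide)
  also have "(1 - l) * (b / (1 - l)) ^ n = (1 / (1 - l)) ^ (n - 1) * b ^ n"
    using assms by (cases n) (auto simp: power_divide)
  finally show ?thesis by (simp add: m_def)
qed

lemma C1c_subset:
  assumes "C1c \<psi> h S" "compact S'" "\<And>x. x \<notin> S' \<Longrightarrow> \<psi> x = 0"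
  shows "C1c \<psi> h S'"
  using assms unfolding C1c_def by blast

context conormal
begin

text \<open>De Giorgi from level 0 on balls of radius 1/2, all inside one compact shell, with the
  increment chosen from the integral of \<open>u ^ N\<close> over that shell.\<close>

lemma u_locally_bounded:
  assumes "R \<ge> 2"
  obtains M where "\<And>x. x \<in> C \<Longrightarrow> 2 \<le> norm x \<Longrightarrow> norm x \<le> R \<Longrightarrow> u x \<le> M"
proof -
  define S where "S = cball 0 (R + 1) - ball (0::real^'n) (3/2)"
  have S: "compact S" "S \<subseteq> - cball 0 1" by (auto simp: S_def intro: compact_diff)
  define I where "I = (LINT x|lborel. indicator (S \<inter> C) x * u x ^ N)"
  have I: "I \<ge> 0" unfolding I_def using u_nonneg by (intro Bochner_Integration.integral_nonneg) auto
  \<comment> \<open>\<open>d / 2 \<ge> 1\<close> gives \<open>d / 2 \<le> (d / 2) ^ N\<close>, so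
    that a multiple of the integral itself, without a root, is large enough.\<close>
  define d where "d = 2 + 2 * I / cDG"
  have d: "d \<ge> 2" using I cDG_pos by (simp add: d_def)
  have "u x \<le> 0 + d" if x: "x \<in> C" "2 \<le> norm x" "norm x \<le> R" for x
  proof -
    have "excess 1 x 0 (1/2) \<le> I"
      unfolding excess_def I_def
    proof (rule integral_mono)
      show "integrable lborel (\<lambda>xa. indicator (C \<inter> ball x (1 / 2)) xa * max 0 (1 * u xa - 0) ^ N)"
        using x by (intro excess_integrable[where \<rho>="1/2"]) auto
      show "integrable lborel (\<lambda>x. indicator (S \<inter> C) x * u x ^ N)" by (rule u_LN[OF S])
      fix y
      show "indicator (C \<inter> ball x (1 / 2)) y * max 0 (1 * u y - 0) ^ N \<le> indicator (S \<inter> C) y * u y ^ N"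
      proof (cases "y \<in> C \<inter> ball x (1/2)")
        case True
        then have "norm (x - y) < 1/2" by (simp add: dist_norm)
        then have "y \<in> S" using x norm_triangle_ineq2[of x y] norm_triangle_ineq2[of y x]
          by (auto simp: S_def norm_minus_commute)
        then show ?thesis using True u_nonneg[of y] by (simp add: max_absorb2)
      qed (use u_nonneg[of y] in simp)
    qed
    also have "I \<le> cDG * (d / 2)" using cDG_pos I by (simp add: d_def distrib_left)
    also have "d / 2 \<le> (d / 2) ^ N" using power_increasing[of 1 N "d / 2"] d Npos by simp
    finally have "excess 1 x 0 (1/2) \<le> cDG * (1/2 * d) ^ N" using cDG_pos by (simp add: mult_left_mono)
    from de_giorgi[OF _ _ _ _ _ this x(1)] x d show ?thesis by simp
  qed
  then show ?thesis using that[of "0 + d"] by blast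
qed

end

text \<open>The level s exceeds u on the shell 2 \<le> |x| \<le> 3 in which the inner cutoff varies.
  Truncations above s vanish there and never see the gradient of that cutoff.\<close>

locale conormal_s = conormal C u f g F a\<^sub>0 a\<^sub>1 K N
  for C :: "(real^'n) set" and u f :: "real^'n \<Rightarrow> real" and g F :: "real^'n \<Rightarrow> real^'n"
    and a\<^sub>0 a\<^sub>1 K :: real and N :: nat +
  fixes s :: real
  assumes s_pos: "s > 0"
    and u_less_s: "\<And>x. x \<in> C \<Longrightarrow> 2 \<le> norm x \<Longrightarrow> norm x \<le> 3 \<Longrightarrow> u x < s"
begin

section \<open>Inner and outer cutoffs, flux and energy\<close>

definition e0 :: "real^'n \<Rightarrow> real" where "e0 x = 1 - cut 0 2 3 x"
definition De0 :: "real^'n \<Rightarrow> real^'n" where "De0 x = - Dcut 0 2 3 x"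

lemma e0_props:
  "0 \<le> e0 x" "e0 x \<le> 1" "norm x \<le> 2 \<Longrightarrow> e0 x = 0" "norm x \<ge> 3 \<Longrightarrow> e0 x = 1"
  "norm x \<le> 2 \<Longrightarrow> De0 x = 0" "norm x \<ge> 3 \<Longrightarrow> De0 x = 0"
  using cut_props[where r=2 and r'=3 and ?x0.0=0 and x=x] by (auto simp: e0_def De0_def)

lemma e0_deriv: "GDERIV e0 x :> De0 x" "continuous_on UNIV De0"
proof -
  note D = C1cD[OF cut_C1c[of 2 3 "0::real^'n"], simplified]
  have "((\<lambda>x. 1 - cut 0 2 3 x) has_derivative (\<lambda>h. 0 - h \<bullet> Dcut 0 2 3 x)) (at x)"
    by (rule has_derivative_diff[OF has_derivative_const]) (use D(1)[of x] in \<open>simp add: gderiv_def\<close>)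
  then show "GDERIV e0 x :> De0 x" by (simp add: gderiv_def e0_def[abs_def] De0_def)
  show "continuous_on UNIV De0" unfolding De0_def[abs_def] by (intro continuous_on_minus D(2))
qed

lemma e0_measurable [measurable]: "e0 \<in> borel_measurable borel" "De0 \<in> borel_measurable borel"
  using e0_deriv GDERIV_imp_continuous_on[of e0 De0] by (auto intro: borel_measurable_continuous_onI)

text \<open>The outer factor gives the inner cutoff a compact support off the unit ball; within
  radius r the product agrees with \<open>e0\<close>.\<close>

definition eR :: "real \<Rightarrow> real \<Rightarrow> real^'n \<Rightarrow> real" where "eR r R x = cut 0 r R x * e0 x"
definition DeR :: "real \<Rightarrow> real \<Rightarrow> real^'n \<Rightarrow> real^'n" where
  "DeR r R x = cut 0 r R x *\<^sub>R De0 x + e0 x *\<^sub>R Dcut 0 r R x"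
definition shell :: "real \<Rightarrow> (real^'n) set" where "shell R = cball 0 R - ball 0 2"

lemma eR_C1c:
  assumes "3 \<le> r" "r < R"
  shows "C1c (eR r R) (DeR r R) (shell R)" "shell R \<subseteq> - cball 0 1"
proof -
  have "C1c (cut 0 r R) (Dcut 0 r R) (cball (0::real^'n) R)" using assms by (intro cut_C1c) auto
  from C1c_mult[OF this e0_deriv]
  have "C1c (eR r R) (DeR r R) (cball 0 R)" unfolding eR_def[abs_def] DeR_def[abs_def] .
  then show "C1c (eR r R) (DeR r R) (shell R)"
  proof (rule C1c_subset)
    show "compact (shell R)" by (simp add: shell_def compact_diff)
    show "eR r R x = 0" if "x \<notin> shell R" for x
      using that cut_props(4)[where r=r and r'=R and ?x0.0=0 and x=x] e0_props(3)[of x] assms by (auto simp: shell_def eR_def)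
  qed
  show "shell R \<subseteq> - cball 0 1" by (auto simp: shell_def)
qed

lemma eR_props:
  assumes "3 \<le> r" "r < R"
  shows "0 \<le> eR r R x" "eR r R x \<le> 1" "norm x \<le> r \<Longrightarrow> eR r R x = e0 x" "norm x \<le> r \<Longrightarrow> DeR r R x = De0 x"
    "norm x \<ge> 3 \<Longrightarrow> DeR r R x = Dcut 0 r R x" "norm x \<ge> R \<Longrightarrow> eR r R x = 0"
  using cut_props[where r=r and r'=R and ?x0.0=0 and x=x] assms e0_props[of x] by (auto simp: eR_def DeR_def mult_le_one)

lemma De0_integrable: "integrable lborel (\<lambda>x. F x \<bullet> De0 x)"
proof -
  have "nice (\<lambda>t. 1) (\<lambda>t. 0)" using nice_clamp[of 1 1 1 0 0] by simp
  from nice_integrable(2)[OF eR_C1c[of 4 5] this]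
  have i: "integrable lborel (\<lambda>x. F x \<bullet> DeR 4 5 x)" by simp
  show ?thesis
  proof (rule Bochner_Integration.integrable_bound[OF i])
    show "AE x in lborel. norm (F x \<bullet> De0 x) \<le> norm (F x \<bullet> DeR 4 5 x)"
    proof (rule AE_I2)
      fix x show "norm (F x \<bullet> De0 x) \<le> norm (F x \<bullet> DeR 4 5 x)"
        using eR_props(4)[of 4 5 x] e0_props(6)[of x] by (cases "norm x \<le> 4") auto
    qed
  qed auto
qed

text \<open>The flux through the inner shell. With the source added, \<open>B h\<close> is an
  average of the fluxes through the level sets of u between s and s + h; \<open>Bmax\<close>
  replaces the weight of the source by 1 and bounds them for all h.\<close>

definition A0 where "A0 = (LINT x|lborel. F x \<bullet> De0 x)"
definition G :: "real \<Rightarrow> real^'n \<Rightarrow> real" where "G h x = 1 - clamp s h (u x) / h"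
definition B where "B h = A0 + (LINT x|lborel. f x * (e0 x * G h x))"
definition Bmax where "Bmax = A0 + (LINT x|lborel. f x)"
definition q :: "real \<Rightarrow> real^'n \<Rightarrow> real" where "q h x = e0 x * dclamp s h (u x)"
definition \<phi> :: "real \<Rightarrow> real^'n \<Rightarrow> real" where "\<phi> h x = e0 x * clamp s h (u x)"

lemma G_bounds: "h > 0 \<Longrightarrow> 0 \<le> G h x" "h > 0 \<Longrightarrow> G h x \<le> 1"
  by (auto simp: G_def clamp_eq min_def max_def divide_le_eq_1)

lemma truncation_measurable [measurable]:
  "G h \<in> borel_measurable borel" "q h \<in> borel_measurable borel" "\<phi> h \<in> borel_measurable borel"
  unfolding G_def[abs_def] q_def[abs_def] \<phi>_def[abs_def] clamp_def dclamp_def sgn_real_def by measurable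

lemma q_bounds: "h > 0 \<Longrightarrow> 0 \<le> q h x" "h > 0 \<Longrightarrow> q h x \<le> 1"
  unfolding q_def using e0_props(1,2)[of x] dclamp_bounds[of h s "u x"] by (auto intro: mult_le_one)

lemma fG_integrable:
  assumes "h > 0"
  shows "integrable lborel (\<lambda>x. f x * (e0 x * G h x))"
proof (rule Bochner_Integration.integrable_bound[OF f_int])
  show "AE x in lborel. norm (f x * (e0 x * G h x)) \<le> norm (f x)"
  proof (rule AE_I2)
    fix x
    have "e0 x * G h x \<le> 1" using e0_props(1,2)[of x] G_bounds[OF assms, of x] by (intro mult_le_one) auto
    then have "f x * (e0 x * G h x) \<le> f x * 1" using f_nonneg by (intro mult_left_mono) auto
    then show "norm (f x * (e0 x * G h x)) \<le> norm (f x)"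
      using f_nonneg[of x] e0_props(1)[of x] G_bounds[OF assms, of x] by simp
  qed
qed auto

lemma B_le_Bmax: "h > 0 \<Longrightarrow> B h \<le> Bmax"
  unfolding B_def Bmax_def
proof (intro add_left_mono integral_mono fG_integrable f_int)
  fix x assume h: "h > 0"
  have "e0 x * G h x \<le> 1" using e0_props(1,2)[of x] G_bounds[OF h, of x] by (intro mult_le_one) auto
  then show "f x * (e0 x * G h x) \<le> f x" using mult_left_mono[of "e0 x * G h x" 1 "f x"] f_nonneg by simp
qed

lemma u_large:
  obtains R where "R \<ge> 3" "\<And>x. x \<in> C \<Longrightarrow> norm x \<ge> R \<Longrightarrow> u x \<ge> Z"
proof -
  obtain b where "\<forall>x\<in>C. norm x \<ge> b \<longrightarrow> u x \<ge> Z" using u_inf by blast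
  then show ?thesis using that[of "max b 3"] by auto
qed

text \<open>
  \<open>e0 * G h\<close> is admissible because \<open>u\<close> tends to infinity, so that \<open>G h\<close> vanishes far away.
\<close>

lemma energy_identity:
  assumes h: "h > 0"
  shows "integrable lborel (\<lambda>x. q h x * (F x \<bullet> g x))" "(LINT x|lborel. q h x * (F x \<bullet> g x)) = h * B h"
proof -
  obtain R where R: "R \<ge> 3" "\<And>x. x \<in> C \<Longrightarrow> norm x \<ge> R \<Longrightarrow> u x \<ge> s + h + 1"
    using u_large[of "s + h + 1"] by blast
  have R2: "3 \<le> R" "R < 2 * R" using R by auto
  note C1 = eR_C1c[OF R2]
  note ep = eR_props[OF R2]
  have n: "nice (\<lambda>t. 1 + (- 1 / h) * clamp s h t) (\<lambda>t. (- 1 / h) * dclamp s h t)"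
    using nice_clamp[of h 1 1 "- 1 / h" s] h by simp
  define \<Phi> where "\<Phi> = (\<lambda>x. (1 + (- 1 / h) * clamp s h (u x)) *\<^sub>R DeR R (2 * R) x + (eR R (2 * R) x * ((- 1 / h) * dclamp s h (u x))) *\<^sub>R g x)"
  have W: "(LINT x|lborel. F x \<bullet> \<Phi> x) = - (LINT x|lborel. f x * (eR R (2 * R) x * (1 + (- 1 / h) * clamp s h (u x))))"
    using testable_weak[OF testable_nice[OF C1 n]] unfolding \<Phi>_def .
  have iF: "integrable lborel (\<lambda>x. F x \<bullet> \<Phi> x)"
    using nice_integrable(2)[OF C1 n] unfolding \<Phi>_def .
  have big: "clamp s h (u x) = h \<and> dclamp s h (u x) = 0" if "x \<in> C" "norm x \<ge> R" for x
    using R(2)[OF that] h by (auto simp: clamp_eq dclamp_def)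
  have small: "clamp s h (u x) = 0 \<and> dclamp s h (u x) = 0" if "x \<in> C" "2 \<le> norm x" "norm x \<le> 3" for x
    using u_less_s[OF that] h by (auto simp: clamp_eq dclamp_def)
  \<comment> \<open>On each of the four ranges of |x| either the cutoffs or the truncation are
    constant. Beyond R the outer cutoff varies, but there the truncation equals h and the test
    function is 0.\<close>
  have eq: "F x \<bullet> \<Phi> x = F x \<bullet> De0 x - (1 / h) * (q h x * (F x \<bullet> g x))" for x
  proof (cases "x \<in> C")
    case True
    consider "norm x \<le> 2" | "2 \<le> norm x" "norm x \<le> 3" | "3 \<le> norm x" "norm x \<le> R" | "norm x \<ge> R" by linarith
    then show ?thesis
    proof cases
      case 1
      then show ?thesis using ep(3,4)[of x] e0_props(3,5)[of x] R by (simp add: \<Phi>_def q_def)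
    next
      case 2
      then show ?thesis using ep(3,4)[of x] small[OF True] R by (simp add: \<Phi>_def q_def)
    next
      case 3
      then show ?thesis using ep(3,4)[of x] e0_props(4,6)[of x] by (simp add: \<Phi>_def q_def)
    next
      case 4
      then show ?thesis using big[OF True] e0_props(6)[of x] R h by (simp add: \<Phi>_def q_def)
    qed
  next
    case False
    then show ?thesis using F_zero by auto
  qed
  have feq: "f x * (eR R (2 * R) x * (1 + (- 1 / h) * clamp s h (u x))) = f x * (e0 x * G h x)" for x
  proof (cases "x \<in> C")
    case True
    then show ?thesis using ep(3)[of x] big[OF True] h by (cases "norm x \<le> R") (auto simp: G_def)
  next
    case False
    then show ?thesis using f_zero by auto
  qed
  have "q h x * (F x \<bullet> g x) = h * (F x \<bullet> De0 x - F x \<bullet> \<Phi> x)" for x using eq[of x] h by simp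
  then show "integrable lborel (\<lambda>x. q h x * (F x \<bullet> g x))"
    using De0_integrable iF by simp
  have "(LINT x|lborel. q h x * (F x \<bullet> g x)) = (LINT x|lborel. h * (F x \<bullet> De0 x - F x \<bullet> \<Phi> x))"
    using \<open>\<And>x. q h x * (F x \<bullet> g x) = h * (F x \<bullet> De0 x - F x \<bullet> \<Phi> x)\<close> by simp
  also have "\<dots> = h * (A0 - (LINT x|lborel. F x \<bullet> \<Phi> x))"
    using De0_integrable iF by (simp add: A0_def)
  also have "(LINT x|lborel. F x \<bullet> \<Phi> x) = - (LINT x|lborel. f x * (e0 x * G h x))"
    unfolding W feq ..
  finally show "(LINT x|lborel. q h x * (F x \<bullet> g x)) = h * B h" by (simp add: B_def)
qed

definition E where "E h = (LINT x|lborel. q h x * norm (g x) ^ N)"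

lemma qg_integrable:
  assumes h: "h > 0"
  shows "integrable lborel (\<lambda>x. q h x * norm (g x) ^ N)"
proof (rule Bochner_Integration.integrable_bound)
  show "integrable lborel (\<lambda>x. 1 / a\<^sub>0 * (q h x * (F x \<bullet> g x)))"
    by (intro integrable_mult_right energy_identity(1) h)
  show "AE x in lborel. norm (q h x * norm (g x) ^ N) \<le> norm (1 / a\<^sub>0 * (q h x * (F x \<bullet> g x)))"
  proof (rule AE_I2)
    fix x
    have "norm (g x) ^ N \<le> 1 / a\<^sub>0 * (F x \<bullet> g x)" using F_ge[of x] a0 by (simp add: field_simps)
    from mult_left_mono[OF this q_bounds(1)[OF h, of x]]
    have *: "q h x * norm (g x) ^ N \<le> 1 / a\<^sub>0 * (q h x * (F x \<bullet> g x))" by (simp add: mult_ac)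
    have "F x \<bullet> g x \<ge> 0" using order_trans[OF mult_nonneg_nonneg[of a\<^sub>0 "norm (g x) ^ N"] F_ge[of x]] a0 by simp
    then have "0 \<le> 1 / a\<^sub>0 * (q h x * (F x \<bullet> g x))" using a0 q_bounds(1)[OF h, of x] by simp
    then show "norm (q h x * norm (g x) ^ N) \<le> norm (1 / a\<^sub>0 * (q h x * (F x \<bullet> g x)))"
      using * q_bounds(1)[OF h, of x] by (simp only: real_norm_def abs_of_nonneg mult_nonneg_nonneg zero_le_power norm_ge_zero)
  qed
qed auto

lemma E_le: "h > 0 \<Longrightarrow> E h \<le> h * B h / a\<^sub>0"
proof -
  assume h: "h > 0"
  have "a\<^sub>0 * E h = (LINT x|lborel. a\<^sub>0 * (q h x * norm (g x) ^ N))" by (simp add: E_def)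
  also have "\<dots> \<le> (LINT x|lborel. q h x * (F x \<bullet> g x))"
  proof (intro integral_mono integrable_mult_right qg_integrable energy_identity(1) h)
    fix x
    show "a\<^sub>0 * (q h x * norm (g x) ^ N) \<le> q h x * (F x \<bullet> g x)"
      using mult_left_mono[OF F_ge[of x] q_bounds(1)[OF h, of x]] by (simp add: mult_ac)
  qed
  also have "\<dots> = h * B h" by (rule energy_identity(2)[OF h])
  finally show "E h \<le> h * B h / a\<^sub>0" using a0 by (simp add: field_simps)
qed

text \<open>The cutoff gradient drops out because the truncation vanishes where \<open>e0\<close>
  varies, and the N-th power of the weight q is at most q, which lies between 0 and 1. The radius R
  only makes a compactly supported cutoff available and does not enter the bound.\<close>

lemma \<phi>_le:
  assumes h: "h > 0" and A [measurable]: "A \<in> sets borel" "A' \<in> sets borel" and A': "A' \<subseteq> C" "A' \<subseteq> ball 0 R" and l: "l \<ge> 1"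
    and A1: "\<And>x t. x \<in> A \<Longrightarrow> 0 \<le> t \<Longrightarrow> t \<le> 1 \<Longrightarrow> (1 + t * (l - 1)) *\<^sub>R x + t *\<^sub>R v \<in> A'"
    and A2: "\<And>x. x \<in> A \<Longrightarrow> norm ((l - 1) *\<^sub>R x + v) \<le> r"
  shows "(\<integral>\<^sup>+x. indicator A x * ennreal (\<bar>\<phi> h (l *\<^sub>R x + v) - \<phi> h x\<bar> ^ N) \<partial>lborel)
     \<le> ennreal (r ^ N) * (\<integral>\<^sup>+x. indicator A' x * ennreal (q h x * norm (g x) ^ N) \<partial>lborel)"
proof -
  define R1 where "R1 = max R 3"
  have R2: "3 \<le> R1" "R1 < 2 * R1" by (auto simp: R1_def)
  note C1 = eR_C1c[OF R2]
  note ep = eR_props[OF R2]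
  have n: "nice (\<lambda>t. clamp s h t) (\<lambda>t. dclamp s h t)"
    using nice_clamp[of h 1 0 1 s] h by simp
  define \<Phi> where "\<Phi> = (\<lambda>x. clamp s h (u x) *\<^sub>R DeR R1 (2 * R1) x + (eR R1 (2 * R1) x * dclamp s h (u x)) *\<^sub>R g x)"
  have testable: "testable (\<lambda>x. eR R1 (2 * R1) x * clamp s h (u x)) \<Phi>"
    unfolding \<Phi>_def by (rule testable_nice[OF C1 n])
  have in1: "norm x \<le> R1" if "x \<in> A'" for x using A'(2) that by (auto simp: R1_def)
  have xA: "x \<in> A'" "l *\<^sub>R x + v \<in> A'" if "x \<in> A" for x
    using A1[OF that, of 0] A1[OF that, of 1] by auto
  have "(\<integral>\<^sup>+x. indicator A x * ennreal (\<bar>\<phi> h (l *\<^sub>R x + v) - \<phi> h x\<bar> ^ N) \<partial>lborel)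
    = (\<integral>\<^sup>+x. indicator A x * ennreal (\<bar>eR R1 (2 * R1) (l *\<^sub>R x + v) * clamp s h (u (l *\<^sub>R x + v)) - eR R1 (2 * R1) x * clamp s h (u x)\<bar> ^ N) \<partial>lborel)"
  proof (rule nn_integral_cong)
    fix x
    show "indicator A x * ennreal (\<bar>\<phi> h (l *\<^sub>R x + v) - \<phi> h x\<bar> ^ N)
      = indicator A x * ennreal (\<bar>eR R1 (2 * R1) (l *\<^sub>R x + v) * clamp s h (u (l *\<^sub>R x + v)) - eR R1 (2 * R1) x * clamp s h (u x)\<bar> ^ N)"
    proof (cases "x \<in> A")
      case True
      show ?thesis unfolding \<phi>_def ep(3)[OF in1[OF xA(1)[OF True]]] ep(3)[OF in1[OF xA(2)[OF True]]] ..
    qed simp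
  qed
  also have "\<dots> \<le> ennreal (r ^ N) * (\<integral>\<^sup>+x. indicator A' x * ennreal (norm (\<Phi> x) ^ N) \<partial>lborel)"
    by (rule testable_le[OF testable A A'(1) l A1 A2])
  also have "(\<integral>\<^sup>+x. indicator A' x * ennreal (norm (\<Phi> x) ^ N) \<partial>lborel) \<le> (\<integral>\<^sup>+x. indicator A' x * ennreal (q h x * norm (g x) ^ N) \<partial>lborel)"
  proof (rule nn_integral_mono)
    fix x
    show "indicator A' x * ennreal (norm (\<Phi> x) ^ N) \<le> indicator A' x * ennreal (q h x * norm (g x) ^ N)"
    proof (cases "x \<in> A'")
      case True
      then have xC: "x \<in> C" using A'(1) by auto
      have "clamp s h (u x) *\<^sub>R De0 x = 0"
      proof -
        consider "norm x \<le> 2" | "2 \<le> norm x" "norm x \<le> 3" | "3 \<le> norm x" by linarith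
        then show ?thesis
        proof cases
          case 2
          then show ?thesis using u_less_s[OF xC] h by (simp add: clamp_eq)
        qed (use e0_props(5,6)[of x] in auto)
      qed
      then have "\<Phi> x = q h x *\<^sub>R g x"
        using ep(3,4)[OF in1[OF True]] by (simp add: \<Phi>_def q_def)
      then have "norm (\<Phi> x) ^ N = q h x ^ N * norm (g x) ^ N"
        using q_bounds(1)[OF h, of x] by (simp add: power_mult_distrib)
      also have "q h x ^ N \<le> q h x ^ 1" using q_bounds[OF h, of x] Npos by (intro power_decreasing) auto
      finally have "norm (\<Phi> x) ^ N \<le> q h x * norm (g x) ^ N" by (simp add: mult_right_mono)
      then show ?thesis by (intro mult_left_mono ennreal_leI) auto
    qed simp
  qed
  finally show ?thesis by (simp add: mult_left_mono)
qed

lemma \<phi>_bounds: "h > 0 \<Longrightarrow> 0 \<le> \<phi> h x" "h > 0 \<Longrightarrow> \<phi> h x \<le> h"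
proof -
  assume h: "h > 0"
  have c: "0 \<le> clamp s h (u x)" "clamp s h (u x) \<le> h" using h by (auto simp: clamp_eq)
  show "0 \<le> \<phi> h x" unfolding \<phi>_def using e0_props(1)[of x] c by simp
  show "\<phi> h x \<le> h" unfolding \<phi>_def using mult_mono[OF e0_props(2)[of x] c(2)] c(1) by simp
qed

section \<open>Dyadic annuli and the logarithmic Hardy inequality\<close>

definition annulus :: "nat \<Rightarrow> (real^'n) set" where "annulus j = {x \<in> C. 2 ^ j \<le> norm x \<and> norm x < 2 ^ Suc j}"

lemma annulus_measurable [measurable]: "annulus j \<in> sets borel"
  unfolding annulus_def by measurable

lemma annulus_bounded: "annulus j \<subseteq> cball 0 (2 ^ Suc j)"
  by (auto simp: annulus_def)

lemma annulus_finite: "emeasure lborel (annulus j) < \<infinity>"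
  using emeasure_bounded_finite[OF bounded_subset[OF bounded_cball annulus_bounded]] by simp

text \<open>Mass (\<open>X\<close>) and energy (\<open>En\<close>) of the truncation in one annulus.
  The natural scale of the mass is 2^(j N), whereas the energy is invariant under dilations.\<close>

definition X where "X h j = (LINT x|lborel. indicator (annulus j) x * \<phi> h x ^ N)"
definition En where "En h j = (LINT x|lborel. indicator (annulus j) x * (q h x * norm (g x) ^ N))"

lemma En_integrable: "h > 0 \<Longrightarrow> integrable lborel (\<lambda>x. indicator (annulus j) x * (q h x * norm (g x) ^ N))"
  by (rule Bochner_Integration.integrable_bound[OF qg_integrable]) (auto simp: indicator_def)

lemma En_nonneg: "h > 0 \<Longrightarrow> En h j \<ge> 0"
  unfolding En_def by (intro Bochner_Integration.integral_nonneg) (auto simp: q_bounds)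

lemma X_integrable: "h > 0 \<Longrightarrow> integrable lborel (\<lambda>x. indicator (annulus j) x * \<phi> h x ^ N)"
proof (rule Bochner_Integration.integrable_bound[of _ "\<lambda>x. h ^ N * indicator (annulus j) x"])
  assume h: "h > 0"
  show "integrable lborel (\<lambda>x. h ^ N * indicator (annulus j) x)"
    using annulus_finite by (intro integrable_mult_right integrable_real_indicator) auto
  show "AE x in lborel. norm (indicator (annulus j) x * \<phi> h x ^ N) \<le> norm (h ^ N * indicator (annulus j) x)"
    using \<phi>_bounds[OF h] h by (intro AE_I2) (auto simp: indicator_def intro!: power_mono)
qed auto

lemma sum_En_le: "h > 0 \<Longrightarrow> (\<Sum>i<n. En h i) \<le> E h"
proof -
  assume h: "h > 0"
  have "(\<Sum>i<n. En h i) = (LINT x|lborel. (\<Sum>i<n. indicator (annulus i) x * (q h x * norm (g x) ^ N)))"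
    unfolding En_def by (rule Bochner_Integration.integral_sum[symmetric]) (rule En_integrable[OF h])
  also have "\<dots> \<le> E h"
    unfolding E_def
  proof (rule integral_mono)
    show "integrable lborel (\<lambda>x. (\<Sum>i<n. indicator (annulus i) x * (q h x * norm (g x) ^ N)))"
      by (intro Bochner_Integration.integrable_sum En_integrable h)
    fix x
    have "(\<Sum>i<n. indicator (annulus i) x :: real) \<le> 1"
    proof -
      have dis: "disjoint_family_on annulus {..<n}"
        unfolding disjoint_family_on_def
      proof (intro ballI impI)
        fix i j :: nat assume "i \<noteq> j"
        have "\<not> (x \<in> annulus a \<and> x \<in> annulus b)" if "a < b" for a b x
        proof
          assume "x \<in> annulus a \<and> x \<in> annulus b"
          then have "(2::real) ^ b < 2 ^ Suc a" by (auto simp: annulus_def)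
          then have "b < Suc a" by (simp only: power_strict_increasing_iff)
          with that show False by simp
        qed
        then show "annulus i \<inter> annulus j = {}" using \<open>i \<noteq> j\<close> by (metis disjoint_iff linorder_neqE_nat)
      qed
      have "(\<Sum>i<n. indicator (annulus i) x :: real) = indicator (\<Union>i<n. annulus i) x"
        by (rule indicator_UN_disjoint[OF _ dis, symmetric]) simp
      then show ?thesis by (simp add: indicator_def)
    qed
    then show "(\<Sum>i<n. indicator (annulus i) x * (q h x * norm (g x) ^ N)) \<le> q h x * norm (g x) ^ N"
      using mult_right_mono[of "\<Sum>i<n. indicator (annulus i) x" 1 "q h x * norm (g x) ^ N"] q_bounds(1)[OF h, of x]
      by (simp add: sum_distrib_right)
  qed (rule qg_integrable[OF h])
  finally show ?thesis .
qed

text \<open>Doubling maps an annulus onto the next one and moves each point along a segment inside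
  the two, of length at most \<open>2 ^ Suc j\<close>. Dividing by \<open>2 ^ (j * N)\<close>
  removes the scaling; the weight l stays free for the iteration.\<close>

lemma hardy_step:
  assumes h: "h > 0" and l: "0 < l" "l < 1"
  shows "X h (Suc j) / 2 ^ (Suc j * N) \<le> (1 / l) ^ (N - 1) * (X h j / 2 ^ (j * N)) + (1 / (1 - l)) ^ (N - 1) * (2 ^ N * (En h j + En h (Suc j)))"
proof -
  define A' where "A' = annulus j \<union> annulus (Suc j)"
  have [measurable]: "A' \<in> sets borel" by (simp add: A'_def)
  define r where "r = (2::real) ^ Suc j"
  define d where "d = (\<lambda>x. \<bar>\<phi> h (2 *\<^sub>R x) - \<phi> h x\<bar> ^ N)"
  have [measurable]: "d \<in> borel_measurable borel" unfolding d_def by measurable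
  have "(\<integral>\<^sup>+x. indicator (annulus j) x * ennreal (\<bar>\<phi> h (2 *\<^sub>R x + 0) - \<phi> h x\<bar> ^ N) \<partial>lborel)
     \<le> ennreal (r ^ N) * (\<integral>\<^sup>+x. indicator A' x * ennreal (q h x * norm (g x) ^ N) \<partial>lborel)"
  proof (rule \<phi>_le[OF h, where R="2 ^ Suc (Suc j)"])
    show "A' \<subseteq> C" "A' \<subseteq> ball 0 (2 ^ Suc (Suc j))" by (auto simp: A'_def annulus_def)
    fix x assume x: "x \<in> annulus j"
    show "norm ((2 - 1) *\<^sub>R x + 0) \<le> r" using x by (simp add: annulus_def r_def)
    fix t :: real assume t: "0 \<le> t" "t \<le> 1"
    have "(1 + t) *\<^sub>R x \<in> C" using x t C_scale[of x "1 + t"] by (simp add: annulus_def)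
    moreover have "norm x \<le> (1 + t) * norm x" "(1 + t) * norm x \<le> 2 * norm x"
      using t mult_right_mono[of 1 "1 + t" "norm x"] mult_right_mono[of "1 + t" 2 "norm x"] by auto
    ultimately show "(1 + t * (2 - 1)) *\<^sub>R x + t *\<^sub>R 0 \<in> A'" using x t by (auto simp: A'_def annulus_def)
  qed auto
  also have "(\<integral>\<^sup>+x. indicator A' x * ennreal (q h x * norm (g x) ^ N) \<partial>lborel) \<le> ennreal (En h j + En h (Suc j))"
  proof -
    have "(\<integral>\<^sup>+x. indicator A' x * ennreal (q h x * norm (g x) ^ N) \<partial>lborel)
      \<le> (\<integral>\<^sup>+x. ennreal (indicator (annulus j) x * (q h x * norm (g x) ^ N)) + ennreal (indicator (annulus (Suc j)) x * (q h x * norm (g x) ^ N)) \<partial>lborel)"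
      by (intro nn_integral_mono) (auto simp: A'_def indicator_def)
    also have "\<dots> = ennreal (En h j) + ennreal (En h (Suc j))"
      unfolding En_def using En_integrable[OF h] q_bounds(1)[OF h]
      by (subst nn_integral_add) (auto simp: nn_integral_eq_integral)
    finally show ?thesis using En_nonneg[OF h] by (simp add: ennreal_plus)
  qed
  finally have *: "(\<integral>\<^sup>+x. indicator (annulus j) x * ennreal (\<bar>\<phi> h (2 *\<^sub>R x + 0) - \<phi> h x\<bar> ^ N) \<partial>lborel) \<le> ennreal (r ^ N) * ennreal (En h j + En h (Suc j))"
    by (simp add: mult_left_mono)
  have D: "(\<integral>\<^sup>+x. ennreal (indicator (annulus j) x * d x) \<partial>lborel) \<le> ennreal (r ^ N * (En h j + En h (Suc j)))"
  proof -
    have "(\<integral>\<^sup>+x. ennreal (indicator (annulus j) x * d x) \<partial>lborel) = (\<integral>\<^sup>+x. indicator (annulus j) x * ennreal (\<bar>\<phi> h (2 *\<^sub>R x + 0) - \<phi> h x\<bar> ^ N) \<partial>lborel)"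
      by (intro nn_integral_cong) (auto simp: d_def indicator_def)
    with * show ?thesis using ennreal_mult[of "r ^ N" "En h j + En h (Suc j)"] En_nonneg[OF h] by (simp add: r_def)
  qed
  have d0: "0 \<le> indicator (annulus j) x * d x" for x by (simp add: d_def)
  have dI: "integrable lborel (\<lambda>x. indicator (annulus j) x * d x)"
    by (rule integrableI_nonneg) (use D d0 in \<open>auto intro: le_less_trans\<close>)
  have D': "(LINT x|lborel. indicator (annulus j) x * d x) \<le> r ^ N * (En h j + En h (Suc j))"
    using D d0 En_nonneg[OF h] unfolding nn_integral_eq_integral[OF dI AE_I2[OF d0]]
    by (subst (asm) ennreal_le_iff) (auto simp: r_def)
  have scale: "indicator (annulus (Suc j)) (2 *\<^sub>R x + 0) = (indicator (annulus j) x :: real)" for x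
  proof -
    have "2 *\<^sub>R x \<in> C \<longleftrightarrow> x \<in> C" using C_scale[of x 2] C_scale[of "2 *\<^sub>R x" "1/2"] by auto
    then show ?thesis by (auto simp: annulus_def indicator_def)
  qed
  have iX: "integrable lborel (\<lambda>x. indicator (annulus j) x * \<phi> h (2 *\<^sub>R x) ^ N)"
    using integrable_lborel_affine[OF X_integrable[OF h, of "Suc j"], of 2 0] unfolding scale by simp
  have "(1 / 2 ^ N) * X h (Suc j) = (LINT x|lborel. indicator (annulus (Suc j)) (2 *\<^sub>R x + 0) * \<phi> h (2 *\<^sub>R x + 0) ^ N)"
    unfolding X_def using integral_lborel_affine[of "\<lambda>x. indicator (annulus (Suc j)) x * \<phi> h x ^ N" 2 0] by (simp add: N_def)
  also have "\<dots> = (LINT x|lborel. indicator (annulus j) x * \<phi> h (2 *\<^sub>R x) ^ N)" unfolding scale by simp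
  also have "\<dots> \<le> (LINT x|lborel. (1 / l) ^ (N - 1) * (indicator (annulus j) x * \<phi> h x ^ N) + (1 / (1 - l)) ^ (N - 1) * (indicator (annulus j) x * d x))"
  proof (rule integral_mono[OF iX])
    show "integrable lborel (\<lambda>x. (1 / l) ^ (N - 1) * (indicator (annulus j) x * \<phi> h x ^ N) + (1 / (1 - l)) ^ (N - 1) * (indicator (annulus j) x * d x))"
      using dI X_integrable[OF h] by auto
    fix x
    have "\<phi> h (2 *\<^sub>R x) ^ N \<le> (\<phi> h x + \<bar>\<phi> h (2 *\<^sub>R x) - \<phi> h x\<bar>) ^ N"
      using \<phi>_bounds[OF h] by (intro power_mono) auto
    also have "\<dots> \<le> (1 / l) ^ (N - 1) * \<phi> h x ^ N + (1 / (1 - l)) ^ (N - 1) * d x"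
      unfolding d_def using \<phi>_bounds[OF h] l Npos by (intro convex_power_split) auto
    finally show "indicator (annulus j) x * \<phi> h (2 *\<^sub>R x) ^ N \<le> (1 / l) ^ (N - 1) * (indicator (annulus j) x * \<phi> h x ^ N) + (1 / (1 - l)) ^ (N - 1) * (indicator (annulus j) x * d x)"
      by (auto simp: indicator_def)
  qed
  also have "\<dots> = (1 / l) ^ (N - 1) * X h j + (1 / (1 - l)) ^ (N - 1) * (LINT x|lborel. indicator (annulus j) x * d x)"
    unfolding X_def using dI X_integrable[OF h] by simp
  also have "\<dots> \<le> (1 / l) ^ (N - 1) * X h j + (1 / (1 - l)) ^ (N - 1) * (r ^ N * (En h j + En h (Suc j)))"
    using l by (intro add_left_mono mult_left_mono D') auto
  finally have fin: "(1 / 2 ^ N) * X h (Suc j) \<le> (1 / l) ^ (N - 1) * X h j + (1 / (1 - l)) ^ (N - 1) * (r ^ N * (En h j + En h (Suc j)))" .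
  define P where "P = (2::real) ^ (j * N)"
  have P: "P > 0" by (simp add: P_def)
  have rN: "r ^ N = 2 ^ N * P" by (simp add: r_def P_def power_mult power_mult_distrib)
  have SN: "(2::real) ^ (Suc j * N) = 2 ^ N * P" by (simp add: P_def power_add)
  have "X h (Suc j) / 2 ^ (Suc j * N) = ((1 / 2 ^ N) * X h (Suc j)) / P" unfolding SN by simp
  also have "\<dots> \<le> ((1 / l) ^ (N - 1) * X h j + (1 / (1 - l)) ^ (N - 1) * (r ^ N * (En h j + En h (Suc j)))) / P"
    using fin P by (intro divide_right_mono) auto
  also have "\<dots> = (1 / l) ^ (N - 1) * (X h j / P) + (1 / (1 - l)) ^ (N - 1) * (2 ^ N * (En h j + En h (Suc j)))"
    using P unfolding rN add_divide_distrib by simp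
  finally show ?thesis unfolding P_def .
qed

text \<open>
  In \<open>hardy_step\<close> the weight \<open>l = m / (m + 1)\<close> makes the product of the factors \<open>1 / l\<close> telescope to a
  power of the logarithm of the radius.
\<close>

lemma hardy:
  assumes h: "h > 0"
  shows "X h (Suc j) \<le> 2 ^ (Suc j * N) * real (Suc j) ^ (N - 1) * (2 ^ Suc N * E h)"
proof -
  have claim: "X h (Suc j) / 2 ^ (Suc j * N) \<le> real (Suc j) ^ (N - 1) * (2 ^ N * (\<Sum>i\<le>j. En h i + En h (Suc i)))"
  proof (induction j)
    case 0
    have X0: "X h 0 = 0"
    proof -
      have z: "indicator (annulus 0) x * \<phi> h x ^ N = 0" for x
        using e0_props(3)[of x] Npos by (auto simp: annulus_def indicator_def \<phi>_def zero_power)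
      show ?thesis unfolding X_def z by simp
    qed
    \<comment> \<open>The weight m / (m + 1) would be 0 here, which \<open>hardy_step\<close>
      excludes. As the mass of annulus 0 vanishes, l can be sent to 0 instead.\<close>
    have lim: "(\<lambda>n. (1 / (1 - 1 / real (Suc (Suc n)))) ^ (N - 1) * (2 ^ N * (En h 0 + En h (Suc 0)))) \<longlonglongrightarrow> (1 / (1 - 0)) ^ (N - 1) * (2 ^ N * (En h 0 + En h (Suc 0)))"
    proof (intro tendsto_mult tendsto_const tendsto_power tendsto_divide tendsto_diff)
      have "(\<lambda>n. 1 / real (Suc n)) \<longlonglongrightarrow> 0" using LIMSEQ_inverse_real_of_nat by (simp only: divide_inverse mult_1_left)
      then show "(\<lambda>n. 1 / real (Suc (Suc n))) \<longlonglongrightarrow> 0" by (rule LIMSEQ_Suc)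
    qed simp
    have "X h (Suc 0) / 2 ^ (Suc 0 * N) \<le> (1 / (1 - 1 / real (Suc (Suc n)))) ^ (N - 1) * (2 ^ N * (En h 0 + En h (Suc 0)))" for n
      using hardy_step[OF h, of "1 / real (Suc (Suc n))" 0] X0 by simp
    then have "X h (Suc 0) / 2 ^ (Suc 0 * N) \<le> (1 / (1 - 0)) ^ (N - 1) * (2 ^ N * (En h 0 + En h (Suc 0)))"
      by (intro LIMSEQ_le_const[OF lim]) auto
    then show ?case by simp
  next
    case (Suc j)
    define m where "m = real (Suc j)"
    have m: "m > 0" by (simp add: m_def)
    define l where "l = m / (m + 1)"
    have l: "0 < l" "l < 1" "1 / l = (m + 1) / m" "1 / (1 - l) = m + 1" using m by (auto simp: l_def field_simps)
    have "X h (Suc (Suc j)) / 2 ^ (Suc (Suc j) * N) \<le> ((m + 1) / m) ^ (N - 1) * (X h (Suc j) / 2 ^ (Suc j * N)) + (m + 1) ^ (N - 1) * (2 ^ N * (En h (Suc j) + En h (Suc (Suc j))))"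
      using hardy_step[OF h l(1,2), of "Suc j"] unfolding l(3,4) .
    also have "\<dots> \<le> ((m + 1) / m) ^ (N - 1) * (m ^ (N - 1) * (2 ^ N * (\<Sum>i\<le>j. En h i + En h (Suc i)))) + (m + 1) ^ (N - 1) * (2 ^ N * (En h (Suc j) + En h (Suc (Suc j))))"
      using Suc m unfolding m_def[symmetric] by (intro add_right_mono mult_left_mono) auto
    also have "\<dots> = (m + 1) ^ (N - 1) * (2 ^ N * (\<Sum>i\<le>Suc j. En h i + En h (Suc i)))"
      using m by (simp add: power_divide distrib_left)
    finally show ?case by (simp add: m_def add.commute)
  qed
  \<comment> \<open>Every annulus is counted at most twice.\<close>
  have "(\<Sum>i\<le>j. En h i + En h (Suc i)) \<le> 2 * E h"
  proof -
    have "(\<Sum>i\<le>j. En h i) \<le> E h" using sum_En_le[OF h, of "Suc j"] by (simp add: lessThan_Suc_atMost)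
    moreover have "(\<Sum>i\<le>j. En h (Suc i)) \<le> (\<Sum>i<Suc (Suc j). En h i)"
      using sum.lessThan_Suc_shift[of "En h" "Suc j"] En_nonneg[OF h, of 0]
      by (simp only: lessThan_Suc_atMost)
    moreover have "(\<Sum>i<Suc (Suc j). En h i) \<le> E h" by (rule sum_En_le[OF h])
    ultimately show ?thesis by (simp add: sum.distrib)
  qed
  then have "real (Suc j) ^ (N - 1) * (2 ^ N * (\<Sum>i\<le>j. En h i + En h (Suc i))) \<le> real (Suc j) ^ (N - 1) * (2 ^ N * (2 * E h))"
    by (intro mult_left_mono) auto
  also have "2 ^ N * (2 * E h) = 2 ^ Suc N * E h" by simp
  finally have "X h (Suc j) / 2 ^ (Suc j * N) \<le> real (Suc j) ^ (N - 1) * (2 ^ Suc N * E h)" using claim by (rule order_trans[rotated])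
  then show ?thesis by (simp add: divide_le_eq mult_ac)
qed

text \<open>Far out the truncation equals h, so its mass in a distant annulus is positive. Hardy
  then forces a positive energy, and the energy is at most
  \<open>h * B h / a\<^sub>0\<close>.\<close>

lemma B_pos:
  assumes h: "h > 0"
  shows "B h > 0"
proof -
  obtain R where R: "R \<ge> 3" "\<And>x. x \<in> C \<Longrightarrow> norm x \<ge> R \<Longrightarrow> u x \<ge> s + h" using u_large[of "s + h"] by blast
  obtain j where j: "R < 2 ^ j" using real_arch_pow[of 2 R] by auto
  define i where "i = Suc j"
  have i: "R \<le> 2 ^ i" using j zero_less_power[of "2::real" j] unfolding i_def power_Suc by linarith
  have z: "indicator (annulus i) x * \<phi> h x ^ N = h ^ N * indicator (annulus i) x" for x
  proof (cases "x \<in> annulus i")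
    case True
    then have x: "x \<in> C" "norm x \<ge> R" using i by (auto simp: annulus_def)
    then have "clamp s h (u x) = h" using R(2)[OF x] h by (simp add: clamp_eq)
    then show ?thesis using True e0_props(4)[of x] x R(1) by (simp add: \<phi>_def)
  qed simp
  have "X h i = h ^ N * measure lborel (annulus i)" unfolding X_def z by simp
  moreover have "measure lborel (annulus i) > 0"
  proof -
    obtain p where p: "p \<in> C" "p \<noteq> 0"
      using C_open C_ne not_open_singleton[of "0::real^'n"] by (metis is_singletonI' is_singleton_the_elem singletonI subsetI subset_singletonD)
    define U where "U = C \<inter> (ball 0 (2 ^ Suc i) - cball 0 (2 ^ i))"
    have oU: "open U" unfolding U_def using C_open by auto
    define x where "x = (3 / 2 * 2 ^ i / norm p) *\<^sub>R p"
    have "norm x = 3 / 2 * 2 ^ i" using p by (simp add: x_def)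
    moreover have "x \<in> C" unfolding x_def using p by (intro C_scale) auto
    moreover have "(2::real) ^ i > 0" by simp
    ultimately have "x \<in> U" unfolding U_def by (simp, linarith)
    then have "0 < emeasure lborel U" using oU open_pos_measure by blast
    also have "\<dots> \<le> emeasure lborel (annulus i)" by (intro emeasure_mono) (auto simp: U_def annulus_def)
    finally show ?thesis using annulus_finite[of i] by (simp add: measure_def enn2real_positive_iff less_top)
  qed
  ultimately have "X h i > 0" using h by simp
  then have "0 < 2 ^ (Suc j * N) * real (Suc j) ^ (N - 1) * (2 ^ Suc N * E h)" using hardy[OF h, of j] unfolding i_def by (rule less_le_trans)
  then have "0 < (2 ^ (Suc j * N) * real (Suc j) ^ (N - 1) * 2 ^ Suc N) * E h" by (simp only: mult.assoc)
  moreover have "0 < 2 ^ (Suc j * N) * real (Suc j) ^ (N - 1) * 2 ^ Suc N" by (intro mult_pos_pos zero_less_power) auto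
  ultimately have "E h > 0" by (rule zero_less_mult_pos)
  then have "0 < h * B h / a\<^sub>0" using E_le[OF h] by linarith
  then show ?thesis using h a0 by (simp add: zero_less_divide_iff zero_less_mult_iff)
qed

lemma Bmax_pos: "Bmax > 0"
  using B_pos[of 1] B_le_Bmax[of 1] by simp

lemma E_le_max:
  assumes "h > 0"
  shows "E h \<le> h * Bmax / a\<^sub>0"
proof -
  have "h * B h / a\<^sub>0 \<le> h * Bmax / a\<^sub>0"
    using assms a0 B_le_Bmax[OF assms] by (intro divide_right_mono mult_left_mono) auto
  then show ?thesis using E_le[OF assms] by linarith
qed

end

section \<open>Upper bound and Poincare inequality\<close>

lemma ln2_bounds: "1 / 2 \<le> ln (2::real)" "ln (2::real) \<le> 1"
proof -
  have "exp 1 \<le> (4::real)" using exp_le by simp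
  then have "1 \<le> ln (4::real)" by (simp add: ln_ge_iff)
  moreover have "ln (4::real) = 2 * ln 2" using ln_realpow[of 2 2] by simp
  ultimately show "1 / 2 \<le> ln (2::real)" by simp
  show "ln (2::real) \<le> 1" using ln_le_minus_one[of 2] by simp
qed

lemma ln_ge_1: "R \<ge> 3 \<Longrightarrow> ln R \<ge> (1::real)"
  using exp_le by (simp add: ln_ge_iff)

lemma dyadic_bracket:
  fixes R :: real
  assumes "R \<ge> 1"
  obtains j where "2 ^ j \<le> R" "R < 2 ^ Suc j" "real j \<le> 2 * ln R" "ln R \<le> real (Suc j)"
proof -
  obtain n0 where "R < 2 ^ n0" using real_arch_pow[of 2 R] by auto
  define n where "n = (LEAST n. R < 2 ^ n)"
  have n: "R < 2 ^ n" unfolding n_def by (rule LeastI) (rule \<open>R < 2 ^ n0\<close>)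
  have "n \<noteq> 0" using n assms by (cases n) auto
  then obtain j where j: "n = Suc j" by (cases n) auto
  have le: "2 ^ j \<le> R" using not_less_Least[of j "\<lambda>n. R < 2 ^ n"] j unfolding n_def[symmetric] by (simp add: not_less)
  have "real j * ln 2 \<le> ln R" using ln_mono[OF le] by (simp add: ln_realpow)
  moreover have "real j * (1 / 2) \<le> real j * ln 2" using ln2_bounds by (intro mult_left_mono) auto
  ultimately have 1: "real j \<le> 2 * ln R" by linarith
  have "ln R \<le> ln (2 ^ Suc j)" using n j assms by (simp add: less_imp_le)
  also have "\<dots> = real (Suc j) * ln 2" by (rule ln_realpow)
  also have "\<dots> \<le> real (Suc j) * 1" using ln2_bounds by (intro mult_left_mono) auto
  finally have "ln R \<le> real (Suc j)" by simp
  then show ?thesis using that le n j 1 by blast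
qed

context conormal_s
begin

text \<open>Hardy on the three dyadic annuli that cover the part of the cone in a ball of radius
  |x0| / 2 about x0. The factors \<open>2 ^ N\<close> and \<open>3 ^ (N - 1)\<close> compare the
  outer radii of these annuli with |x0| and their indices with ln |x0|.\<close>

definition CU where "CU = 3 * (2 ^ N * 3 ^ (N - 1) * (2 ^ Suc N * (Bmax / a\<^sub>0)))"

lemma CU_pos: "CU > 0" unfolding CU_def using Bmax_pos a0 by (intro mult_pos_pos divide_pos_pos) auto

lemma \<phi>_ball_integrable:
  assumes h: "h > 0"
  shows "integrable lborel (\<lambda>x. indicator (C \<inter> ball x0 r) x * \<phi> h x ^ N)"
proof (rule Bochner_Integration.integrable_bound[of _ "\<lambda>x. h ^ N * indicator (cball x0 r) x"])
  show "integrable lborel (\<lambda>x. h ^ N * indicator (cball x0 r) x)"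
    by (intro integrable_mult_right integrable_indicator_compact) auto
  show "AE x in lborel. norm (indicator (C \<inter> ball x0 r) x * \<phi> h x ^ N) \<le> norm (h ^ N * indicator (cball x0 r) x)"
    using \<phi>_bounds[OF h] h by (intro AE_I2) (auto simp: indicator_def intro!: power_mono)
  have [measurable]: "C \<inter> ball x0 r \<in> sets borel" using C_open by auto
  have "(\<lambda>x. indicator (C \<inter> ball x0 r) x * \<phi> h x ^ N) \<in> borel_measurable borel" by measurable
  then show "(\<lambda>x. indicator (C \<inter> ball x0 r) x * \<phi> h x ^ N) \<in> borel_measurable lborel" by simp
qed

lemma mass:
  assumes h: "h > 0" and x0: "norm x0 \<ge> 8"
  shows "(LINT x|lborel. indicator (C \<inter> ball x0 (norm x0 / 2)) x * \<phi> h x ^ N) \<le> CU * norm x0 ^ N * ln (norm x0) ^ (N - 1) * h"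
proof -
  define R where "R = norm x0"
  have R: "R \<ge> 8" using x0 by (simp add: R_def)
  obtain j where j: "2 ^ j \<le> R" "R < 2 ^ Suc j" "real j \<le> 2 * ln R" using dyadic_bracket[of R] R by auto
  have lnR: "ln R \<ge> 1" using R by (intro ln_ge_1) auto
  have "j \<ge> 3"
  proof (rule ccontr)
    assume "\<not> j \<ge> 3"
    then have "(2::real) ^ Suc j \<le> 2 ^ 3" by (intro power_increasing) auto
    then show False using j(2) R by simp
  qed
  then obtain i where i: "j = Suc (Suc i)" by (metis Suc_le_D numeral_3_eq_3 Suc_le_mono)
  have sub: "C \<inter> ball x0 (R / 2) \<subseteq> annulus (Suc i) \<union> annulus (Suc (Suc i)) \<union> annulus (Suc (Suc (Suc i)))"
  proof
    fix x assume x: "x \<in> C \<inter> ball x0 (R / 2)"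
    then have "norm x > R / 2" "norm x < 3 / 2 * R"
      using norm_triangle_ineq2[of x0 x] norm_triangle_ineq2[of x x0] by (auto simp: R_def dist_norm norm_minus_commute)
    then have "2 ^ Suc i \<le> norm x" "norm x < 2 ^ Suc (Suc (Suc (Suc i)))" using j(1,2) unfolding i by auto
    then show "x \<in> annulus (Suc i) \<union> annulus (Suc (Suc i)) \<union> annulus (Suc (Suc (Suc i)))"
      using x unfolding annulus_def by (auto simp: not_le)
  qed
  define Z where "Z = 2 ^ N * R ^ N * (3 * ln R) ^ (N - 1) * (2 ^ Suc N * E h)"
  have E0: "E h \<ge> 0" unfolding E_def using q_bounds(1)[OF h] by (intro Bochner_Integration.integral_nonneg) auto
  have XZ: "X h (Suc a) \<le> Z" if "a \<le> Suc (Suc i)" for a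
  proof -
    have "X h (Suc a) \<le> 2 ^ (Suc a * N) * real (Suc a) ^ (N - 1) * (2 ^ Suc N * E h)" by (rule hardy[OF h])
    also have "\<dots> \<le> (2 ^ N * R ^ N) * (3 * ln R) ^ (N - 1) * (2 ^ Suc N * E h)"
    proof (intro mult_mono)
      have "(2::real) ^ (Suc a * N) = (2 ^ Suc a) ^ N" by (rule power_mult)
      also have "\<dots> \<le> (2 * R) ^ N"
      proof (intro power_mono)
        have "(2::real) ^ Suc a \<le> 2 ^ Suc j" using that unfolding i by (intro power_increasing) auto
        also have "\<dots> \<le> 2 * R" using j(1) by simp
        finally show "(2::real) ^ Suc a \<le> 2 * R" .
      qed simp
      finally show "2 ^ (Suc a * N) \<le> 2 ^ N * R ^ N" by (simp add: power_mult_distrib)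
      show "real (Suc a) ^ (N - 1) \<le> (3 * ln R) ^ (N - 1)"
        using that j(3) lnR unfolding i by (intro power_mono) auto
    qed (use E0 R lnR in auto)
    finally show ?thesis by (simp add: Z_def)
  qed
  have "(LINT x|lborel. indicator (C \<inter> ball x0 (R / 2)) x * \<phi> h x ^ N) \<le>
     (LINT x|lborel. indicator (annulus (Suc i)) x * \<phi> h x ^ N + indicator (annulus (Suc (Suc i))) x * \<phi> h x ^ N + indicator (annulus (Suc (Suc (Suc i)))) x * \<phi> h x ^ N)"
  proof (rule integral_mono[OF \<phi>_ball_integrable[OF h]])
    show "integrable lborel (\<lambda>x. indicator (annulus (Suc i)) x * \<phi> h x ^ N + indicator (annulus (Suc (Suc i))) x * \<phi> h x ^ N + indicator (annulus (Suc (Suc (Suc i)))) x * \<phi> h x ^ N)"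
      by (intro Bochner_Integration.integrable_add X_integrable[OF h])
    fix x
    show "indicator (C \<inter> ball x0 (R / 2)) x * \<phi> h x ^ N \<le> indicator (annulus (Suc i)) x * \<phi> h x ^ N + indicator (annulus (Suc (Suc i))) x * \<phi> h x ^ N + indicator (annulus (Suc (Suc (Suc i)))) x * \<phi> h x ^ N"
    proof (cases "x \<in> C \<inter> ball x0 (R / 2)")
      case True
      then have "x \<in> annulus (Suc i) \<or> x \<in> annulus (Suc (Suc i)) \<or> x \<in> annulus (Suc (Suc (Suc i)))" using sub by blast
      then show ?thesis using True \<phi>_bounds(1)[OF h, of x] by (auto simp: indicator_def)
    qed (use \<phi>_bounds(1)[OF h, of x] in simp)
  qed
  also have "\<dots> = X h (Suc i) + X h (Suc (Suc i)) + X h (Suc (Suc (Suc i)))"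
    unfolding X_def by (simp add: X_integrable[OF h])
  also have "\<dots> \<le> 3 * Z" using XZ[of i] XZ[of "Suc i"] XZ[of "Suc (Suc i)"] by simp
  also have "\<dots> \<le> 3 * (2 ^ N * R ^ N * (3 * ln R) ^ (N - 1) * (2 ^ Suc N * (h * Bmax / a\<^sub>0)))"
    unfolding Z_def using E_le_max[OF h] R lnR by (intro mult_left_mono) auto
  also have "\<dots> = CU * R ^ N * ln R ^ (N - 1) * h"
    unfolding CU_def power_mult_distrib by (simp add: mult_ac)
  finally show ?thesis by (simp add: R_def)
qed

text \<open>
  De Giorgi's estimate at \<open>x\<close> involves the supremum of \<open>u\<close> on a larger ball; it is absorbed by
  maximising \<open>(sg x)\<^sup>2 * u x\<close>, where \<open>sg\<close> is the normalised distance to the boundary of the ball.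
\<close>

lemma upper_bound:
  "\<exists>L>0. \<forall>x\<in>C. norm x \<ge> 12 \<longrightarrow> u x \<le> L * ln (norm x)"
proof -
  \<comment> \<open>Large enough for the mass bound to meet the De Giorgi threshold;
    \<open>2 ^ N\<close> and 16 anticipate the choices of \<rho> and d.\<close>
  define Q where "Q = 1 + CU * 2 ^ N * 16 / cDG"
  have Q: "Q \<ge> 1" using CU_pos cDG_pos by (simp add: Q_def)
  have QC: "CU \<le> cDG / 2 ^ N / 16 * Q" using CU_pos cDG_pos by (simp add: Q_def field_simps)
  show ?thesis
  proof (intro exI[of _ "8 * s + 4 + 8 * Q"] conjI ballI impI)
    show "8 * s + 4 + 8 * Q > 0" using s_pos Q by simp
    fix x0 assume x0: "x0 \<in> C" "norm x0 \<ge> 12"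
    define R where "R = norm x0"
    have R: "R \<ge> 12" using x0 by (simp add: R_def)
    have lnR: "ln R \<ge> 1" using R by (intro ln_ge_1) auto
    define T where "T = C \<inter> ball x0 (R / 2)"
    define sg where "sg = (\<lambda>x. 1 / 2 - norm (x - x0) / R)"
    have sg: "0 < sg x" "sg x \<le> 1 / 2" if "x \<in> T" for x
      using that R by (auto simp: T_def sg_def dist_norm norm_minus_commute field_simps)
    have Tn: "norm x \<ge> R / 2 + sg x * R" "norm x \<le> 2 * R" if "x \<in> T" for x
    proof -
      have "sg x * R = R / 2 - norm (x - x0)" using R by (simp add: sg_def field_simps)
      moreover have "norm (x - x0) < R / 2" using that by (simp add: T_def dist_norm norm_minus_commute)
      ultimately show "norm x \<ge> R / 2 + sg x * R" "norm x \<le> 2 * R"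
        using norm_triangle_ineq2[of x0 x] norm_triangle_ineq2[of x x0] by (auto simp: R_def norm_minus_commute)
    qed
    define v where "v = (\<lambda>x. (sg x)\<^sup>2 * u x)"
    \<comment> \<open>Local boundedness makes the supremum \<open>W\<close> finite, without which it
      could not be absorbed.\<close>
    obtain M where M: "\<And>x. x \<in> C \<Longrightarrow> 2 \<le> norm x \<Longrightarrow> norm x \<le> 2 * R \<Longrightarrow> u x \<le> M"
      using u_locally_bounded[of "2 * R"] R by auto
    have bdd: "bdd_above (v ` T)"
    proof (rule bdd_aboveI2)
      fix x assume x: "x \<in> T"
      have "norm x \<ge> 2" using Tn(1)[OF x] mult_nonneg_nonneg[of "sg x" R] sg(1)[OF x] R by linarith
      then have "u x \<le> M" using M[of x] x Tn(2)[OF x] by (simp add: T_def)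
      moreover have "(sg x)\<^sup>2 \<le> 1" using sg[OF x] by (simp add: power_le_one)
      ultimately show "v x \<le> M" unfolding v_def using u_nonneg[of x] mult_mono[of "(sg x)\<^sup>2" 1 "u x" M] by simp
    qed
    define W where "W = Sup (v ` T)"
    have vW: "v x \<le> W" if "x \<in> T" for x unfolding W_def using that bdd by (intro cSup_upper) auto
    have x0T: "x0 \<in> T" using x0 R by (simp add: T_def)
    have W0: "W \<ge> 0" using vW[OF x0T] u_nonneg[of x0] by (simp add: v_def) (smt (verit) mult_nonneg_nonneg zero_le_power2)
    have main: "v x \<le> s + (4 * W + 1) / 16 + Q * ln R" if x: "x \<in> T" for x
    proof -
      define \<sigma> where "\<sigma> = sg x"
      have \<sigma>: "0 < \<sigma>" "\<sigma> \<le> 1 / 2" using sg[OF x] by (auto simp: \<sigma>_def)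
      \<comment> \<open>On the ball of radius \<rho> about x the weight is still at least \<sigma> /
        2, so u \<le> 4 W / \<sigma>^2 there and truncating at height h does not cut anything above
        s.\<close>
      define h where "h = 4 * W / \<sigma>\<^sup>2 + 1"
      have h: "h > 0" using W0 by (simp add: h_def add_nonneg_pos)
      define \<rho> where "\<rho> = \<sigma> * R / 2"
      have \<rho>: "\<rho> > 0" using \<sigma> R by (simp add: \<rho>_def)
      define q where "q = Q * ln R / \<sigma>\<^sup>2"
      have \<sigma>21: "\<sigma>\<^sup>2 \<le> 1" using \<sigma> by (simp add: power_le_one)
      have q: "q \<ge> 1"
      proof -
        have "1 \<le> Q * ln R" using Q lnR mult_mono[of 1 Q 1 "ln R"] by simp
        then have "\<sigma>\<^sup>2 \<le> Q * ln R" using \<sigma>21 by linarith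
        then show ?thesis unfolding q_def using \<sigma> by (simp add: le_divide_eq)
      qed
      \<comment> \<open>In \<open>d ^ N\<close> one factor pays for h through h / 16, and the other
        N - 1 pay for the powers of ln R through q. After multiplication by \<sigma>^2 the first
        part contributes at most W / 4 + 1 / 16.\<close>
      define d where "d = h / 16 + q"
      have d: "d \<ge> 1" "d \<ge> q" "d \<ge> h / 16" using h q by (auto simp: d_def)
      have dist: "y \<in> T \<and> sg y \<ge> \<sigma> / 2" if "y \<in> C" "y \<in> ball x \<rho>" for y
      proof -
        have "norm (y - x0) \<le> norm (x - x0) + norm (y - x)" using norm_triangle_ineq[of "x - x0" "y - x"] by simp
        moreover have "norm (y - x) < \<rho>" using that by (simp add: dist_norm norm_minus_commute)
        moreover have "norm (x - x0) = (1 / 2 - \<sigma>) * R" using R by (simp add: \<sigma>_def sg_def)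
        ultimately have *: "norm (y - x0) \<le> (1 / 2 - \<sigma> / 2) * R" by (simp add: \<rho>_def field_simps)
        then have "norm (y - x0) / R \<le> 1 / 2 - \<sigma> / 2" using R by (simp add: divide_le_eq)
        moreover have "norm (y - x0) < R / 2" using * \<sigma> R by (simp add: field_simps) (smt (verit) mult_pos_pos)
        ultimately show ?thesis using that by (simp add: T_def sg_def dist_norm norm_minus_commute)
      qed
      have uh: "u y \<le> h" if "y \<in> C" "y \<in> ball x \<rho>" for y
      proof -
        have y: "y \<in> T" "sg y \<ge> \<sigma> / 2" using dist[OF that] by auto
        have "(\<sigma> / 2)\<^sup>2 * u y \<le> (sg y)\<^sup>2 * u y" using y(2) \<sigma> u_nonneg[of y] by (intro mult_right_mono power_mono) auto
        also have "\<dots> \<le> W" using vW[OF y(1)] by (simp add: v_def)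
        finally have "\<sigma>\<^sup>2 * u y \<le> 4 * W" by (simp add: power_divide)
        then have "u y \<le> 4 * W / \<sigma>\<^sup>2" using \<sigma> by (simp add: le_divide_eq mult.commute)
        then show ?thesis by (simp add: h_def)
      qed
      have xfar: "norm x > 1 + \<rho>" "norm x \<ge> 2 * \<rho>"
        using Tn(1)[OF x] mult_nonneg_nonneg[of \<sigma> R] R \<sigma> unfolding \<rho>_def \<sigma>_def[symmetric] by linarith+
      have "excess 1 x s \<rho> \<le> (LINT x|lborel. indicator (C \<inter> ball x0 (norm x0 / 2)) x * \<phi> h x ^ N)"
        unfolding excess_def
      proof (rule integral_mono[OF _ \<phi>_ball_integrable[OF h]])
        show "integrable lborel (\<lambda>y. indicator (C \<inter> ball x \<rho>) y * max 0 (1 * u y - s) ^ N)"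
          using xfar by (intro excess_integrable[where \<rho>=\<rho>]) auto
        fix y
        show "indicator (C \<inter> ball x \<rho>) y * max 0 (1 * u y - s) ^ N \<le> indicator (C \<inter> ball x0 (norm x0 / 2)) y * \<phi> h y ^ N"
        proof (cases "y \<in> C \<inter> ball x \<rho>")
          case True
          then have y: "y \<in> T" using dist by blast
          have "norm y \<ge> 3" using Tn(1)[OF y] mult_nonneg_nonneg[of "sg y" R] sg(1)[OF y] R by linarith
          moreover have "clamp s h (u y) = max 0 (1 * u y - s)" using uh[of y] True s_pos h by (simp add: clamp_eq max.commute)
          ultimately have "\<phi> h y = max 0 (1 * u y - s)" using e0_props(4)[of y] by (simp add: \<phi>_def)
          then show ?thesis using y True by (simp add: T_def R_def)
        qed (use \<phi>_bounds(1)[OF h, of y] in simp)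
      qed
      also have "\<dots> \<le> CU * R ^ N * ln R ^ (N - 1) * h" using mass[OF h, of x0] x0 by (simp add: R_def)
      also have "\<dots> \<le> cDG * (\<rho> * d) ^ N"
      proof -
        \<comment> \<open>Uses 2 (N - 1) \<ge> N and \<sigma> \<le> 1. The square in the weight
          makes q compensate the loss of \<sigma>^N in the volume of the ball.\<close>
        have "(\<sigma>\<^sup>2) ^ (N - 1) \<le> \<sigma> ^ N"
          unfolding power_mult[symmetric] using \<sigma> N2 by (intro power_decreasing) auto
        have "q ^ (N - 1) * (\<sigma>\<^sup>2) ^ (N - 1) = (Q * ln R) ^ (N - 1)"
          using \<sigma> by (simp add: q_def power_mult_distrib[symmetric])
        moreover have "Q * ln R ^ (N - 1) \<le> (Q * ln R) ^ (N - 1)"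
          unfolding power_mult_distrib using Q lnR N2 power_increasing[of 1 "N - 1" Q] by (intro mult_right_mono) auto
        ultimately have "Q * ln R ^ (N - 1) \<le> q ^ (N - 1) * (\<sigma>\<^sup>2) ^ (N - 1)" by simp
        also have "\<dots> \<le> q ^ (N - 1) * \<sigma> ^ N" using q \<open>(\<sigma>\<^sup>2) ^ (N - 1) \<le> \<sigma> ^ N\<close> by (intro mult_left_mono) auto
        finally have 1: "Q * ln R ^ (N - 1) \<le> q ^ (N - 1) * \<sigma> ^ N" .
        have "q ^ (N - 1) * (h / 16) \<le> d ^ (N - 1) * d" using d q h by (intro mult_mono power_mono) auto
        also have "\<dots> = d ^ N" using Npos by (rule power_minus_mult)
        finally have 2: "q ^ (N - 1) * (h / 16) \<le> d ^ N" .
        have "CU * R ^ N * ln R ^ (N - 1) * h \<le> (cDG / 2 ^ N / 16 * Q) * R ^ N * ln R ^ (N - 1) * h"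
          using QC R lnR h by (intro mult_right_mono) auto
        also have "\<dots> = cDG / 2 ^ N * R ^ N * (h / 16) * (Q * ln R ^ (N - 1))" by simp
        also have "\<dots> \<le> cDG / 2 ^ N * R ^ N * (h / 16) * (q ^ (N - 1) * \<sigma> ^ N)"
          using 1 cDG_pos R h by (intro mult_left_mono) auto
        also have "\<dots> = cDG / 2 ^ N * R ^ N * \<sigma> ^ N * (q ^ (N - 1) * (h / 16))" by simp
        also have "\<dots> \<le> cDG / 2 ^ N * R ^ N * \<sigma> ^ N * d ^ N"
          using 2 cDG_pos R \<sigma> by (intro mult_left_mono) auto
        also have "\<dots> = cDG * (\<rho> * d) ^ N" by (simp add: \<rho>_def power_mult_distrib power_divide)
        finally show ?thesis .
      qed
      finally have small: "excess 1 x s \<rho> \<le> cDG * (\<rho> * d) ^ N" .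
      have "u x \<le> s + d"
        using de_giorgi[OF xfar \<rho> _ d(1) small, of x] x \<rho> by (auto simp: T_def)
      then have "v x \<le> \<sigma>\<^sup>2 * (s + d)" unfolding v_def \<sigma>_def by (intro mult_left_mono) auto
      also have "\<dots> = \<sigma>\<^sup>2 * s + (4 * W + \<sigma>\<^sup>2) / 16 + Q * ln R" using \<sigma> by (simp add: d_def h_def q_def distrib_left add_divide_distrib)
      also have "\<dots> \<le> s + (4 * W + 1) / 16 + Q * ln R"
      proof -
        have "\<sigma>\<^sup>2 * s \<le> 1 * s" using \<sigma>21 s_pos by (intro mult_right_mono) auto
        moreover have "(4 * W + \<sigma>\<^sup>2) / 16 \<le> (4 * W + 1) / 16" using \<sigma>21 by (intro divide_right_mono) auto
        ultimately show ?thesis by (intro add_mono) auto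
      qed
      finally show ?thesis .
    qed
    \<comment> \<open>Only a quarter of \<open>W\<close> returns on the right-hand side.\<close>
    have "W \<le> s + (4 * W + 1) / 16 + Q * ln R"
      unfolding W_def[of] using x0T main by (intro cSup_least) (auto simp: W_def)
    moreover have "(4 * W + 1) / 16 = W / 4 + 1 / 16" by simp
    moreover have "0 \<le> Q * ln R" using Q lnR by simp
    ultimately have "W \<le> 2 * s + 1 + 2 * (Q * ln R)" using s_pos by linarith
    moreover have "v x0 = u x0 / 4" by (simp add: v_def sg_def power2_eq_square)
    ultimately have "u x0 \<le> 8 * s + 4 + 8 * (Q * ln R)" using vW[OF x0T] by linarith
    also have "\<dots> \<le> (8 * s + 4) * ln R + 8 * (Q * ln R)" using lnR s_pos mult_left_mono[OF lnR, of "8 * s + 4"] by simp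
    finally show "u x0 \<le> (8 * s + 4 + 8 * Q) * ln (norm x0)" by (simp add: R_def algebra_simps)
  qed
qed

text \<open>Twice the constant that the double integral over x and y yields, so that a failure of
  the bound for every y is contradictory. The value at a good y takes the role of the mean
  value.\<close>

definition cP where "cP = 2 ^ (N + 2) * (Bmax / a\<^sub>0)"

text \<open>
  For \<open>x\<close> and \<open>y\<close> in the cone so is \<open>x + y\<close>, and \<open>\<phi> x - \<phi> y\<close> is compared through \<open>\<phi> (x + y)\<close>.
\<close>

lemma poincare:
  assumes h: "h > 0" and r: "r > 0"
  shows "\<exists>y\<in>C \<inter> ball 0 r. (\<integral>\<^sup>+x. indicator (C \<inter> ball 0 r) x * ennreal (\<bar>\<phi> h x - \<phi> h y\<bar> ^ N) \<partial>lborel) \<le> ennreal (cP * r ^ N * h)"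
proof (rule ccontr)
  assume "\<not> ?thesis"
  then have gt: "\<And>y. y \<in> C \<inter> ball 0 r \<Longrightarrow> ennreal (cP * r ^ N * h) < (\<integral>\<^sup>+x. indicator (C \<inter> ball 0 r) x * ennreal (\<bar>\<phi> h x - \<phi> h y\<bar> ^ N) \<partial>lborel)"
    by (auto simp: not_le)
  define D where "D = C \<inter> ball 0 r"
  have [measurable]: "D \<in> sets borel" using C_open by (auto simp: D_def)
  define c where "c = r ^ N * (h * Bmax / a\<^sub>0)"
  have c: "c > 0" using r h Bmax_pos a0 by (simp add: c_def)
  define m where "m = cC * r ^ N"
  have m: "m > 0" using cC_pos r by (simp add: m_def)
  have eD: "emeasure lborel D = ennreal m" unfolding D_def m_def by (rule emeasure_cone_ball[OF r])
  have a: "(\<integral>\<^sup>+x. indicator D x * ennreal (\<bar>\<phi> h (x + y) - \<phi> h x\<bar> ^ N) \<partial>lborel) \<le> ennreal c" if y: "y \<in> D" for y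
  proof -
    define D2 where "D2 = C \<inter> ball 0 (2 * r)"
    have D2m [measurable]: "D2 \<in> sets borel" using C_open by (auto simp: D2_def)
    have "(\<integral>\<^sup>+x. indicator D x * ennreal (\<bar>\<phi> h (1 *\<^sub>R x + y) - \<phi> h x\<bar> ^ N) \<partial>lborel)
      \<le> ennreal (r ^ N) * (\<integral>\<^sup>+x. indicator D2 x * ennreal (q h x * norm (g x) ^ N) \<partial>lborel)"
    proof (rule \<phi>_le[OF h, where R="2 * r"])
      show "D2 \<subseteq> C" "D2 \<subseteq> ball 0 (2 * r)" by (auto simp: D2_def)
      fix x assume x: "x \<in> D"
      show "norm ((1 - 1) *\<^sub>R x + y) \<le> r" using y by (simp add: D_def)
      fix t :: real assume t: "0 \<le> t" "t \<le> 1"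
      have "x + t *\<^sub>R y \<in> C" using x y t C_add[of x "t *\<^sub>R y"] C_scale[of y t] by (cases "t = 0") (auto simp: D_def)
      moreover have "norm (x + t *\<^sub>R y) < 2 * r"
      proof -
        have "norm (t *\<^sub>R y) \<le> norm y" using t mult_right_mono[of t 1 "norm y"] by simp
        then show ?thesis using norm_triangle_ineq[of x "t *\<^sub>R y"] x y by (auto simp: D_def)
      qed
      ultimately show "(1 + t * (1 - 1)) *\<^sub>R x + t *\<^sub>R y \<in> D2" by (simp add: D2_def)
    qed auto
    also have "(\<integral>\<^sup>+x. indicator D2 x * ennreal (q h x * norm (g x) ^ N) \<partial>lborel) \<le> (\<integral>\<^sup>+x. ennreal (q h x * norm (g x) ^ N) \<partial>lborel)"
      by (intro nn_integral_mono) (auto simp: indicator_def)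
    also have "\<dots> = ennreal (E h)" unfolding E_def using qg_integrable[OF h] q_bounds(1)[OF h]
      by (intro nn_integral_eq_integral) auto
    also have "\<dots> \<le> ennreal (h * Bmax / a\<^sub>0)" by (intro ennreal_leI E_le_max h)
    also have "ennreal (r ^ N) * \<dots> = ennreal c" using r h Bmax_pos a0 ennreal_mult[of "r ^ N" "h * Bmax / a\<^sub>0"] by (simp add: c_def)
    finally show ?thesis by (simp add: mult_left_mono)
  qed
  have aint: "(\<integral>\<^sup>+y. indicator D y * (\<integral>\<^sup>+x. indicator D x * ennreal (\<bar>\<phi> h (x + y) - \<phi> h x\<bar> ^ N) \<partial>lborel) \<partial>lborel) \<le> ennreal c * ennreal m"
  proof -
    have "(\<integral>\<^sup>+y. indicator D y * (\<integral>\<^sup>+x. indicator D x * ennreal (\<bar>\<phi> h (x + y) - \<phi> h x\<bar> ^ N) \<partial>lborel) \<partial>lborel) \<le> (\<integral>\<^sup>+y. ennreal c * indicator D y \<partial>lborel)"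
      using a by (intro nn_integral_mono) (auto simp: indicator_def)
    then show ?thesis by (simp add: nn_integral_cmult eD)
  qed
  define I where "I = (\<integral>\<^sup>+y. indicator D y * (\<integral>\<^sup>+x. indicator D x * ennreal (\<bar>\<phi> h x - \<phi> h y\<bar> ^ N) \<partial>lborel) \<partial>lborel)"
  have "I \<le> (\<integral>\<^sup>+y. \<integral>\<^sup>+x. ennreal (2 ^ N) * (indicator D y * (indicator D x * ennreal (\<bar>\<phi> h (x + y) - \<phi> h x\<bar> ^ N))) + ennreal (2 ^ N) * (indicator D x * (indicator D y * ennreal (\<bar>\<phi> h (y + x) - \<phi> h y\<bar> ^ N))) \<partial>lborel \<partial>lborel)"
    unfolding I_def
  proof (rule nn_integral_mono)
    fix y :: "real^'n"
    have "indicator D y * (\<integral>\<^sup>+x. indicator D x * ennreal (\<bar>\<phi> h x - \<phi> h y\<bar> ^ N) \<partial>lborel) = (\<integral>\<^sup>+x. indicator D y * (indicator D x * ennreal (\<bar>\<phi> h x - \<phi> h y\<bar> ^ N)) \<partial>lborel)"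
      by (simp add: nn_integral_cmult)
    also have "\<dots> \<le> (\<integral>\<^sup>+x. ennreal (2 ^ N) * (indicator D y * (indicator D x * ennreal (\<bar>\<phi> h (x + y) - \<phi> h x\<bar> ^ N))) + ennreal (2 ^ N) * (indicator D x * (indicator D y * ennreal (\<bar>\<phi> h (y + x) - \<phi> h y\<bar> ^ N))) \<partial>lborel)"
    proof (rule nn_integral_mono)
      fix x
      have "\<bar>\<phi> h x - \<phi> h y\<bar> ^ N \<le> (\<bar>\<phi> h (x + y) - \<phi> h x\<bar> + \<bar>\<phi> h (y + x) - \<phi> h y\<bar>) ^ N"
        by (intro power_mono) (auto simp: add.commute)
      also have "\<dots> \<le> 2 ^ N * (\<bar>\<phi> h (x + y) - \<phi> h x\<bar> ^ N + \<bar>\<phi> h (y + x) - \<phi> h y\<bar> ^ N)" by (intro power_add_le) auto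
      finally have "ennreal (\<bar>\<phi> h x - \<phi> h y\<bar> ^ N) \<le> ennreal (2 ^ N) * ennreal (\<bar>\<phi> h (x + y) - \<phi> h x\<bar> ^ N) + ennreal (2 ^ N) * ennreal (\<bar>\<phi> h (y + x) - \<phi> h y\<bar> ^ N)"
        by (simp add: distrib_left flip: ennreal_mult ennreal_plus)
      then show "indicator D y * (indicator D x * ennreal (\<bar>\<phi> h x - \<phi> h y\<bar> ^ N)) \<le> ennreal (2 ^ N) * (indicator D y * (indicator D x * ennreal (\<bar>\<phi> h (x + y) - \<phi> h x\<bar> ^ N))) + ennreal (2 ^ N) * (indicator D x * (indicator D y * ennreal (\<bar>\<phi> h (y + x) - \<phi> h y\<bar> ^ N)))"
        by (auto simp: indicator_def)
    qed
    finally show "indicator D y * (\<integral>\<^sup>+x. indicator D x * ennreal (\<bar>\<phi> h x - \<phi> h y\<bar> ^ N) \<partial>lborel) \<le> (\<integral>\<^sup>+x. ennreal (2 ^ N) * (indicator D y * (indicator D x * ennreal (\<bar>\<phi> h (x + y) - \<phi> h x\<bar> ^ N))) + ennreal (2 ^ N) * (indicator D x * (indicator D y * ennreal (\<bar>\<phi> h (y + x) - \<phi> h y\<bar> ^ N))) \<partial>lborel)" .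
  qed
  also have "\<dots> = (\<integral>\<^sup>+y. \<integral>\<^sup>+x. ennreal (2 ^ N) * (indicator D y * (indicator D x * ennreal (\<bar>\<phi> h (x + y) - \<phi> h x\<bar> ^ N))) \<partial>lborel \<partial>lborel)
     + (\<integral>\<^sup>+y. \<integral>\<^sup>+x. ennreal (2 ^ N) * (indicator D x * (indicator D y * ennreal (\<bar>\<phi> h (y + x) - \<phi> h y\<bar> ^ N))) \<partial>lborel \<partial>lborel)"
    by (simp add: nn_integral_add)
  also have "(\<integral>\<^sup>+y. \<integral>\<^sup>+x. ennreal (2 ^ N) * (indicator D x * (indicator D y * ennreal (\<bar>\<phi> h (y + x) - \<phi> h y\<bar> ^ N))) \<partial>lborel \<partial>lborel)
     = (\<integral>\<^sup>+x. \<integral>\<^sup>+y. ennreal (2 ^ N) * (indicator D x * (indicator D y * ennreal (\<bar>\<phi> h (y + x) - \<phi> h y\<bar> ^ N))) \<partial>lborel \<partial>lborel)"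
    by (rule lborel_pair.Fubini') measurable
  also have "(\<integral>\<^sup>+y. \<integral>\<^sup>+x. ennreal (2 ^ N) * (indicator D y * (indicator D x * ennreal (\<bar>\<phi> h (x + y) - \<phi> h x\<bar> ^ N))) \<partial>lborel \<partial>lborel)
     = ennreal (2 ^ N) * (\<integral>\<^sup>+y. indicator D y * (\<integral>\<^sup>+x. indicator D x * ennreal (\<bar>\<phi> h (x + y) - \<phi> h x\<bar> ^ N) \<partial>lborel) \<partial>lborel)"
    by (simp add: nn_integral_cmult)
  finally have "I \<le> ennreal (2 ^ N) * (ennreal c * ennreal m) + ennreal (2 ^ N) * (ennreal c * ennreal m)"
    using aint by (elim order_trans) (intro add_mono mult_left_mono, auto)
  also have "\<dots> = ennreal (2 ^ N * (c * m) + 2 ^ N * (c * m))" using c m by (simp flip: ennreal_mult ennreal_plus)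
  finally have up: "I \<le> ennreal (2 ^ N * (c * m) + 2 ^ N * (c * m))" .
  have cp: "cP * r ^ N * h = 4 * 2 ^ N * c" by (simp add: cP_def c_def power_add)
  have "ennreal (4 * 2 ^ N * c) * ennreal m = (\<integral>\<^sup>+y. ennreal (4 * 2 ^ N * c) * indicator D y \<partial>lborel)" by (simp add: nn_integral_cmult eD)
  also have "\<dots> \<le> I" unfolding I_def
    using gt unfolding cp D_def[symmetric] by (intro nn_integral_mono) (auto simp: indicator_def less_imp_le)
  finally have "ennreal (4 * 2 ^ N * c) * ennreal m \<le> ennreal (2 ^ N * (c * m) + 2 ^ N * (c * m))" using up by (rule order_trans)
  then have "4 * 2 ^ N * c * m \<le> 2 ^ N * (c * m) + 2 ^ N * (c * m)" using c m by (simp flip: ennreal_mult)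
  moreover have "2 ^ N * (c * m) > 0" using c m by simp
  ultimately show False by (simp add: mult_ac)
qed

end

section \<open>Lower bound\<close>

context conormal_s
begin

text \<open>By the upper bound, a truncation height of order ln R leaves u uncut up to radius 4 R,
  and Poincare compares it with a constant k up to an error of order R^N ln R. Applying De Giorgi to
  u and to -u with d = \<epsilon> ln R turns this into pointwise bounds. The asymmetric s comes from
  the positive part of u - s.\<close>

lemma oscillation:
  assumes \<epsilon>: "\<epsilon> > 0"
  shows "\<exists>R0. \<forall>R\<ge>R0. \<exists>k\<ge>0. \<forall>x\<in>C. R / 2 \<le> norm x \<longrightarrow> norm x \<le> R \<longrightarrow> k - \<epsilon> * ln R \<le> u x \<and> u x \<le> s + k + \<epsilon> * ln R"
proof -
  obtain L where L: "L > 0" "\<And>x. x \<in> C \<Longrightarrow> norm x \<ge> 12 \<Longrightarrow> u x \<le> L * ln (norm x)" using upper_bound by blast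
  obtain M0 where M0: "\<And>x. x \<in> C \<Longrightarrow> 2 \<le> norm x \<Longrightarrow> norm x \<le> 12 \<Longrightarrow> u x \<le> M0"
    using u_locally_bounded[of 12] by auto
  define M where "M = max M0 1"
  have M: "M \<ge> 1" "\<And>x. x \<in> C \<Longrightarrow> 2 \<le> norm x \<Longrightarrow> norm x \<le> 12 \<Longrightarrow> u x \<le> M"
    using M0 by (force simp: M_def)+
  define CH where "CH = M + 4 * L"
  have CH: "CH > 0" using M L by (simp add: CH_def)
  have cP: "cP > 0" unfolding cP_def using Bmax_pos a0 by simp
  \<comment> \<open>Once ln R exceeds this, d = \<epsilon> ln R is at least 1 and the Poincare error
    lies below the De Giorgi threshold.\<close>
  define Tt where "Tt = max (1 / \<epsilon>) (cP * 2 ^ N * CH * 4 ^ N / (cDG * \<epsilon>\<^sup>2))"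
  show ?thesis
  proof (rule exI[of _ "max 12 (exp Tt)"], intro allI impI)
    fix R assume R': "R \<ge> max 12 (exp Tt)"
    then have R: "R \<ge> 12" by simp
    have lnR: "ln R \<ge> 1" using R by (intro ln_ge_1) auto
    have "exp Tt \<le> R" using R' by simp
    then have T: "ln R \<ge> Tt" using R by (simp add: ln_ge_iff)
    define d where "d = \<epsilon> * ln R"
    have "1 / \<epsilon> \<le> ln R" "cP * 2 ^ N * CH * 4 ^ N / (cDG * \<epsilon>\<^sup>2) \<le> ln R" using T by (auto simp: Tt_def)
    then have d1: "d \<ge> 1" and T2: "cP * 2 ^ N * CH * 4 ^ N \<le> ln R * (cDG * \<epsilon>\<^sup>2)"
      using \<epsilon> cDG_pos by (auto simp: d_def field_simps)
    define h where "h = M + L * ln (4 * R)"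
    have ln4R: "ln (4 * R) \<le> 4 * ln R" "ln (4 * R) \<ge> 0"
    proof -
      have "ln (4 * R) = ln 4 + ln R" using R by (simp add: ln_mult)
      moreover have "ln 4 \<le> (3::real)" using ln_le_minus_one[of 4] by simp
      ultimately show "ln (4 * R) \<le> 4 * ln R" using lnR by linarith
      show "ln (4 * R) \<ge> 0" using R by simp
    qed
    have h: "h > 0" unfolding h_def using M L ln4R by (intro add_pos_nonneg) auto
    have hle: "h \<le> CH * ln R"
    proof -
      have "M \<le> M * ln R" using M lnR by simp
      moreover have "L * ln (4 * R) \<le> L * (4 * ln R)" using L ln4R by (intro mult_left_mono) auto
      ultimately show ?thesis by (simp add: h_def CH_def distrib_right)
    qed
    have uh: "u x \<le> h" if "x \<in> C" "3 \<le> norm x" "norm x \<le> 4 * R" for x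
    proof (cases "norm x \<le> 12")
      case True
      then have "u x \<le> M" using M(2) that by simp
      then show ?thesis unfolding h_def using mult_nonneg_nonneg[of L "ln (4 * R)"] L(1) ln4R by linarith
    next
      case False
      then have "u x \<le> L * ln (norm x)" using L(2) that by simp
      also have "\<dots> \<le> L * ln (4 * R)"
      proof (rule mult_left_mono)
        show "ln (norm x) \<le> ln (4 * R)" by (rule ln_mono) (use that False in linarith)+
      qed (use L(1) in simp)
      finally show ?thesis unfolding h_def using M by linarith
    qed
    have \<phi>u: "\<phi> h x = max 0 (u x - s)" if "x \<in> C" "3 \<le> norm x" "norm x \<le> 4 * R" for x
      using uh[OF that] e0_props(4)[OF that(2)] s_pos h by (simp add: \<phi>_def clamp_eq max.commute)
    \<comment> \<open>Twice the radius, so that the ball of radius |x| / 2 around each x under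
      consideration stays inside.\<close>
    define r where "r = 2 * R"
    have r: "r > 0" using R by (simp add: r_def)
    obtain y where y: "y \<in> C \<inter> ball 0 r" "(\<integral>\<^sup>+x. indicator (C \<inter> ball 0 r) x * ennreal (\<bar>\<phi> h x - \<phi> h y\<bar> ^ N) \<partial>lborel) \<le> ennreal (cP * r ^ N * h)"
      using poincare[OF h r] by blast
    define k where "k = \<phi> h y"
    have k0: "k \<ge> 0" using \<phi>_bounds(1)[OF h] by (simp add: k_def)
    show "\<exists>k\<ge>0. \<forall>x\<in>C. R / 2 \<le> norm x \<longrightarrow> norm x \<le> R \<longrightarrow> k - \<epsilon> * ln R \<le> u x \<and> u x \<le> s + k + \<epsilon> * ln R"
    proof (intro exI[of _ k] conjI[OF k0] ballI impI)
      fix x assume x: "x \<in> C" "R / 2 \<le> norm x" "norm x \<le> R"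
      define \<rho> where "\<rho> = norm x / 2"
      have \<rho>: "\<rho> > 0" "\<rho> \<ge> R / 4" using x R by (auto simp: \<rho>_def)
      have far: "norm x > 1 + \<rho>" "norm x \<ge> 2 * \<rho>" using x R by (auto simp: \<rho>_def)
      have ball: "3 \<le> norm z \<and> norm z \<le> 4 * R \<and> z \<in> C \<inter> ball 0 r" if "z \<in> C" "z \<in> ball x \<rho>" for z
        using that x R norm_triangle_ineq2[of x z] norm_triangle_ineq2[of z x]
        by (auto simp: \<rho>_def dist_norm norm_minus_commute r_def)
      have est: "excess \<sigma> x kk \<rho> \<le> cDG * (\<rho> * d) ^ N"
        if \<sigma>: "\<bar>\<sigma>\<bar> = 1" and le: "\<And>z. z \<in> C \<Longrightarrow> z \<in> ball x \<rho> \<Longrightarrow> max 0 (\<sigma> * u z - kk) \<le> \<bar>\<phi> h z - k\<bar>" for \<sigma> kk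
      proof -
        have "ennreal (excess \<sigma> x kk \<rho>) = (\<integral>\<^sup>+z. ennreal (indicator (C \<inter> ball x \<rho>) z * max 0 (\<sigma> * u z - kk) ^ N) \<partial>lborel)"
          unfolding excess_def using excess_integrable[OF far(1) order_refl \<sigma>] by (intro nn_integral_eq_integral[symmetric]) auto
        also have "\<dots> \<le> (\<integral>\<^sup>+x. indicator (C \<inter> ball 0 r) x * ennreal (\<bar>\<phi> h x - \<phi> h y\<bar> ^ N) \<partial>lborel)"
        proof (rule nn_integral_mono)
          fix z
          show "ennreal (indicator (C \<inter> ball x \<rho>) z * max 0 (\<sigma> * u z - kk) ^ N) \<le> indicator (C \<inter> ball 0 r) z * ennreal (\<bar>\<phi> h z - \<phi> h y\<bar> ^ N)"
          proof (cases "z \<in> C \<inter> ball x \<rho>")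
            case True
            then have "z \<in> C \<inter> ball 0 r" using ball[of z] by blast
            moreover have "max 0 (\<sigma> * u z - kk) ^ N \<le> \<bar>\<phi> h z - k\<bar> ^ N" using le[of z] True by (intro power_mono) auto
            ultimately show ?thesis using True by (simp add: k_def)
          qed simp
        qed
        also have "\<dots> \<le> ennreal (cP * r ^ N * h)" by (rule y(2))
        finally have "excess \<sigma> x kk \<rho> \<le> cP * r ^ N * h" using cP r h by (subst (asm) ennreal_le_iff) auto
        also have "\<dots> \<le> cP * r ^ N * (CH * ln R)" using cP r hle by (intro mult_left_mono) auto
        also have "\<dots> = (cP * 2 ^ N * CH * 4 ^ N) * ((R / 4) ^ N * ln R)" by (simp add: r_def power_mult_distrib power_divide)
        also have "\<dots> \<le> (ln R * (cDG * \<epsilon>\<^sup>2)) * ((R / 4) ^ N * ln R)" using T2 R lnR by (intro mult_right_mono) auto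
        also have "\<dots> = cDG * ((R / 4) ^ N * d\<^sup>2)" by (simp add: d_def power2_eq_square)
        also have "\<dots> \<le> cDG * (\<rho> ^ N * d ^ N)"
          using cDG_pos R \<rho> d1 N2 by (intro mult_left_mono mult_mono power_mono power_increasing) auto
        finally show ?thesis by (simp add: power_mult_distrib)
      qed
      have "excess 1 x (s + k) \<rho> \<le> cDG * (\<rho> * d) ^ N"
      proof (rule est)
        fix z assume z: "z \<in> C" "z \<in> ball x \<rho>"
        then have "\<phi> h z = max 0 (u z - s)" using ball[OF z] by (intro \<phi>u) auto
        then show "max 0 (1 * u z - (s + k)) \<le> \<bar>\<phi> h z - k\<bar>" using k0 by (simp add: max_def abs_if)
      qed simp
      from de_giorgi[OF far \<rho>(1) _ d1 this x(1)] \<rho>(1)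
      have 1: "u x \<le> s + k + d" by simp
      have "excess (-1) x (- k) \<rho> \<le> cDG * (\<rho> * d) ^ N"
      proof (rule est)
        fix z assume z: "z \<in> C" "z \<in> ball x \<rho>"
        then have "\<phi> h z = max 0 (u z - s)" using ball[OF z] by (intro \<phi>u) auto
        then show "max 0 ((-1) * u z - (- k)) \<le> \<bar>\<phi> h z - k\<bar>" using s_pos u_nonneg[of z] by (simp add: max_def abs_if)
      qed simp
      from de_giorgi[OF far \<rho>(1) _ d1 this x(1)] \<rho>(1)
      have 2: "k - d \<le> u x" by simp
      from 1 2 show "k - \<epsilon> * ln R \<le> u x \<and> u x \<le> s + k + \<epsilon> * ln R" by (simp add: d_def)
    qed
  qed
qed

section \<open>Energy in distant annuli\<close>

lemma annulus_g_integrable: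
  assumes "j \<ge> 1"
  shows "integrable lborel (\<lambda>x. indicator (annulus j) x * norm (g x) ^ N)"
proof -
  have S: "compact (shell (2 ^ Suc j))" "shell (2 ^ Suc j) \<subseteq> - cball 0 1"
    by (auto simp: shell_def compact_diff)
  have "(2::real) ^ 1 \<le> 2 ^ j" using assms by (intro power_increasing) auto
  then have "annulus j \<subseteq> shell (2 ^ Suc j)" by (auto simp: annulus_def shell_def)
  then show ?thesis
    by (intro Bochner_Integration.integrable_bound[OF g_LN[OF S]]) (auto simp: indicator_def)
qed

lemma annulus_measure_le: "measure lborel (annulus j) \<le> cC * (2 ^ Suc j) ^ N"
proof -
  have "emeasure lborel (annulus j) \<le> emeasure lborel (C \<inter> ball 0 (2 ^ Suc j))"
    using C_open by (intro emeasure_mono) (auto simp: annulus_def)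
  also have "\<dots> = ennreal (cC * (2 ^ Suc j) ^ N)" by (rule emeasure_cone_ball) simp
  finally show ?thesis using cC_pos annulus_finite[of j] by (simp add: emeasure_eq_ennreal_measure less_top)
qed

text \<open>A cutoff alone as test function shows that the flux through every distant annulus is at
  least \<open>B 1\<close>. Young bounds the flux by \<tau> times the energy plus a term independent
  of the radius, because the cutoff gradient and the volume of the annulus scale inversely; a large
  \<tau> pushes that term below half of \<open>B 1\<close>.\<close>

lemma energy_lower:
  obtains c J where "c > 0" "J \<ge> 2" "\<And>j. j \<ge> J \<Longrightarrow> c \<le> (LINT x|lborel. indicator (annulus j) x * norm (g x) ^ N)"
proof -
  obtain R1 where R1: "R1 \<ge> 3" "\<And>x. x \<in> C \<Longrightarrow> norm x \<ge> R1 \<Longrightarrow> u x \<ge> s + 1" using u_large[of "s + 1"] by blast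
  obtain j1 where j1: "R1 < 2 ^ j1" using real_arch_pow[of 2 R1] by auto
  define J where "J = max 2 j1"
  define b where "b = B 1"
  have b: "b > 0" unfolding b_def by (rule B_pos) simp
  \<comment> \<open>Bound for the volume of the annulus times \<open>(8 / r) ^ N\<close>, uniform in
    r.\<close>
  define Z where "Z = cC * 16 ^ N"
  have Z: "Z > 0" using cC_pos by (simp add: Z_def)
  define \<tau> where "\<tau> = 1 + 2 * a\<^sub>1 * Z / b"
  have \<tau>: "\<tau> \<ge> 1" using a1 Z b by (simp add: \<tau>_def)
  have main: "b / (2 * a\<^sub>1 * \<tau>) \<le> (LINT x|lborel. indicator (annulus j) x * norm (g x) ^ N)" if j: "j \<ge> J" for j
  proof -
    define r where "r = (2::real) ^ j"
    have "(2::real) ^ j1 \<le> r" unfolding r_def using j by (intro power_increasing) (auto simp: J_def)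
    moreover have "(2::real) ^ 2 \<le> r" unfolding r_def using j by (intro power_increasing) (auto simp: J_def)
    ultimately have r: "r \<ge> R1" "r \<ge> 4" using j1 by auto
    have R2: "3 \<le> r" "r < 2 * r" using r by auto
    note C1 = eR_C1c[OF R2]
    note ep = eR_props[OF R2]
    have r0: "0 \<le> r" using r by simp
    note cp = cut_props[OF r0 R2(2), where ?x0.0="0::real^'n"]
    have n1: "nice (\<lambda>t. 1) (\<lambda>t. 0)" using nice_clamp[of 1 1 1 0 0] by simp
    have W: "(LINT x|lborel. F x \<bullet> DeR r (2 * r) x) = - (LINT x|lborel. f x * eR r (2 * r) x)"
      using testable_weak[OF testable_nice[OF C1 n1]] by simp
    have iD: "integrable lborel (\<lambda>x. F x \<bullet> DeR r (2 * r) x)"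
      using nice_integrable(2)[OF C1 n1] by simp
    have split: "F x \<bullet> DeR r (2 * r) x = F x \<bullet> De0 x + F x \<bullet> Dcut 0 r (2 * r) x" for x
      using ep(4,5)[of x] cp(5)[of x] e0_props(6)[of x] r by (cases "norm x \<le> r") auto
    have iC: "integrable lborel (\<lambda>x. F x \<bullet> Dcut 0 r (2 * r) x)"
    proof -
      have "(\<lambda>x. F x \<bullet> Dcut 0 r (2 * r) x) = (\<lambda>x. F x \<bullet> DeR r (2 * r) x - F x \<bullet> De0 x)" using split by auto
      then show ?thesis using iD De0_integrable by simp
    qed
    have "A0 + (LINT x|lborel. F x \<bullet> Dcut 0 r (2 * r) x) = - (LINT x|lborel. f x * eR r (2 * r) x)"
      unfolding W[symmetric] split A0_def using De0_integrable iC by simp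
    \<comment> \<open>The source weighted by the cutoff is at least that in \<open>B 1\<close>:
      beyond radius r, where u \<ge> s + 1, the function \<open>G 1\<close> vanishes on the
      cone.\<close>
    moreover have "(LINT x|lborel. f x * (e0 x * G 1 x)) \<le> (LINT x|lborel. f x * eR r (2 * r) x)"
    proof (rule integral_mono[OF fG_integrable])
      show "integrable lborel (\<lambda>x. f x * eR r (2 * r) x)"
      proof (rule Bochner_Integration.integrable_bound[OF f_int])
        show "AE x in lborel. norm (f x * eR r (2 * r) x) \<le> norm (f x)"
          using ep(1,2) f_nonneg by (intro AE_I2) (auto simp: mult_left_le)
        show "(\<lambda>x. f x * eR r (2 * r) x) \<in> borel_measurable lborel"
        proof -
          have [measurable]: "eR r (2 * r) \<in> borel_measurable borel"
            using C1cD(3)[OF C1(1)] by (rule borel_measurable_continuous_onI)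
          show ?thesis by measurable
        qed
      qed
      fix x
      show "f x * (e0 x * G 1 x) \<le> f x * eR r (2 * r) x"
      proof (cases "x \<in> C")
        case True
        have "e0 x * G 1 x \<le> eR r (2 * r) x"
        proof (cases "norm x \<le> r")
          case True
          then show ?thesis using ep(3)[of x] e0_props(1)[of x] G_bounds[of 1 x] by (simp add: mult_left_le)
        next
          case False
          then have "clamp s 1 (u x) = 1" using R1(2)[OF True] r by (simp add: clamp_eq)
          then show ?thesis using ep(1)[of x] by (simp add: G_def)
        qed
        then show ?thesis using f_nonneg by (intro mult_left_mono) auto
      next
        case False
        then show ?thesis using f_zero by simp
      qed
    qed simp
    ultimately have "b \<le> - (LINT x|lborel. F x \<bullet> Dcut 0 r (2 * r) x)" by (simp add: b_def B_def)
    also have "\<dots> = (LINT x|lborel. - (F x \<bullet> Dcut 0 r (2 * r) x))" by simp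
    also have "\<dots> \<le> (LINT x|lborel. a\<^sub>1 * (\<tau> * (indicator (annulus j) x * norm (g x) ^ N) + (1 / \<tau>) ^ (N - 1) * ((8 / r) ^ N * indicator (annulus j) x)))"
    proof (rule integral_mono)
      show "integrable lborel (\<lambda>x. - (F x \<bullet> Dcut 0 r (2 * r) x))" using iC by simp
      show "integrable lborel (\<lambda>x. a\<^sub>1 * (\<tau> * (indicator (annulus j) x * norm (g x) ^ N) + (1 / \<tau>) ^ (N - 1) * ((8 / r) ^ N * indicator (annulus j) x)))"
        using annulus_g_integrable[of j] annulus_finite[of j] j
        by (intro integrable_mult_right Bochner_Integration.integrable_add integrable_real_indicator) (auto simp: J_def)
      fix x
      show "- (F x \<bullet> Dcut 0 r (2 * r) x) \<le> a\<^sub>1 * (\<tau> * (indicator (annulus j) x * norm (g x) ^ N) + (1 / \<tau>) ^ (N - 1) * ((8 / r) ^ N * indicator (annulus j) x))"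
      proof (cases "x \<in> annulus j")
        case True
        have "- (F x \<bullet> Dcut 0 r (2 * r) x) \<le> norm (F x) * norm (Dcut 0 r (2 * r) x)"
          using Cauchy_Schwarz_ineq2[of "F x" "Dcut 0 r (2 * r) x"] by linarith
        also have "\<dots> \<le> (a\<^sub>1 * norm (g x) ^ (N - 1)) * (8 / r)"
          using F_le[of x] cp(7)[of x] a1 by (intro mult_mono) auto
        also have "\<dots> = a\<^sub>1 * (norm (g x) ^ (N - 1) * (8 / r))" by simp
        also have "\<dots> \<le> a\<^sub>1 * (\<tau> * norm (g x) ^ N + (1 / \<tau>) ^ (N - 1) * (8 / r) ^ N)"
          using a1 r \<tau> by (intro mult_left_mono power_young) auto
        finally show ?thesis using True by simp
      next
        case False
        then consider "x \<notin> C" | "norm x < r" | "norm x \<ge> 2 * r" by (auto simp: annulus_def r_def not_le not_less)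
        then have "F x \<bullet> Dcut 0 r (2 * r) x = 0"
          by cases (use F_zero[of x] cp(5,6)[of x] in auto)
        then show ?thesis using False by simp
      qed
    qed
    also have "\<dots> = a\<^sub>1 * (\<tau> * (LINT x|lborel. indicator (annulus j) x * norm (g x) ^ N) + (1 / \<tau>) ^ (N - 1) * ((8 / r) ^ N * measure lborel (annulus j)))"
      using annulus_g_integrable[of j] annulus_finite[of j] j by (simp add: J_def)
    also have "(1 / \<tau>) ^ (N - 1) * ((8 / r) ^ N * measure lborel (annulus j)) \<le> 1 / \<tau> * Z"
    proof (intro mult_mono)
      have "(1 / \<tau>) ^ (N - 1) \<le> (1 / \<tau>) ^ 1" using \<tau> N2 by (intro power_decreasing) auto
      then show "(1 / \<tau>) ^ (N - 1) \<le> 1 / \<tau>" by simp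
      have "(8 / r) ^ N * measure lborel (annulus j) \<le> (8 / r) ^ N * (cC * (2 * r) ^ N)"
        using annulus_measure_le[of j] r by (intro mult_left_mono) (auto simp: r_def)
      also have "\<dots> = cC * ((8 / r) * (2 * r)) ^ N" by (simp only: power_mult_distrib mult_ac)
      also have "(8 / r) * (2 * r) = 16" using r by simp
      finally show "(8 / r) ^ N * measure lborel (annulus j) \<le> Z" by (simp add: Z_def)
    qed (use \<tau> r in auto)
    finally have "b \<le> a\<^sub>1 * (\<tau> * (LINT x|lborel. indicator (annulus j) x * norm (g x) ^ N) + 1 / \<tau> * Z)"
      using a1 by (simp add: mult_left_mono)
    then have "b \<le> a\<^sub>1 * \<tau> * (LINT x|lborel. indicator (annulus j) x * norm (g x) ^ N) + a\<^sub>1 * (1 / \<tau> * Z)"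
      by (simp only: distrib_left mult.assoc)
    moreover have "a\<^sub>1 * (1 / \<tau> * Z) \<le> b / 2"
    proof -
      have "2 * a\<^sub>1 * Z \<le> b * \<tau>" using b by (simp add: \<tau>_def distrib_left)
      then show ?thesis using \<tau> by (simp add: field_simps)
    qed
    ultimately have "b / 2 \<le> a\<^sub>1 * \<tau> * (LINT x|lborel. indicator (annulus j) x * norm (g x) ^ N)"
      by linarith
    then show ?thesis using a1 \<tau> by (simp add: field_simps)
  qed
  show ?thesis
    by (rule that[of "b / (2 * a\<^sub>1 * \<tau>)" J]) (use main b a1 \<tau> in \<open>auto simp: J_def\<close>)
qed

text \<open>If u stays below m up to radius 2^n, truncation at height m + 1 keeps the full energy of
  the annuli with index from J to n - 1. Each carries at least a fixed amount, while the total is at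
  most a multiple of the height.\<close>

lemma log_lower:
  obtains c J where "c > 0" "\<And>n m. m \<ge> 0 \<Longrightarrow> (\<And>x. x \<in> C \<Longrightarrow> 3 \<le> norm x \<Longrightarrow> norm x \<le> 2 ^ n \<Longrightarrow> u x \<le> m) \<Longrightarrow> c * (real n - J) \<le> m + 1"
proof -
  obtain cE J0 where cE: "cE > 0" "J0 \<ge> 2" "\<And>j. j \<ge> J0 \<Longrightarrow> cE \<le> (LINT x|lborel. indicator (annulus j) x * norm (g x) ^ N)"
    using energy_lower by blast
  obtain R1 where R1: "R1 \<ge> 3" "\<And>x. x \<in> C \<Longrightarrow> norm x \<ge> R1 \<Longrightarrow> u x \<ge> s + 1" using u_large[of "s + 1"] by blast
  obtain j1 where j1: "R1 < 2 ^ j1" using real_arch_pow[of 2 R1] by auto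
  define J where "J = max J0 j1"
  define c where "c = cE * a\<^sub>0 / Bmax"
  have c: "c > 0" using cE a0 Bmax_pos by (simp add: c_def)
  show ?thesis
  proof (rule that[of c "real J"])
    show "c > 0" by (rule c)
    fix n m assume m: "(0::real) \<le> m" and um: "\<And>x. x \<in> C \<Longrightarrow> 3 \<le> norm x \<Longrightarrow> norm x \<le> 2 ^ n \<Longrightarrow> u x \<le> m"
    define h where "h = m + 1"
    have h: "h > 0" using m by (simp add: h_def)
    have En: "cE \<le> En h j" if "J \<le> j" "j < n" for j
    proof -
      have "indicator (annulus j) x * (q h x * norm (g x) ^ N) = indicator (annulus j) x * norm (g x) ^ N" for x
      proof (cases "x \<in> annulus j")
        case True
        have "(2::real) ^ j1 \<le> 2 ^ j" using that by (intro power_increasing) (auto simp: J_def)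
        then have "R1 \<le> 2 ^ j" using j1 by linarith
        then have x: "x \<in> C" "norm x \<ge> R1" using True by (auto simp: annulus_def)
        have "(2::real) ^ Suc j \<le> 2 ^ n" using that by (intro power_increasing) auto
        then have "norm x \<le> 2 ^ n" using True by (auto simp: annulus_def)
        then have "u x \<le> m" using um[OF x(1)] x R1(1) by simp
        moreover have "u x > s" using R1(2)[OF x] by simp
        ultimately have "dclamp s h (u x) = 1" using s_pos by (simp add: dclamp_def h_def)
        moreover have "e0 x = 1" using e0_props(4)[of x] x R1(1) by simp
        ultimately show ?thesis by (simp add: q_def)
      qed simp
      then have "En h j = (LINT x|lborel. indicator (annulus j) x * norm (g x) ^ N)" unfolding En_def by presburger
      then show ?thesis using cE(3)[of j] that by (simp add: J_def)
    qed
    show "c * (real n - real J) \<le> m + 1"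
    proof (cases "n \<le> J")
      case True
      then have "c * (real n - real J) \<le> 0" using c by (intro mult_nonneg_nonpos) auto
      then show ?thesis using m by linarith
    next
      case False
      have "cE * (real n - real J) = (\<Sum>j\<in>{J..<n}. cE)" using False by (simp add: of_nat_diff)
      also have "\<dots> \<le> (\<Sum>j\<in>{J..<n}. En h j)" using En by (intro sum_mono) auto
      also have "\<dots> \<le> (\<Sum>j<n. En h j)" using En_nonneg[OF h] by (intro sum_mono2) auto
      also have "\<dots> \<le> E h" by (rule sum_En_le[OF h])
      also have "\<dots> \<le> h * Bmax / a\<^sub>0" by (rule E_le_max[OF h])
      finally have "cE * (real n - real J) \<le> h * Bmax / a\<^sub>0" .
      then have "cE * (real n - real J) * (a\<^sub>0 / Bmax) \<le> h * Bmax / a\<^sub>0 * (a\<^sub>0 / Bmax)"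
        using a0 Bmax_pos by (intro mult_right_mono) auto
      also have "\<dots> = h" using a0 Bmax_pos by simp
      finally show ?thesis by (simp add: c_def h_def mult_ac)
    qed
  qed
qed

text \<open>Test with the positive part of u - k, truncated at 1, times a cutoff that varies only
  where u \<le> k. Since f \<ge> 0, coercivity makes the gradient vanish, and Faber-Krahn then makes
  the function itself vanish.\<close>

lemma max_principle:
  assumes R: "R \<ge> 6" and k: "k \<ge> s" and bd: "\<And>x. x \<in> C \<Longrightarrow> R / 2 \<le> norm x \<Longrightarrow> norm x \<le> R \<Longrightarrow> u x \<le> k"
    and x: "x \<in> C" "3 \<le> norm x" "norm x \<le> R"
  shows "u x \<le> k"
proof (rule ccontr)
  assume "\<not> u x \<le> k"
  then have ux: "u x > k" by simp
  then have xn: "norm x < R / 2" "norm x > 3" using bd[OF x(1)] x u_less_s[OF x(1)] k by force+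
  define r where "r = R / 2"
  have R2: "3 \<le> r" "r < R" using R by (auto simp: r_def)
  note C1 = eR_C1c[OF R2]
  note ep = eR_props[OF R2]
  have r0: "0 \<le> r" using R2 by simp
  note cp = cut_props[OF r0 R2(2), where ?x0.0="0::real^'n"]
  have n: "nice (\<lambda>t. clamp k 1 t) (\<lambda>t. dclamp k 1 t)" using nice_clamp[of 1 1 0 1 k] by simp
  define \<Phi> where "\<Phi> = (\<lambda>x. clamp k 1 (u x) *\<^sub>R DeR r R x + (eR r R x * dclamp k 1 (u x)) *\<^sub>R g x)"
  have testable: "testable (\<lambda>x. eR r R x * clamp k 1 (u x)) \<Phi>" unfolding \<Phi>_def by (rule testable_nice[OF C1 n])
  have iF: "integrable lborel (\<lambda>x. F x \<bullet> \<Phi> x)" and iP: "integrable lborel (\<lambda>x. norm (\<Phi> x) ^ N)"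
    using nice_integrable[OF C1 n] unfolding \<Phi>_def by auto
  have c0: "clamp k 1 (u y) \<ge> 0" for y by (simp add: clamp_eq)
  have zero: "clamp k 1 (u y) *\<^sub>R DeR r R y = 0" if y: "y \<in> C" for y
  proof -
    consider "norm y \<le> 2" | "2 \<le> norm y" "norm y \<le> 3" | "3 \<le> norm y" "norm y \<le> r" | "r \<le> norm y" "norm y \<le> R" | "norm y \<ge> R" by linarith
    then show ?thesis
    proof cases
      case 1 then show ?thesis using ep(4)[of y] e0_props(5)[of y] R2 by simp
    next
      case 2 then show ?thesis using u_less_s[OF y] k by (simp add: clamp_eq)
    next
      case 3 then show ?thesis using ep(4)[of y] e0_props(6)[of y] by simp
    next
      case 4 then show ?thesis using bd[OF y] by (simp add: clamp_eq r_def)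
    next
      case 5 then show ?thesis using ep(5)[of y] cp(6)[of y] R2 by simp
    qed
  qed
  have \<Phi>C: "\<Phi> y = (eR r R y * dclamp k 1 (u y)) *\<^sub>R g y" if "y \<in> C" for y using zero[OF that] by (simp add: \<Phi>_def)
  have wt: "0 \<le> eR r R y * dclamp k 1 (u y)" "eR r R y * dclamp k 1 (u y) \<le> 1" for y
    using ep(1,2)[of y] dclamp_bounds[of 1 k "u y"] by (auto intro: mult_le_one)
  have Fpos: "F y \<bullet> \<Phi> y \<ge> a\<^sub>0 * (indicator C y * norm (\<Phi> y) ^ N)" for y
  proof (cases "y \<in> C")
    case True
    define w where "w = eR r R y * dclamp k 1 (u y)"
    have "w ^ N \<le> w ^ 1" using wt[of y] Npos unfolding w_def[symmetric] by (intro power_decreasing) auto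
    then have "a\<^sub>0 * (w ^ N * norm (g y) ^ N) \<le> w * (a\<^sub>0 * norm (g y) ^ N)" using a0 by (simp add: mult_right_mono)
    also have "\<dots> \<le> w * (F y \<bullet> g y)" using F_ge wt(1)[of y] by (intro mult_left_mono) (auto simp: w_def)
    finally show ?thesis using True \<Phi>C[OF True] wt(1)[of y] by (simp add: w_def[symmetric] power_mult_distrib)
  next
    case False then show ?thesis using F_zero by simp
  qed
  have "a\<^sub>0 * (LINT y|lborel. indicator C y * norm (\<Phi> y) ^ N) \<le> (LINT y|lborel. F y \<bullet> \<Phi> y)"
    unfolding integral_mult_right_zero[symmetric]
  proof (rule integral_mono[OF _ iF Fpos])
    show "integrable lborel (\<lambda>y. a\<^sub>0 * (indicator C y * norm (\<Phi> y) ^ N))"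
      by (intro integrable_mult_right Bochner_Integration.integrable_bound[OF iP])
        (use testable_measurable(2)[OF testable] in \<open>auto simp: indicator_def\<close>)
  qed
  also have "\<dots> = - (LINT y|lborel. f y * (eR r R y * clamp k 1 (u y)))" by (rule testable_weak[OF testable])
  also have "\<dots> \<le> 0" using f_nonneg ep(1) c0 by (simp add: Bochner_Integration.integral_nonneg)
  finally have "(LINT y|lborel. indicator C y * norm (\<Phi> y) ^ N) \<le> 0" using a0 by (simp add: mult_le_0_iff)
  moreover have ge0: "0 \<le> indicator C y * norm (\<Phi> y) ^ N" for y by simp
  moreover have iC: "integrable lborel (\<lambda>y. indicator C y * norm (\<Phi> y) ^ N)"
    by (intro Bochner_Integration.integrable_bound[OF iP]) (use testable_measurable(2)[OF testable] in \<open>auto simp: indicator_def\<close>)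
  moreover have "0 \<le> (LINT y|lborel. indicator C y * norm (\<Phi> y) ^ N)"
    by (intro Bochner_Integration.integral_nonneg ge0)
  ultimately have LZ: "(LINT y|lborel. indicator C y * norm (\<Phi> y) ^ N) = 0" by linarith
  have "(\<integral>\<^sup>+y. indicator C y * ennreal (norm (\<Phi> y) ^ N) \<partial>lborel) = (\<integral>\<^sup>+y. ennreal (indicator C y * norm (\<Phi> y) ^ N) \<partial>lborel)"
    by (intro nn_integral_cong) (auto simp: indicator_def)
  also have "\<dots> = 0" using nn_integral_eq_integral[OF iC AE_I2[OF ge0]] LZ by simp
  finally have Z: "(\<integral>\<^sup>+y. indicator C y * ennreal (norm (\<Phi> y) ^ N) \<partial>lborel) = 0" .
  define S where "S = cball (0::real^'n) R"
  have eS: "emeasure lborel S \<le> ennreal (measure lborel S + 1)"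
  proof -
    have "emeasure lborel S = ennreal (measure lborel S)"
      unfolding S_def using emeasure_lborel_cball_finite[of "0::real^'n" R] by (intro emeasure_eq_ennreal_measure) auto
    then show ?thesis by (simp add: ennreal_leI)
  qed
  have "(\<integral>\<^sup>+y. indicator C y * ennreal (\<bar>eR r R y * clamp k 1 (u y)\<bar> ^ N) \<partial>lborel) \<le> ennreal (4 * (measure lborel S + 1) / cC) * 0"
    unfolding Z[symmetric]
  \<comment> \<open>Any finite measure bound for the support works, the energy being 0.\<close>
  proof (rule faber_krahn[OF testable _ _ eS])
    show "S \<in> sets borel" by (simp add: S_def)
    show "0 < measure lborel S + 1" by (simp add: add_nonneg_pos)
    show "y \<in> S" if "eR r R y * clamp k 1 (u y) \<noteq> 0" for y
      using that ep(6)[of y] by (cases "norm y \<ge> R") (auto simp: S_def)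
  qed
  then have nz: "(\<integral>\<^sup>+y. indicator C y * ennreal (\<bar>eR r R y * clamp k 1 (u y)\<bar> ^ N) \<partial>lborel) = 0" by simp
  have mm: "(\<lambda>y. indicator C y * ennreal (\<bar>eR r R y * clamp k 1 (u y)\<bar> ^ N)) \<in> borel_measurable lborel"
    using testable_measurable(1)[OF testable] by measurable
  have ae: "AE y in lborel. indicator C y * ennreal (\<bar>eR r R y * clamp k 1 (u y)\<bar> ^ N) = 0"
    using nz nn_integral_0_iff_AE[OF mm] by simp
  define D where "D = C \<inter> (ball 0 r - cball 0 3)"
  have oD: "open D" unfolding D_def using C_open by auto
  define V where "V = D \<inter> u -` {k<..}"
  have oV: "open V" unfolding V_def
    by (rule continuous_open_preimage[OF _ oD]) (auto intro!: continuous_on_subset[OF u_cont] simp: D_def)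
  have xV: "x \<in> V" using x xn ux by (simp add: V_def D_def r_def)
  have "V \<in> null_sets lborel"
  proof (subst AE_iff_null_sets)
    show "V \<in> sets lborel" using oV by simp
    show "AE y in lborel. y \<notin> V" using ae
    proof eventually_elim
      case (elim y)
      show ?case
      proof
        assume y: "y \<in> V"
        then have "y \<in> C" "norm y \<le> r" "norm y \<ge> 3" "u y > k" by (auto simp: V_def D_def)
        then have "eR r R y * clamp k 1 (u y) > 0" using ep(3)[of y] e0_props(4)[of y] by (simp add: clamp_eq)
        then have "\<bar>eR r R y * clamp k 1 (u y)\<bar> ^ N > 0" by (intro zero_less_power) auto
        then show False using elim \<open>y \<in> C\<close> by simp
      qed
    qed
  qed
  then show False using open_pos_measure[OF oV xV] by (simp add: null_sets_def)
qed

text \<open>The oscillation estimate gives an upper bound m on the outer annulus, the maximum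
  principle extends it inwards, and \<open>log_lower\<close> forces m to grow like c ln R. The lower
  oscillation bound differs from m only by s and a quarter of c ln R.\<close>

lemma lower_bound:
  "\<exists>c>0. \<exists>R0. \<forall>x\<in>C. norm x \<ge> R0 \<longrightarrow> c * ln (norm x) \<le> u x"
proof -
  obtain c J :: real where c: "c > 0" "\<And>n m. m \<ge> 0 \<Longrightarrow> (\<And>x. x \<in> C \<Longrightarrow> 3 \<le> norm x \<Longrightarrow> norm x \<le> 2 ^ n \<Longrightarrow> u x \<le> m) \<Longrightarrow> c * (real n - J) \<le> m + 1"
  proof (rule log_lower)
    fix c J :: real
    assume "c > 0" and *: "\<And>n m. m \<ge> 0 \<Longrightarrow> (\<And>x. x \<in> C \<Longrightarrow> 3 \<le> norm x \<Longrightarrow> norm x \<le> 2 ^ n \<Longrightarrow> u x \<le> m) \<Longrightarrow> c * (real n - J) \<le> m + 1"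
    show thesis by (rule that[OF \<open>c > 0\<close>], rule *)
  qed
  obtain R0 where R0: "\<And>R. R \<ge> R0 \<Longrightarrow> \<exists>k\<ge>0. \<forall>x\<in>C. R / 2 \<le> norm x \<longrightarrow> norm x \<le> R \<longrightarrow> k - c / 8 * ln R \<le> u x \<and> u x \<le> s + k + c / 8 * ln R"
  proof -
    have "c / 8 > 0" using c(1) by simp
    from oscillation[OF this] show thesis using that by blast
  qed
  \<comment> \<open>From here on the additive constants cost at most (c / 2) ln R; with twice (c /
    8) ln R for the oscillation, a quarter of c ln R remains.\<close>
  define T where "T = 2 / c * (c * J + s + 1)"
  show ?thesis
  proof (rule exI[of _ "c / 4"], rule conjI, simp add: c(1), rule exI[of _ "max R0 (max 6 (exp T))"], intro ballI impI)
    fix x assume x: "x \<in> C" "max R0 (max 6 (exp T)) \<le> norm x"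
    then have xn: "norm x \<ge> R0" "norm x \<ge> 6" "norm x \<ge> exp T" by auto
    obtain j where j: "2 ^ j \<le> norm x" "norm x < 2 ^ Suc j" using dyadic_bracket[of "norm x"] xn by auto
    \<comment> \<open>The dyadic radius above |x|, which puts x into the annulus where the
      oscillation is controlled.\<close>
    define R where "R = (2::real) ^ Suc j"
    have R: "R \<ge> R0" "R \<ge> 6" "R / 2 \<le> norm x" "norm x \<le> R" using j xn by (auto simp: R_def)
    have lnR0: "ln R \<ge> ln (norm x)" by (rule ln_mono) (use R xn in linarith)+
    have "ln (norm x) \<ge> T" using xn by (subst ln_ge_iff) linarith+
    then have lnT: "ln R \<ge> T" using lnR0 by linarith
    have lnR: "ln R \<ge> 1" using R by (intro ln_ge_1) auto
    obtain k where k: "k \<ge> 0" "\<And>x. x \<in> C \<Longrightarrow> R / 2 \<le> norm x \<Longrightarrow> norm x \<le> R \<Longrightarrow> k - c / 8 * ln R \<le> u x \<and> u x \<le> s + k + c / 8 * ln R"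
      using R0[OF R(1)] by blast
    define m where "m = s + k + c / 8 * ln R"
    have clnR: "c / 8 * ln R \<ge> 0" using c lnR by simp
    have m: "m \<ge> s" "m \<ge> 0" using k(1) clnR s_pos by (auto simp: m_def)
    have um: "u y \<le> m" if "y \<in> C" "R / 2 \<le> norm y" "norm y \<le> R" for y
      using k(2)[OF that] unfolding m_def by (rule conjunct2)
    have "u y \<le> m" if "y \<in> C" "3 \<le> norm y" "norm y \<le> 2 ^ Suc j" for y
      by (rule max_principle[OF R(2) m(1) um]) (use that in \<open>simp_all add: R_def\<close>)
    then have "c * (real (Suc j) - J) \<le> m + 1" by (rule c(2)[OF m(2)])
    moreover have "ln R \<le> real (Suc j)"
    proof -
      have "ln R = real (Suc j) * ln 2" unfolding R_def by (rule ln_realpow)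
      also have "\<dots> \<le> real (Suc j) * 1" using ln2_bounds by (intro mult_left_mono) auto
      finally show ?thesis by simp
    qed
    then have "c * (ln R - J) \<le> c * (real (Suc j) - J)" using c(1) by (intro mult_left_mono) auto
    ultimately have "c * ln R - c * J \<le> s + k + c / 8 * ln R + 1" by (simp add: m_def right_diff_distrib)
    moreover have "c * J + s + 1 \<le> c / 2 * ln R"
    proof -
      have "c / 2 * T \<le> c / 2 * ln R" using lnT c(1) by (intro mult_left_mono) auto
      moreover have "c / 2 * T = c * J + s + 1" using c(1) by (simp add: T_def)
      ultimately show ?thesis by simp
    qed
    moreover have "k - c / 8 * ln R \<le> u x" using k(2)[OF x(1) R(3,4)] by simp
    moreover have "c / 4 * ln (norm x) \<le> c / 4 * ln R" using lnR0 c(1) by (intro mult_left_mono) auto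
    ultimately show "c / 4 * ln (norm x) \<le> u x" by linarith
  qed
qed

end

lemma (in conormal) logarithmic_growth:
  "\<exists>L>1. \<exists>R. \<forall>x\<in>C. norm x \<ge> R \<longrightarrow> 1 / L * ln (norm x) \<le> u x \<and> u x \<le> L * ln (norm x)"
proof -
  obtain M where M: "\<And>x. x \<in> C \<Longrightarrow> 2 \<le> norm x \<Longrightarrow> norm x \<le> 3 \<Longrightarrow> u x \<le> M"
    using u_locally_bounded[of 3] by auto
  define s where "s = max M 0 + 1"
  interpret conormal_s C u f g F a\<^sub>0 a\<^sub>1 K N s
    by unfold_locales (use M in \<open>force simp: s_def\<close>)+
  obtain L where L: "L > 0" "\<And>x. x \<in> C \<Longrightarrow> norm x \<ge> 12 \<Longrightarrow> u x \<le> L * ln (norm x)" using upper_bound by blast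
  obtain c R0 where c: "c > 0" "\<And>x. x \<in> C \<Longrightarrow> norm x \<ge> R0 \<Longrightarrow> c * ln (norm x) \<le> u x" using lower_bound by blast
  define L' where "L' = max 2 (max L (1 / c))"
  have L': "L' > 1" "L \<le> L'" "1 / c \<le> L'" by (auto simp: L'_def)
  then have c': "1 / L' \<le> c" using c(1) by (simp add: field_simps)
  show ?thesis
  proof (rule exI[of _ L'], rule conjI[OF L'(1)], rule exI[of _ "max 12 R0"], intro conjI ballI impI)
    fix x assume x: "x \<in> C" "max 12 R0 \<le> norm x"
    then have ln: "ln (norm x) \<ge> 0" by simp
    show "1 / L' * ln (norm x) \<le> u x" using c(2)[OF x(1)] x mult_right_mono[OF c' ln] by simp
    show "u x \<le> L' * ln (norm x)" using L(2)[OF x(1)] x mult_right_mono[OF L'(2) ln] by simp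
  qed
qed

section \<open>Reduction to Borel data\<close>

text \<open>The cone is the preimage of \<open>D\<close> under the projection that annihilates the
  coordinates in \<open>I\<close>; openness, convexity and dilation invariance pull back along this
  linear map.\<close>

lemma coordinate_cone_props:
  fixes C :: "(real^'n) set"
  assumes "coordinate_cone k C"
  shows "open C" "C \<noteq> {}" "convex C" "\<And>x t. x \<in> C \<Longrightarrow> t > 0 \<Longrightarrow> t *\<^sub>R x \<in> C"
proof -
  obtain I D where D: "open_convex_cone_in {x::real^'n. \<forall>i\<in>I. x $ i = 0} D"
    "C = {y + z |y z. (\<forall>i. i \<notin> I \<longrightarrow> y $ i = 0) \<and> z \<in> D}"
    using assms by (auto simp: coordinate_cone_def)
  define V where "V = {x::real^'n. \<forall>i\<in>I. x $ i = 0}"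
  define P where "P = (\<lambda>x::real^'n. \<chi> i. if i \<in> I then 0 else x $ i)"
  have DV: "D \<noteq> {}" "D \<subseteq> V" "openin (top_of_set V) D" "convex D" "\<And>x t. x \<in> D \<Longrightarrow> t > 0 \<Longrightarrow> t *\<^sub>R x \<in> D"
    using D(1) by (auto simp: open_convex_cone_in_def V_def)
  have linP: "linear P" by (rule linearI) (auto simp: P_def vec_eq_iff)
  have PV: "P x \<in> V" for x by (simp add: P_def V_def)
  have PD: "P z = z" if "z \<in> V" for z using that by (auto simp: P_def V_def vec_eq_iff)
  have C: "C = P -` D"
  proof (intro set_eqI iffI)
    fix x assume "x \<in> C"
    then obtain y z where yz: "x = y + z" "\<And>i. i \<notin> I \<Longrightarrow> y $ i = 0" "z \<in> D" unfolding D(2) by blast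
    have "z \<in> V" using yz(3) DV(2) by blast
    then have "P x = z" using yz(2) by (auto simp: yz(1) P_def V_def vec_eq_iff)
    then show "x \<in> P -` D" using yz(3) by simp
  next
    fix x assume "x \<in> P -` D"
    then have "x = (x - P x) + P x \<and> (\<forall>i. i \<notin> I \<longrightarrow> (x - P x) $ i = 0) \<and> P x \<in> D" by (simp add: P_def)
    then show "x \<in> C" unfolding D(2) by blast
  qed
  obtain T where T: "open T" "D = V \<inter> T" using DV(3) by (auto simp: openin_open)
  have "C = P -` T" using PV by (auto simp: C T(2))
  then show "open C" using T(1) linear_continuous_on[OF linP[unfolded linear_conv_bounded_linear], of UNIV]
    by (simp add: continuous_on_open_vimage)
  show "C \<noteq> {}" using DV(1,2) PD by (auto simp: C)
  show "convex C" unfolding C by (rule convex_linear_vimage[OF linP DV(4)])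
  show "t *\<^sub>R x \<in> C" if "x \<in> C" "t > 0" for x t
    using that DV(5)[of "P x" t] by (simp add: C linear_scale[OF linP])
qed

section \<open>Borel versions of Lebesgue measurable data\<close>

lemma lebesgue_on_borel_version:
  fixes q q' :: "'a::euclidean_space \<Rightarrow> 'b::euclidean_space"
  assumes S: "S \<in> sets borel" and q: "q \<in> borel_measurable (lebesgue_on S)" and q': "q' \<in> borel_measurable borel"
    and eq: "AE x in lborel. indicator S x *\<^sub>R q x = q' x"
  shows "integrable (lebesgue_on S) q \<longleftrightarrow> integrable lborel q'" "integral\<^sup>L (lebesgue_on S) q = integral\<^sup>L lborel q'"
proof -
  have S': "S \<inter> space lebesgue \<in> sets lebesgue" using S by simp
  have m1: "(\<lambda>x. indicator S x *\<^sub>R q x) \<in> borel_measurable lebesgue"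
    using q S' by (simp add: borel_measurable_restrict_space_iff)
  have q'l: "q' \<in> borel_measurable lebesgue" using q' by (intro measurable_completion) simp
  have ae: "AE x in lebesgue. indicator S x *\<^sub>R q x = q' x" using eq by (rule AE_completion)
  show "integrable (lebesgue_on S) q \<longleftrightarrow> integrable lborel q'"
    unfolding integrable_restrict_space[OF S']
    using integrable_cong_AE[OF m1 q'l ae] integrable_lebesgue_iff_lborel(1)[OF q'] by simp
  show "integral\<^sup>L (lebesgue_on S) q = integral\<^sup>L lborel q'"
    unfolding integral_restrict_space[OF S']
    using integral_cong_AE[OF m1 q'l ae] integrable_lebesgue_iff_lborel(2)[OF q'] by simp
qed

text \<open>Componentwise, since a real function measurable for the completion agrees almost
  everywhere with a Borel one.\<close>

lemma borel_version_exists: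
  fixes h :: "'a::euclidean_space \<Rightarrow> 'b::euclidean_space"
  assumes S: "S \<in> sets borel" and h: "h \<in> borel_measurable (lebesgue_on S)"
  obtains h' where "h' \<in> borel_measurable borel" "AE x in lborel. x \<in> S \<longrightarrow> h x = h' x"
proof -
  have m1: "(\<lambda>x. indicator S x *\<^sub>R h x) \<in> borel_measurable lebesgue"
    using h S by (simp add: borel_measurable_restrict_space_iff)
  have "\<forall>b. \<exists>g'. g' \<in> borel_measurable lborel \<and> (AE x in lborel. (indicator S x *\<^sub>R h x) \<bullet> b = g' x)"
  proof
    fix b
    have "(\<lambda>x. (indicator S x *\<^sub>R h x) \<bullet> b) \<in> borel_measurable lebesgue" using m1 by (intro borel_measurable_inner) auto
    from completion_ex_borel_measurable_real[OF this]
    show "\<exists>g'. g' \<in> borel_measurable lborel \<and> (AE x in lborel. (indicator S x *\<^sub>R h x) \<bullet> b = g' x)" by blast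
  qed
  from choice[OF this] obtain G where G: "\<And>b. G b \<in> borel_measurable lborel"
    "\<And>b. AE x in lborel. (indicator S x *\<^sub>R h x) \<bullet> b = G b x" by blast
  show ?thesis
  proof
    show "(\<lambda>x. \<Sum>b\<in>Basis. G b x *\<^sub>R b) \<in> borel_measurable borel"
      using G(1) by (intro borel_measurable_sum borel_measurable_scaleR) auto
    have "AE x in lborel. \<forall>b\<in>Basis. (indicator S x *\<^sub>R h x) \<bullet> b = G b x"
      using G(2) by (intro AE_finite_allI) auto
    then show "AE x in lborel. x \<in> S \<longrightarrow> h x = (\<Sum>b\<in>Basis. G b x *\<^sub>R b)"
    proof eventually_elim
      case (elim x)
      show ?case
      proof
        assume "x \<in> S"
        then have "\<And>b. b \<in> Basis \<Longrightarrow> G b x = h x \<bullet> b" using elim by simp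
        then show "h x = (\<Sum>b\<in>Basis. G b x *\<^sub>R b)" by (simp add: euclidean_representation)
      qed
    qed
  qed
qed

text \<open>An open set is a countable union of compact boxes, on each of which local integrability
  applies.\<close>

lemma locally_integrable_imp_measurable:
  assumes "open S" "locally_integrable S h"
  shows "h \<in> borel_measurable (lebesgue_on S)"
proof -
  obtain \<D> where D: "countable \<D>" "\<D> \<subseteq> Pow S" "\<And>X. X \<in> \<D> \<Longrightarrow> \<exists>a b. X = cbox a b" "\<Union>\<D> = S"
    using open_countable_Union_open_cbox[OF assms(1)] by metis
  show ?thesis
  proof (rule measurable_piecewise_restrict[OF D(1)])
    show "space (lebesgue_on S) \<subseteq> \<Union>\<D>" using D(4) by simp
    fix X assume X: "X \<in> \<D>"
    then obtain a b where ab: "X = cbox a b" using D(3) by blast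
    have XS: "X \<subseteq> S" using X D(2) by blast
    have m: "S \<in> sets lebesgue" "X \<in> sets lebesgue" using assms(1) ab by auto
    show "X \<inter> space (lebesgue_on S) \<in> sets (lebesgue_on S)"
      using m XS by (simp add: sets_restrict_space_iff Int_absorb2)
    have "h absolutely_integrable_on X" using assms(2) XS ab by (auto simp: locally_integrable_def)
    then have "h \<in> borel_measurable (lebesgue_on X)" using m(2) by (rule absolutely_integrable_imp_borel_measurable)
    moreover have "restrict_space (lebesgue_on S) X = lebesgue_on X"
      using m XS by (subst restrict_restrict_space) (auto simp: Int_absorb1)
    ultimately show "h \<in> borel_measurable (restrict_space (lebesgue_on S) X)" by simp
  qed
qed

lemma le_one_plus_power:
  fixes t :: real
  assumes "t \<ge> 0" "n > 0"
  shows "t \<le> 1 + t ^ n"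
proof (cases "t \<le> 1")
  case True
  then show ?thesis using assms(1) zero_le_power[of t n] by linarith
next
  case False
  then show ?thesis using power_increasing[of 1 n t] assms(2) by simp
qed

text \<open>On a set of finite measure the pointwise bound t \<le> 1 + t^n takes the place of
  Hoelder's inequality.\<close>

lemma integrable_indicator_of_power:
  fixes q :: "'a::euclidean_space \<Rightarrow> 'b::euclidean_space"
  assumes [measurable]: "q \<in> borel_measurable borel" "A \<in> sets borel" and fin: "emeasure lborel A < \<infinity>"
    and "n > 0" and int: "integrable lborel (\<lambda>x. indicator A x * norm (q x) ^ n)"
  shows "integrable lborel (\<lambda>x. indicator A x *\<^sub>R q x)"
proof (rule Bochner_Integration.integrable_bound)
  show "integrable lborel (\<lambda>x. indicator A x + indicator A x * norm (q x) ^ n)"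
    using fin int by (intro Bochner_Integration.integrable_add) auto
  show "AE x in lborel. norm (indicator A x *\<^sub>R q x) \<le> norm (indicator A x + indicator A x * norm (q x) ^ n)"
    using le_one_plus_power[OF norm_ge_zero \<open>n > 0\<close>] by (intro AE_I2) (auto simp: indicator_def)
qed measurable

theorem theorem2p5:
  fixes C :: "(real^'n) set" and k :: nat
    and a :: "real^'n \<Rightarrow> real^'n"
    and f u :: "real^'n \<Rightarrow> real"
    and a\<^sub>0 a\<^sub>1 K :: real
  assumes "CARD('n) \<ge> 2"
    and "coordinate_cone k C"
    and "a\<^sub>0 > 0" and "a\<^sub>1 > 0"
    and "\<And>p. norm (a p) \<le> a\<^sub>1 * norm p ^ (CARD('n) - 1)"
    and "\<And>p. a p \<bullet> p \<ge> a\<^sub>0 * norm p ^ CARD('n)"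
    and "integrable (lebesgue_on (C - cball 0 1)) f"
    and "K > 0"
    and "AE x in lebesgue_on (C - cball 0 1). 0 \<le> f x \<and> f x \<le> K / norm x ^ CARD('n)"
    and "weak_solution a f C u"
    and "continuous_on (C - cball 0 1) u"
    and "\<And>x. x \<in> C - cball 0 1 \<Longrightarrow> u x \<ge> 0"
    and "filterlim u at_top (inf at_infinity (principal C))"
  shows "\<exists>L>1. \<exists>R. \<forall>x\<in>C. norm x \<ge> R \<longrightarrow> 1 / L * ln (norm x) \<le> u x \<and> u x \<le> L * ln (norm x)"
proof -
  note cone = coordinate_cone_props[OF assms(2)]
  define \<Omega> where "\<Omega> = C - cball 0 1"
  have op: "open \<Omega>" unfolding \<Omega>_def by (intro open_Diff cone(1) closed_cball)
  have [measurable]: "\<Omega> \<in> sets borel" "C \<in> sets borel" using op cone(1) by auto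
  obtain g where W: "W1p_loc CARD('n) \<Omega> (closure C - cball 0 1) u g"
    and am: "(\<lambda>x. a (g x)) \<in> borel_measurable (lebesgue_on \<Omega>)"
    and weak0: "\<forall>\<psi> h. W1p CARD('n) UNIV \<psi> h \<longrightarrow> in_Linf UNIV \<psi> \<longrightarrow>
      (\<exists>K. compact K \<and> K \<subseteq> - cball 0 1 \<and> (AE x in lebesgue. x \<notin> K \<longrightarrow> \<psi> x = 0)) \<longrightarrow>
      (LINT x|lebesgue_on \<Omega>. a (g x) \<bullet> h x) = - (LINT x|lebesgue_on \<Omega>. f x * \<psi> x)"
    using assms(10) unfolding weak_solution_def \<Omega>_def[symmetric] by (elim exE conjE)
  have wg: "weak_gradient \<Omega> u g" using W by (simp add: W1p_loc_def)
  have gm: "g \<in> borel_measurable (lebesgue_on \<Omega>)"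
    using wg op by (intro locally_integrable_imp_measurable) (simp_all add: weak_gradient_def)
  have um: "u \<in> borel_measurable (lebesgue_on \<Omega>)"
    using wg op by (intro locally_integrable_imp_measurable) (simp_all add: weak_gradient_def)
  have fint: "integrable (lebesgue_on \<Omega>) f" using assms(7) by (simp add: \<Omega>_def)
  then have fm: "f \<in> borel_measurable (lebesgue_on \<Omega>)" by (rule borel_measurable_integrable)
  obtain g1 where g1 [measurable]: "g1 \<in> borel_measurable borel" and g1e: "AE x in lborel. x \<in> \<Omega> \<longrightarrow> g x = g1 x"
    using borel_version_exists[OF _ gm] by auto
  obtain F1 where F1 [measurable]: "F1 \<in> borel_measurable borel" and F1e: "AE x in lborel. x \<in> \<Omega> \<longrightarrow> a (g x) = F1 x"
    using borel_version_exists[OF _ am] by auto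
  obtain f1 where f1 [measurable]: "f1 \<in> borel_measurable borel" and f1e: "AE x in lborel. x \<in> \<Omega> \<longrightarrow> f x = f1 x"
    using borel_version_exists[OF _ fm] by auto
  have fb: "AE x in lborel. x \<in> \<Omega> \<longrightarrow> 0 \<le> f x \<and> f x \<le> K / norm x ^ CARD('n)"
    using assms(9) op unfolding \<Omega>_def[symmetric]
    by (subst (asm) AE_restrict_space_iff) (simp_all only: AE_completion_iff, simp)
  define good where "good = (\<lambda>x. x \<in> \<Omega> \<longrightarrow> g x = g1 x \<and> a (g x) = F1 x \<and> f x = f1 x \<and> 0 \<le> f x \<and> f x \<le> K / norm x ^ CARD('n))"
  have "AE x in lborel. good x" using g1e F1e f1e fb by eventually_elim (auto simp: good_def)
  then obtain Z where Z: "{x \<in> space lborel. \<not> good x} \<subseteq> Z" "emeasure lborel Z = 0" "Z \<in> sets lborel" by (rule AE_E)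
  \<comment> \<open>One null set collects all exceptions. Off \<open>G\<close> the Borel versions
    are set to 0, so growth, coercivity and the upper bound on f hold at every point at which the
    locale demands them.\<close>
  define G where "G = \<Omega> - Z"
  have Gm [measurable]: "G \<in> sets borel" unfolding G_def using Z(3) by auto
  have G\<Omega>: "G \<subseteq> \<Omega>" by (simp add: G_def)
  have Gg: "g x = g1 x" "a (g x) = F1 x" "f x = f1 x" "0 \<le> f x" "f x \<le> K / norm x ^ CARD('n)" if "x \<in> G" for x
  proof -
    have "good x" "x \<in> \<Omega>" using that Z(1) by (auto simp: G_def)
    then show "g x = g1 x" "a (g x) = F1 x" "f x = f1 x" "0 \<le> f x" "f x \<le> K / norm x ^ CARD('n)" by (auto simp: good_def)
  qed
  have aeG: "AE x in lborel. x \<in> \<Omega> \<longrightarrow> x \<in> G"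
    using AE_not_in[of Z lborel] Z(2,3) by (auto simp: G_def null_sets_def)
  define g' where "g' = (\<lambda>x. indicator G x *\<^sub>R g1 x)"
  define F' where "F' = (\<lambda>x. indicator G x *\<^sub>R F1 x)"
  define f' where "f' = (\<lambda>x. indicator G x * f1 x)"
  define u' where "u' = (\<lambda>x. indicator \<Omega> x * u x)"
  have [measurable]: "g' \<in> borel_measurable borel" "F' \<in> borel_measurable borel" "f' \<in> borel_measurable borel"
    unfolding g'_def F'_def f'_def by measurable
  have u'm [measurable]: "u' \<in> borel_measurable borel"
  proof -
    have "(\<lambda>x. indicator \<Omega> x *\<^sub>R u x) \<in> borel_measurable borel"
      by (rule borel_measurable_continuous_on_indicator) (use assms(11) in \<open>auto simp: \<Omega>_def\<close>)
    then show ?thesis by (simp add: u'_def)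
  qed
  have G': "g' x = g x" "F' x = a (g x)" "f' x = f x" if "x \<in> G" for x
    using that Gg[OF that] by (simp_all add: g'_def F'_def f'_def)
  have nG: "g' x = 0" "F' x = 0" "f' x = 0" if "x \<notin> G" for x using that by (simp_all add: g'_def F'_def f'_def)
  have n\<Omega>: "g' x = 0" "F' x = 0" "f' x = 0" if "x \<notin> \<Omega>" for x using nG that G\<Omega> by blast+
  have u'eq: "u' x = u x" if "x \<in> \<Omega>" for x using that by (simp add: u'_def)
  define N where "N = CARD('n)"
  have N2: "N \<ge> 2" using assms(1) by (simp add: N_def)
  have LN: "integrable lborel (\<lambda>x. indicator (S \<inter> C) x * norm (u' x) ^ N)"
    "integrable lborel (\<lambda>x. indicator (S \<inter> C) x * norm (g' x) ^ N)"
    if S: "compact S" "S \<subseteq> - cball 0 1" for S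
  proof -
    have [measurable]: "S \<in> sets borel" using S(1) by (rule borel_compact)
    \<comment> \<open>\<open>S \<inter> C\<close> need not be compact. Its replacement may touch the
      boundary of the cone because integrability is required up to there.\<close>
    define T where "T = S \<inter> closure C"
    have T: "compact T" "T \<subseteq> closure C - cball 0 1" using S by (auto simp: T_def intro: compact_Int_closed)
    have TC: "T \<inter> \<Omega> = S \<inter> C" using S(2) closure_subset[of C] by (auto simp: T_def \<Omega>_def)
    have L: "in_Lp N (S \<inter> C) u" "in_Lp N (S \<inter> C) g" using W T unfolding W1p_loc_def N_def TC[symmetric] by blast+
    have SC: "S \<inter> C \<in> sets borel" by measurable
    have S\<Omega>: "S \<inter> C \<subseteq> \<Omega>" using S(2) by (auto simp: \<Omega>_def)
    have "integrable lborel (\<lambda>x. indicator (S \<inter> C) x * norm (u' x) ^ N)"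
    proof (subst lebesgue_on_borel_version(1)[OF SC, symmetric])
      show "integrable (lebesgue_on (S \<inter> C)) (\<lambda>x. norm (u x) ^ N)" using L(1) by (simp add: in_Lp_def)
      then show "(\<lambda>x. norm (u x) ^ N) \<in> borel_measurable (lebesgue_on (S \<inter> C))" by (rule borel_measurable_integrable)
      show "AE x in lborel. indicator (S \<inter> C) x *\<^sub>R norm (u x) ^ N = indicator (S \<inter> C) x * norm (u' x) ^ N"
        using S\<Omega> u'eq by (intro AE_I2) (auto simp: indicator_def)
    qed measurable
    then show "integrable lborel (\<lambda>x. indicator (S \<inter> C) x * norm (u' x) ^ N)" .
    have "integrable lborel (\<lambda>x. indicator (S \<inter> C) x * norm (g' x) ^ N)"
    proof (subst lebesgue_on_borel_version(1)[OF SC, symmetric])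
      show "integrable (lebesgue_on (S \<inter> C)) (\<lambda>x. norm (g x) ^ N)" using L(2) by (simp add: in_Lp_def)
      then show "(\<lambda>x. norm (g x) ^ N) \<in> borel_measurable (lebesgue_on (S \<inter> C))" by (rule borel_measurable_integrable)
      show "AE x in lborel. indicator (S \<inter> C) x *\<^sub>R norm (g x) ^ N = indicator (S \<inter> C) x * norm (g' x) ^ N"
        using aeG by eventually_elim (use S\<Omega> G'(1) in \<open>auto simp: indicator_def\<close>)
    qed measurable
    then show "integrable lborel (\<lambda>x. indicator (S \<inter> C) x * norm (g' x) ^ N)" .
  qed
  have L1: "integrable lborel (\<lambda>x. indicator (S \<inter> C) x *\<^sub>R u' x)" "integrable lborel (\<lambda>x. indicator (S \<inter> C) x *\<^sub>R g' x)"
    if S: "compact S" "S \<subseteq> - cball 0 1" for S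
  proof -
    have [measurable]: "S \<in> sets borel" using S(1) by (rule borel_compact)
    have "emeasure lborel (S \<inter> C) < \<infinity>"
      by (rule emeasure_bounded_finite) (use S compact_imp_bounded in \<open>blast intro: bounded_subset\<close>)
    then show "integrable lborel (\<lambda>x. indicator (S \<inter> C) x *\<^sub>R u' x)" "integrable lborel (\<lambda>x. indicator (S \<inter> C) x *\<^sub>R g' x)"
      by (intro integrable_indicator_of_power[where n=N], use LN[OF S] N2 in simp_all)+
  qed
  have wg': "(LINT x|lborel. (indicator \<Omega> x * u' x) *\<^sub>R D x) = - (LINT x|lborel. \<phi> x *\<^sub>R g' x)"
    if \<phi>: "test_function \<Omega> \<phi>" "\<And>x. GDERIV \<phi> x :> D x" for \<phi> D
  proof -
    obtain D' where D': "\<And>x. GDERIV \<phi> x :> D' x" "continuous_on UNIV D'"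
      using smooth_imp_C1[of \<phi>] \<phi>(1) by (auto simp: test_function_def)
    have "D = D'" using GDERIV_unique \<phi>(2) D'(1) by blast
    then have [measurable]: "D \<in> borel_measurable borel" using D'(2) by (simp add: borel_measurable_continuous_onI)
    have [measurable]: "\<phi> \<in> borel_measurable borel"
      by (intro borel_measurable_continuous_onI GDERIV_imp_continuous_on[OF \<phi>(2)])
    have m: "D \<in> borel_measurable (lebesgue_on \<Omega>)" "\<phi> \<in> borel_measurable (lebesgue_on \<Omega>)"
      by (auto intro!: measurable_restrict_space1 measurable_completion)
    have "(LINT x|lborel. (indicator \<Omega> x * u' x) *\<^sub>R D x) = (LINT x|lebesgue_on \<Omega>. u x *\<^sub>R D x)"
    proof (rule lebesgue_on_borel_version(2)[symmetric])
      show "AE x in lborel. indicator \<Omega> x *\<^sub>R u x *\<^sub>R D x = (indicator \<Omega> x * u' x) *\<^sub>R D x"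
        by (intro AE_I2) (simp add: u'_def indicator_def)
    qed (use um m(1) in auto)
    also have "\<dots> = - (LINT x|lebesgue_on \<Omega>. \<phi> x *\<^sub>R g x)" using wg \<phi> by (auto simp: weak_gradient_def)
    also have "(LINT x|lebesgue_on \<Omega>. \<phi> x *\<^sub>R g x) = (LINT x|lborel. \<phi> x *\<^sub>R g' x)"
    proof (rule lebesgue_on_borel_version(2))
      show "AE x in lborel. indicator \<Omega> x *\<^sub>R \<phi> x *\<^sub>R g x = \<phi> x *\<^sub>R g' x"
        using aeG by eventually_elim (use n\<Omega>(1) G'(1) in \<open>auto simp: indicator_def\<close>)
    qed (use gm m(2) in auto)
    finally show ?thesis .
  qed
  interpret conormal C u' f' g' F' a\<^sub>0 a\<^sub>1 K N
  proof
    show "N = CARD('n)" by (simp add: N_def)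
    show "N \<ge> 2" by (rule N2)
    show "open C" "C \<noteq> {}" "convex C" by (rule cone)+
    show "a\<^sub>0 > 0" "a\<^sub>1 > 0" "K > 0" by (rule assms)+
    show "t *\<^sub>R x \<in> C" if "x \<in> C" "t > 0" for x t using that by (rule cone(4))
    show "f' x = 0" "F' x = 0" "g' x = 0" if "x \<notin> C - cball 0 1" for x
      by (rule n\<Omega>, use that in \<open>simp add: \<Omega>_def\<close>)+
    show "norm (F' x) \<le> a\<^sub>1 * norm (g' x) ^ (N - 1)" for x
      using assms(4) assms(5)[of "g x"] G'(1,2)[of x] nG(1,2)[of x] N2 by (cases "x \<in> G") (auto simp: N_def)
    show "F' x \<bullet> g' x \<ge> a\<^sub>0 * norm (g' x) ^ N" for x
      using assms(6)[of "g x"] G'(1,2)[of x] nG(1,2)[of x] N2 by (cases "x \<in> G") (auto simp: N_def power_0_left)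
    show "f' x \<ge> 0" for x using Gg(4)[of x] G'(3)[of x] nG(3)[of x] by (cases "x \<in> G") auto
    show "f' x \<le> K / norm x ^ N" if "x \<in> C - cball 0 1" for x
      using Gg(5)[of x] G'(3)[of x] nG(3)[of x] assms(8) by (cases "x \<in> G") (auto simp: N_def)
    show "integrable lborel f'"
    proof (subst lebesgue_on_borel_version(1)[symmetric])
      show "integrable (lebesgue_on \<Omega>) f" by (rule fint)
      show "AE x in lborel. indicator \<Omega> x *\<^sub>R f x = f' x"
        using aeG by eventually_elim (use n\<Omega>(3) G'(3) in \<open>auto simp: indicator_def\<close>)
    qed (use fm in auto)
    show uc: "continuous_on (C - cball 0 1) u'"
      using assms(11) continuous_on_cong[of \<Omega> \<Omega> u' u] u'eq by (simp add: \<Omega>_def)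
    show "u' x \<ge> 0" for x using assms(12)[of x] by (auto simp: u'_def \<Omega>_def indicator_def)
    show "\<exists>b. \<forall>x\<in>C. norm x \<ge> b \<longrightarrow> u' x \<ge> M" for M
    proof -
      have "eventually (\<lambda>x. u x \<ge> M) (inf at_infinity (principal C))"
        using assms(13) by (simp add: filterlim_at_top)
      then obtain b where b: "\<And>x. norm x \<ge> b \<Longrightarrow> x \<in> C \<Longrightarrow> u x \<ge> M"
        by (auto simp: eventually_inf_principal eventually_at_infinity)
      \<comment> \<open>Radius 2 keeps away from the unit ball, where \<open>u'\<close> is 0 by
        definition.\<close>
      show ?thesis
        by (rule exI[of _ "max b 2"]) (use b in \<open>auto simp: u'_def \<Omega>_def indicator_def\<close>)
    qed
    have u'n: "u' x \<ge> 0" for x using assms(12)[of x] by (auto simp: u'_def \<Omega>_def indicator_def)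
    fix S :: "(real^'n) set" assume S: "compact S" "S \<subseteq> - cball 0 1"
    show "integrable lborel (\<lambda>x. indicator (S \<inter> C) x * u' x ^ N)" using LN(1)[OF S] u'n by simp
    have "(\<lambda>x. indicator (S \<inter> C) x * norm (g' x) ^ N) = (\<lambda>x. indicator S x * norm (g' x) ^ N)"
    proof
      show "indicator (S \<inter> C) x * norm (g' x) ^ N = indicator S x * norm (g' x) ^ N" for x
        using n\<Omega>(1)[of x] N2 by (cases "x \<in> \<Omega>") (auto simp: indicator_def \<Omega>_def)
    qed
    then show "integrable lborel (\<lambda>x. indicator S x * norm (g' x) ^ N)" using LN(2)[OF S] by metis
    show "\<exists>v Dv w. (\<forall>n::nat. \<forall>x. GDERIV (v n) x :> Dv n x) \<and> (\<forall>n. continuous_on UNIV (Dv n)) \<and>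
        (\<forall>x\<in>S \<inter> C. (\<lambda>n. v n x) \<longlonglongrightarrow> u' x) \<and>
        (AE x in lborel. x \<in> S \<inter> C \<longrightarrow> (\<lambda>n. Dv n x) \<longlonglongrightarrow> g' x) \<and>
        integrable lborel w \<and> (AE x in lborel. x \<in> S \<inter> C \<longrightarrow> (\<forall>n. norm (Dv n x) ^ N \<le> w x))"
    proof (rule mollification)
      show "N > 0" using N2 by simp
      show "g' \<in> borel_measurable borel" by measurable
      show "integrable lborel (\<lambda>x. indicator (T \<inter> C) x * u' x)" if "compact T" "T \<subseteq> - cball 0 1" for T
        using L1(1)[OF that] by simp
      show "(LINT x|lborel. (indicator (C - cball 0 1) x * u' x) *\<^sub>R D x) = - (LINT x|lborel. \<phi> x *\<^sub>R g' x)"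
        if "test_function (C - cball 0 1) \<phi>" "\<And>x. GDERIV \<phi> x :> D x" for \<phi> D
        using wg'[of \<phi> D] that by (simp add: \<Omega>_def)
    qed (fact cone uc L1(2) LN(2) S)+
  next
    fix \<psi> :: "real^'n \<Rightarrow> real" and h S
    assume psi: "C1c \<psi> h S" and S: "S \<subseteq> - cball 0 1"
    note P = C1cD[OF psi]
    have [measurable]: "\<psi> \<in> borel_measurable borel" "h \<in> borel_measurable borel"
      using P(2,3) by (auto intro: borel_measurable_continuous_onI)
    have m: "h \<in> borel_measurable (lebesgue_on \<Omega>)" "\<psi> \<in> borel_measurable (lebesgue_on \<Omega>)"
      by (auto intro!: measurable_restrict_space1 measurable_completion)
    \<comment> \<open>\<psi> vanishes near the closed unit ball but not on the boundary of the cone,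
      so the conormal condition is part of this identity.\<close>
    have "(LINT x|lebesgue_on \<Omega>. a (g x) \<bullet> h x) = - (LINT x|lebesgue_on \<Omega>. f x * \<psi> x)"
      by (rule weak0[rule_format, OF C1c_W1p[OF psi]]) (use P(4,5) S in \<open>auto intro!: exI[of _ S]\<close>)
    moreover have "(LINT x|lebesgue_on \<Omega>. a (g x) \<bullet> h x) = (LINT x|lborel. F' x \<bullet> h x)"
    proof (rule lebesgue_on_borel_version(2))
      show "AE x in lborel. indicator \<Omega> x *\<^sub>R (a (g x) \<bullet> h x) = F' x \<bullet> h x"
        using aeG by eventually_elim (use n\<Omega>(2) G'(2) in \<open>auto simp: indicator_def\<close>)
    qed (use am m(1) in auto)
    moreover have "(LINT x|lebesgue_on \<Omega>. f x * \<psi> x) = (LINT x|lborel. f' x * \<psi> x)"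
    proof (rule lebesgue_on_borel_version(2))
      show "AE x in lborel. indicator \<Omega> x *\<^sub>R (f x * \<psi> x) = f' x * \<psi> x"
        using aeG by eventually_elim (use n\<Omega>(3) G'(3) in \<open>auto simp: indicator_def\<close>)
    qed (use fm m(2) in auto)
    ultimately show "(LINT x|lborel. F' x \<bullet> h x) = - (LINT x|lborel. f' x * \<psi> x)" by simp
  qed measurable
  obtain L R where "L > 1" and R: "\<And>x. x \<in> C \<Longrightarrow> norm x \<ge> R \<Longrightarrow> 1 / L * ln (norm x) \<le> u' x \<and> u' x \<le> L * ln (norm x)"
    using logarithmic_growth by blast
  show ?thesis
  proof (rule exI[of _ L], rule conjI[OF \<open>L > 1\<close>], rule exI[of _ "max R 2"], intro ballI impI)
    fix x assume x: "x \<in> C" "max R 2 \<le> norm x"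
    then have "u' x = u x" by (intro u'eq) (auto simp: \<Omega>_def)
    then show "1 / L * ln (norm x) \<le> u x \<and> u x \<le> L * ln (norm x)" using R[OF x(1)] x(2) by simp
  qed
qed

end
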